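(* Let $(X,J)$ be an almost complex manifold with Lipschitz-continuous almost complex structure $J$, let $(S,j)$ be a smooth connected complex curve and let $u:(S,j)\to(X,J)$ be a non-constant $J$-holomorphic map. Then there exist a smooth connected complex curve $(\tilde S,\tilde\jmath)$, a primitive $J$-holomorphic map $\tilde u:(\tilde S,\tilde\jmath)\to(X,J)$ and a surjective holomorphic map $\pi:(S,j)\to(\tilde S,\tilde\jmath)$ such that $u=\tilde u\circ\pi$.
   Context: An almost complex structure on a real manifold $X$ is a section $J$ of $\mathrm{End}(TX)$ with $J^2=-\mathrm{id}$; it is Lipschitz-continuous if it is so in local coordinates. A complex curve $(S,j)$ is a Riemann surface (not necessarily compact) with complex structure $j$. A $J$-holomorphic map $u:(S,j)\to(X,J)$ is a $\mathcal C^1$-map with $du(s)\circ j(s)=J(u(s))\circ du(s)$ for every $s\in S$. A $J$-holomorphic map $u:S\to X$ is called primitive if there are no disjoint non-empty open sets $U_1,U_2\subset S$ with $u(U_1)=u(U_2)$. *)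

theory Defs
  imports "HOL-Analysis.Analysis"
begin

text \<open>
  A chart is a pair \<open>(U, \<phi>)\<close>; the values of \<open>\<phi>\<close> outside \<open>U\<close> are irrelevant.
  Manifolds are abstract topologies together with a (not necessarily maximal) atlas.
\<close>

type_synonym ('a, 'e) chart = "'a set \<times> ('a \<Rightarrow> 'e)"

definition is_chart :: "'a topology \<Rightarrow> ('a, 'e::euclidean_space) chart \<Rightarrow> bool" where
  "is_chart M c \<longleftrightarrow> openin M (fst c) \<and> open (snd c ` fst c) \<and>
     homeomorphic_map (subtopology M (fst c)) (top_of_set (snd c ` fst c)) (snd c)"

definition chart_inv :: "('a, 'e) chart \<Rightarrow> 'e \<Rightarrow> 'a" where
  "chart_inv c = inv_into (fst c) (snd c)"

definition local_rep :: "('a, 'e) chart \<Rightarrow> ('b, 'f) chart \<Rightarrow> ('a \<Rightarrow> 'b) \<Rightarrow> 'e \<Rightarrow> 'f" where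
  "local_rep c d f = snd d \<circ> f \<circ> chart_inv c"

definition local_dom :: "('a, 'e) chart \<Rightarrow> ('b, 'f) chart \<Rightarrow> ('a \<Rightarrow> 'b) \<Rightarrow> 'e set" where
  "local_dom c d f = snd c ` (fst c \<inter> f -` fst d)"

definition topological_manifold :: "'a topology \<Rightarrow> ('a, 'e::euclidean_space) chart set \<Rightarrow> bool" where
  "topological_manifold M A \<longleftrightarrow>
     Hausdorff_space M \<and> second_countable M \<and>
     (\<forall>c\<in>A. is_chart M c) \<and> \<Union> (fst ` A) = topspace M"

text \<open>
  \<open>Ck_on k f U\<close>: \<open>f\<close> is \<open>k\<close> times continuously differentiable on \<open>U\<close>,
  expressed by iterated directional derivatives. Only meant for open \<open>U\<close>
  in a finite-dimensional space.
\<close>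

fun Ck_on :: "nat \<Rightarrow> ('e::euclidean_space \<Rightarrow> 'f::real_normed_vector) \<Rightarrow> 'e set \<Rightarrow> bool" where
  "Ck_on 0 f U \<longleftrightarrow> continuous_on U f"
| "Ck_on (Suc k) f U \<longleftrightarrow> (\<forall>x\<in>U. f differentiable (at x)) \<and>
     (\<forall>v. Ck_on k (\<lambda>x. frechet_derivative f (at x) v) U)"

definition smooth_manifold :: "'a topology \<Rightarrow> ('a, 'e::euclidean_space) chart set \<Rightarrow> bool" where
  "smooth_manifold M A \<longleftrightarrow> topological_manifold M A \<and>
     (\<forall>c\<in>A. \<forall>d\<in>A. \<forall>k. Ck_on k (local_rep c d id) (local_dom c d id))"

definition riemann_surface :: "'a topology \<Rightarrow> ('a, complex) chart set \<Rightarrow> bool" where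
  "riemann_surface S A \<longleftrightarrow> topological_manifold S A \<and>
     (\<forall>c\<in>A. \<forall>d\<in>A. (local_rep c d id) holomorphic_on (local_dom c d id))"

definition holomorphic_map ::
  "'a topology \<Rightarrow> ('a, complex) chart set \<Rightarrow> 'b topology \<Rightarrow> ('b, complex) chart set
     \<Rightarrow> ('a \<Rightarrow> 'b) \<Rightarrow> bool" where
  "holomorphic_map S A S' A' f \<longleftrightarrow> continuous_map S S' f \<and>
     (\<forall>c\<in>A. \<forall>d\<in>A'. (local_rep c d f) holomorphic_on (local_dom c d f))"

definition C1_map ::
  "'a topology \<Rightarrow> ('a, 'e::euclidean_space) chart set \<Rightarrow>
     'b topology \<Rightarrow> ('b, 'f::euclidean_space) chart set \<Rightarrow> ('a \<Rightarrow> 'b) \<Rightarrow> bool" where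
  "C1_map M A N B f \<longleftrightarrow> continuous_map M N f \<and>
     (\<forall>c\<in>A. \<forall>d\<in>B. Ck_on 1 (local_rep c d f) (local_dom c d f))"

text \<open>
  A tangent vector at \<open>p\<close> is a family of coordinate vectors, one for each chart around \<open>p\<close>,
  related by the derivatives of the chart transitions. The family is set to \<open>0\<close> at all
  other charts, so that tangent vectors are equal iff they have the same coordinates.
  The vector space operations are pointwise.
\<close>

type_synonym ('a, 'e) tangent = "('a, 'e) chart \<Rightarrow> 'e"

definition charts_at :: "('a, 'e) chart set \<Rightarrow> 'a \<Rightarrow> ('a, 'e) chart set" where
  "charts_at A p = {c \<in> A. p \<in> fst c}"

definition tangent_space ::
  "('a, 'e::euclidean_space) chart set \<Rightarrow> 'a \<Rightarrow> ('a, 'e) tangent set" where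
  "tangent_space A p = {\<xi>. (\<forall>c. c \<notin> charts_at A p \<longrightarrow> \<xi> c = 0) \<and>
     (\<forall>c\<in>charts_at A p. \<forall>d\<in>charts_at A p.
        \<xi> d = frechet_derivative (local_rep c d id) (at (snd c p)) (\<xi> c))}"

definition tangent_of_coord ::
  "('a, 'e::euclidean_space) chart set \<Rightarrow> 'a \<Rightarrow> ('a, 'e) chart \<Rightarrow> 'e \<Rightarrow> ('a, 'e) tangent" where
  "tangent_of_coord A p c v =
     (\<lambda>d. if d \<in> charts_at A p
          then frechet_derivative (local_rep c d id) (at (snd c p)) v else 0)"

text \<open>
  By the chain rule the differential of a \<open>C\<^sup>1\<close> map does not depend on the chosen chart
  of the domain.
\<close>

definition differential ::
  "('a, 'e::euclidean_space) chart set \<Rightarrow> ('b, 'f::euclidean_space) chart set \<Rightarrow> ('a \<Rightarrow> 'b) \<Rightarrow>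
     'a \<Rightarrow> ('a, 'e) tangent \<Rightarrow> ('b, 'f) tangent" where
  "differential A B f p \<xi> =
     (let c = (SOME c. c \<in> charts_at A p) in
      (\<lambda>d. if d \<in> charts_at B (f p)
           then frechet_derivative (local_rep c d f) (at (snd c p)) (\<xi> c) else 0))"

definition tangent_endomorphism ::
  "('a, 'e::euclidean_space) chart set \<Rightarrow> 'a \<Rightarrow> (('a, 'e) tangent \<Rightarrow> ('a, 'e) tangent) \<Rightarrow> bool"
where
  "tangent_endomorphism A p T \<longleftrightarrow>
     (\<forall>\<xi>\<in>tangent_space A p. T \<xi> \<in> tangent_space A p) \<and>
     (\<forall>\<xi>\<in>tangent_space A p. \<forall>\<eta>\<in>tangent_space A p. \<forall>a b.
        T (\<lambda>c. a *\<^sub>R \<xi> c + b *\<^sub>R \<eta> c) = (\<lambda>c. a *\<^sub>R T \<xi> c + b *\<^sub>R T \<eta> c))"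

definition almost_complex_structure ::
  "'a topology \<Rightarrow> ('a, 'e::euclidean_space) chart set \<Rightarrow>
     ('a \<Rightarrow> ('a, 'e) tangent \<Rightarrow> ('a, 'e) tangent) \<Rightarrow> bool" where
  "almost_complex_structure X A J \<longleftrightarrow>
     (\<forall>p\<in>topspace X. tangent_endomorphism A p (J p) \<and>
        (\<forall>\<xi>\<in>tangent_space A p. J p (J p \<xi>) = (\<lambda>c. - \<xi> c)))"

definition coord_endomorphism ::
  "('a, 'e::euclidean_space) chart set \<Rightarrow> ('a \<Rightarrow> ('a, 'e) tangent \<Rightarrow> ('a, 'e) tangent) \<Rightarrow>
     ('a, 'e) chart \<Rightarrow> 'e \<Rightarrow> 'e \<Rightarrow>\<^sub>L 'e" where
  "coord_endomorphism A J c y =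
     (let p = chart_inv c y in Blinfun (\<lambda>v. J p (tangent_of_coord A p c v) c))"

text \<open>
  Lipschitz continuity in local coordinates is local: a Lipschitz constant on the whole
  image of a chart would not be invariant under change of atlas.
\<close>

definition lipschitz_structure ::
  "('a, 'e::euclidean_space) chart set \<Rightarrow> ('a \<Rightarrow> ('a, 'e) tangent \<Rightarrow> ('a, 'e) tangent) \<Rightarrow> bool"
where
  "lipschitz_structure A J \<longleftrightarrow>
     (\<forall>c\<in>A. \<forall>y\<in>snd c ` fst c. \<exists>r>0. \<exists>L.
        L-lipschitz_on (ball y r \<inter> snd c ` fst c) (coord_endomorphism A J c))"

definition complex_structure :: "('s, complex) tangent \<Rightarrow> ('s, complex) tangent" where
  "complex_structure \<xi> = (\<lambda>c. \<i> * \<xi> c)"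

definition J_holomorphic ::
  "'s topology \<Rightarrow> ('s, complex) chart set \<Rightarrow> 'x topology \<Rightarrow> ('x, 'e::euclidean_space) chart set \<Rightarrow>
     ('x \<Rightarrow> ('x, 'e) tangent \<Rightarrow> ('x, 'e) tangent) \<Rightarrow> ('s \<Rightarrow> 'x) \<Rightarrow> bool" where
  "J_holomorphic S A X B J u \<longleftrightarrow> C1_map S A X B u \<and>
     (\<forall>s\<in>topspace S. \<forall>\<xi>\<in>tangent_space A s.
        differential A B u s (complex_structure \<xi>) = J (u s) (differential A B u s \<xi>))"

definition primitive_map :: "'s topology \<Rightarrow> ('s \<Rightarrow> 'x) \<Rightarrow> bool" where
  "primitive_map S u \<longleftrightarrow>
     \<not> (\<exists>U1 U2. openin S U1 \<and> openin S U2 \<and> U1 \<noteq> {} \<and> U2 \<noteq> {} \<and> U1 \<inter> U2 = {} \<and> u ` U1 = u ` U2)"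

end

theory Submission
  imports Defs "HOL-Complex_Analysis.Complex_Analysis"
begin

text \<open>
  In a chart, the complex linear parts \<open>f\<^sub>b\<close> of the differential of a \<open>J\<close>-holomorphic map satisfy
  \<open>\<bar>\<partial>f/\<partial>z\<^bsup>*\<^esup>\<bar> \<le> C \<bar>f\<bar>\<close>. For a merely Lipschitz \<open>J\<close> the map need not have second derivatives, so the
  inequality is read as a bound on integrals of \<open>f\<close> over boundaries of small squares. It still implies
  that \<open>f\<close> either vanishes near a point or has a limit \<open>f(z) / z ^ m \<longlongrightarrow> a \<noteq> 0\<close>. Hence critical points
  are isolated, \<open>u\<close> is locally injective at the other points, and, again by such an inequality for the
  distance of two curves, a curve that meets an immersed one in points accumulating at the common
  centre factors through it holomorphically.

  Points \<open>s\<close> and \<open>t\<close> are identified if arbitrarily close to them there are nonempty open sets with the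
  same image under \<open>u\<close>. By the factorization this relation continues along punctured discs, so it is
  transitive, and near each point it is \<open>y ^ k = y' ^ k\<close> in a suitable coordinate. The quotient is a
  Riemann surface with charts \<open>y ^ k\<close>, to which \<open>u\<close> descends as a map that is still \<open>C\<^sup>1\<close> by the
  expansion above. It is primitive, because open sets with the same image contain identified points.
\<close>

subsection \<open>Integrals over the boundary of a rectangle\<close>

text \<open>The obstacle: the usual tools for |dbar f| \<le> C |f| integrate dbar f over the plane,
  and here dbar f need not exist. What survives is its effect on boundary integrals. A superadditive
  function of rectangles takes the place of the area integral, and Goursat bisection turns an
  infinitesimal bound into one for a whole square, also after multiplication with a meromorphic
  kernel. Kernels such as z^(-k) / (z - \<zeta>) are all compared with |z - p|^(-3/2). This power is
  integrable in the plane, absorbs a simple pole times an inverse square root, and is, up to a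
  constant, below the mixed derivative of a product of fourth roots, which yields a majorant in
  closed form.

  The second delicate point is a branch point of the quotient. If \<open>u\<close> factors through y
  ^ k and its derivative has leading order m, invariance under the k-th roots of unity forces k to
  divide m + 1. Hence m \<ge> k - 1, and the derivative of the descended map has a limit
  there.\<close>

definition rect :: "real \<Rightarrow> real \<Rightarrow> real \<Rightarrow> real \<Rightarrow> complex set" where
  "rect a b c d = {z. a \<le> Re z \<and> Re z \<le> b \<and> c \<le> Im z \<and> Im z \<le> d}"

text \<open>This is the integral of \<open>f\<close> dz along the positively oriented boundary. Four
  real integrals make the subdivision of rectangles a matter of splitting intervals.\<close>

definition rint :: "(complex \<Rightarrow> complex) \<Rightarrow> real \<Rightarrow> real \<Rightarrow> real \<Rightarrow> real \<Rightarrow> complex" where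
  "rint f a b c d = integral {a..b} (\<lambda>x. f (Complex x c)) - integral {a..b} (\<lambda>x. f (Complex x d))
     + \<i> * (integral {c..d} (\<lambda>y. f (Complex b y)) - integral {c..d} (\<lambda>y. f (Complex a y)))"

lemma rect_cbox: "rect a b c d = cbox (Complex a c) (Complex b d)"
  by (auto simp: rect_def in_cbox_complex_iff)

lemma compact_rect: "compact (rect a b c d)"
  by (simp add: rect_cbox)

lemma rect_mono: "a \<le> a' \<Longrightarrow> b' \<le> b \<Longrightarrow> c \<le> c' \<Longrightarrow> d' \<le> d \<Longrightarrow> rect a' b' c' d' \<subseteq> rect a b c d"
  by (auto simp: rect_def)

lemma rect_subset_cball: "p \<in> rect a b c d \<Longrightarrow> rect a b c d \<subseteq> cball p ((b - a) + (d - c))"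
proof
  fix z assume p: "p \<in> rect a b c d" and z: "z \<in> rect a b c d"
  have "norm (p - z) \<le> \<bar>Re (p - z)\<bar> + \<bar>Im (p - z)\<bar>" by (rule cmod_le)
  also have "\<dots> \<le> (b - a) + (d - c)" using p z by (auto simp: rect_def)
  finally show "z \<in> cball p ((b - a) + (d - c))" by (simp add: dist_norm)
qed

lemma continuous_on_Complex_x: "continuous_on X (\<lambda>x. Complex x c)"
  by (intro continuous_intros)

lemma continuous_on_Complex_y: "continuous_on X (\<lambda>y. Complex c y)"
  by (intro continuous_intros)

lemma continuous_on_horizontal:
  assumes "continuous_on X f" "\<And>x. a \<le> x \<Longrightarrow> x \<le> b \<Longrightarrow> Complex x c \<in> X"
  shows "continuous_on {a..b} (\<lambda>x. f (Complex x c))"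
  by (rule continuous_on_compose2[OF assms(1) continuous_on_Complex_x]) (use assms(2) in auto)

lemma continuous_on_vertical:
  assumes "continuous_on X f" "\<And>y. a \<le> y \<Longrightarrow> y \<le> b \<Longrightarrow> Complex c y \<in> X"
  shows "continuous_on {a..b} (\<lambda>y. f (Complex c y))"
  by (rule continuous_on_compose2[OF assms(1) continuous_on_Complex_y]) (use assms(2) in auto)

lemma integrable_on_horizontal:
  fixes f :: "complex \<Rightarrow> complex"
  assumes "continuous_on X f" "\<And>x. a \<le> x \<Longrightarrow> x \<le> b \<Longrightarrow> Complex x c \<in> X"
  shows "(\<lambda>x. f (Complex x c)) integrable_on {a..b}"
  by (rule integrable_continuous_real, rule continuous_on_horizontal[OF assms(1)]) (use assms(2) in auto)

lemma integrable_on_vertical: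
  fixes f :: "complex \<Rightarrow> complex"
  assumes "continuous_on X f" "\<And>y. a \<le> y \<Longrightarrow> y \<le> b \<Longrightarrow> Complex c y \<in> X"
  shows "(\<lambda>y. f (Complex c y)) integrable_on {a..b}"
  by (rule integrable_continuous_real, rule continuous_on_vertical[OF assms(1)]) (use assms(2) in auto)

text \<open>Only the two sides that are cut need to avoid the singularities of \<open>f\<close>.\<close>

lemma rint_split_x:
  assumes "a \<le> m" "m \<le> b" "continuous_on X f"
    and "\<And>x. a \<le> x \<Longrightarrow> x \<le> b \<Longrightarrow> Complex x c \<in> X \<and> Complex x d \<in> X"
  shows "rint f a b c d = rint f a m c d + rint f m b c d"
proof -
  have 1: "integral {a..b} (\<lambda>x. f (Complex x e)) = integral {a..m} (\<lambda>x. f (Complex x e)) + integral {m..b} (\<lambda>x. f (Complex x e))"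
    if "e = c \<or> e = d" for e
    using assms that by (intro Henstock_Kurzweil_Integration.integral_combine[symmetric] integrable_on_horizontal[where X=X]) auto
  show ?thesis unfolding rint_def 1[of c, simplified] 1[of d, simplified]
    by (simp add: algebra_simps)
qed

lemma rint_split_y:
  assumes "c \<le> m" "m \<le> d" "continuous_on X f"
    and "\<And>y. c \<le> y \<Longrightarrow> y \<le> d \<Longrightarrow> Complex a y \<in> X \<and> Complex b y \<in> X"
  shows "rint f a b c d = rint f a b c m + rint f a b m d"
proof -
  have 1: "integral {c..d} (\<lambda>x. f (Complex e x)) = integral {c..m} (\<lambda>x. f (Complex e x)) + integral {m..d} (\<lambda>x. f (Complex e x))"
    if "e = a \<or> e = b" for e
    using assms that by (intro Henstock_Kurzweil_Integration.integral_combine[symmetric] integrable_on_vertical[where X=X]) auto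
  show ?thesis unfolding rint_def 1[of a, simplified] 1[of b, simplified]
    by (simp add: algebra_simps)
qed

lemma rint_cong:
  assumes "a \<le> b" "c \<le> d"
    and "\<And>z. z \<in> rect a b c d \<Longrightarrow> Re z = a \<or> Re z = b \<or> Im z = c \<or> Im z = d \<Longrightarrow> f z = g z"
  shows "rint f a b c d = rint g a b c d"
proof -
  have "integral {a..b} (\<lambda>x. f (Complex x e)) = integral {a..b} (\<lambda>x. g (Complex x e))" if "e = c \<or> e = d" for e
    using assms that by (intro Henstock_Kurzweil_Integration.integral_cong) (auto simp: rect_def)
  moreover have "integral {c..d} (\<lambda>x. f (Complex e x)) = integral {c..d} (\<lambda>x. g (Complex e x))" if "e = a \<or> e = b" for e
    using assms that by (intro Henstock_Kurzweil_Integration.integral_cong) (auto simp: rect_def)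
  ultimately show ?thesis by (simp add: rint_def)
qed

lemma rint_linear:
  assumes "a \<le> b" "c \<le> d" "continuous_on X f" "continuous_on X g"
    and "\<And>z. z \<in> rect a b c d \<Longrightarrow> Re z = a \<or> Re z = b \<or> Im z = c \<or> Im z = d \<Longrightarrow> z \<in> X"
  shows "rint (\<lambda>z. k * f z + g z) a b c d = k * rint f a b c d + rint g a b c d"
proof -
  have "integral {a..b} (\<lambda>x. k * f (Complex x e) + g (Complex x e))
     = k * integral {a..b} (\<lambda>x. f (Complex x e)) + integral {a..b} (\<lambda>x. g (Complex x e))" if "e = c \<or> e = d" for e
  proof -
    have f: "(\<lambda>x. f (Complex x e)) integrable_on {a..b}" using assms(1,2,5) that by (intro integrable_on_horizontal[OF assms(3)]) (auto simp: rect_def)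
    have g: "(\<lambda>x. g (Complex x e)) integrable_on {a..b}" using assms(1,2,5) that by (intro integrable_on_horizontal[OF assms(4)]) (auto simp: rect_def)
    show ?thesis using f g
      by (subst Henstock_Kurzweil_Integration.integral_add) (auto intro: integrable_on_mult_right)
  qed
  moreover have "integral {c..d} (\<lambda>x. k * f (Complex e x) + g (Complex e x))
     = k * integral {c..d} (\<lambda>x. f (Complex e x)) + integral {c..d} (\<lambda>x. g (Complex e x))" if "e = a \<or> e = b" for e
  proof -
    have f: "(\<lambda>x. f (Complex e x)) integrable_on {c..d}" using assms(1,2,5) that by (intro integrable_on_vertical[OF assms(3)]) (auto simp: rect_def)
    have g: "(\<lambda>x. g (Complex e x)) integrable_on {c..d}" using assms(1,2,5) that by (intro integrable_on_vertical[OF assms(4)]) (auto simp: rect_def)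
    show ?thesis using f g
      by (subst Henstock_Kurzweil_Integration.integral_add) (auto intro: integrable_on_mult_right)
  qed
  ultimately show ?thesis by (simp add: rint_def algebra_simps)
qed

lemma rint_bound:
  assumes ab: "a \<le> b" and cd: "c \<le> d" and "continuous_on X f"
    and "\<And>z. z \<in> rect a b c d \<Longrightarrow> Re z = a \<or> Re z = b \<or> Im z = c \<or> Im z = d \<Longrightarrow> z \<in> X \<and> norm (f z) \<le> B"
  shows "norm (rint f a b c d) \<le> 2 * B * ((b - a) + (d - c))"
proof -
  have h: "norm (integral {a..b} (\<lambda>x. f (Complex x e))) \<le> B * (b - a)" if "e = c \<or> e = d" for e
    using assms that by (intro integral_bound continuous_on_horizontal[OF assms(3)]) (auto simp: rect_def)
  have v: "norm (integral {c..d} (\<lambda>x. f (Complex e x))) \<le> B * (d - c)" if "e = a \<or> e = b" for e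
    using assms that by (intro integral_bound continuous_on_vertical[OF assms(3)]) (auto simp: rect_def)
  have "norm (rint f a b c d) \<le> (norm (integral {a..b} (\<lambda>x. f (Complex x c))) + norm (integral {a..b} (\<lambda>x. f (Complex x d))))
     + (norm (integral {c..d} (\<lambda>y. f (Complex b y))) + norm (integral {c..d} (\<lambda>y. f (Complex a y))))"
    unfolding rint_def
    by (rule order_trans[OF norm_triangle_ineq]) (auto simp: norm_mult intro!: add_mono norm_triangle_ineq4)
  also have "\<dots> \<le> (B * (b - a) + B * (b - a)) + (B * (d - c) + B * (d - c))"
    by (intro add_mono h v) auto
  finally show ?thesis by (simp add: algebra_simps)
qed

text \<open>\<open>G'\<close> is only real linear. Along a side with unit direction \<open>w\<close>
  the integrand is compared with the derivative of \<open>G\<close> in that direction, whose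
  integral is the increment of \<open>G\<close>.\<close>

lemma segment_primitive_bound:
  fixes f G :: "complex \<Rightarrow> complex"
  assumes ab: "a \<le> b" and \<gamma>: "\<And>x. (\<gamma> has_derivative (\<lambda>t. t *\<^sub>R w)) (at x)" and w: "norm w = 1"
    and int: "(\<lambda>x. f (\<gamma> x)) integrable_on {a..b}"
    and der: "\<And>x. x \<in> {a..b} \<Longrightarrow> (G has_derivative G' (\<gamma> x)) (at (\<gamma> x))"
    and bd: "\<And>x t. x \<in> {a..b} \<Longrightarrow> norm (f (\<gamma> x) * t - G' (\<gamma> x) t) \<le> e * norm t"
  shows "norm (w * integral {a..b} (\<lambda>x. f (\<gamma> x)) - (G (\<gamma> b) - G (\<gamma> a))) \<le> e * (b - a)"
proof -
  have "((\<lambda>x. G (\<gamma> x)) has_vector_derivative G' (\<gamma> x) w) (at x within {a..b})" if x: "x \<in> {a..b}" for x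
    using has_derivative_compose[OF \<gamma> der[OF x]] linear_cmul[OF has_derivative_linear[OF der[OF x]]]
    by (simp add: has_vector_derivative_def has_derivative_at_withinI)
  from fundamental_theorem_of_calculus[OF ab this]
  have "((\<lambda>x. G' (\<gamma> x) w) has_integral (G (\<gamma> b) - G (\<gamma> a))) {a..b}" .
  from has_integral_diff[OF has_integral_mult_right[OF integrable_integral[OF int], of w] this]
  have "((\<lambda>x. w * f (\<gamma> x) - G' (\<gamma> x) w) has_integral (w * integral {a..b} (\<lambda>x. f (\<gamma> x)) - (G (\<gamma> b) - G (\<gamma> a)))) {a..b}" .
  moreover have "norm (w * f (\<gamma> x) - G' (\<gamma> x) w) \<le> e" if "x \<in> {a..b}" for x
    using bd[OF that, of w] w by (simp add: mult.commute)
  moreover have "0 \<le> e" using order_trans[OF norm_ge_zero bd[of a w]] ab w by simp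
  ultimately show ?thesis
    using has_integral_bound_real[of e "{}" "\<lambda>x. w * f (\<gamma> x) - G' (\<gamma> x) w" _ a b] ab by simp
qed

text \<open>The increments of \<open>G\<close> cancel around the closed boundary, so only
  \<open>e\<close> times the perimeter remains. This replaces Stokes' formula: no derivative of
  \<open>f\<close> occurs.\<close>

lemma rint_primitive_bound:
  assumes ab: "a \<le> b" and cd: "c \<le> d" and cont: "continuous_on (rect a b c d) f"
    and der: "\<And>z. z \<in> rect a b c d \<Longrightarrow> (G has_derivative G' z) (at z)"
    and bd: "\<And>z t. z \<in> rect a b c d \<Longrightarrow> norm (f z * t - G' z t) \<le> e * norm t"
  shows "norm (rint f a b c d) \<le> 2 * e * ((b - a) + (d - c))"
proof -
  let ?H = "\<lambda>k. integral {a..b} (\<lambda>x. f (Complex x k)) - (G (Complex b k) - G (Complex a k))"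
  let ?V = "\<lambda>k. \<i> * integral {c..d} (\<lambda>y. f (Complex k y)) - (G (Complex k d) - G (Complex k c))"
  have h: "norm (?H k) \<le> e * (b - a)" if k: "k = c \<or> k = d" for k
  proof -
    have m: "x \<in> {a..b} \<Longrightarrow> Complex x k \<in> rect a b c d" for x using k cd by (auto simp: rect_def)
    have "((\<lambda>x. Complex x k) has_derivative (\<lambda>t. t *\<^sub>R 1)) (at x)" for x
      unfolding Complex_eq by (auto intro!: derivative_eq_intros simp: scaleR_conv_of_real)
    from segment_primitive_bound[OF ab this _ integrable_on_horizontal[OF cont m] der[OF m] bd[OF m]] show ?thesis by simp
  qed
  have v: "norm (?V k) \<le> e * (d - c)" if k: "k = a \<or> k = b" for k
  proof -
    have m: "y \<in> {c..d} \<Longrightarrow> Complex k y \<in> rect a b c d" for y using k ab by (auto simp: rect_def)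
    have "((\<lambda>y. Complex k y) has_derivative (\<lambda>t. t *\<^sub>R \<i>)) (at y)" for y
      unfolding Complex_eq by (auto intro!: derivative_eq_intros simp: scaleR_conv_of_real)
    from segment_primitive_bound[OF cd this _ integrable_on_vertical[OF cont m] der[OF m] bd[OF m]] show ?thesis by simp
  qed
  have "rint f a b c d = (?H c - ?H d) + (?V b - ?V a)"
    by (simp add: rint_def algebra_simps)
  also have "norm \<dots> \<le> (norm (?H c) + norm (?H d)) + (norm (?V b) + norm (?V a))"
    by (rule order_trans[OF norm_triangle_ineq]) (intro add_mono norm_triangle_ineq4)
  also have "\<dots> \<le> (e * (b - a) + e * (b - a)) + (e * (d - c) + e * (d - c))"
    by (intro add_mono h v) auto
  finally show ?thesis by (simp add: algebra_simps)
qed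

lemma rint_holomorphic:
  assumes "a \<le> b" "c \<le> d" "open U" "convex U" "rect a b c d \<subseteq> U" "f holomorphic_on U"
  shows "rint f a b c d = 0"
proof -
  obtain g where g: "\<And>x. x \<in> U \<Longrightarrow> (g has_field_derivative f x) (at x)"
    using holomorphic_convex_primitive'[OF assms(4,3,6)] assms(3) at_within_open by metis
  \<comment> \<open>A holomorphic function has an exact primitive on the convex set, so the error
    constant is 0.\<close>
  have "norm (rint f a b c d) \<le> 2 * 0 * ((b - a) + (d - c))"
  proof (rule rint_primitive_bound)
    show "continuous_on (rect a b c d) f"
      using assms holomorphic_on_imp_continuous_on continuous_on_subset by blast
    show "(g has_derivative (*) (f z)) (at z)" if "z \<in> rect a b c d" for z
      using g[of z] that assms(5) by (auto simp: has_field_derivative_def)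
  qed (use assms in auto)
  thus ?thesis by simp
qed

text \<open>Subtracting opposite sides before integrating leaves 2 e / (t^2 + e^2), for the
  horizontal pair with a factor i. Its integral over [-e, e] is pi because arctan 1 = pi /
  4.\<close>

lemma rint_inverse:
  assumes "e > 0"
  shows "rint (\<lambda>z. 1 / (z - w)) (Re w - e) (Re w + e) (Im w - e) (Im w + e) = 2 * pi * \<i>"
proof -
  have I: "((\<lambda>x. e / ((x - m)\<^sup>2 + e\<^sup>2)) has_integral (pi / 2)) {m - e..m + e}" for m
  proof -
    have "((\<lambda>x. e / ((x - m)\<^sup>2 + e\<^sup>2)) has_integral (arctan ((m + e - m) / e) - arctan ((m - e - m) / e))) {m - e..m + e}"
    proof (rule fundamental_theorem_of_calculus)
      fix x assume "x \<in> {m - e..m + e}"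
      show "((\<lambda>x. arctan ((x - m) / e)) has_vector_derivative e / ((x - m)\<^sup>2 + e\<^sup>2)) (at x within {m - e..m + e})"
        unfolding has_real_derivative_iff_has_vector_derivative[symmetric] using assms
        by (auto intro!: derivative_eq_intros simp: field_simps power2_eq_square add_nonneg_eq_0_iff)
    qed (use assms in auto)
    thus ?thesis using assms by (simp add: arctan_one arctan_minus)
  qed
  have J: "((\<lambda>x. of_real (e / ((x - m)\<^sup>2 + e\<^sup>2)) :: complex) has_integral (of_real (pi / 2))) {m - e..m + e}" for m
    using has_integral_of_real[OF I[of m]] .
  have "integral {Re w - e..Re w + e} (\<lambda>x. 1 / (Complex x (Im w - e) - w)) - integral {Re w - e..Re w + e} (\<lambda>x. 1 / (Complex x (Im w + e) - w)) = \<i> * pi"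
  proof -
    have "continuous_on (- {w}) (\<lambda>z. 1 / (z - w))" by (intro continuous_intros) auto
    note c = integrable_on_horizontal[OF this]
    have "integral {Re w - e..Re w + e} (\<lambda>x. 1 / (Complex x (Im w - e) - w)) - integral {Re w - e..Re w + e} (\<lambda>x. 1 / (Complex x (Im w + e) - w))
      = integral {Re w - e..Re w + e} (\<lambda>x. 1 / (Complex x (Im w - e) - w) - 1 / (Complex x (Im w + e) - w))"
      using assms by (intro Henstock_Kurzweil_Integration.integral_diff[symmetric] c) (auto simp: complex_eq_iff)
    also have "\<dots> = integral {Re w - e..Re w + e} (\<lambda>x. 2 * \<i> * of_real (e / ((x - Re w)\<^sup>2 + e\<^sup>2)))"
      using assms by (intro Henstock_Kurzweil_Integration.integral_cong)
        (auto simp: complex_eq_iff Re_divide Im_divide field_simps power2_eq_square)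
    also have "\<dots> = 2 * \<i> * of_real (pi / 2)"
      by (intro integral_unique has_integral_mult_right J)
    finally show ?thesis by simp
  qed
  moreover have "integral {Im w - e..Im w + e} (\<lambda>y. 1 / (Complex (Re w + e) y - w)) - integral {Im w - e..Im w + e} (\<lambda>y. 1 / (Complex (Re w - e) y - w)) = pi"
  proof -
    have "continuous_on (- {w}) (\<lambda>z. 1 / (z - w))" by (intro continuous_intros) auto
    note c = integrable_on_vertical[OF this]
    have "integral {Im w - e..Im w + e} (\<lambda>y. 1 / (Complex (Re w + e) y - w)) - integral {Im w - e..Im w + e} (\<lambda>y. 1 / (Complex (Re w - e) y - w))
      = integral {Im w - e..Im w + e} (\<lambda>y. 1 / (Complex (Re w + e) y - w) - 1 / (Complex (Re w - e) y - w))"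
      using assms by (intro Henstock_Kurzweil_Integration.integral_diff[symmetric] c) (auto simp: complex_eq_iff)
    also have "\<dots> = integral {Im w - e..Im w + e} (\<lambda>x. 2 * of_real (e / ((x - Im w)\<^sup>2 + e\<^sup>2)))"
      using assms by (intro Henstock_Kurzweil_Integration.integral_cong)
        (auto simp: complex_eq_iff Re_divide Im_divide field_simps power2_eq_square)
    also have "\<dots> = 2 * of_real (pi / 2)"
      by (intro integral_unique has_integral_mult_right J)
    finally show ?thesis by simp
  qed
  ultimately show ?thesis unfolding rint_def by (simp add: algebra_simps)
qed

subsection \<open>Goursat bisection with a majorant\<close>

text \<open>Superadditivity under cuts and positivity are all that the bisection needs of an area
  integral.\<close>

definition rect_majorant :: "(real \<Rightarrow> real \<Rightarrow> real \<Rightarrow> real \<Rightarrow> real) \<Rightarrow> bool" where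
  "rect_majorant \<Phi> \<longleftrightarrow>
     (\<forall>a m b c d. a \<le> m \<longrightarrow> m \<le> b \<longrightarrow> c \<le> d \<longrightarrow> \<Phi> a m c d + \<Phi> m b c d \<le> \<Phi> a b c d) \<and>
     (\<forall>a b c m d. a \<le> b \<longrightarrow> c \<le> m \<longrightarrow> m \<le> d \<longrightarrow> \<Phi> a b c m + \<Phi> a b m d \<le> \<Phi> a b c d) \<and>
     (\<forall>a b c d. a \<le> b \<longrightarrow> c \<le> d \<longrightarrow> 0 \<le> \<Phi> a b c d)"

lemma rect_majorant_split_x:
  "rect_majorant \<Phi> \<Longrightarrow> a \<le> m \<Longrightarrow> m \<le> b \<Longrightarrow> c \<le> d \<Longrightarrow> \<Phi> a m c d + \<Phi> m b c d \<le> \<Phi> a b c d"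
  by (simp add: rect_majorant_def)

lemma rect_majorant_split_y:
  "rect_majorant \<Phi> \<Longrightarrow> a \<le> b \<Longrightarrow> c \<le> m \<Longrightarrow> m \<le> d \<Longrightarrow> \<Phi> a b c m + \<Phi> a b m d \<le> \<Phi> a b c d"
  by (simp add: rect_majorant_def)

lemma rect_majorant_nonneg: "rect_majorant \<Phi> \<Longrightarrow> a \<le> b \<Longrightarrow> c \<le> d \<Longrightarrow> 0 \<le> \<Phi> a b c d"
  by (simp add: rect_majorant_def)

text \<open>The bound is asked only near each point and with a slack of \<open>e\<close> times the
  area, as a first order expansion provides it. The side ratio is at most 2, since otherwise the
  squared perimeter is not controlled by the area.\<close>

definition loc_majorized :: "(complex \<Rightarrow> complex) \<Rightarrow> (real \<Rightarrow> real \<Rightarrow> real \<Rightarrow> real \<Rightarrow> real) \<Rightarrow> complex set \<Rightarrow> bool" where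
  "loc_majorized f \<Phi> R \<longleftrightarrow> (\<forall>p\<in>R. \<forall>e>0. \<exists>\<delta>>0. \<forall>a b c d.
     a < b \<and> c < d \<and> b - a \<le> 2 * (d - c) \<and> d - c \<le> 2 * (b - a) \<and>
     p \<in> rect a b c d \<and> rect a b c d \<subseteq> ball p \<delta> \<inter> R \<longrightarrow>
     norm (rint f a b c d) \<le> \<Phi> a b c d + e * ((b - a) * (d - c)))"

lemma loc_majorized_subset: "loc_majorized f \<Phi> R \<Longrightarrow> R' \<subseteq> R \<Longrightarrow> loc_majorized f \<Phi> R'"
  unfolding loc_majorized_def
  by (intro ballI allI impI, drule bspec, erule subsetD, assumption, drule spec, drule mp, assumption,
    elim exE conjE, intro exI conjI, assumption) auto

text \<open>Goursat's argument. Boundary integrals add up, \<open>\<Phi>\<close> is superadditive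
  and the area is additive, so a violation by more than \<open>e\<close> times the area is inherited
  by one of the four quarters. Quartering preserves the side ratio, and the limit point of the
  nested rectangles contradicts the local bound.\<close>

lemma rint_le_majorant_fat:
  assumes "a < b" "c < d" "b - a \<le> 2 * (d - c)" "d - c \<le> 2 * (b - a)"
    and cont: "continuous_on (rect a b c d) f"
    and \<Phi>: "rect_majorant \<Phi>" and loc: "loc_majorized f \<Phi> (rect a b c d)"
  shows "norm (rint f a b c d) \<le> \<Phi> a b c d"
proof (rule ccontr)
  assume nt: "\<not> norm (rint f a b c d) \<le> \<Phi> a b c d"
  \<comment> \<open>Half of the violation, measured per unit area; the other half keeps
    \<open>bad0\<close> strict.\<close>
  define e where "e = (norm (rint f a b c d) - \<Phi> a b c d) / (2 * ((b - a) * (d - c)))"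
  have e: "e > 0" using nt assms(1,2) by (simp add: e_def)
  have bad0: "norm (rint f a b c d) > \<Phi> a b c d + e * ((b - a) * (d - c))"
  proof -
    define A where "A = (b - a) * (d - c)"
    have "A > 0" using assms(1,2) by (simp add: A_def)
    hence "e * A = (norm (rint f a b c d) - \<Phi> a b c d) / 2" by (simp add: e_def A_def[symmetric])
    thus ?thesis using nt by (simp add: A_def)
  qed
  define R where "R = (\<lambda>(a,b,c,d). rect a b c d)"
  define P where "P = (\<lambda>n (a',b',c',d'). b' - a' = (b - a) / 2 ^ n \<and> d' - c' = (d - c) / 2 ^ n \<and>
     rect a' b' c' d' \<subseteq> rect a b c d \<and> norm (rint f a' b' c' d') > \<Phi> a' b' c' d' + e * ((b' - a') * (d' - c')))"
  have "\<exists>g. \<forall>n. P n (g n) \<and> R (g (Suc n)) \<subseteq> R (g n)"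
  proof (rule dependent_nat_choice)
    show "\<exists>x. P 0 x" using bad0 by (intro exI[of _ "(a,b,c,d)"]) (auto simp: P_def)
  next
    fix x n assume "P n x"
    obtain a' b' c' d' where x: "x = (a',b',c',d')" by (metis surj_pair)
    have len: "b' - a' = (b - a) / 2 ^ n" "d' - c' = (d - c) / 2 ^ n" and sub: "rect a' b' c' d' \<subseteq> rect a b c d"
      and bad: "norm (rint f a' b' c' d') > \<Phi> a' b' c' d' + e * ((b' - a') * (d' - c'))"
      using \<open>P n x\<close> by (auto simp: P_def x)
    have ord: "a' < b'" "c' < d'"
    proof -
      have "b' - a' > 0" "d' - c' > 0" unfolding len using assms(1,2) by auto
      thus "a' < b'" "c' < d'" by auto
    qed
    define p q where "p = (a' + b') / 2" and "q = (c' + d') / 2"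
    have pq: "a' \<le> p" "p \<le> b'" "c' \<le> q" "q \<le> d'" using ord by (auto simp: p_def q_def)
    have c': "continuous_on (rect a' b' c' d') f" using cont sub continuous_on_subset by blast
    have "rint f a' b' c' d' = rint f a' p c' d' + rint f p b' c' d'"
      by (rule rint_split_x[OF _ _ c']) (use pq ord in \<open>auto simp: rect_def\<close>)
    moreover have "rint f a' p c' d' = rint f a' p c' q + rint f a' p q d'"
      by (rule rint_split_y[OF _ _ c']) (use pq ord in \<open>auto simp: rect_def\<close>)
    moreover have "rint f p b' c' d' = rint f p b' c' q + rint f p b' q d'"
      by (rule rint_split_y[OF _ _ c']) (use pq ord in \<open>auto simp: rect_def\<close>)
    ultimately have "rint f a' b' c' d' = (rint f a' p c' q + rint f a' p q d') + (rint f p b' c' q + rint f p b' q d')" by simp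
    hence sum: "norm (rint f a' b' c' d') \<le> (norm (rint f a' p c' q) + norm (rint f a' p q d')) + (norm (rint f p b' c' q) + norm (rint f p b' q d'))"
      by (auto intro!: norm_triangle_le add_mono)
    have "\<Phi> a' p c' d' + \<Phi> p b' c' d' \<le> \<Phi> a' b' c' d'" "\<Phi> a' p c' q + \<Phi> a' p q d' \<le> \<Phi> a' p c' d'"
      "\<Phi> p b' c' q + \<Phi> p b' q d' \<le> \<Phi> p b' c' d'"
      using pq ord by (intro rect_majorant_split_x[OF \<Phi>] rect_majorant_split_y[OF \<Phi>]; simp)+
    hence sum\<Phi>: "\<Phi> a' p c' q + \<Phi> a' p q d' + \<Phi> p b' c' q + \<Phi> p b' q d' \<le> \<Phi> a' b' c' d'" by linarith
    have half: "p - a' = (b' - a') / 2" "b' - p = (b' - a') / 2" "q - c' = (d' - c') / 2" "d' - q = (d' - c') / 2"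
      by (auto simp: p_def q_def field_simps)
    have area: "e * ((p - a') * (q - c')) + e * ((p - a') * (d' - q)) + e * ((b' - p) * (q - c')) + e * ((b' - p) * (d' - q)) = e * ((b' - a') * (d' - c'))"
      unfolding half by (simp add: field_simps)
    have *: "\<exists>y. P (Suc n) y \<and> R y \<subseteq> R x"
      if bad: "norm (rint f a2 b2 c2 d2) > \<Phi> a2 b2 c2 d2 + e * ((b2 - a2) * (d2 - c2))"
        and l: "b2 - a2 = (b' - a') / 2" "d2 - c2 = (d' - c') / 2" and s: "a' \<le> a2" "b2 \<le> b'" "c' \<le> c2" "d2 \<le> d'"
      for a2 b2 c2 d2
    proof (intro exI conjI)
      have s': "rect a2 b2 c2 d2 \<subseteq> rect a' b' c' d'" using s by (rule rect_mono)
      show "P (Suc n) (a2,b2,c2,d2)" using bad l s' sub by (auto simp: P_def len)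
      show "R (a2,b2,c2,d2) \<subseteq> R x" using s' by (simp add: R_def x)
    qed
    consider "(norm (rint f a' p c' q) > \<Phi> a' p c' q + e * ((p - a') * (q - c')))" |
      "(norm (rint f a' p q d') > \<Phi> a' p q d' + e * ((p - a') * (d' - q)))" |
      "(norm (rint f p b' c' q) > \<Phi> p b' c' q + e * ((b' - p) * (q - c')))" |
      "(norm (rint f p b' q d') > \<Phi> p b' q d' + e * ((b' - p) * (d' - q)))"
      using sum sum\<Phi> bad area by linarith
    then show "\<exists>y. P (Suc n) y \<and> R y \<subseteq> R x"
    proof cases
      case 1 thus ?thesis by (rule *) (use pq half in auto)
    next
      case 2 thus ?thesis by (rule *) (use pq half in auto)
    next
      case 3 thus ?thesis by (rule *) (use pq half in auto)
    next
      case 4 thus ?thesis by (rule *) (use pq half in auto)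
    qed
  qed
  then obtain g where g: "\<And>n. P n (g n)" "\<And>n. R (g (Suc n)) \<subseteq> R (g n)" by blast
  have ne: "a' < b' \<and> c' < d'" if "g n = (a',b',c',d')" for n a' b' c' d'
  proof -
    have "b' - a' = (b - a) / 2 ^ n" "d' - c' = (d - c) / 2 ^ n" using g(1)[of n] that by (auto simp: P_def)
    moreover have "(b - a) / 2 ^ n > 0" "(d - c) / 2 ^ n > 0" using assms(1,2) by auto
    ultimately show ?thesis by linarith
  qed
  have "\<Inter>(range (\<lambda>n. R (g n))) \<noteq> {}"
  proof (rule compact_nest)
    show "compact (R (g n))" for n by (cases "g n") (simp add: R_def compact_rect)
    show "R (g n) \<noteq> {}" for n
    proof -
      obtain a' b' c' d' where x: "g n = (a',b',c',d')" by (metis surj_pair)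
      have "Complex a' c' \<in> R (g n)" using ne[OF x] by (simp add: x R_def rect_def)
      thus ?thesis by blast
    qed
    show "R (g n) \<subseteq> R (g m)" if "m \<le> n" for m n
      by (rule lift_Suc_antimono_le[where f="\<lambda>n. R (g n)"]) (use g(2) that in auto)
  qed
  then obtain p where p: "\<And>n. p \<in> R (g n)" by blast
  have pR: "p \<in> rect a b c d" using p[of 0] g(1)[of 0] by (cases "g 0") (auto simp: P_def R_def)
  then obtain \<delta> where \<delta>: "\<delta> > 0" and H: "\<And>a' b' c' d'. a' < b' \<and> c' < d' \<and> b' - a' \<le> 2 * (d' - c') \<and> d' - c' \<le> 2 * (b' - a') \<and>
     p \<in> rect a' b' c' d' \<and> rect a' b' c' d' \<subseteq> ball p \<delta> \<inter> rect a b c d \<Longrightarrow>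
     norm (rint f a' b' c' d') \<le> \<Phi> a' b' c' d' + e * ((b' - a') * (d' - c'))"
    using loc[unfolded loc_majorized_def, rule_format, OF pR e] by auto
  obtain n where n: "((b - a) + (d - c)) * (1/2) ^ n < \<delta>"
  proof -
    have "(\<lambda>n. ((b - a) + (d - c)) * (1/2) ^ n) \<longlonglongrightarrow> ((b - a) + (d - c)) * 0"
      by (intro tendsto_intros LIMSEQ_power_zero) auto
    hence "\<forall>\<^sub>F n in sequentially. ((b - a) + (d - c)) * (1/2) ^ n < \<delta>"
      using \<delta> by (intro order_tendstoD(2)) auto
    thus ?thesis using that eventually_happens by force
  qed
  obtain a' b' c' d' where x: "g n = (a',b',c',d')" by (metis surj_pair)
  have len: "b' - a' = (b - a) / 2 ^ n" "d' - c' = (d - c) / 2 ^ n" and sub: "rect a' b' c' d' \<subseteq> rect a b c d"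
    and bad: "norm (rint f a' b' c' d') > \<Phi> a' b' c' d' + e * ((b' - a') * (d' - c'))"
    using g(1)[of n] by (auto simp: P_def x)
  have pin: "p \<in> rect a' b' c' d'" using p[of n] by (simp add: R_def x)
  have "rect a' b' c' d' \<subseteq> ball p \<delta>"
  proof -
    have "(b' - a') + (d' - c') = ((b - a) + (d - c)) * (1/2) ^ n" unfolding len by (simp add: power_one_over add_divide_distrib)
    hence "(b' - a') + (d' - c') < \<delta>" using n by simp
    thus ?thesis using rect_subset_cball[OF pin] by (auto simp: subset_iff)
  qed
  moreover have "b' - a' \<le> 2 * (d' - c')" "d' - c' \<le> 2 * (b' - a')"
    unfolding len using assms(3,4) by (simp_all add: divide_right_mono)
  ultimately show False using H[of a' b' c' d'] ne[OF x] pin sub bad by auto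
qed

text \<open>A long rectangle is halved across its longer side until its ratio is at most 2; the
  \<open>n\<close> of the auxiliary claim limits the number of halvings.\<close>

lemma rint_le_majorant:
  assumes "a < b" "c < d"
    and cont: "continuous_on (rect a b c d) f"
    and \<Phi>: "rect_majorant \<Phi>" and loc: "loc_majorized f \<Phi> (rect a b c d)"
  shows "norm (rint f a b c d) \<le> \<Phi> a b c d"
proof -
  have *: "norm (rint f a b c d) \<le> \<Phi> a b c d"
    if "a < b" "c < d" "continuous_on (rect a b c d) f" "loc_majorized f \<Phi> (rect a b c d)"
      "b - a \<le> 2 * 2 ^ n * (d - c)" "d - c \<le> 2 * 2 ^ n * (b - a)" for n a b c d
    using that
  proof (induction n arbitrary: a b c d)
    case 0 thus ?case using rint_le_majorant_fat[of a b c d f \<Phi>] \<Phi> by simp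
  next
    case (Suc n)
    have "1 \<le> (2::real) ^ n" by simp
    consider "b - a \<le> 2 * (d - c)" "d - c \<le> 2 * (b - a)" | "b - a > 2 * (d - c)" | "d - c > 2 * (b - a)" by linarith
    thus ?case
    proof cases
      case 1 show ?thesis by (rule rint_le_majorant_fat[OF Suc.prems(1,2) 1 Suc.prems(3) \<Phi> Suc.prems(4)])
    next
      case 2
      define m where "m = (a + b) / 2"
      have m: "a < m" "m < b" "m - a = (b - a) / 2" "b - m = (b - a) / 2" using Suc.prems by (auto simp: m_def field_simps)
      have s: "rect a m c d \<subseteq> rect a b c d" "rect m b c d \<subseteq> rect a b c d" using m by (intro rect_mono; simp)+
      have r: "d - c \<le> 2 * 2 ^ n * (m - a)" "d - c \<le> 2 * 2 ^ n * (b - m)"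
        "m - a \<le> 2 * 2 ^ n * (d - c)" "b - m \<le> 2 * 2 ^ n * (d - c)"
      proof -
        have "d - c \<le> 1 * (b - a)" using 2 Suc.prems(1,2) by simp
        also have "\<dots> \<le> 2 ^ n * (b - a)" using Suc.prems by (intro mult_right_mono) auto
        finally show "d - c \<le> 2 * 2 ^ n * (m - a)" "d - c \<le> 2 * 2 ^ n * (b - m)" unfolding m(3,4) by simp_all
        show "m - a \<le> 2 * 2 ^ n * (d - c)" "b - m \<le> 2 * 2 ^ n * (d - c)" unfolding m(3,4) using Suc.prems(5) by simp_all
      qed
      have "norm (rint f a m c d) \<le> \<Phi> a m c d"
        by (rule Suc.IH) (fact m(1) m(2) Suc.prems(1,2) r continuous_on_subset[OF Suc.prems(3) s(1)] continuous_on_subset[OF Suc.prems(3) s(2)]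
          loc_majorized_subset[OF Suc.prems(4) s(1)] loc_majorized_subset[OF Suc.prems(4) s(2)])+
      moreover have "norm (rint f m b c d) \<le> \<Phi> m b c d"
        by (rule Suc.IH) (fact m(1) m(2) Suc.prems(1,2) r continuous_on_subset[OF Suc.prems(3) s(1)] continuous_on_subset[OF Suc.prems(3) s(2)]
          loc_majorized_subset[OF Suc.prems(4) s(1)] loc_majorized_subset[OF Suc.prems(4) s(2)])+
      moreover have "rint f a b c d = rint f a m c d + rint f m b c d"
        by (rule rint_split_x[OF _ _ Suc.prems(3)]) (use m Suc.prems in \<open>auto simp: rect_def\<close>)
      moreover have "\<Phi> a m c d + \<Phi> m b c d \<le> \<Phi> a b c d"
        using m Suc.prems by (intro rect_majorant_split_x[OF \<Phi>]) auto
      ultimately show ?thesis by (smt (verit) norm_triangle_ineq)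
    next
      case 3
      define m where "m = (c + d) / 2"
      have m: "c < m" "m < d" "m - c = (d - c) / 2" "d - m = (d - c) / 2" using Suc.prems by (auto simp: m_def field_simps)
      have s: "rect a b c m \<subseteq> rect a b c d" "rect a b m d \<subseteq> rect a b c d" using m by (intro rect_mono; simp)+
      have r: "b - a \<le> 2 * 2 ^ n * (m - c)" "b - a \<le> 2 * 2 ^ n * (d - m)"
        "m - c \<le> 2 * 2 ^ n * (b - a)" "d - m \<le> 2 * 2 ^ n * (b - a)"
      proof -
        have "b - a \<le> 1 * (d - c)" using 3 Suc.prems(1,2) by simp
        also have "\<dots> \<le> 2 ^ n * (d - c)" using Suc.prems by (intro mult_right_mono) auto
        finally show "b - a \<le> 2 * 2 ^ n * (m - c)" "b - a \<le> 2 * 2 ^ n * (d - m)" unfolding m(3,4) by simp_all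
        show "m - c \<le> 2 * 2 ^ n * (b - a)" "d - m \<le> 2 * 2 ^ n * (b - a)" unfolding m(3,4) using Suc.prems(6) by simp_all
      qed
      have "norm (rint f a b c m) \<le> \<Phi> a b c m"
        by (rule Suc.IH) (fact m(1) m(2) Suc.prems(1,2) r continuous_on_subset[OF Suc.prems(3) s(1)] continuous_on_subset[OF Suc.prems(3) s(2)]
          loc_majorized_subset[OF Suc.prems(4) s(1)] loc_majorized_subset[OF Suc.prems(4) s(2)])+
      moreover have "norm (rint f a b m d) \<le> \<Phi> a b m d"
        by (rule Suc.IH) (fact m(1) m(2) Suc.prems(1,2) r continuous_on_subset[OF Suc.prems(3) s(1)] continuous_on_subset[OF Suc.prems(3) s(2)]
          loc_majorized_subset[OF Suc.prems(4) s(1)] loc_majorized_subset[OF Suc.prems(4) s(2)])+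
      moreover have "rint f a b c d = rint f a b c m + rint f a b m d"
        by (rule rint_split_y[OF _ _ Suc.prems(3)]) (use m Suc.prems in \<open>auto simp: rect_def\<close>)
      moreover have "\<Phi> a b c m + \<Phi> a b m d \<le> \<Phi> a b c d"
        using m Suc.prems by (intro rect_majorant_split_y[OF \<Phi>]) auto
      ultimately show ?thesis by (smt (verit) norm_triangle_ineq)
    qed
  qed
  obtain n where n: "(b - a) / (d - c) + (d - c) / (b - a) < 2 ^ n" using real_arch_pow[of 2] by auto
  have pos: "(b - a) / (d - c) > 0" "(d - c) / (b - a) > 0" using assms by auto
  have "(b - a) / (d - c) \<le> 2 * 2 ^ n" "(d - c) / (b - a) \<le> 2 * 2 ^ n" using n pos by linarith+
  hence "b - a \<le> 2 * 2 ^ n * (d - c)" "d - c \<le> 2 * 2 ^ n * (b - a)"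
    using assms(1,2) by (simp_all add: divide_le_eq)
  thus ?thesis using *[of a b c d n] assms by blast
qed

text \<open>A square around an isolated singularity is cut out by four rectangles.\<close>

lemma rint_annulus:
  assumes "a < a'" "a' < b'" "b' < b" "c < c'" "c' < d'" "d' < d"
    and cont: "continuous_on (rect a b c d - Z) f" and Z: "Z \<subseteq> {z. a' < Re z \<and> Re z < b' \<and> c' < Im z \<and> Im z < d'}"
    and \<Phi>: "rect_majorant \<Phi>" and loc: "loc_majorized f \<Phi> (rect a b c d - Z)"
  shows "norm (rint f a b c d - rint f a' b' c' d') \<le> \<Phi> a b c d"
proof -
  have "rint f a b c d = rint f a a' c d + rint f a' b c d"
    by (rule rint_split_x[OF _ _ cont]) (use assms(1-6) Z in \<open>auto simp: rect_def\<close>)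
  moreover have "rint f a' b c d = rint f a' b' c d + rint f b' b c d"
    by (rule rint_split_x[OF _ _ cont]) (use assms(1-6) Z in \<open>auto simp: rect_def\<close>)
  moreover have "rint f a' b' c d = rint f a' b' c c' + rint f a' b' c' d"
    by (rule rint_split_y[OF _ _ cont]) (use assms(1-6) Z in \<open>auto simp: rect_def\<close>)
  moreover have "rint f a' b' c' d = rint f a' b' c' d' + rint f a' b' d' d"
    by (rule rint_split_y[OF _ _ cont]) (use assms(1-6) Z in \<open>auto simp: rect_def\<close>)
  ultimately have eq: "rint f a b c d - rint f a' b' c' d' = rint f a a' c d + rint f b' b c d + rint f a' b' c c' + rint f a' b' d' d"
    by simp
  \<comment> \<open>The share of the hole is discarded, which is allowed because
    \<open>\<Phi>\<close> is nonnegative.\<close>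
  have m: "\<Phi> a b c d \<ge> \<Phi> a a' c d + \<Phi> a' b c d" "\<Phi> a' b c d \<ge> \<Phi> a' b' c d + \<Phi> b' b c d"
      "\<Phi> a' b' c d \<ge> \<Phi> a' b' c c' + \<Phi> a' b' c' d" "\<Phi> a' b' c' d \<ge> \<Phi> a' b' c' d' + \<Phi> a' b' d' d"
      "\<Phi> a' b' c' d' \<ge> 0"
    using assms(1-6) by (intro rect_majorant_split_x[OF \<Phi>] rect_majorant_split_y[OF \<Phi>] rect_majorant_nonneg[OF \<Phi>]; simp)+
  have *: "norm (rint f a2 b2 c2 d2) \<le> \<Phi> a2 b2 c2 d2" if "a2 < b2" "c2 < d2" "rect a2 b2 c2 d2 \<subseteq> rect a b c d - Z" for a2 b2 c2 d2
    using that by (intro rint_le_majorant \<Phi> continuous_on_subset[OF cont] loc_majorized_subset[OF loc])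
  have "norm (rint f a a' c d) \<le> \<Phi> a a' c d" "norm (rint f b' b c d) \<le> \<Phi> b' b c d"
    "norm (rint f a' b' c c') \<le> \<Phi> a' b' c c'" "norm (rint f a' b' d' d) \<le> \<Phi> a' b' d' d"
    by (rule *; use assms(1-6) Z in \<open>auto simp: rect_def\<close>)+
  thus ?thesis unfolding eq using m
    by (smt (verit) norm_triangle_ineq)
qed

definition sq_rint :: "(complex \<Rightarrow> complex) \<Rightarrow> complex \<Rightarrow> real \<Rightarrow> complex" where
  "sq_rint f p e = rint f (Re p - e) (Re p + e) (Im p - e) (Im p + e)"

text \<open>A residue theorem with an error term. \<open>L p\<close> is a limit of integrals over
  shrinking squares, since \<open>f\<close> is not holomorphic and has no Laurent series. A cut
  between two singularities reduces their number; for a single one the annulus estimate is passed to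
  the limit.\<close>

lemma rint_singular:
  assumes "finite Z" "a < b" "c < d" and Z: "Z \<subseteq> {z. a < Re z \<and> Re z < b \<and> c < Im z \<and> Im z < d}"
    and cont: "continuous_on (rect a b c d - Z) f"
    and \<Phi>: "rect_majorant \<Phi>" and loc: "loc_majorized f \<Phi> (rect a b c d - Z)"
    and L: "\<And>p. p \<in> Z \<Longrightarrow> (sq_rint f p \<longlongrightarrow> L p) (at_right 0)"
  shows "norm (rint f a b c d - (\<Sum>p\<in>Z. L p)) \<le> \<Phi> a b c d"
  using assms(1-5) loc L
proof (induction "card Z" arbitrary: Z a b c d rule: less_induct)
  case less
  note cont = less.prems(5)
  consider "Z = {}" | p where "Z = {p}" | p q where "p \<in> Z" "q \<in> Z" "Re p < Re q" | p q where "p \<in> Z" "q \<in> Z" "Im p < Im q"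
    by (metis complex_eqI is_singletonI' is_singleton_def linorder_less_linear)
  thus ?case
  proof cases
    case 1 thus ?thesis using rint_le_majorant[of a b c d f \<Phi>] less.prems \<Phi> by simp
  next
    case (2 p)
    define r where "r = Min {Re p - a, b - Re p, Im p - c, d - Im p}"
    have "r > 0" using less.prems 2 by (auto simp: r_def)
    have rle: "r \<le> Re p - a" "r \<le> b - Re p" "r \<le> Im p - c" "r \<le> d - Im p" by (auto simp: r_def)
    have "norm (rint f a b c d - L p) \<le> \<Phi> a b c d"
    proof (rule tendsto_upperbound)
      show "((\<lambda>e. norm (rint f a b c d - sq_rint f p e)) \<longlongrightarrow> norm (rint f a b c d - L p)) (at_right 0)"
        using less.prems(7) 2 by (intro tendsto_intros) auto
      show "\<forall>\<^sub>F e in at_right 0. norm (rint f a b c d - sq_rint f p e) \<le> \<Phi> a b c d"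
        unfolding eventually_at_right_field
      proof (intro exI[of _ r] conjI allI impI)
        fix e assume "0 < e" "e < r"
        thus "norm (rint f a b c d - sq_rint f p e) \<le> \<Phi> a b c d" unfolding sq_rint_def
          using rle less.prems 2 by (intro rint_annulus[where Z=Z] \<Phi>) auto
      qed fact
    qed simp
    thus ?thesis by (simp add: 2)
  next
    case (3 p q)
    have "finite (Re ` Z)" using less.prems by simp
    \<comment> \<open>The cut must avoid every singularity; finitely many real parts leave room for
      it.\<close>
    hence "infinite ({Re p<..<Re q} - Re ` Z)" using 3 by (simp add: Diff_infinite_finite)
    then obtain m where m: "m \<in> {Re p<..<Re q}" "m \<notin> Re ` Z"
      by (metis DiffE ex_in_conv finite.emptyI)
    have am: "a < m" "m < b" using m 3 less.prems by auto
    have mz: "Re z < m \<or> m < Re z" if "z \<in> Z" for z using m that by (metis image_eqI linorder_less_linear)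
    define Z1 Z2 where "Z1 = {z\<in>Z. Re z < m}" and "Z2 = {z\<in>Z. Re z > m}"
    have Zeq: "Z = Z1 \<union> Z2" "Z1 \<inter> Z2 = {}"
      using m(2) unfolding Z1_def Z2_def by (force, force)
    have "q \<in> Z - Z1" "Z1 \<subseteq> Z" "p \<in> Z - Z2" "Z2 \<subseteq> Z" using m 3 by (auto simp: Z1_def Z2_def)
    hence "Z1 \<subset> Z" "Z2 \<subset> Z" by blast+
    hence card: "card Z1 < card Z" "card Z2 < card Z" using less.prems by (auto intro: psubset_card_mono)
    have s: "rect a m c d - Z1 \<subseteq> rect a b c d - Z" "rect m b c d - Z2 \<subseteq> rect a b c d - Z"
      using am by (auto simp: rect_def Z1_def Z2_def dest: mz)
    have 1: "norm (rint f a m c d - (\<Sum>p\<in>Z1. L p)) \<le> \<Phi> a m c d"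
      by (rule less.hyps[OF card(1)])
        (use am less.prems s in \<open>auto simp: Z1_def intro: continuous_on_subset loc_majorized_subset\<close>)
    have 2: "norm (rint f m b c d - (\<Sum>p\<in>Z2. L p)) \<le> \<Phi> m b c d"
      by (rule less.hyps[OF card(2)])
        (use am less.prems s in \<open>auto simp: Z2_def intro: continuous_on_subset loc_majorized_subset\<close>)
    have "rint f a b c d = rint f a m c d + rint f m b c d"
      by (rule rint_split_x[OF _ _ cont]) (use am less.prems in \<open>auto simp: rect_def\<close>)
    moreover have "(\<Sum>p\<in>Z. L p) = (\<Sum>p\<in>Z1. L p) + (\<Sum>p\<in>Z2. L p)"
      using less.prems Zeq by (metis finite_Un sum.union_disjoint)
    ultimately have "rint f a b c d - (\<Sum>p\<in>Z. L p) = (rint f a m c d - (\<Sum>p\<in>Z1. L p)) + (rint f m b c d - (\<Sum>p\<in>Z2. L p))"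
      by simp
    moreover have "\<Phi> a m c d + \<Phi> m b c d \<le> \<Phi> a b c d"
      using am less.prems by (intro rect_majorant_split_x[OF \<Phi>]) auto
    ultimately show ?thesis using 1 2 by (smt (verit) norm_triangle_ineq)
  next
    case (4 p q)
    have "finite (Im ` Z)" using less.prems by simp
    hence "infinite ({Im p<..<Im q} - Im ` Z)" using 4 by (simp add: Diff_infinite_finite)
    then obtain m where m: "m \<in> {Im p<..<Im q}" "m \<notin> Im ` Z"
      by (metis DiffE ex_in_conv finite.emptyI)
    have am: "c < m" "m < d" using m 4 less.prems by auto
    have mz: "Im z < m \<or> m < Im z" if "z \<in> Z" for z using m that by (metis image_eqI linorder_less_linear)
    define Z1 Z2 where "Z1 = {z\<in>Z. Im z < m}" and "Z2 = {z\<in>Z. Im z > m}"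
    have Zeq: "Z = Z1 \<union> Z2" "Z1 \<inter> Z2 = {}"
      using m(2) unfolding Z1_def Z2_def by (force, force)
    have "q \<in> Z - Z1" "Z1 \<subseteq> Z" "p \<in> Z - Z2" "Z2 \<subseteq> Z" using m 4 by (auto simp: Z1_def Z2_def)
    hence "Z1 \<subset> Z" "Z2 \<subset> Z" by blast+
    hence card: "card Z1 < card Z" "card Z2 < card Z" using less.prems by (auto intro: psubset_card_mono)
    have s: "rect a b c m - Z1 \<subseteq> rect a b c d - Z" "rect a b m d - Z2 \<subseteq> rect a b c d - Z"
      using am by (auto simp: rect_def Z1_def Z2_def dest: mz)
    have 1: "norm (rint f a b c m - (\<Sum>p\<in>Z1. L p)) \<le> \<Phi> a b c m"
      by (rule less.hyps[OF card(1)])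
        (use am less.prems s in \<open>auto simp: Z1_def intro: continuous_on_subset loc_majorized_subset\<close>)
    have 2: "norm (rint f a b m d - (\<Sum>p\<in>Z2. L p)) \<le> \<Phi> a b m d"
      by (rule less.hyps[OF card(2)])
        (use am less.prems s in \<open>auto simp: Z2_def intro: continuous_on_subset loc_majorized_subset\<close>)
    have "rint f a b c d = rint f a b c m + rint f a b m d"
      by (rule rint_split_y[OF _ _ cont]) (use am less.prems in \<open>auto simp: rect_def\<close>)
    moreover have "(\<Sum>p\<in>Z. L p) = (\<Sum>p\<in>Z1. L p) + (\<Sum>p\<in>Z2. L p)"
      using less.prems Zeq by (metis finite_Un sum.union_disjoint)
    ultimately have "rint f a b c d - (\<Sum>p\<in>Z. L p) = (rint f a b c m - (\<Sum>p\<in>Z1. L p)) + (rint f a b m d - (\<Sum>p\<in>Z2. L p))"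
      by simp
    moreover have "\<Phi> a b c m + \<Phi> a b m d \<le> \<Phi> a b c d"
      using am less.prems by (intro rect_majorant_split_y[OF \<Phi>]) auto
    ultimately show ?thesis using 1 2 by (smt (verit) norm_triangle_ineq)
  qed
qed

subsection \<open>Functions with bounded antiholomorphic derivative\<close>

definition sroot :: "real \<Rightarrow> real" where
  "sroot t = sgn t * sqrt (sqrt \<bar>t\<bar>)"

text \<open>The exponent 3/2 is a compromise: below 2, so the kernel is integrable in the plane, and
  above 1, so it absorbs a simple pole together with an inverse square root.\<close>

definition kern :: "real \<Rightarrow> real" where
  "kern t = 1 / (t * sqrt t)"

lemma kern_nonneg: "t \<ge> 0 \<Longrightarrow> kern t \<ge> 0"
  by (simp add: kern_def)

lemma sroot_inverse: "sroot t * \<bar>sroot t\<bar> ^ 3 = t"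
proof -
  have "x ^ 4 = (x ^ 2) ^ 2" for x :: real by (simp add: eval_nat_numeral)
  hence "sqrt (sqrt \<bar>t\<bar>) ^ 4 = (sqrt (sqrt \<bar>t\<bar>) ^ 2) ^ 2" .
  also have "\<dots> = \<bar>t\<bar>" by simp
  finally have "sqrt (sqrt \<bar>t\<bar>) ^ 4 = \<bar>t\<bar>" .
  thus ?thesis
    by (cases t "0::real" rule: linorder_cases) (simp_all add: sroot_def eval_nat_numeral mult.assoc)
qed

lemma sroot_mono: "a \<le> b \<Longrightarrow> sroot a \<le> sroot b"
proof -
  assume "a \<le> b"
  consider "0 < a" | "b < 0" | "a \<le> 0" "0 \<le> b" by linarith
  thus ?thesis
  proof cases
    case 3
    have "sroot a \<le> 0" "0 \<le> sroot b" using 3 by (auto simp: sroot_def sgn_if)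
    thus ?thesis by linarith
  qed (use \<open>a \<le> b\<close> in \<open>auto simp: sroot_def sgn_if\<close>)
qed

lemma abs_sroot_le: "\<bar>t\<bar> \<le> M \<Longrightarrow> \<bar>sroot t\<bar> \<le> sqrt (sqrt M)"
  by (auto simp: sroot_def abs_mult sgn_if)

text \<open>The signed fourth power is the inverse of \<open>sroot\<close> and has derivative 4
  |t|^3. Estimating it instead of \<open>sroot\<close> avoids the infinite slope of the root at
  0.\<close>

lemma quartic_diff_le:
  fixes x y s :: real
  assumes "x \<le> y" "\<bar>x\<bar> \<le> s" "\<bar>y\<bar> \<le> s"
  shows "y * \<bar>y\<bar> ^ 3 - x * \<bar>x\<bar> ^ 3 \<le> 4 * s ^ 3 * (y - x)"
proof -
  have pos: "y ^ 4 - x ^ 4 \<le> 4 * s ^ 3 * (y - x)" if "0 \<le> x" "x \<le> y" "y \<le> s" for x y :: real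
  proof -
    have "y ^ 4 - x ^ 4 = (y ^ 3 + y ^ 2 * x + y * x ^ 2 + x ^ 3) * (y - x)"
      by (simp add: algebra_simps eval_nat_numeral)
    also have "y ^ 3 + y ^ 2 * x + y * x ^ 2 + x ^ 3 \<le> s ^ 3 + s ^ 2 * s + s * s ^ 2 + s ^ 3"
      using that by (intro add_mono mult_mono power_mono) auto
    also have "\<dots> = 4 * s ^ 3" by (simp add: eval_nat_numeral)
    finally show ?thesis using that by (simp add: mult_right_mono)
  qed
  have q: "z * z ^ 3 = z ^ 4" for z :: real by (simp add: eval_nat_numeral)
  consider "0 \<le> x" | "y \<le> 0" | "x < 0" "0 < y" by linarith
  thus ?thesis
  proof cases
    case 1 thus ?thesis using pos[of x y] assms by (simp add: q)
  next
    case 2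
    have "(-x) ^ 4 - (-y) ^ 4 \<le> 4 * s ^ 3 * ((-x) - (-y))" using pos[of "-y" "-x"] assms 2 by simp
    thus ?thesis using 2 assms by (simp add: eval_nat_numeral algebra_simps)
  next
    case 3
    have "y * y ^ 3 \<le> y * s ^ 3" using assms 3 by (intro mult_left_mono power_mono) auto
    moreover have "(-x) * (-x) ^ 3 \<le> (-x) * s ^ 3" using assms 3 by (intro mult_left_mono power_mono) auto
    moreover have "0 \<le> s ^ 3 * (y - x)" using assms by auto
    moreover have "s ^ 3 * (y - x) = y * s ^ 3 + (-x) * s ^ 3" "4 * s ^ 3 * (y - x) = 4 * (s ^ 3 * (y - x))"
      by (simp_all add: algebra_simps)
    moreover have "y * \<bar>y\<bar> ^ 3 - x * \<bar>x\<bar> ^ 3 = y * y ^ 3 + (-x) * (-x) ^ 3" using 3 by simp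
    ultimately show ?thesis by linarith
  qed
qed

lemma sroot_diff_ge:
  assumes "a \<le> b" "\<bar>a\<bar> \<le> M" "\<bar>b\<bar> \<le> M" "M > 0"
  shows "sroot b - sroot a \<ge> (b - a) / (4 * sqrt (sqrt M) ^ 3)"
proof -
  have "b - a \<le> 4 * sqrt (sqrt M) ^ 3 * (sroot b - sroot a)"
    using quartic_diff_le[OF sroot_mono[OF assms(1)] abs_sroot_le[OF assms(2)] abs_sroot_le[OF assms(3)]]
    by (simp add: sroot_inverse)
  thus ?thesis using assms(4) by (simp add: divide_le_eq mult.commute)
qed

text \<open>A product of increments is the integral of a product density, here |x|^(-3/4) |y|^(-3/4)
  / 16 in coordinates centred at \<open>p\<close>. As |x| and |y| are at most |z|, this density
  dominates |z|^(-3/2) / 16.\<close>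

definition kmaj :: "real \<Rightarrow> complex set \<Rightarrow> real \<Rightarrow> real \<Rightarrow> real \<Rightarrow> real \<Rightarrow> real" where
  "kmaj K Z a b c d = K * (\<Sum>p\<in>Z. (sroot (b - Re p) - sroot (a - Re p)) * (sroot (d - Im p) - sroot (c - Im p)))"

lemma rect_majorant_kmaj:
  assumes "K \<ge> 0"
  shows "rect_majorant (kmaj K Z)"
  unfolding rect_majorant_def kmaj_def
proof (intro conjI allI impI)
  fix a m b c d :: real
  show "K * (\<Sum>p\<in>Z. (sroot (m - Re p) - sroot (a - Re p)) * (sroot (d - Im p) - sroot (c - Im p))) +
       K * (\<Sum>p\<in>Z. (sroot (b - Re p) - sroot (m - Re p)) * (sroot (d - Im p) - sroot (c - Im p)))
       \<le> K * (\<Sum>p\<in>Z. (sroot (b - Re p) - sroot (a - Re p)) * (sroot (d - Im p) - sroot (c - Im p)))"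
    unfolding distrib_left[symmetric] sum.distrib[symmetric]
    by (intro eq_refl arg_cong[where f="(*) K"] sum.cong refl) (simp add: algebra_simps)
next
  fix a b c m d :: real
  show "K * (\<Sum>p\<in>Z. (sroot (b - Re p) - sroot (a - Re p)) * (sroot (m - Im p) - sroot (c - Im p))) +
       K * (\<Sum>p\<in>Z. (sroot (b - Re p) - sroot (a - Re p)) * (sroot (d - Im p) - sroot (m - Im p)))
       \<le> K * (\<Sum>p\<in>Z. (sroot (b - Re p) - sroot (a - Re p)) * (sroot (d - Im p) - sroot (c - Im p)))"
    unfolding distrib_left[symmetric] sum.distrib[symmetric]
    by (intro eq_refl arg_cong[where f="(*) K"] sum.cong refl) (simp add: algebra_simps)
next
  fix a b c d :: real assume "a \<le> b" "c \<le> d"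
  thus "0 \<le> K * (\<Sum>p\<in>Z. (sroot (b - Re p) - sroot (a - Re p)) * (sroot (d - Im p) - sroot (c - Im p)))"
    using assms by (intro mult_nonneg_nonneg sum_nonneg) (auto intro: sroot_mono)
qed

text \<open>The factor 16 comes from the two factors 4 in \<open>sroot_diff_ge\<close>; six fourth
  roots of \<open>M p\<close> multiply to its power 3/2, the denominator of \<open>kern\<close>.
  Rectangles that contain \<open>p\<close> are included.\<close>

lemma kmaj_ge:
  assumes "K \<ge> 0" "a \<le> b" "c \<le> d" and M: "\<And>p. p \<in> Z \<Longrightarrow> M p > 0 \<and> rect a b c d \<subseteq> cball p (M p)"
  shows "kmaj (16 * K) Z a b c d \<ge> K * (\<Sum>p\<in>Z. kern (M p)) * ((b - a) * (d - c))"
proof -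
  have "kern (M p) * ((b - a) * (d - c)) \<le> 16 * ((sroot (b - Re p) - sroot (a - Re p)) * (sroot (d - Im p) - sroot (c - Im p)))"
    if p: "p \<in> Z" for p
  proof -
    have "Complex a c \<in> rect a b c d" "Complex b d \<in> rect a b c d" using assms(2,3) by (auto simp: rect_def)
    hence "Complex a c \<in> cball p (M p)" "Complex b d \<in> cball p (M p)" using M[OF p] by blast+
    hence n: "norm (Complex a c - p) \<le> M p" "norm (Complex b d - p) \<le> M p" by (auto simp: dist_norm norm_minus_commute)
    have bd: "\<bar>a - Re p\<bar> \<le> M p" "\<bar>c - Im p\<bar> \<le> M p" "\<bar>b - Re p\<bar> \<le> M p" "\<bar>d - Im p\<bar> \<le> M p"
      using order_trans[OF abs_Re_le_cmod n(1)] order_trans[OF abs_Im_le_cmod n(1)]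
        order_trans[OF abs_Re_le_cmod n(2)] order_trans[OF abs_Im_le_cmod n(2)] by auto
    let ?s = "sqrt (sqrt (M p))"
    have s6: "?s ^ 3 * ?s ^ 3 = M p * sqrt (M p)"
    proof -
      have "x ^ 3 * x ^ 3 = x ^ 2 * x ^ 2 * x ^ 2" for x :: real by (simp add: eval_nat_numeral)
      hence "?s ^ 3 * ?s ^ 3 = ?s ^ 2 * ?s ^ 2 * ?s ^ 2" .
      moreover have "?s ^ 2 = sqrt (M p)" "sqrt (M p) * sqrt (M p) = M p" using M[OF p] by simp_all
      ultimately show ?thesis by presburger
    qed
    have "((b - Re p) - (a - Re p)) / (4 * ?s ^ 3) * (((d - Im p) - (c - Im p)) / (4 * ?s ^ 3))
      \<le> (sroot (b - Re p) - sroot (a - Re p)) * (sroot (d - Im p) - sroot (c - Im p))"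
      using bd M[OF p] assms(2,3) by (intro mult_mono sroot_diff_ge) (auto simp: sroot_mono)
    moreover have "((b - Re p) - (a - Re p)) / (4 * ?s ^ 3) * (((d - Im p) - (c - Im p)) / (4 * ?s ^ 3)) = kern (M p) * ((b - a) * (d - c)) / 16"
      using s6 by (simp add: kern_def field_simps)
    ultimately show ?thesis by linarith
  qed
  hence "(\<Sum>p\<in>Z. kern (M p) * ((b - a) * (d - c))) \<le> (\<Sum>p\<in>Z. 16 * ((sroot (b - Re p) - sroot (a - Re p)) * (sroot (d - Im p) - sroot (c - Im p))))"
    by (rule sum_mono)
  from mult_left_mono[OF this assms(1)] show ?thesis
    by (simp add: kmaj_def sum_distrib_left sum_distrib_right mult_ac)
qed

text \<open>Integrability of the kernel in quantitative form. That the mass is small for small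
  \<open>R\<close> later allows an error term to be absorbed.\<close>

lemma kmaj_square_le:
  assumes "K \<ge> 0" "R > 0" "\<And>p. p \<in> Z \<Longrightarrow> \<bar>Re p\<bar> \<le> R \<and> \<bar>Im p\<bar> \<le> R"
  shows "kmaj K Z (-R) R (-R) R \<le> 4 * K * card Z * sqrt (2 * R)"
proof -
  have "(sroot (R - Re p) - sroot (-R - Re p)) * (sroot (R - Im p) - sroot (-R - Im p)) \<le> 4 * sqrt (2 * R)" if "p \<in> Z" for p
  proof -
    let ?s = "sqrt (sqrt (2 * R))"
    have b: "\<bar>sroot (R - Re p)\<bar> \<le> ?s" "\<bar>sroot (-R - Re p)\<bar> \<le> ?s" "\<bar>sroot (R - Im p)\<bar> \<le> ?s" "\<bar>sroot (-R - Im p)\<bar> \<le> ?s"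
      using assms(3)[OF that] by (intro abs_sroot_le; simp add: abs_le_iff)+
    have "(sroot (R - Re p) - sroot (-R - Re p)) * (sroot (R - Im p) - sroot (-R - Im p)) \<le> (2 * ?s) * (2 * ?s)"
      using b assms(2) by (intro mult_mono) (auto simp: sroot_mono abs_le_iff)
    also have "\<dots> = 4 * sqrt (2 * R)" using assms(2) by simp
    finally show ?thesis .
  qed
  hence "(\<Sum>p\<in>Z. (sroot (R - Re p) - sroot (-R - Re p)) * (sroot (R - Im p) - sroot (-R - Im p))) \<le> (\<Sum>p\<in>Z. 4 * sqrt (2 * R))"
    by (rule sum_mono)
  from mult_left_mono[OF this assms(1)] show ?thesis by (simp add: kmaj_def mult_ac)
qed

text \<open>An infinitesimal form of \<open>\<bar>\<partial>f\<^sub>i/\<partial>z\<^bsup>*\<^esup>\<bar> \<le> C \<Sum>\<^sub>j \<bar>f\<^sub>j\<bar>\<close> that makes sense for merely continuous \<open>f\<^sub>i\<close>.\<close>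

definition dbar_bounded :: "'i set \<Rightarrow> ('i \<Rightarrow> complex \<Rightarrow> complex) \<Rightarrow> real \<Rightarrow> complex set \<Rightarrow> bool" where
  "dbar_bounded I f C \<Omega> \<longleftrightarrow> (\<forall>i\<in>I. continuous_on \<Omega> (f i)) \<and>
    (\<forall>i\<in>I. \<forall>p\<in>\<Omega>. \<forall>e>0. \<exists>\<delta>>0. \<forall>a b c d.
     a < b \<and> c < d \<and> b - a \<le> 2 * (d - c) \<and> d - c \<le> 2 * (b - a) \<and>
     p \<in> rect a b c d \<and> rect a b c d \<subseteq> ball p \<delta> \<inter> \<Omega> \<longrightarrow>
     norm (rint (f i) a b c d) \<le> (C * (\<Sum>j\<in>I. norm (f j p)) + e) * ((b - a) * (d - c)))"

text \<open>An integrand error of the order of the side, times the perimeter, is compared with the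
  area. Here the side ratio 2 is used, and from here come the later factors 9.\<close>

lemma fat_rect_area:
  fixes w h :: real
  assumes "w \<le> 2 * h" "h \<le> 2 * w"
  shows "2 * (w + h) * (w + h) \<le> 9 * (w * h)"
proof -
  have "0 \<le> (2 * h - w) * (2 * w - h)" using assms by simp
  thus ?thesis by (simp add: algebra_simps)
qed

text \<open>Write h f = h(p) f + f(p) (h - h(p)) + (h - h(p)) (f - f(p)). The middle term is
  holomorphic and integrates to 0. The last one is o(side), because \<open>h\<close> is Lipschitz at
  \<open>p\<close> and \<open>f i\<close> is continuous, so its boundary integral is
  o(area).\<close>

lemma dbar_bounded_mult:
  assumes dbar: "dbar_bounded I f C \<Omega>" and i: "i \<in> I" and h: "h holomorphic_on U" "open U" and p: "p \<in> \<Omega>" "p \<in> U" and e: "e > 0"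
  obtains \<delta> where "\<delta> > 0" "\<And>a b c d. a < b \<Longrightarrow> c < d \<Longrightarrow> b - a \<le> 2 * (d - c) \<Longrightarrow> d - c \<le> 2 * (b - a) \<Longrightarrow>
     p \<in> rect a b c d \<Longrightarrow> rect a b c d \<subseteq> ball p \<delta> \<inter> \<Omega> \<Longrightarrow>
     norm (rint (\<lambda>z. h z * f i z) a b c d) \<le> (norm (h p) * (C * (\<Sum>j\<in>I. norm (f j p))) + e) * ((b - a) * (d - c))"
proof -
  obtain h' where h': "(h has_field_derivative h') (at p)"
    using holomorphic_derivI[OF h p(2)] by blast
  obtain d0 where d0: "d0 > 0" "\<And>z. norm (z - p) < d0 \<Longrightarrow> norm (h z - h p - h' * (z - p)) \<le> 1 * norm (z - p)"
    using h'[unfolded has_field_derivative_def has_derivative_at_alt, THEN conjunct2, rule_format, of 1] by auto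
  define Lh where "Lh = norm h' + 1"
  have Lh: "Lh > 0" by (simp add: Lh_def add_nonneg_pos)
  have hL: "norm (h z - h p) \<le> Lh * norm (z - p)" if "norm (z - p) < d0" for z
  proof -
    have "norm (h z - h p) \<le> norm (h z - h p - h' * (z - p)) + norm (h' * (z - p))"
      using norm_triangle_ineq[of "h z - h p - h' * (z - p)" "h' * (z - p)"] by simp
    thus ?thesis using d0(2)[OF that] by (simp add: Lh_def norm_mult distrib_right)
  qed
  obtain d1 where d1: "d1 > 0" "ball p d1 \<subseteq> U" using h(2) p(2) openE by blast
  \<comment> \<open>With the factor 9 of \<open>fat_rect_area\<close> the remainder costs
    \<open>Lh * e1 * 9 = e / 2\<close> per unit area.\<close>
  define e1 where "e1 = e / (18 * Lh)"
  have e1: "e1 > 0" using e Lh by (simp add: e1_def)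
  have cf: "continuous_on \<Omega> (f i)" using dbar i by (simp add: dbar_bounded_def)
  obtain d2 where d2: "d2 > 0" "\<And>z. z \<in> \<Omega> \<Longrightarrow> dist z p < d2 \<Longrightarrow> norm (f i z - f i p) \<le> e1"
    using cf[unfolded continuous_on_iff, rule_format, OF p(1) e1] by (auto simp: dist_norm intro: less_imp_le)
  define e2 where "e2 = e / (2 * (norm (h p) + 1))"
  have e2: "e2 > 0" using e by (simp add: e2_def add_nonneg_pos)
  obtain d3 where d3: "d3 > 0" "\<And>a b c d. a < b \<and> c < d \<and> b - a \<le> 2 * (d - c) \<and> d - c \<le> 2 * (b - a) \<and>
     p \<in> rect a b c d \<and> rect a b c d \<subseteq> ball p d3 \<inter> \<Omega> \<Longrightarrow>
     norm (rint (f i) a b c d) \<le> (C * (\<Sum>j\<in>I. norm (f j p)) + e2) * ((b - a) * (d - c))"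
    using dbar[unfolded dbar_bounded_def, THEN conjunct2, rule_format, OF i p(1) e2] by auto
  define \<delta> where "\<delta> = min (min d0 d1) (min d2 d3)"
  show ?thesis
  proof (rule that[of \<delta>])
    show "\<delta> > 0" using d0 d1 d2 d3 by (simp add: \<delta>_def)
    fix a b c d assume ord: "a < b" "c < d" and rat: "b - a \<le> 2 * (d - c)" "d - c \<le> 2 * (b - a)"
      and pr: "p \<in> rect a b c d" and sub: "rect a b c d \<subseteq> ball p \<delta> \<inter> \<Omega>"
    let ?Q = "rect a b c d" and ?A = "(b - a) * (d - c)"
    have QU: "?Q \<subseteq> ball p d1" and QO: "?Q \<subseteq> \<Omega>" using sub by (auto simp: \<delta>_def)
    have hol: "h holomorphic_on ball p d1" using h(1) d1(2) holomorphic_on_subset by blast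
    have ch: "continuous_on ?Q h" using hol QU holomorphic_on_imp_continuous_on continuous_on_subset by blast
    have cfQ: "continuous_on ?Q (f i)" using cf QO continuous_on_subset by blast
    let ?r = "\<lambda>z. (h z - h p) * (f i z - f i p)"
    have cr: "continuous_on ?Q ?r" using ch cfQ by (intro continuous_intros)
    have "rint (\<lambda>z. h z * f i z) a b c d = rint (\<lambda>z. h p * f i z + (f i p * (h z - h p) + ?r z)) a b c d"
      by (simp add: algebra_simps)
    also have "\<dots> = h p * rint (f i) a b c d + rint (\<lambda>z. f i p * (h z - h p) + ?r z) a b c d"
      using ord ch cfQ by (intro rint_linear[where X="?Q"]) (auto intro!: continuous_intros)
    also have "rint (\<lambda>z. f i p * (h z - h p) + ?r z) a b c d = f i p * rint (\<lambda>z. h z - h p) a b c d + rint ?r a b c d"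
      using ord ch cfQ by (intro rint_linear[where X="?Q"]) (auto intro!: continuous_intros)
    also have "rint (\<lambda>z. h z - h p) a b c d = 0"
      using ord QU hol by (intro rint_holomorphic[where U="ball p d1"]) (auto intro!: holomorphic_intros)
    finally have eq: "rint (\<lambda>z. h z * f i z) a b c d = h p * rint (f i) a b c d + rint ?r a b c d" by simp
    have "norm (rint ?r a b c d) \<le> 2 * (Lh * ((b - a) + (d - c)) * e1) * ((b - a) + (d - c))"
    proof (rule rint_bound[OF _ _ cr])
      fix z assume z: "z \<in> ?Q"
      have zb: "norm (z - p) \<le> (b - a) + (d - c)" using rect_subset_cball[OF pr] z by (auto simp: dist_norm norm_minus_commute)
      have zd: "dist z p < \<delta>" using sub z by (auto simp: dist_commute)
      have "norm (h z - h p) \<le> Lh * norm (z - p)" using hL zd by (simp add: \<delta>_def dist_norm)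
      also have "\<dots> \<le> Lh * ((b - a) + (d - c))" using zb Lh by simp
      finally have 1: "norm (h z - h p) \<le> Lh * ((b - a) + (d - c))" .
      have 2: "norm (f i z - f i p) \<le> e1" using d2(2)[of z] zd z QO by (auto simp: \<delta>_def)
      show "z \<in> ?Q \<and> norm (?r z) \<le> Lh * ((b - a) + (d - c)) * e1"
        using z ord Lh 1 2 unfolding norm_mult by (intro conjI mult_mono) auto
    qed (use ord in auto)
    also have "\<dots> = Lh * e1 * (2 * ((b - a) + (d - c)) * ((b - a) + (d - c)))" by (simp add: algebra_simps)
    also have "\<dots> \<le> Lh * e1 * (9 * ?A)"
      using Lh e1 by (intro mult_left_mono fat_rect_area rat) auto
    also have "\<dots> = e / 2 * ?A" using Lh by (simp add: e1_def)
    finally have r: "norm (rint ?r a b c d) \<le> e / 2 * ?A" .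
    have "norm (h p * rint (f i) a b c d) \<le> norm (h p) * ((C * (\<Sum>j\<in>I. norm (f j p)) + e2) * ?A)"
      unfolding norm_mult by (intro mult_left_mono d3(2)) (use ord rat pr sub in \<open>auto simp: \<delta>_def\<close>)
    also have "\<dots> = norm (h p) * (C * (\<Sum>j\<in>I. norm (f j p))) * ?A + (norm (h p) * e2) * ?A" by (simp add: algebra_simps)
    also have "norm (h p) * e2 \<le> e / 2"
    proof -
      define n where "n = norm (h p) + 1"
      have "n > 0" "norm (h p) = n - 1" by (simp_all add: n_def add_nonneg_pos)
      hence "n * e2 = e / 2" by (simp add: e2_def)
      thus ?thesis using e2 \<open>norm (h p) = n - 1\<close> by (simp add: left_diff_distrib)
    qed
    finally have "norm (h p * rint (f i) a b c d) \<le> norm (h p) * (C * (\<Sum>j\<in>I. norm (f j p))) * ?A + e / 2 * ?A"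
      using ord by (simp add: mult_right_mono)
    hence "norm (rint (\<lambda>z. h z * f i z) a b c d) \<le> norm (h p) * (C * (\<Sum>j\<in>I. norm (f j p))) * ?A + e / 2 * ?A + e / 2 * ?A"
      unfolding eq using r norm_triangle_ineq[of "h p * rint (f i) a b c d" "rint ?r a b c d"] by linarith
    thus "norm (rint (\<lambda>z. h z * f i z) a b c d) \<le> (norm (h p) * (C * (\<Sum>j\<in>I. norm (f j p))) + e) * ?A"
      by (simp add: algebra_simps)
  qed
qed

text \<open>The substitute for the Cauchy-Pompeiu formula with weight \<open>h\<close>: the poles
  contribute the limits \<open>L p\<close>, and what would be the area integral of h dbar f is
  dominated by the kernel sum, hence by \<open>kmaj\<close>. The 64 is 16 from
  \<open>kmaj_ge\<close> times 4 from \<open>kmaj_square_le\<close>.\<close>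

lemma dbar_bounded_pole_estimate:
  assumes dbar: "dbar_bounded I f C \<Omega>" and i: "i \<in> I"
    and R: "R > 0" "rect (-R) R (-R) R \<subseteq> \<Omega>"
    and Z: "finite Z" "Z \<subseteq> {z. -R < Re z \<and> Re z < R \<and> -R < Im z \<and> Im z < R}"
    and h: "h holomorphic_on - Z" and K: "K \<ge> 0"
    and bd: "\<And>z. z \<in> rect (-R) R (-R) R - Z \<Longrightarrow> norm (h z) * (C * (\<Sum>j\<in>I. norm (f j z))) \<le> K * (\<Sum>q\<in>Z. kern (norm (z - q)))"
    and L: "\<And>p. p \<in> Z \<Longrightarrow> (sq_rint (\<lambda>z. h z * f i z) p \<longlongrightarrow> L p) (at_right 0)"
  shows "norm (rint (\<lambda>z. h z * f i z) (-R) R (-R) R - (\<Sum>p\<in>Z. L p)) \<le> 64 * K * card Z * sqrt (2 * R)"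
proof -
  let ?Q = "rect (-R) R (-R) R"
  have oZ: "open (- Z)" using Z(1) by (simp add: finite_imp_closed open_Compl)
  have cont: "continuous_on (?Q - Z) (\<lambda>z. h z * f i z)"
  proof (intro continuous_intros)
    show "continuous_on (?Q - Z) h" using holomorphic_on_imp_continuous_on[OF h] by (rule continuous_on_subset) auto
    have "continuous_on \<Omega> (f i)" using dbar i by (simp add: dbar_bounded_def)
    thus "continuous_on (?Q - Z) (f i)" by (rule continuous_on_subset) (use R(2) in auto)
  qed
  have loc: "loc_majorized (\<lambda>z. h z * f i z) (kmaj (16 * K) Z) (?Q - Z)"
    unfolding loc_majorized_def
  proof (intro ballI allI impI)
    fix p :: complex and e :: real assume p: "p \<in> ?Q - Z" and e: "e > 0"
    have p': "p \<in> \<Omega>" "p \<in> - Z" using p R(2) by auto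
    have "e / 2 > 0" using e by simp
    from dbar_bounded_mult[OF dbar i h oZ p' this] obtain d1 where d1: "d1 > 0" and
      H: "\<And>a b c d. a < b \<Longrightarrow> c < d \<Longrightarrow> b - a \<le> 2 * (d - c) \<Longrightarrow> d - c \<le> 2 * (b - a) \<Longrightarrow>
     p \<in> rect a b c d \<Longrightarrow> rect a b c d \<subseteq> ball p d1 \<inter> \<Omega> \<Longrightarrow>
     norm (rint (\<lambda>z. h z * f i z) a b c d) \<le> (norm (h p) * (C * (\<Sum>j\<in>I. norm (f j p))) + e / 2) * ((b - a) * (d - c))"
      by blast
    \<comment> \<open>\<open>kmaj_ge\<close> sees a rectangle near \<open>p\<close> only through
      balls around the poles that contain it, which enlarges the distances. Continuity of the kernel
      off \<open>Z\<close> makes the loss at most e / 2.\<close>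
    have "((\<lambda>t. K * (\<Sum>q\<in>Z. kern (norm (p - q) + t))) \<longlongrightarrow> K * (\<Sum>q\<in>Z. kern (norm (p - q) + 0))) (at_right 0)"
      unfolding kern_def using p by (intro tendsto_intros) auto
    hence "\<forall>\<^sub>F t in at_right 0. K * (\<Sum>q\<in>Z. kern (norm (p - q) + t)) > K * (\<Sum>q\<in>Z. kern (norm (p - q))) - e / 2"
      using e by (intro order_tendstoD(1)) auto
    then obtain d2 where d2: "d2 > 0" "\<And>t. 0 < t \<Longrightarrow> t < d2 \<Longrightarrow> K * (\<Sum>q\<in>Z. kern (norm (p - q) + t)) > K * (\<Sum>q\<in>Z. kern (norm (p - q))) - e / 2"
      unfolding eventually_at_right_field by auto
    define \<delta> where "\<delta> = min d1 (d2 / 2)"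
    show "\<exists>\<delta>>0. \<forall>a b c d. a < b \<and> c < d \<and> b - a \<le> 2 * (d - c) \<and> d - c \<le> 2 * (b - a) \<and> p \<in> rect a b c d \<and> rect a b c d \<subseteq> ball p \<delta> \<inter> (?Q - Z) \<longrightarrow>
       norm (rint (\<lambda>z. h z * f i z) a b c d) \<le> kmaj (16 * K) Z a b c d + e * ((b - a) * (d - c))"
    proof (intro exI[of _ \<delta>] conjI allI impI)
      show \<delta>0: "\<delta> > 0" using d1 d2 by (simp add: \<delta>_def)
      fix a b c d assume "a < b \<and> c < d \<and> b - a \<le> 2 * (d - c) \<and> d - c \<le> 2 * (b - a) \<and> p \<in> rect a b c d \<and> rect a b c d \<subseteq> ball p \<delta> \<inter> (?Q - Z)"
      hence ord: "a < b" "c < d" and rat: "b - a \<le> 2 * (d - c)" "d - c \<le> 2 * (b - a)" and pr: "p \<in> rect a b c d" and sub: "rect a b c d \<subseteq> ball p \<delta> \<inter> (?Q - Z)"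
        by auto
      let ?A = "(b - a) * (d - c)"
      have A: "?A \<ge> 0" using ord by simp
      have "norm (rint (\<lambda>z. h z * f i z) a b c d) \<le> (norm (h p) * (C * (\<Sum>j\<in>I. norm (f j p))) + e / 2) * ?A"
        using ord rat pr sub R(2) by (intro H) (auto simp: \<delta>_def)
      also have "\<dots> \<le> (K * (\<Sum>q\<in>Z. kern (norm (p - q) + \<delta>)) + e) * ?A"
      proof (rule mult_right_mono[OF _ A])
        have "\<delta> < d2" using d2(1) by (simp add: \<delta>_def min_def)
        from d2(2)[OF \<delta>0 this] bd[OF p]
        show "norm (h p) * (C * (\<Sum>j\<in>I. norm (f j p))) + e / 2 \<le> K * (\<Sum>q\<in>Z. kern (norm (p - q) + \<delta>)) + e" by linarith
      qed
      also have "\<dots> = K * (\<Sum>q\<in>Z. kern (norm (p - q) + \<delta>)) * ?A + e * ?A" by (simp add: algebra_simps)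
      also have "\<dots> \<le> kmaj (16 * K) Z a b c d + e * ?A"
      proof (intro add_right_mono kmaj_ge K)
        fix q assume "q \<in> Z"
        show "0 < norm (p - q) + \<delta> \<and> rect a b c d \<subseteq> cball q (norm (p - q) + \<delta>)"
        proof (intro conjI subsetI)
          show "0 < norm (p - q) + \<delta>" using \<delta>0 by (simp add: add_nonneg_pos)
          fix z assume "z \<in> rect a b c d"
          hence "dist p z < \<delta>" using sub by auto
          moreover have "dist q z \<le> dist q p + dist p z" by (rule dist_triangle)
          ultimately show "z \<in> cball q (norm (p - q) + \<delta>)" by (simp add: dist_norm norm_minus_commute)
        qed
      qed (use ord in auto)
      finally show "norm (rint (\<lambda>z. h z * f i z) a b c d) \<le> kmaj (16 * K) Z a b c d + e * ?A" .
    qed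
  qed
  have "norm (rint (\<lambda>z. h z * f i z) (-R) R (-R) R - (\<Sum>p\<in>Z. L p)) \<le> kmaj (16 * K) Z (-R) R (-R) R"
    using R K Z L by (intro rint_singular[OF _ _ _ _ cont _ loc] rect_majorant_kmaj) auto
  also have "\<dots> \<le> 4 * (16 * K) * card Z * sqrt (2 * R)"
    using K R Z by (intro kmaj_square_le) force+
  finally show ?thesis by simp
qed

section \<open>Limits of integrals over small squares\<close>

lemma square_boundary_norm_ge:
  assumes "e \<ge> 0" "z \<in> rect (Re p - e) (Re p + e) (Im p - e) (Im p + e)"
    "Re z = Re p - e \<or> Re z = Re p + e \<or> Im z = Im p - e \<or> Im z = Im p + e"
  shows "norm (z - p) \<ge> e"
  using assms abs_Re_le_cmod[of "z - p"] abs_Im_le_cmod[of "z - p"] by auto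

lemma square_subset_cball: "rect (Re p - e) (Re p + e) (Im p - e) (Im p + e) \<subseteq> cball p (2 * e)"
proof
  fix z assume "z \<in> rect (Re p - e) (Re p + e) (Im p - e) (Im p + e)"
  thus "z \<in> cball p (2 * e)" using cmod_le[of "z - p"] by (auto simp: rect_def dist_norm norm_minus_commute)
qed

text \<open>A singularity of order 1/2 carries no residue: the perimeter 8 e beats e^(-1/2).\<close>

lemma sq_rint_removable:
  assumes "r > 0" "continuous_on (ball p r - {p}) g" "\<And>z. z \<in> ball p r - {p} \<Longrightarrow> norm (g z) \<le> B / sqrt (norm (z - p))" "B \<ge> 0"
  shows "(sq_rint g p \<longlongrightarrow> 0) (at_right 0)"
proof (rule Lim_null_comparison)
  show "((\<lambda>e. 8 * B * sqrt e) \<longlongrightarrow> 0) (at_right 0)" by (auto intro!: tendsto_eq_intros)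
  show "\<forall>\<^sub>F e in at_right 0. norm (sq_rint g p e) \<le> 8 * B * sqrt e"
    unfolding eventually_at_right_field
  proof (intro exI[of _ "r / 2"] conjI allI impI)
    fix e :: real assume e: "0 < e" "e < r / 2"
    have "norm (sq_rint g p e) \<le> 2 * (B / sqrt e) * ((Re p + e - (Re p - e)) + (Im p + e - (Im p - e)))"
      unfolding sq_rint_def
    proof (rule rint_bound[OF _ _ assms(2)])
      fix z assume z: "z \<in> rect (Re p - e) (Re p + e) (Im p - e) (Im p + e)"
        "Re z = Re p - e \<or> Re z = Re p + e \<or> Im z = Im p - e \<or> Im z = Im p + e"
      have ge: "norm (z - p) \<ge> e" using square_boundary_norm_ge[OF _ z] e by simp
      have zin: "z \<in> ball p r - {p}" using square_subset_cball[of p e] z(1) e ge by auto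
      have "norm (g z) \<le> B / sqrt (norm (z - p))" by (rule assms(3)[OF zin])
      also have "\<dots> \<le> B / sqrt e"
        using assms(4) e ge less_le_trans[OF e(1) ge] by (intro divide_left_mono mult_pos_pos) auto
      finally show "z \<in> ball p r - {p} \<and> norm (g z) \<le> B / sqrt e" using zin by simp
    qed (use e in auto)
    also have "\<dots> = 8 * B * (e / sqrt e)" by simp
    also have "e / sqrt e = sqrt e" using e by (simp add: real_div_sqrt)
    finally show "norm (sq_rint g p e) \<le> 8 * B * sqrt e" .
  qed (use assms in auto)
qed

text \<open>\<open>w\<close> is merely continuous. Its variation near \<open>p\<close> is divided by
  a distance of at least \<open>e\<close> and integrated over a perimeter proportional to
  \<open>e\<close>, so it disappears in the limit and the pure pole remains.\<close>

lemma sq_rint_pole: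
  assumes "r > 0" "continuous_on (ball p r) w"
  shows "(sq_rint (\<lambda>z. w z / (z - p)) p \<longlongrightarrow> 2 * pi * \<i> * w p) (at_right 0)"
proof (rule LIM_zero_cancel, rule tendstoI)
  fix \<epsilon> :: real assume \<epsilon>: "\<epsilon> > 0"
  have "\<exists>d>0. \<forall>z\<in>ball p r. dist z p < d \<longrightarrow> dist (w z) (w p) < \<epsilon> / 16"
    using assms(2)[unfolded continuous_on_iff, rule_format, of p "\<epsilon> / 16"] assms(1) \<epsilon> by simp
  then obtain d where d: "d > 0" "\<And>z. z \<in> ball p r \<Longrightarrow> dist z p < d \<Longrightarrow> dist (w z) (w p) < \<epsilon> / 16"
    by blast
  show "\<forall>\<^sub>F e in at_right 0. dist (sq_rint (\<lambda>z. w z / (z - p)) p e - 2 * pi * \<i> * w p) 0 < \<epsilon>"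
    unfolding eventually_at_right_field
  proof (intro exI[of _ "min r d / 2"] conjI allI impI)
    fix e :: real assume e: "0 < e" "e < min r d / 2"
    let ?Q = "rect (Re p - e) (Re p + e) (Im p - e) (Im p + e)"
    have sub: "?Q \<subseteq> ball p (min r d)" using square_subset_cball[of p e] e by force
    have X: "continuous_on (ball p r - {p}) (\<lambda>z. (w z - w p) / (z - p))"
      by (intro continuous_intros continuous_on_subset[OF assms(2)]) auto
    have zin: "z \<in> ball p r - {p} \<and> norm ((w z - w p) / (z - p)) \<le> \<epsilon> / 16 / e"
      if z: "z \<in> ?Q" "Re z = Re p - e \<or> Re z = Re p + e \<or> Im z = Im p - e \<or> Im z = Im p + e" for z
    proof -
      have ge: "norm (z - p) \<ge> e" using square_boundary_norm_ge[OF _ z] e by simp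
      have zin: "z \<in> ball p r - {p}" "dist z p < d" using sub z(1) e ge by (auto simp: dist_commute)
      have "norm ((w z - w p) / (z - p)) \<le> \<epsilon> / 16 / e"
        unfolding norm_divide using d(2)[of z] zin e ge \<epsilon> by (intro frac_le) (auto simp: dist_norm)
      thus ?thesis using zin by simp
    qed
    have b: "norm (sq_rint (\<lambda>z. (w z - w p) / (z - p)) p e) \<le> 2 * (\<epsilon> / 16 / e) * ((Re p + e - (Re p - e)) + (Im p + e - (Im p - e)))"
      unfolding sq_rint_def by (rule rint_bound[OF _ _ X zin]) (use e in auto)
    have "sq_rint (\<lambda>z. w z / (z - p)) p e = sq_rint (\<lambda>z. w p * (1 / (z - p)) + (w z - w p) / (z - p)) p e"
      by (simp add: diff_divide_distrib)
    also have "\<dots> = w p * sq_rint (\<lambda>z. 1 / (z - p)) p e + sq_rint (\<lambda>z. (w z - w p) / (z - p)) p e"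
      unfolding sq_rint_def
      by (rule rint_linear[OF _ _ _ X]) (use e zin in \<open>auto intro!: continuous_intros\<close>)
    finally have split: "sq_rint (\<lambda>z. w z / (z - p)) p e = w p * sq_rint (\<lambda>z. 1 / (z - p)) p e + sq_rint (\<lambda>z. (w z - w p) / (z - p)) p e" .
    have "sq_rint (\<lambda>z. 1 / (z - p)) p e = 2 * pi * \<i>" unfolding sq_rint_def by (rule rint_inverse[OF e(1)])
    hence "sq_rint (\<lambda>z. w z / (z - p)) p e - 2 * pi * \<i> * w p = sq_rint (\<lambda>z. (w z - w p) / (z - p)) p e"
      unfolding split by simp
    also have "norm \<dots> \<le> \<epsilon> / 2" using b e by (simp add: field_simps)
    finally show "dist (sq_rint (\<lambda>z. w z / (z - p)) p e - 2 * pi * \<i> * w p) 0 < \<epsilon>" using \<epsilon> by simp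
  qed (use assms d in auto)
qed

subsection \<open>Order of vanishing\<close>

lemma sq_rint_pole':
  assumes "r > 0" "continuous_on (ball p r) w" "\<And>z. z \<in> ball p r - {p} \<Longrightarrow> g z = w z / (z - p)"
  shows "(sq_rint g p \<longlongrightarrow> 2 * pi * \<i> * w p) (at_right 0)"
proof (rule Lim_transform_eventually[OF sq_rint_pole[OF assms(1,2)]])
  show "\<forall>\<^sub>F e in at_right 0. sq_rint (\<lambda>z. w z / (z - p)) p e = sq_rint g p e"
    unfolding eventually_at_right_field
  proof (intro exI[of _ "r / 2"] conjI allI impI)
    fix e :: real assume e: "0 < e" "e < r / 2"
    show "sq_rint (\<lambda>z. w z / (z - p)) p e = sq_rint g p e"
      unfolding sq_rint_def
    proof (rule rint_cong)
      fix z assume z: "z \<in> rect (Re p - e) (Re p + e) (Im p - e) (Im p + e)"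
        "Re z = Re p - e \<or> Re z = Re p + e \<or> Im z = Im p - e \<or> Im z = Im p + e"
      have "norm (z - p) \<ge> e" using square_boundary_norm_ge[OF _ z] e by simp
      hence "z \<in> ball p r - {p}" using square_subset_cball[of p e] z(1) e by auto
      thus "w z / (z - p) = g z" using assms(3) by simp
    qed (use e in auto)
  qed (use assms in auto)
qed

lemma le_divide_of_le_one: "0 \<le> B \<Longrightarrow> 0 < s \<Longrightarrow> s \<le> 1 \<Longrightarrow> B \<le> B / (s::real)"
  by (simp add: le_divide_eq mult_left_le)

lemma norm_le_norm_two_pi: "norm (x::complex) \<le> norm (2 * pi * \<i> * x)"
proof -
  have "1 * norm x \<le> (2 * pi) * norm x" using pi_ge_two by (intro mult_right_mono) auto
  thus ?thesis by (simp add: norm_mult)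
qed

text \<open>Replace both distances by the smaller one: the exponents 1/2 and 1 add up to the 3/2 of
  \<open>kern\<close>.\<close>

lemma kern_mix:
  assumes "x > 0" "y > 0"
  shows "1 / (sqrt x * y) \<le> kern x + kern y"
proof (cases "x \<le> y")
  case True
  have "1 / (sqrt x * y) \<le> 1 / (x * sqrt x)"
    using assms True by (intro divide_left_mono) (auto simp: mult.commute)
  moreover have "0 \<le> 1 / (y * sqrt y)" using assms by simp
  ultimately show ?thesis unfolding kern_def by linarith
next
  case False
  have "1 / (sqrt x * y) \<le> 1 / (y * sqrt y)"
    using assms False by (intro divide_left_mono) (auto simp: mult.commute)
  moreover have "0 \<le> 1 / (x * sqrt x)" using assms by simp
  ultimately show ?thesis unfolding kern_def by linarith
qed

text \<open>The difference of two Cauchy kernels has size d / (x y), of order 2 when x and y are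
  comparable. Splitting d = sqrt d * sqrt d and using sqrt d \<le> sqrt x + sqrt y lowers the order
  to 3/2 and leaves a factor sqrt d, the source of the Hoelder exponent 1/2.\<close>

lemma kern_difference:
  assumes "x > 0" "y > 0" "0 \<le> d" "d \<le> x + y"
  shows "d / (x * y) \<le> 2 * sqrt d * (kern x + kern y)"
proof -
  have "sqrt d \<le> sqrt x + sqrt y"
    using assms sqrt_add_le_add_sqrt[of x y] by (meson less_imp_le order_trans real_sqrt_le_mono)
  hence "sqrt d * (sqrt d / (x * y)) \<le> sqrt d * ((sqrt x + sqrt y) / (x * y))"
    using assms by (intro mult_left_mono divide_right_mono) auto
  also have "(sqrt x + sqrt y) / (x * y) = 1 / (sqrt x * y) + 1 / (sqrt y * x)"
    using assms real_sqrt_pow2[of x] real_sqrt_pow2[of y] by (simp add: field_simps power2_eq_square[symmetric])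
  also have "sqrt d * \<dots> \<le> sqrt d * ((kern x + kern y) + (kern y + kern x))"
    using assms by (intro mult_left_mono add_mono kern_mix) auto
  finally show ?thesis using assms by (simp add: algebra_simps)
qed

text \<open>Uniform continuity on the punctured disc yields a limit at the centre, and the Hoelder
  bound survives the passage to it.\<close>

lemma holder_limit:
  fixes w :: "complex \<Rightarrow> complex"
  assumes "\<rho> > 0" "A \<ge> 0"
    and H: "\<And>x y. x \<noteq> 0 \<Longrightarrow> y \<noteq> 0 \<Longrightarrow> norm x < \<rho> \<Longrightarrow> norm y < \<rho> \<Longrightarrow> norm (w x - w y) \<le> A * sqrt (norm (x - y))"
  obtains a where "\<And>z. z \<noteq> 0 \<Longrightarrow> norm z < \<rho> \<Longrightarrow> norm (w z - a) \<le> A * sqrt (norm z)"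
proof -
  define X where "X = ball 0 \<rho> - {0::complex}"
  have "uniformly_continuous_on X w"
    unfolding uniformly_continuous_on_def
  proof (intro allI impI)
    fix e :: real assume e: "e > 0"
    show "\<exists>d>0. \<forall>x\<in>X. \<forall>x'\<in>X. dist x' x < d \<longrightarrow> dist (w x') (w x) < e"
    proof (intro exI[of _ "(e / (A + 1))\<^sup>2"] conjI ballI impI)
      show "0 < (e / (A + 1))\<^sup>2" using e assms(2) by simp
      fix x y assume xy: "x \<in> X" "y \<in> X" "dist y x < (e / (A + 1))\<^sup>2"
      have "sqrt (norm (y - x)) \<le> e / (A + 1)"
        using xy(3) e assms(2) by (intro real_le_lsqrt) (auto simp: dist_norm)
      moreover have "norm (w y - w x) \<le> A * sqrt (norm (y - x))" using xy by (intro H) (auto simp: X_def)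
      ultimately have "norm (w y - w x) \<le> A * (e / (A + 1))" using assms(2) by (meson mult_left_mono order_trans)
      also have "\<dots> < (A + 1) * (e / (A + 1))" using e assms(2) by (intro mult_strict_right_mono) auto
      finally show "dist (w y) (w x) < e" using assms(2) by (simp add: dist_norm)
    qed
  qed
  moreover have lp: "0 islimpt X"
    using islimpt_insert[of 0 0 X] assms(1) by (simp add: X_def insert_absorb islimpt_ball)
  ultimately obtain a where a: "(w \<longlongrightarrow> a) (at 0 within X)"
    using uniformly_continuous_on_extension_at_closure by (metis closure_def UnI2 mem_Collect_eq)
  show ?thesis
  proof (rule that)
    fix z :: complex assume z: "z \<noteq> 0" "norm z < \<rho>"
    show "norm (w z - a) \<le> A * sqrt (norm z)"
    proof (rule tendsto_le)
      show "at 0 within X \<noteq> bot" using lp by (simp add: trivial_limit_within)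
      show "((\<lambda>y. norm (w z - w y)) \<longlongrightarrow> norm (w z - a)) (at 0 within X)" using a by (intro tendsto_intros)
      have "((\<lambda>y. A * sqrt (norm (z - y))) \<longlongrightarrow> A * sqrt (norm (z - 0))) (at 0 within X)" by (intro tendsto_intros)
      thus "((\<lambda>y. A * sqrt (norm (z - y))) \<longlongrightarrow> A * sqrt (norm z)) (at 0 within X)" by simp
      show "\<forall>\<^sub>F y in at 0 within X. norm (w z - w y) \<le> A * sqrt (norm (z - y))"
        unfolding eventually_at by (intro exI[of _ 1] conjI ballI) (use z in \<open>auto simp: X_def intro!: H\<close>)
    qed
  qed
qed

lemma norm_le_sum_norm: "finite I \<Longrightarrow> i \<in> I \<Longrightarrow> norm (f i z) \<le> (\<Sum>j\<in>I. norm (f j z))"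
  by (rule member_le_sum) auto

lemma origin_square_boundary:
  assumes "R > 0" "z \<in> rect (-R) R (-R) R" "Re z = -R \<or> Re z = R \<or> Im z = -R \<or> Im z = R"
  shows "norm z \<ge> R" "\<And>\<zeta>. norm \<zeta> < R / 2 \<Longrightarrow> norm (z - \<zeta>) \<ge> R / 2"
proof -
  show 1: "norm z \<ge> R" using square_boundary_norm_ge[of R z 0] assms by simp
  show "norm (z - \<zeta>) \<ge> R / 2" if "norm \<zeta> < R / 2" for \<zeta>
    using norm_triangle_ineq2[of z \<zeta>] 1 that by linarith
qed

lemma norm_less_mem_square: "norm z < R \<Longrightarrow> -R < Re z \<and> Re z < R \<and> -R < Im z \<and> Im z < R"
  using abs_Re_le_cmod[of z] abs_Im_le_cmod[of z] by auto

lemma norm_less_mem_rect: "norm z < R \<Longrightarrow> z \<in> rect (-R) R (-R) R"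
  using norm_less_mem_square[of z R] by (auto simp: rect_def)

lemma dbar_bounded_continuous: "dbar_bounded I f C \<Omega> \<Longrightarrow> i \<in> I \<Longrightarrow> X \<subseteq> \<Omega> \<Longrightarrow> continuous_on X (f i)"
  unfolding dbar_bounded_def by (auto intro: continuous_on_subset)

text \<open>Take the weight z^(-k) (1/(z - \<zeta>1) - 1/(z - \<zeta>2)) in the pole estimate. The
  residues are the two quotients, and 0 contributes nothing because \<open>f i\<close> is O(|z| ^
  k). The error term and the boundary integral both carry the square root of the distance of the two
  points.\<close>

lemma dbar_bounded_holder:
  assumes I: "finite I" "i \<in> I" and dbar: "dbar_bounded I f C \<Omega>" and C: "C \<ge> 0"
    and R: "R > 0" "rect (-R) R (-R) R \<subseteq> \<Omega>" and M: "M \<ge> 0"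
    and bd: "\<And>z. z \<in> rect (-R) R (-R) R \<Longrightarrow> (\<Sum>j\<in>I. norm (f j z)) \<le> M * norm z ^ k"
    and z: "\<zeta>1 \<noteq> 0" "\<zeta>2 \<noteq> 0" "\<zeta>1 \<noteq> \<zeta>2" "norm \<zeta>1 < R / 2" "norm \<zeta>2 < R / 2"
  shows "norm (f i \<zeta>1 / \<zeta>1 ^ k - f i \<zeta>2 / \<zeta>2 ^ k) \<le> (32 * M * sqrt R / R + 384 * C * M * sqrt (2 * R)) * sqrt (norm (\<zeta>1 - \<zeta>2))"
proof -
  define d where "d = norm (\<zeta>1 - \<zeta>2)"
  have d: "d > 0" "d \<le> R" using z norm_triangle_ineq4[of \<zeta>1 \<zeta>2] by (auto simp: d_def)
  define h where "h = (\<lambda>z. inverse (z ^ k) * (1 / (z - \<zeta>1) - 1 / (z - \<zeta>2)))"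
  define Z where "Z = {0, \<zeta>1, \<zeta>2}"
  let ?Q = "rect (-R) R (-R) R"
  have nh: "norm (h z) * (M * norm z ^ k) = M * (d / (norm (z - \<zeta>1) * norm (z - \<zeta>2)))" if "z \<notin> Z" for z
  proof -
    have "1 / (z - \<zeta>1) - 1 / (z - \<zeta>2) = (\<zeta>1 - \<zeta>2) / ((z - \<zeta>1) * (z - \<zeta>2))" using that by (simp add: Z_def field_simps)
    thus ?thesis using that by (simp add: h_def d_def Z_def norm_mult norm_divide norm_inverse norm_power)
  qed
  have fM: "norm (f i z) \<le> M * norm z ^ k" if "z \<in> ?Q" for z
    using norm_le_sum_norm[OF I, of f z] bd[OF that] by linarith
  have cf: "continuous_on ?Q (f i)" by (rule dbar_bounded_continuous[OF dbar I(2) R(2)])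
  define L where "L = (\<lambda>p::complex. if p = 0 then 0 else if p = \<zeta>1 then 2 * pi * \<i> * (f i \<zeta>1 / \<zeta>1 ^ k) else - 2 * pi * \<i> * (f i \<zeta>2 / \<zeta>2 ^ k))"
  have hol: "h holomorphic_on - Z" unfolding h_def Z_def by (intro holomorphic_intros) auto
  have main: "norm (rint (\<lambda>z. h z * f i z) (-R) R (-R) R - (\<Sum>p\<in>Z. L p)) \<le> 64 * (2 * C * M * sqrt d) * card Z * sqrt (2 * R)"
  proof (rule dbar_bounded_pole_estimate[OF dbar I(2) R _ _ hol])
    show "finite Z" "0 \<le> 2 * C * M * sqrt d" using C M d by (auto simp: Z_def)
    show "Z \<subseteq> {z. - R < Re z \<and> Re z < R \<and> - R < Im z \<and> Im z < R}"
      using z R norm_less_mem_square[of \<zeta>1 R] norm_less_mem_square[of \<zeta>2 R] by (auto simp: Z_def)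
    fix z assume zQ: "z \<in> ?Q - Z"
    let ?x = "norm (z - \<zeta>1)" and ?y = "norm (z - \<zeta>2)"
    have xy: "?x > 0" "?y > 0" using zQ by (auto simp: Z_def)
    have "d \<le> ?x + ?y" unfolding d_def by (metis norm_minus_commute norm_triangle_sub dist_norm dist_triangle3 dist_commute)
    have "norm (h z) * (C * (\<Sum>j\<in>I. norm (f j z))) \<le> norm (h z) * (C * (M * norm z ^ k))"
      using bd[of z] zQ C by (intro mult_left_mono) auto
    also have "\<dots> = C * (norm (h z) * (M * norm z ^ k))" by simp
    also have "\<dots> = C * (M * (d / (?x * ?y)))" using nh zQ by simp
    also have "\<dots> \<le> C * (M * (2 * sqrt d * (kern ?x + kern ?y)))"
      using C M xy d \<open>d \<le> ?x + ?y\<close> by (intro mult_left_mono kern_difference) auto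
    also have "\<dots> \<le> 2 * C * M * sqrt d * (kern (norm (z - 0)) + (kern ?x + kern ?y))"
      using C M d kern_nonneg[of "norm z"] by (simp add: algebra_simps)
    also have "kern (norm (z - 0)) + (kern ?x + kern ?y) = (\<Sum>q\<in>Z. kern (norm (z - q)))"
      using z by (simp add: Z_def)
    finally show "norm (h z) * (C * (\<Sum>j\<in>I. norm (f j z))) \<le> 2 * C * M * sqrt d * (\<Sum>q\<in>Z. kern (norm (z - q)))" .
  next
    fix p assume "p \<in> Z"
    then consider "p = 0" | "p = \<zeta>1" | "p = \<zeta>2" by (auto simp: Z_def)
    thus "(sq_rint (\<lambda>z. h z * f i z) p \<longlongrightarrow> L p) (at_right 0)"
    proof cases
      case 1
      define r where "r = min 1 (min (norm \<zeta>1) (norm \<zeta>2) / 2)"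
      have r: "r > 0" "r \<le> 1" "r \<le> norm \<zeta>1 / 2" "r \<le> norm \<zeta>2 / 2" using z by (auto simp: r_def)
      have "r < R" using r(3) z(4) R(1) by linarith
      have far: "norm (z - \<zeta>1) \<ge> r" "norm (z - \<zeta>2) \<ge> r" if "norm z < r" for z
        using norm_triangle_ineq2[of \<zeta>1 z] norm_triangle_ineq2[of \<zeta>2 z] that r by (auto simp: norm_minus_commute)
      have sub: "ball 0 r - {0} \<subseteq> ?Q - Z"
        using r \<open>r < R\<close> far norm_less_mem_rect[of _ R] by (force simp: Z_def)
      have "(sq_rint (\<lambda>z. h z * f i z) 0 \<longlongrightarrow> 0) (at_right 0)"
      proof (rule sq_rint_removable[where r=r and B="M * (d / (r * r))"])
        show "continuous_on (ball 0 r - {0}) (\<lambda>z. h z * f i z)"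
          using sub by (intro continuous_intros continuous_on_subset[OF holomorphic_on_imp_continuous_on[OF hol]] continuous_on_subset[OF cf]) auto
        fix z assume zb: "z \<in> ball 0 r - {0::complex}"
        have zQ: "z \<in> ?Q" "z \<notin> Z" using sub zb by auto
        have n1: "norm z < r" using zb by simp
        have "norm (h z * f i z) \<le> norm (h z) * (M * norm z ^ k)" unfolding norm_mult by (intro mult_left_mono fM zQ) simp
        also have "\<dots> = M * (d / (norm (z - \<zeta>1) * norm (z - \<zeta>2)))" by (rule nh[OF zQ(2)])
        also have "\<dots> \<le> M * (d / (r * r))"
          using far[OF n1] M d r by (intro mult_left_mono divide_left_mono mult_mono mult_pos_pos) auto
        also have "\<dots> \<le> M * (d / (r * r)) / sqrt (norm (z - 0))"
          using n1 r zb M d by (intro le_divide_of_le_one) auto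
        finally show "norm (h z * f i z) \<le> M * (d / (r * r)) / sqrt (norm (z - 0))" .
      qed (use r M d in auto)
      thus ?thesis using 1 by (simp add: L_def)
    next
      case 2
      define r where "r = min (norm \<zeta>1) (min d (R / 2))"
      have r: "r > 0" "r \<le> norm \<zeta>1" "r \<le> d" "r \<le> R / 2" using z d R by (auto simp: r_def)
      have ne: "z \<noteq> 0" "z \<noteq> \<zeta>2" "z \<in> ?Q" if "norm (\<zeta>1 - z) < r" for z
        using that r z norm_triangle_ineq2[of z \<zeta>1] norm_less_mem_rect[of z R] by (auto simp: d_def norm_minus_commute)
      have "(sq_rint (\<lambda>z. h z * f i z) \<zeta>1 \<longlongrightarrow> 2 * pi * \<i> * ((f i \<zeta>1 / \<zeta>1 ^ k) * (1 - (\<zeta>1 - \<zeta>1) / (\<zeta>1 - \<zeta>2)))) (at_right 0)"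
      proof (rule sq_rint_pole'[where w="\<lambda>z. (f i z / z ^ k) * (1 - (z - \<zeta>1) / (z - \<zeta>2))", OF r(1)])
        show "continuous_on (ball \<zeta>1 r) (\<lambda>z. (f i z / z ^ k) * (1 - (z - \<zeta>1) / (z - \<zeta>2)))"
          using ne by (intro continuous_intros continuous_on_subset[OF cf]) (auto simp: dist_norm)
        show "h z * f i z = f i z / z ^ k * (1 - (z - \<zeta>1) / (z - \<zeta>2)) / (z - \<zeta>1)" if "z \<in> ball \<zeta>1 r - {\<zeta>1}" for z
          using that ne[of z] by (simp add: h_def dist_norm field_simps)
      qed
      thus ?thesis using 2 z by (simp add: L_def)
    next
      case 3
      define r where "r = min (norm \<zeta>2) (min d (R / 2))"
      have r: "r > 0" "r \<le> norm \<zeta>2" "r \<le> d" "r \<le> R / 2" using z d R by (auto simp: r_def)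
      have ne: "z \<noteq> 0" "z \<noteq> \<zeta>1" "z \<in> ?Q" if "norm (\<zeta>2 - z) < r" for z
        using that r z norm_triangle_ineq2[of z \<zeta>2] norm_less_mem_rect[of z R] by (auto simp: d_def norm_minus_commute)
      have "(sq_rint (\<lambda>z. h z * f i z) \<zeta>2 \<longlongrightarrow> 2 * pi * \<i> * ((f i \<zeta>2 / \<zeta>2 ^ k) * ((\<zeta>2 - \<zeta>2) / (\<zeta>2 - \<zeta>1) - 1))) (at_right 0)"
      proof (rule sq_rint_pole'[where w="\<lambda>z. (f i z / z ^ k) * ((z - \<zeta>2) / (z - \<zeta>1) - 1)", OF r(1)])
        show "continuous_on (ball \<zeta>2 r) (\<lambda>z. (f i z / z ^ k) * ((z - \<zeta>2) / (z - \<zeta>1) - 1))"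
          using ne by (intro continuous_intros continuous_on_subset[OF cf]) (auto simp: dist_norm)
        show "h z * f i z = f i z / z ^ k * ((z - \<zeta>2) / (z - \<zeta>1) - 1) / (z - \<zeta>2)" if "z \<in> ball \<zeta>2 r - {\<zeta>2}" for z
          using that ne[of z] by (simp add: h_def dist_norm field_simps)
      qed
      thus ?thesis using 3 z by (simp add: L_def)
    qed
  qed
  have sumL: "(\<Sum>p\<in>Z. L p) = 2 * pi * \<i> * (f i \<zeta>1 / \<zeta>1 ^ k - f i \<zeta>2 / \<zeta>2 ^ k)"
    using z by (simp add: Z_def L_def algebra_simps)
  have bdry: "norm (rint (\<lambda>z. h z * f i z) (-R) R (-R) R) \<le> 2 * (4 * M * d / R\<^sup>2) * ((R - -R) + (R - -R))"
  proof (rule rint_bound[where X="?Q - Z"])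
    show "continuous_on (?Q - Z) (\<lambda>z. h z * f i z)"
      by (intro continuous_intros continuous_on_subset[OF holomorphic_on_imp_continuous_on[OF hol]] continuous_on_subset[OF cf]) auto
    fix z assume zz: "z \<in> ?Q" "Re z = -R \<or> Re z = R \<or> Im z = -R \<or> Im z = R"
    have n: "norm z \<ge> R" "norm (z - \<zeta>1) \<ge> R / 2" "norm (z - \<zeta>2) \<ge> R / 2" using origin_square_boundary[OF R(1) zz] z by auto
    have zQ: "z \<notin> Z" using n R by (auto simp: Z_def)
    have "norm (h z * f i z) \<le> norm (h z) * (M * norm z ^ k)" unfolding norm_mult by (intro mult_left_mono fM zz) simp
    also have "\<dots> = M * (d / (norm (z - \<zeta>1) * norm (z - \<zeta>2)))" by (rule nh[OF zQ])
    also have "\<dots> \<le> M * (d / ((R / 2) * (R / 2)))"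
      using n M d R by (intro mult_left_mono divide_left_mono mult_mono mult_pos_pos) auto
    also have "\<dots> = 4 * M * d / R\<^sup>2" by (simp add: power2_eq_square)
    finally show "z \<in> ?Q - Z \<and> norm (h z * f i z) \<le> 4 * M * d / R\<^sup>2" using zz zQ by simp
  qed (use R in auto)
  have sd: "sqrt d * sqrt d = d" "sqrt d \<le> sqrt R" using d by auto
  \<comment> \<open>Half a power of the distance is traded for sqrt R, so that the boundary term has
    the same form as the error term.\<close>
  have "2 * (4 * M * d / R\<^sup>2) * ((R - -R) + (R - -R)) = 32 * M / R * (sqrt d * sqrt d)"
    unfolding sd(1) using R by (simp add: power2_eq_square)
  also have "\<dots> \<le> 32 * M / R * (sqrt R * sqrt d)"
    using sd(2) M R d by (intro mult_left_mono mult_right_mono) auto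
  finally have b2: "norm (rint (\<lambda>z. h z * f i z) (-R) R (-R) R) \<le> 32 * M * sqrt R / R * sqrt d" using bdry by simp
  have "card Z = 3" using z by (simp add: Z_def)
  hence c: "64 * (2 * C * M * sqrt d) * card Z * sqrt (2 * R) = 384 * C * M * sqrt (2 * R) * sqrt d" by simp
  have "norm (\<Sum>p\<in>Z. L p) \<le> norm (rint (\<lambda>z. h z * f i z) (-R) R (-R) R - (\<Sum>p\<in>Z. L p)) + norm (rint (\<lambda>z. h z * f i z) (-R) R (-R) R)"
    by (metis norm_minus_commute norm_triangle_sub add.commute)
  hence "norm (\<Sum>p\<in>Z. L p) \<le> (32 * M * sqrt R / R + 384 * C * M * sqrt (2 * R)) * sqrt d"
    using main[unfolded c] b2 unfolding distrib_right by linarith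
  moreover have "norm (f i \<zeta>1 / \<zeta>1 ^ k - f i \<zeta>2 / \<zeta>2 ^ k) \<le> norm (\<Sum>p\<in>Z. L p)"
    unfolding sumL by (rule norm_le_norm_two_pi)
  ultimately show ?thesis unfolding d_def by linarith
qed

lemma dbar_bounded_limit:
  assumes I: "finite I" "i \<in> I" and dbar: "dbar_bounded I f C \<Omega>" and C: "C \<ge> 0"
    and R: "R > 0" "rect (-R) R (-R) R \<subseteq> \<Omega>" and M: "M \<ge> 0"
    and bd: "\<And>z. z \<in> rect (-R) R (-R) R \<Longrightarrow> (\<Sum>j\<in>I. norm (f j z)) \<le> M * norm z ^ k"
  obtains a A where "A \<ge> 0" "\<And>z. z \<noteq> 0 \<Longrightarrow> norm z < R / 2 \<Longrightarrow> norm (f i z / z ^ k - a) \<le> A * sqrt (norm z)"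
proof -
  define A where "A = 32 * M * sqrt R / R + 384 * C * M * sqrt (2 * R)"
  have A: "A \<ge> 0" using M C R by (simp add: A_def)
  have H: "norm (f i x / x ^ k - f i y / y ^ k) \<le> A * sqrt (norm (x - y))" if "x \<noteq> 0" "y \<noteq> 0" "norm x < R / 2" "norm y < R / 2" for x y
  proof (cases "x = y")
    case True thus ?thesis by simp
  next
    case False thus ?thesis unfolding A_def using that by (intro dbar_bounded_holder[OF I dbar C R M bd]) auto
  qed
  show ?thesis
    by (rule holder_limit[of "R / 2" A "\<lambda>z. f i z / z ^ k"]) (use R(1) that[OF A] A H in auto)
qed

text \<open>When the coefficient of order k vanishes, the Hoelder rate gives only order k + 1/2. The
  weight z^(-k-1) / (z - \<zeta>) then leaves a singularity of order 1/2 at 0, which has no residue,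
  and the error density |z|^(-1/2) / |z - \<zeta>| is covered by \<open>kern_mix\<close>. So the
  order rises to k + 1.\<close>

lemma dbar_bounded_improve:
  assumes I: "finite I" and dbar: "dbar_bounded I f C \<Omega>" and C: "C \<ge> 0"
    and R: "R > 0" "rect (-R) R (-R) R \<subseteq> \<Omega>" and M: "M \<ge> 0"
    and bd: "\<And>z. z \<in> rect (-R) R (-R) R \<Longrightarrow> (\<Sum>j\<in>I. norm (f j z)) \<le> M * (norm z ^ k * sqrt (norm z))"
    and B: "\<And>z. z \<in> rect (-R) R (-R) R \<Longrightarrow> (\<Sum>j\<in>I. norm (f j z)) \<le> B"
  obtains M' where "\<And>z. norm z < R / 2 \<Longrightarrow> (\<Sum>j\<in>I. norm (f j z)) \<le> M' * norm z ^ Suc k"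
proof -
  \<comment> \<open>The first summand bounds the boundary integral; the second is the error of the
    pole estimate with two poles (128 = 64 * 2).\<close>
  define D where "D = 16 * B / R ^ Suc k + 128 * (C * M) * sqrt (2 * R)"
  let ?Q = "rect (-R) R (-R) R"
  have *: "norm (f i \<zeta>) \<le> D * norm \<zeta> ^ Suc k" if i: "i \<in> I" and z: "\<zeta> \<noteq> 0" "norm \<zeta> < R / 2" for i \<zeta>
  proof -
    define h where "h = (\<lambda>z. inverse (z ^ Suc k) * (1 / (z - \<zeta>)))"
    define Z where "Z = {0, \<zeta>}"
    have cf: "continuous_on ?Q (f i)" by (rule dbar_bounded_continuous[OF dbar i R(2)])
    have hol: "h holomorphic_on - Z" unfolding h_def Z_def by (intro holomorphic_intros) auto
    have fF: "norm (f i z) \<le> (\<Sum>j\<in>I. norm (f j z))" for z by (rule norm_le_sum_norm[OF I i])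
    have nh: "norm (h z) * (M * (norm z ^ k * sqrt (norm z))) = M * (1 / (sqrt (norm z) * norm (z - \<zeta>)))" if "z \<notin> Z" for z
    proof -
      have "sqrt (norm z) * sqrt (norm z) = norm z" by simp
      hence "sqrt (norm z) / norm z = 1 / sqrt (norm z)" using that by (simp add: Z_def field_simps)
      moreover have "norm (h z) = inverse (norm z * norm z ^ k) * (1 / norm (z - \<zeta>))"
        by (simp add: h_def norm_mult norm_divide norm_inverse norm_power)
      hence "norm (h z) * (M * (norm z ^ k * sqrt (norm z))) = M * ((sqrt (norm z) / norm z) * (1 / norm (z - \<zeta>)))"
        using that by (simp add: Z_def divide_simps mult_ac)
      ultimately show ?thesis by simp
    qed
    define L where "L = (\<lambda>p::complex. if p = 0 then 0 else 2 * pi * \<i> * (f i \<zeta> / \<zeta> ^ Suc k))"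
    have main: "norm (rint (\<lambda>z. h z * f i z) (-R) R (-R) R - (\<Sum>p\<in>Z. L p)) \<le> 64 * (C * M) * card Z * sqrt (2 * R)"
    proof (rule dbar_bounded_pole_estimate[OF dbar i R _ _ hol])
      show "finite Z" "0 \<le> C * M" using C M by (auto simp: Z_def)
      show "Z \<subseteq> {z. - R < Re z \<and> Re z < R \<and> - R < Im z \<and> Im z < R}"
        using z R norm_less_mem_square[of \<zeta> R] by (auto simp: Z_def)
      fix z assume zQ: "z \<in> ?Q - Z"
      let ?x = "norm z" and ?y = "norm (z - \<zeta>)"
      have xy: "?x > 0" "?y > 0" using zQ by (auto simp: Z_def)
      have "norm (h z) * (C * (\<Sum>j\<in>I. norm (f j z))) \<le> norm (h z) * (C * (M * (norm z ^ k * sqrt (norm z))))"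
        using bd[of z] zQ C by (intro mult_left_mono) auto
      also have "\<dots> = C * (norm (h z) * (M * (norm z ^ k * sqrt (norm z))))" by simp
      also have "\<dots> = C * (M * (1 / (sqrt ?x * ?y)))" using nh zQ by simp
      also have "\<dots> \<le> C * (M * (kern ?x + kern ?y))"
        using C M xy by (intro mult_left_mono kern_mix) auto
      also have "\<dots> = C * M * (\<Sum>q\<in>Z. kern (norm (z - q)))"
        using z by (simp add: Z_def)
      finally show "norm (h z) * (C * (\<Sum>j\<in>I. norm (f j z))) \<le> C * M * (\<Sum>q\<in>Z. kern (norm (z - q)))" .
    next
      fix p assume "p \<in> Z"
      then consider "p = 0" | "p = \<zeta>" by (auto simp: Z_def)
      thus "(sq_rint (\<lambda>z. h z * f i z) p \<longlongrightarrow> L p) (at_right 0)"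
      proof cases
        case 1
        define r where "r = norm \<zeta> / 2"
        have r: "r > 0" "r < R" using z R unfolding r_def by (simp, linarith)
        have far: "norm (z - \<zeta>) \<ge> r" if "norm z < r" for z
          using norm_triangle_ineq2[of \<zeta> z] that r by (auto simp: norm_minus_commute r_def)
        have sub: "ball 0 r - {0} \<subseteq> ?Q - Z"
          using r far norm_less_mem_rect[of _ R] by (force simp: Z_def)
        have "(sq_rint (\<lambda>z. h z * f i z) 0 \<longlongrightarrow> 0) (at_right 0)"
        proof (rule sq_rint_removable[where r=r and B="M / r"])
          show "continuous_on (ball 0 r - {0}) (\<lambda>z. h z * f i z)"
            using sub by (intro continuous_intros continuous_on_subset[OF holomorphic_on_imp_continuous_on[OF hol]] continuous_on_subset[OF cf]) auto
          fix z assume zb: "z \<in> ball 0 r - {0::complex}"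
          have zQ: "z \<in> ?Q" "z \<notin> Z" using sub zb by auto
          have n1: "norm z < r" using zb by simp
          have "norm (h z * f i z) \<le> norm (h z) * (M * (norm z ^ k * sqrt (norm z)))"
            unfolding norm_mult using fF[of z] bd[OF zQ(1)] by (intro mult_left_mono) auto
          also have "\<dots> = M * (1 / (sqrt (norm z) * norm (z - \<zeta>)))" by (rule nh[OF zQ(2)])
          also have "\<dots> \<le> M * (1 / (sqrt (norm z) * r))"
            using far[OF n1] M r zb by (intro mult_left_mono divide_left_mono mult_pos_pos) auto
          finally show "norm (h z * f i z) \<le> M / r / sqrt (norm (z - 0))" by (simp add: field_simps)
        qed (use r M in auto)
        thus ?thesis using 1 by (simp add: L_def)
      next
        case 2
        define r where "r = norm \<zeta>"
        have r: "r > 0" "r < R / 2" using z by (auto simp: r_def)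
        have ne: "z \<noteq> 0" "z \<in> ?Q" if "norm (\<zeta> - z) < r" for z
          using that r z norm_triangle_ineq2[of z \<zeta>] norm_less_mem_rect[of z R] by (auto simp: r_def norm_minus_commute)
        have "(sq_rint (\<lambda>z. h z * f i z) \<zeta> \<longlongrightarrow> 2 * pi * \<i> * (f i \<zeta> / \<zeta> ^ Suc k)) (at_right 0)"
        proof (rule sq_rint_pole'[where w="\<lambda>z. f i z / z ^ Suc k", OF r(1)])
          show "continuous_on (ball \<zeta> r) (\<lambda>z. f i z / z ^ Suc k)"
            using ne by (intro continuous_intros continuous_on_subset[OF cf]) (auto simp: dist_norm)
          show "h z * f i z = f i z / z ^ Suc k / (z - \<zeta>)" if "z \<in> ball \<zeta> r - {\<zeta>}" for z
            using that ne[of z] by (simp add: h_def dist_norm field_simps)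
        qed
        thus ?thesis using 2 z by (simp add: L_def)
      qed
    qed
    have bdry: "norm (rint (\<lambda>z. h z * f i z) (-R) R (-R) R) \<le> 2 * (2 * B / R ^ Suc k / R) * ((R - -R) + (R - -R))"
    proof (rule rint_bound[where X="?Q - Z"])
      show "continuous_on (?Q - Z) (\<lambda>z. h z * f i z)"
        by (intro continuous_intros continuous_on_subset[OF holomorphic_on_imp_continuous_on[OF hol]] continuous_on_subset[OF cf]) auto
      fix z assume zz: "z \<in> ?Q" "Re z = -R \<or> Re z = R \<or> Im z = -R \<or> Im z = R"
      have n: "norm z \<ge> R" "norm (z - \<zeta>) \<ge> R / 2" using origin_square_boundary[OF R(1) zz] z by auto
      have zQ: "z \<notin> Z" using n R by (auto simp: Z_def)
      have fB: "norm (f i z) \<le> B" by (rule order_trans[OF fF B[OF zz(1)]])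
      have "norm (h z * f i z) = norm (f i z) / (norm z ^ Suc k * norm (z - \<zeta>))"
        by (simp add: h_def norm_mult norm_divide norm_inverse norm_power divide_inverse mult_ac)
      also have "\<dots> \<le> B / (R ^ Suc k * (R / 2))"
        using n R fB order_trans[OF norm_ge_zero fB] by (intro frac_le mult_mono power_mono mult_pos_pos) auto
      also have "\<dots> = 2 * B / R ^ Suc k / R" by simp
      finally show "z \<in> ?Q - Z \<and> norm (h z * f i z) \<le> 2 * B / R ^ Suc k / R" using zz zQ by simp
    qed (use R in auto)
    have "2 * (2 * B / R ^ Suc k / R) * ((R - -R) + (R - -R)) = 16 * B / R ^ Suc k" using R by simp
    moreover have "card Z = 2" using z by (simp add: Z_def)
    moreover have "norm (\<Sum>p\<in>Z. L p) \<le> norm (rint (\<lambda>z. h z * f i z) (-R) R (-R) R - (\<Sum>p\<in>Z. L p)) + norm (rint (\<lambda>z. h z * f i z) (-R) R (-R) R)"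
      by (metis norm_minus_commute norm_triangle_sub add.commute)
    ultimately have "norm (\<Sum>p\<in>Z. L p) \<le> D" using main bdry by (simp add: D_def)
    moreover have "norm (f i \<zeta> / \<zeta> ^ Suc k) \<le> norm (\<Sum>p\<in>Z. L p)"
      using norm_le_norm_two_pi[of "f i \<zeta> / \<zeta> ^ Suc k"] z by (simp add: Z_def L_def)
    ultimately have "norm (f i \<zeta> / \<zeta> ^ Suc k) \<le> D" by linarith
    thus ?thesis using z by (simp add: norm_divide norm_power norm_mult divide_le_eq)
  qed
  show ?thesis
  proof (rule that[of "card I * D"])
    fix z :: complex assume z: "norm z < R / 2"
    show "(\<Sum>j\<in>I. norm (f j z)) \<le> card I * D * norm z ^ Suc k"
    proof (cases "z = 0")
      case True
      thus ?thesis using bd[of 0] R by (simp add: rect_def)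
    next
      case False
      have "(\<Sum>j\<in>I. norm (f j z)) \<le> (\<Sum>j\<in>I. D * norm z ^ Suc k)" using *[OF _ False z] by (rule sum_mono)
      thus ?thesis by simp
    qed
  qed
qed


text \<open>Comparing the estimates for all \<open>k\<close> on one small square: the constants grow only like \<open>(2 / R) ^ k\<close>.\<close>

lemma dbar_bounded_vanish:
  fixes R :: real
  assumes I: "finite I" and dbar: "dbar_bounded I f C \<Omega>" and C: "C \<ge> 0"
    and R: "R > 0" "rect (-R) R (-R) R \<subseteq> \<Omega>"
    and ord: "\<And>k::nat. \<exists>M. \<forall>z\<in>rect (-R) R (-R) R. (\<Sum>j\<in>I. norm (f j z)) \<le> M * norm z ^ k"
    and B: "\<And>z. z \<in> rect (-R) R (-R) R \<Longrightarrow> (\<Sum>j\<in>I. norm (f j z)) \<le> B"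
    and small: "card I * (384 * C * R) \<le> 1 / 2"
    and z: "norm z < R / 2" and i: "i \<in> I"
  shows "f i z = 0"
proof -
  let ?Q = "rect (-R) R (-R) R"
  define F where "F = (\<lambda>z. \<Sum>j\<in>I. norm (f j z))"
  have F0: "F z \<ge> 0" for z by (simp add: F_def sum_nonneg)
  have B': "F z \<le> B" if "z \<in> ?Q" for z using B[OF that] by (simp add: F_def)
  have B0: "B \<ge> 0" using B'[of 0] F0[of 0] R by (simp add: rect_def)
  define n where "n = real (card I)"
  \<comment> \<open>The factor in front of (2 / R) ^ k must not depend on \<open>k\<close>, since
    \<open>k\<close> tends to infinity at the end.\<close>
  have key: "F \<zeta> / norm \<zeta> ^ k \<le> (2 * n * 16 + 2) * B * (2 / R) ^ k" if \<zeta>: "\<zeta> \<in> ?Q - {0}" for \<zeta> k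
  proof -
    define T where "T = (\<lambda>z. F z / norm z ^ k) ` (?Q - {0})"
    \<comment> \<open>The best constant in F z \<le> S |z| ^ k. The hypothesis \<open>ord\<close>
      makes it finite, which the absorption below requires.\<close>
    define S where "S = Sup T"
    obtain M where M: "\<And>z. z \<in> ?Q \<Longrightarrow> F z \<le> M * norm z ^ k" using ord[of k] by (auto simp: F_def)
    have bdd: "bdd_above T"
    proof (rule bdd_aboveI[of _ M])
      fix x assume "x \<in> T"
      then obtain z where z: "z \<in> ?Q" "z \<noteq> 0" and x: "x = F z / norm z ^ k" by (auto simp: T_def)
      show "x \<le> M" unfolding x using M[OF z(1)] z(2) by (simp add: divide_le_eq)
    qed
    have leS: "F z \<le> S * norm z ^ k" if "z \<in> ?Q - {0}" for z
    proof -
      have "F z / norm z ^ k \<le> S" unfolding S_def using that bdd by (intro cSup_upper) (auto simp: T_def)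
      thus ?thesis using that by (simp add: divide_le_eq)
    qed
    have S0: "S \<ge> 0"
    proof -
      have "0 \<le> S * norm \<zeta> ^ k" using F0[of \<zeta>] leS[OF \<zeta>] by linarith
      moreover have "norm \<zeta> ^ k > 0" using \<zeta> by simp
      ultimately show ?thesis using mult_neg_pos[of S "norm \<zeta> ^ k"] by linarith
    qed
    \<comment> \<open>On the inner half the pole estimate reproduces \<open>S\<close> with a
      coefficient proportional to \<open>R\<close>, which \<open>small\<close> makes at most 1/2
      after summing over \<open>I\<close>.\<close>
    have inner: "norm (f i \<zeta>) \<le> (384 * C * R * S + 16 * B / R ^ k) * norm \<zeta> ^ k" if i: "i \<in> I" and z: "\<zeta> \<noteq> 0" "norm \<zeta> < R / 2" for i \<zeta>
    proof -
      define h where "h = (\<lambda>z. inverse (z ^ k) * (1 / (z - \<zeta>)))"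
      define Z where "Z = {0, \<zeta>}"
      have cf: "continuous_on ?Q (f i)" by (rule dbar_bounded_continuous[OF dbar i R(2)])
      have hol: "h holomorphic_on - Z" unfolding h_def Z_def by (intro holomorphic_intros) auto
      have fF: "norm (f i z) \<le> F z" for z unfolding F_def by (rule norm_le_sum_norm[OF I i])
      have nh: "norm (h z) * (S * norm z ^ k) = S * (1 / norm (z - \<zeta>))" if "z \<notin> Z" for z
      proof -
        have "norm (h z) = inverse (norm z ^ k) * (1 / norm (z - \<zeta>))"
          by (simp add: h_def norm_mult norm_divide norm_inverse norm_power)
        thus ?thesis using that by (simp add: Z_def divide_simps mult_ac)
      qed
      define L where "L = (\<lambda>p::complex. if p = 0 then 0 else 2 * pi * \<i> * (f i \<zeta> / \<zeta> ^ k))"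
      have main: "norm (rint (\<lambda>z. h z * f i z) (-R) R (-R) R - (\<Sum>p\<in>Z. L p)) \<le> 64 * (C * S * sqrt (4 * R)) * card Z * sqrt (2 * R)"
      proof (rule dbar_bounded_pole_estimate[OF dbar i R _ _ hol])
        show "finite Z" "0 \<le> C * S * sqrt (4 * R)" using C S0 R by (auto simp: Z_def)
        show "Z \<subseteq> {z. - R < Re z \<and> Re z < R \<and> - R < Im z \<and> Im z < R}"
          using z R norm_less_mem_square[of \<zeta> R] by (auto simp: Z_def)
        fix z assume zQ: "z \<in> ?Q - Z"
        let ?y = "norm (z - \<zeta>)"
        have y: "?y > 0" using zQ by (auto simp: Z_def)
        have "norm z \<le> 2 * R" using zQ cmod_le[of z] by (auto simp: rect_def)
        hence y4: "?y \<le> 4 * R" using norm_triangle_ineq4[of z \<zeta>] z R by linarith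
        have "norm (h z) * (C * (\<Sum>j\<in>I. norm (f j z))) \<le> norm (h z) * (C * (S * norm z ^ k))"
          using leS[of z] zQ C by (intro mult_left_mono) (auto simp: Z_def F_def)
        also have "\<dots> = C * (norm (h z) * (S * norm z ^ k))" by simp
        also have "\<dots> = C * S * (1 / ?y)" using nh zQ by simp
        \<comment> \<open>A simple pole is weaker than \<open>kern\<close> by the square root of a
          distance of at most 4 R. Together with the sqrt (2 R) of the pole estimate this produces
          the factor \<open>R\<close>.\<close>
        also have "1 / ?y = sqrt ?y * kern ?y" using y by (simp add: kern_def)
        also have "C * S * (sqrt ?y * kern ?y) \<le> C * S * (sqrt (4 * R) * (kern (norm (z - 0)) + kern ?y))"
        proof (intro mult_left_mono mult_mono)
          show "sqrt ?y \<le> sqrt (4 * R)" using y4 by simp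
          show "kern ?y \<le> kern (norm (z - 0)) + kern ?y" "0 \<le> kern ?y" by (simp_all add: kern_nonneg)
          show "0 \<le> sqrt (4 * R)" using R(1) by simp
          show "0 \<le> C * S" using C S0 by simp
        qed
        also have "\<dots> = C * S * sqrt (4 * R) * (\<Sum>q\<in>Z. kern (norm (z - q)))"
          using z by (simp add: Z_def)
        finally show "norm (h z) * (C * (\<Sum>j\<in>I. norm (f j z))) \<le> C * S * sqrt (4 * R) * (\<Sum>q\<in>Z. kern (norm (z - q)))" .
      next
        fix p assume "p \<in> Z"
        then consider "p = 0" | "p = \<zeta>" by (auto simp: Z_def)
        thus "(sq_rint (\<lambda>z. h z * f i z) p \<longlongrightarrow> L p) (at_right 0)"
        proof cases
          case 1
          define r where "r = min 1 (norm \<zeta> / 2)"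
          have r: "r > 0" "r \<le> 1" "r \<le> norm \<zeta> / 2" using z by (auto simp: r_def)
          have "r < R" using r z R by linarith
          have far: "norm (z - \<zeta>) \<ge> r" if "norm z < r" for z
            using norm_triangle_ineq2[of \<zeta> z] that r by (auto simp: norm_minus_commute)
          have sub: "ball 0 r - {0} \<subseteq> ?Q - Z"
            using r \<open>r < R\<close> far norm_less_mem_rect[of _ R] by (force simp: Z_def)
          have "(sq_rint (\<lambda>z. h z * f i z) 0 \<longlongrightarrow> 0) (at_right 0)"
          proof (rule sq_rint_removable[where r=r and B="S / r"])
            show "continuous_on (ball 0 r - {0}) (\<lambda>z. h z * f i z)"
              using sub by (intro continuous_intros continuous_on_subset[OF holomorphic_on_imp_continuous_on[OF hol]] continuous_on_subset[OF cf]) auto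
            fix z assume zb: "z \<in> ball 0 r - {0::complex}"
            have zQ: "z \<in> ?Q" "z \<notin> Z" using sub zb by auto
            have n1: "norm z < r" using zb by simp
            have "norm (h z * f i z) \<le> norm (h z) * (S * norm z ^ k)"
              unfolding norm_mult using fF[of z] leS[of z] zQ by (intro mult_left_mono) (auto simp: Z_def)
            also have "\<dots> = S * (1 / norm (z - \<zeta>))" by (rule nh[OF zQ(2)])
            also have "\<dots> \<le> S * (1 / r)"
              using far[OF n1] S0 r by (intro mult_left_mono divide_left_mono mult_pos_pos) auto
            also have "\<dots> \<le> S / r / sqrt (norm (z - 0))"
              using n1 r zb S0 by (simp only: mult_1_right times_divide_eq_right) (intro le_divide_of_le_one; simp)
            finally show "norm (h z * f i z) \<le> S / r / sqrt (norm (z - 0))" .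
          qed (use r S0 in auto)
          thus ?thesis using 1 by (simp add: L_def)
        next
          case 2
          define r where "r = norm \<zeta>"
          have r: "r > 0" "r < R / 2" using z by (auto simp: r_def)
          have ne: "z \<noteq> 0" "z \<in> ?Q" if "norm (\<zeta> - z) < r" for z
            using that r z norm_triangle_ineq2[of z \<zeta>] norm_less_mem_rect[of z R] by (auto simp: r_def norm_minus_commute)
          have "(sq_rint (\<lambda>z. h z * f i z) \<zeta> \<longlongrightarrow> 2 * pi * \<i> * (f i \<zeta> / \<zeta> ^ k)) (at_right 0)"
          proof (rule sq_rint_pole'[where w="\<lambda>z. f i z / z ^ k", OF r(1)])
            show "continuous_on (ball \<zeta> r) (\<lambda>z. f i z / z ^ k)"
              using ne by (intro continuous_intros continuous_on_subset[OF cf]) (auto simp: dist_norm)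
            show "h z * f i z = f i z / z ^ k / (z - \<zeta>)" if "z \<in> ball \<zeta> r - {\<zeta>}" for z
              using that ne[of z] by (simp add: h_def dist_norm field_simps)
          qed
          thus ?thesis using 2 z by (simp add: L_def)
        qed
      qed
      have bdry: "norm (rint (\<lambda>z. h z * f i z) (-R) R (-R) R) \<le> 2 * (2 * B / R ^ k / R) * ((R - -R) + (R - -R))"
      proof (rule rint_bound[where X="?Q - Z"])
        show "continuous_on (?Q - Z) (\<lambda>z. h z * f i z)"
          by (intro continuous_intros continuous_on_subset[OF holomorphic_on_imp_continuous_on[OF hol]] continuous_on_subset[OF cf]) auto
        fix z assume zz: "z \<in> ?Q" "Re z = -R \<or> Re z = R \<or> Im z = -R \<or> Im z = R"
        have n: "norm z \<ge> R" "norm (z - \<zeta>) \<ge> R / 2" using origin_square_boundary[OF R(1) zz] z by auto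
        have zQ: "z \<notin> Z" using n R by (auto simp: Z_def)
        have "norm (h z * f i z) = norm (f i z) / (norm z ^ k * norm (z - \<zeta>))"
          by (simp add: h_def norm_mult norm_divide norm_inverse norm_power divide_inverse mult_ac)
        also have "\<dots> \<le> B / (R ^ k * (R / 2))"
          using n R B0 order_trans[OF fF B'[OF zz(1)]] by (intro frac_le mult_mono power_mono mult_pos_pos) auto
        also have "\<dots> = 2 * B / R ^ k / R" by simp
        finally show "z \<in> ?Q - Z \<and> norm (h z * f i z) \<le> 2 * B / R ^ k / R" using zz zQ by simp
      qed (use R in auto)
      have "2 * (2 * B / R ^ k / R) * ((R - -R) + (R - -R)) = 16 * B / R ^ k" using R by simp
      moreover have "card Z = 2" using z by (simp add: Z_def)
      moreover have "sqrt (4 * R) * sqrt (2 * R) \<le> 3 * R"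
      proof -
        have "sqrt (4 * R) * sqrt (2 * R) = sqrt (8 * R\<^sup>2)" by (simp flip: real_sqrt_mult add: power2_eq_square)
        also have "\<dots> \<le> 3 * R" using R by (intro real_le_lsqrt) (auto simp: power2_eq_square)
        finally show ?thesis .
      qed
      hence "128 * (C * S) * (sqrt (4 * R) * sqrt (2 * R)) \<le> 128 * (C * S) * (3 * R)" using C S0 by (intro mult_left_mono) auto
      moreover have "norm (\<Sum>p\<in>Z. L p) \<le> norm (rint (\<lambda>z. h z * f i z) (-R) R (-R) R - (\<Sum>p\<in>Z. L p)) + norm (rint (\<lambda>z. h z * f i z) (-R) R (-R) R)"
        by (metis norm_minus_commute norm_triangle_sub add.commute)
      ultimately have "norm (\<Sum>p\<in>Z. L p) \<le> 384 * C * R * S + 16 * B / R ^ k" using main bdry by (simp add: mult_ac)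
      moreover have "norm (f i \<zeta> / \<zeta> ^ k) \<le> norm (\<Sum>p\<in>Z. L p)"
      using norm_le_norm_two_pi[of "f i \<zeta> / \<zeta> ^ k"] z by (simp add: Z_def L_def)
    ultimately have "norm (f i \<zeta> / \<zeta> ^ k) \<le> 384 * C * R * S + 16 * B / R ^ k" by linarith
      thus ?thesis using z by (simp add: norm_divide norm_power norm_mult divide_le_eq)
    qed
    have pw: "1 / R ^ k \<le> (2 / R) ^ k" using R by (simp add: power_divide divide_right_mono)
    have "S \<le> S / 2 + (n * 16 + 1) * B * (2 / R) ^ k"
      unfolding S_def
    proof (rule cSup_least)
      show "T \<noteq> {}" using \<zeta> by (auto simp: T_def)
      fix x assume "x \<in> T"
      then obtain z where z: "z \<in> ?Q" "z \<noteq> 0" and x: "x = F z / norm z ^ k" by (auto simp: T_def)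
      show "x \<le> Sup T / 2 + (n * 16 + 1) * B * (2 / R) ^ k"
      proof (cases "norm z < R / 2")
        case True
        have "F z \<le> (\<Sum>j\<in>I. (384 * C * R * S + 16 * B / R ^ k) * norm z ^ k)"
          unfolding F_def using inner[OF _ z(2) True] by (rule sum_mono)
        also have "\<dots> = (n * (384 * C * R) * S + n * 16 * B * (1 / R ^ k)) * norm z ^ k" by (simp add: n_def algebra_simps)
        finally have "x \<le> n * (384 * C * R) * S + n * 16 * B * (1 / R ^ k)" using z by (simp add: x divide_le_eq)
        also have "\<dots> \<le> 1 / 2 * S + (n * 16 + 1) * B * (2 / R) ^ k"
          using small S0 B0 pw R by (intro add_mono mult_mono) (auto simp: n_def)
        finally show ?thesis by (simp add: S_def)
      next
        case False
        \<comment> \<open>On the outer half |z| is at least R / 2, and boundedness of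
          \<open>F\<close> alone suffices.\<close>
        have "F z \<le> B" using B[OF z(1)] by (simp add: F_def)
        moreover have "(R / 2) ^ k \<le> norm z ^ k" using False R by (intro power_mono) auto
        ultimately have "x \<le> B / (R / 2) ^ k" unfolding x using R B0 by (intro frac_le) auto
        also have "\<dots> = 1 * B * (2 / R) ^ k" using R by (simp add: power_divide field_simps)
        also have "\<dots> \<le> (n * 16 + 1) * B * (2 / R) ^ k" using B0 R by (intro mult_right_mono) (auto simp: n_def)
        also have "\<dots> \<le> Sup T / 2 + \<dots>" using S0 by (simp add: S_def)
        finally show ?thesis .
      qed
    qed
    hence "S \<le> (2 * n * 16 + 2) * B * (2 / R) ^ k" by (simp add: algebra_simps)
    moreover have "F \<zeta> / norm \<zeta> ^ k \<le> S" using leS[OF \<zeta>] \<zeta> by (simp add: divide_le_eq)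
    ultimately show ?thesis by linarith
  qed
  have "F z \<le> 0"
  proof (cases "z = 0")
    case True
    obtain M where M: "\<And>z. z \<in> ?Q \<Longrightarrow> F z \<le> M * norm z ^ 1" using ord[of 1] by (auto simp: F_def)
    have "0 \<in> ?Q" using R by (simp add: rect_def)
    from M[OF this] show ?thesis using True by simp
  next
    case False
    have zQ: "z \<in> ?Q" using z R by (intro norm_less_mem_rect) auto
    have le: "F z \<le> (2 * n * 16 + 2) * B * (2 / R * norm z) ^ k" for k
      using key[of z k] zQ False unfolding power_mult_distrib[of "2 / R" "norm z"] by (simp add: divide_le_eq mult_ac)
    have "(\<lambda>k. (2 * n * 16 + 2) * B * (2 / R * norm z) ^ k) \<longlonglongrightarrow> (2 * n * 16 + 2) * B * 0"
      using z R by (intro tendsto_intros LIMSEQ_power_zero) (auto simp: field_simps)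
    thus ?thesis using le by (simp add: LIMSEQ_le_const)
  qed
  hence "F z = 0" using F0[of z] by simp
  thus ?thesis using norm_le_sum_norm[OF I i, of f z] by (simp add: F_def)
qed

text \<open>Strong unique continuation with a leading term. Take the largest k with F = O(|z| ^ k).
  If all its leading coefficients vanished, the Hoelder rate and \<open>dbar_bounded_improve\<close>
  would give order k + 1. If there is no largest k, \<open>dbar_bounded_vanish\<close>
  applies.\<close>

theorem dbar_bounded_order:
  assumes I: "finite I" and dbar: "dbar_bounded I f C (ball 0 r)" and C: "C \<ge> 0" and r: "r > 0"
  obtains \<rho> where "\<rho> > 0" "\<And>z i. norm z < \<rho> \<Longrightarrow> i \<in> I \<Longrightarrow> f i z = 0"
  | m a i0 where "i0 \<in> I" "a i0 \<noteq> 0" "\<And>i. i \<in> I \<Longrightarrow> ((\<lambda>z. f i z / z ^ m) \<longlongrightarrow> a i) (at 0)"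
proof -
  define n where "n = real (card I)"
  define F where "F = (\<lambda>z. \<Sum>j\<in>I. norm (f j z))"
  have F0: "F z \<ge> 0" for z by (simp add: F_def sum_nonneg)
  \<comment> \<open>r / 4 keeps the square inside the disc; 768 = 2 * 384 makes the coefficient to
    be absorbed in \<open>dbar_bounded_vanish\<close> at most 1/2.\<close>
  define R where "R = min (r / 4) (1 / (768 * (n * C + 1)))"
  have n0: "n * C \<ge> 0" using C by (simp add: n_def)
  have R: "R > 0" using r n0 by (simp add: R_def)
  have "R \<le> r / 4" by (simp add: R_def)
  hence sub: "rect (-R) R (-R) R \<subseteq> ball 0 r"
    using square_subset_cball[of 0 R] R r by force
  have small: "card I * (384 * C * R) \<le> 1 / 2"
  proof -
    have "n * C * R \<le> (n * C + 1) * (1 / (768 * (n * C + 1)))"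
      using n0 R by (intro mult_mono) (auto simp: R_def)
    also have "\<dots> = 1 / 768" using n0 by simp
    finally show ?thesis by (simp add: n_def mult_ac)
  qed
  have cF: "continuous_on (rect (-R) R (-R) R) F"
    unfolding F_def by (intro continuous_intros dbar_bounded_continuous[OF dbar _ sub])
  obtain B where B: "\<And>z. z \<in> rect (-R) R (-R) R \<Longrightarrow> F z \<le> B"
    using compact_imp_bounded[OF compact_continuous_image[OF cF compact_rect]] unfolding bounded_real
    by (metis abs_le_D1 imageI)
  have B0: "B \<ge> 0" using B[of 0] F0[of 0] R by (simp add: rect_def)
  define P where "P = (\<lambda>k::nat. \<exists>M. \<forall>z\<in>rect (-R) R (-R) R. F z \<le> M * norm z ^ k)"
  \<comment> \<open>An order of vanishing near 0 holds on the whole square with a worse constant. So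
    all orders refer to one fixed square, as \<open>dbar_bounded_vanish\<close> demands.\<close>
  have extend: "P k" if "\<rho> > 0" "\<And>z. norm z < \<rho> \<Longrightarrow> F z \<le> M * norm z ^ k" for \<rho> M k
    unfolding P_def
  proof (intro exI ballI)
    fix z assume z: "z \<in> rect (-R) R (-R) R"
    show "F z \<le> (\<bar>M\<bar> + B / \<rho> ^ k) * norm z ^ k"
    proof (cases "norm z < \<rho>")
      case True
      have "F z \<le> M * norm z ^ k" by (rule that(2)[OF True])
      also have "\<dots> \<le> (\<bar>M\<bar> + B / \<rho> ^ k) * norm z ^ k"
        using B0 that(1) by (intro mult_right_mono) (auto intro: add_increasing2)
      finally show ?thesis .
    next
      case False
      have "F z \<le> B" by (rule B[OF z])
      also have "B = B / \<rho> ^ k * \<rho> ^ k" using that(1) by simp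
      also have "\<dots> \<le> (\<bar>M\<bar> + B / \<rho> ^ k) * norm z ^ k"
        using B0 that(1) False by (intro mult_mono power_mono) auto
      finally show ?thesis .
    qed
  qed
  show ?thesis
  proof (cases "\<forall>k. P k")
    case True
    have "f i z = 0" if "norm z < R / 2" "i \<in> I" for z i
      by (rule dbar_bounded_vanish[OF I dbar C R sub _ _ small that]) (use True B in \<open>auto simp: P_def F_def\<close>)
    thus ?thesis using R that(1)[of "R / 2"] by simp
  next
    case False
    have "P 0" unfolding P_def using B by auto
    then obtain k where k: "P k" "\<not> P (Suc k)" using False by (metis nat_induct)
    then obtain M0 where "\<And>z. z \<in> rect (-R) R (-R) R \<Longrightarrow> F z \<le> M0 * norm z ^ k" by (auto simp: P_def)
    moreover have "M0 * norm z ^ k \<le> \<bar>M0\<bar> * norm z ^ k" for z :: complex by (intro mult_right_mono) auto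
    ultimately obtain M where M: "M \<ge> 0" "\<And>z. z \<in> rect (-R) R (-R) R \<Longrightarrow> F z \<le> M * norm z ^ k"
      by (metis abs_ge_zero order_trans)
    have "\<exists>a A. A \<ge> 0 \<and> (\<forall>z. z \<noteq> 0 \<longrightarrow> norm z < R / 2 \<longrightarrow> norm (f i z / z ^ k - a) \<le> A * sqrt (norm z))" if "i \<in> I" for i
      by (rule dbar_bounded_limit[OF I that dbar C R sub M(1), of k]) (use M(2) in \<open>auto simp: F_def\<close>)
    then obtain a A where aA: "\<And>i. i \<in> I \<Longrightarrow> A i \<ge> 0" "\<And>i z. i \<in> I \<Longrightarrow> z \<noteq> 0 \<Longrightarrow> norm z < R / 2 \<Longrightarrow> norm (f i z / z ^ k - a i) \<le> A i * sqrt (norm z)"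
      by metis
    have lim: "((\<lambda>z. f i z / z ^ k) \<longlongrightarrow> a i) (at 0)" if i: "i \<in> I" for i
    proof (rule LIM_zero_cancel, rule Lim_null_comparison)
      have "isCont (\<lambda>z::complex. A i * sqrt (norm z)) 0" by (intro continuous_intros)
      thus "((\<lambda>z::complex. A i * sqrt (norm z)) \<longlongrightarrow> 0) (at 0)" by (simp add: isCont_def)
      show "\<forall>\<^sub>F z in at 0. norm (f i z / z ^ k - a i) \<le> A i * sqrt (norm z)"
        unfolding eventually_at using R aA(2)[OF i] by (intro exI[of _ "R / 2"]) auto
    qed
    have "\<exists>i0\<in>I. a i0 \<noteq> 0"
    proof (rule ccontr)
      assume "\<not> ?thesis"
      hence a0: "a i = 0" if "i \<in> I" for i using that by blast
      define D where "D = (\<Sum>i\<in>I. A i)"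
      have D0: "D \<ge> 0" unfolding D_def using aA(1) by (rule sum_nonneg)
      have F1: "F z \<le> D * (norm z ^ k * sqrt (norm z))" if "norm z < R / 2" "z \<noteq> 0" for z
      proof -
        have "norm (f i z) \<le> A i * (norm z ^ k * sqrt (norm z))" if "i \<in> I" for i
          using aA(2)[OF that \<open>z \<noteq> 0\<close> \<open>norm z < R / 2\<close>] a0[OF that] \<open>z \<noteq> 0\<close> by (simp add: norm_divide norm_power divide_le_eq mult_ac)
        hence "F z \<le> (\<Sum>i\<in>I. A i * (norm z ^ k * sqrt (norm z)))" unfolding F_def by (rule sum_mono)
        thus ?thesis by (simp add: D_def sum_distrib_right)
      qed
      have F00: "F 0 \<le> 0"
      proof (rule tendsto_le[of "at 0"])
        have "isCont F 0"
          using cF R by (intro continuous_on_interior[of "rect (-R) R (-R) R"]) (auto simp: rect_cbox box_def Basis_complex_def)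
        thus "(F \<longlongrightarrow> F 0) (at 0)" by (simp add: isCont_def)
        have "isCont (\<lambda>z::complex. D * (norm z ^ k * sqrt (norm z))) 0" by (intro continuous_intros)
        thus "((\<lambda>z::complex. D * (norm z ^ k * sqrt (norm z))) \<longlongrightarrow> 0) (at 0)" by (simp add: isCont_def)
        show "\<forall>\<^sub>F z in at 0. F z \<le> D * (norm z ^ k * sqrt (norm z))"
          unfolding eventually_at using R F1 by (intro exI[of _ "R / 2"]) auto
      qed simp
      define D' where "D' = D + B / ((R / 2) ^ k * sqrt (R / 2))"
      have D'0: "D' \<ge> 0" using D0 B0 R by (simp add: D'_def)
      have F2: "F z \<le> D' * (norm z ^ k * sqrt (norm z))" if z: "z \<in> rect (-R) R (-R) R" for z
      proof -
        consider "z = 0" | "z \<noteq> 0" "norm z < R / 2" | "norm z \<ge> R / 2" by linarith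
        thus ?thesis
        proof cases
          case 1 thus ?thesis using F00 by simp
        next
          case 2
          have "D * (norm z ^ k * sqrt (norm z)) \<le> D' * (norm z ^ k * sqrt (norm z))"
            using B0 R by (intro mult_right_mono) (auto simp: D'_def)
          thus ?thesis using F1[OF 2(2,1)] by linarith
        next
          case 3
          have "F z \<le> B" by (rule B[OF z])
          also have "B = B / ((R / 2) ^ k * sqrt (R / 2)) * ((R / 2) ^ k * sqrt (R / 2))" using R by simp
          also have "\<dots> \<le> D' * (norm z ^ k * sqrt (norm z))"
            using 3 B0 D0 D'0 R by (intro mult_mono power_mono) (auto simp: D'_def)
          finally show ?thesis .
        qed
      qed
      obtain M' where "\<And>z. norm z < R / 2 \<Longrightarrow> F z \<le> M' * norm z ^ Suc k"
        by (rule dbar_bounded_improve[OF I dbar C R sub D'0, of k B]) (use F2 B in \<open>auto simp: F_def\<close>)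
      hence "P (Suc k)" using R by (intro extend[of "R / 2"]) auto
      thus False using k(2) by blast
    qed
    thus ?thesis using that(2) lim by blast
  qed
qed

subsection \<open>Pseudoholomorphic curves in coordinates\<close>

text \<open>\<open>J\<close> is a family of plain functions, so the Lipschitz condition is stated on
  vectors instead of in an operator norm.\<close>

definition acs_on :: "('e::euclidean_space \<Rightarrow> 'e \<Rightarrow> 'e) \<Rightarrow> 'e set \<Rightarrow> bool" where
  "acs_on J V \<longleftrightarrow> open V \<and> (\<forall>y\<in>V. linear (J y) \<and> (\<forall>v. J y (J y v) = - v)) \<and>
     (\<forall>y\<in>V. \<exists>r>0. \<exists>L. \<forall>p\<in>ball y r \<inter> V. \<forall>q\<in>ball y r \<inter> V. \<forall>v. norm (J p v - J q v) \<le> L * norm (p - q) * norm v)"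

text \<open>The derivative is an explicit argument, so that composed and descended curves can bring
  their own formula. Continuity in each fixed direction is enough in finite dimension.\<close>

definition jcurve :: "('e::euclidean_space \<Rightarrow> 'e \<Rightarrow> 'e) \<Rightarrow> 'e set \<Rightarrow> complex set \<Rightarrow> (complex \<Rightarrow> 'e) \<Rightarrow> (complex \<Rightarrow> complex \<Rightarrow> 'e) \<Rightarrow> bool" where
  "jcurve J V W u du \<longleftrightarrow> open W \<and> u ` W \<subseteq> V \<and> (\<forall>z\<in>W. (u has_derivative du z) (at z)) \<and>
     (\<forall>t. continuous_on W (\<lambda>z. du z t)) \<and> (\<forall>z\<in>W. \<forall>t. du z (\<i> * t) = J (u z) (du z t))"

text \<open>The \<open>J q\<close>-linear functional with real part \<open>v \<mapsto> b \<bullet> v\<close>.\<close>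

definition jfun :: "('e::euclidean_space \<Rightarrow> 'e \<Rightarrow> 'e) \<Rightarrow> 'e \<Rightarrow> 'e \<Rightarrow> 'e \<Rightarrow> complex" where
  "jfun J q b v = Complex (b \<bullet> v) (- (b \<bullet> J q v))"

lemma acs_on_local:
  assumes "acs_on J V" "y \<in> V"
  obtains r L K where "r > 0" "L \<ge> 0" "K \<ge> 0" "ball y r \<subseteq> V"
    "\<And>p q v. p \<in> ball y r \<Longrightarrow> q \<in> ball y r \<Longrightarrow> norm (J p v - J q v) \<le> L * norm (p - q) * norm v"
    "\<And>p v. p \<in> ball y r \<Longrightarrow> norm (J p v) \<le> K * norm v"
proof -
  have oV: "open V" and lin: "linear (J y)" using assms by (auto simp: acs_on_def)
  obtain r1 L where r1: "r1 > 0" and L: "\<And>p q v. p \<in> ball y r1 \<inter> V \<Longrightarrow> q \<in> ball y r1 \<inter> V \<Longrightarrow> norm (J p v - J q v) \<le> L * norm (p - q) * norm v"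
    using assms unfolding acs_on_def by blast
  obtain r2 where r2: "r2 > 0" "ball y r2 \<subseteq> V" using oV assms(2) openE by blast
  define r where "r = min 1 (min r1 r2)"
  have r: "r > 0" "r \<le> 1" "r \<le> r1" "r \<le> r2" using r1 r2 by (auto simp: r_def)
  have rV: "ball y r \<subseteq> V" using r2 r by auto
  have L': "norm (J p v - J q v) \<le> \<bar>L\<bar> * norm (p - q) * norm v" if "p \<in> ball y r" "q \<in> ball y r" for p q v
  proof -
    have "norm (J p v - J q v) \<le> L * norm (p - q) * norm v" using that rV r by (intro L) auto
    also have "\<dots> \<le> \<bar>L\<bar> * norm (p - q) * norm v" by (intro mult_right_mono) auto
    finally show ?thesis .
  qed
  obtain K0 where K0: "K0 > 0" "\<And>v. norm (J y v) \<le> K0 * norm v"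
    using linear_bounded_pos[OF lin] by blast
  have K: "norm (J p v) \<le> (K0 + \<bar>L\<bar>) * norm v" if "p \<in> ball y r" for p v
  proof -
    have "norm (J p v) \<le> norm (J p v - J y v) + norm (J y v)" by (metis norm_triangle_sub add.commute)
    also have "\<dots> \<le> \<bar>L\<bar> * 1 * norm v + K0 * norm v"
    proof (intro add_mono K0(2))
      have "norm (J p v - J y v) \<le> \<bar>L\<bar> * norm (p - y) * norm v" using that r by (intro L') auto
      also have "\<dots> \<le> \<bar>L\<bar> * 1 * norm v"
        using that r by (intro mult_right_mono mult_left_mono) (auto simp: dist_norm norm_minus_commute)
      finally show "norm (J p v - J y v) \<le> \<bar>L\<bar> * 1 * norm v" .
    qed
    finally show ?thesis by (simp add: algebra_simps)
  qed
  show ?thesis by (rule that[of r "\<bar>L\<bar>" "K0 + \<bar>L\<bar>"]) (use r rV L' K K0 in auto)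
qed

lemma acs_linear: "acs_on J V \<Longrightarrow> q \<in> V \<Longrightarrow> linear (J q)"
  and acs_square: "acs_on J V \<Longrightarrow> q \<in> V \<Longrightarrow> J q (J q v) = - v"
  by (auto simp: acs_on_def)

lemma Re_jfun [simp]: "Re (jfun J q b v) = b \<bullet> v"
  by (simp add: jfun_def)

lemma linear_jfun:
  assumes "acs_on J V" "q \<in> V"
  shows "linear (jfun J q b)"
  using acs_linear[OF assms]
  by (intro linearI) (auto simp: jfun_def complex_eq_iff linear_add linear_cmul inner_add_right)

lemma bounded_linear_jfun: "acs_on J V \<Longrightarrow> q \<in> V \<Longrightarrow> bounded_linear (jfun J q b)"
  using linear_jfun linear_conv_bounded_linear by blast

lemma jfun_J: "acs_on J V \<Longrightarrow> q \<in> V \<Longrightarrow> jfun J q b (J q v) = \<i> * jfun J q b v"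
  by (simp add: jfun_def complex_eq_iff acs_square)

lemma norm_jfun_diff_le:
  assumes "b \<in> Basis"
  shows "norm (jfun J q b v - jfun J q' b v) \<le> norm (J q v - J q' v)"
proof -
  have "jfun J q b v - jfun J q' b v = Complex 0 (- (b \<bullet> (J q v - J q' v)))"
    by (simp add: jfun_def complex_eq_iff inner_diff_right)
  hence "norm (jfun J q b v - jfun J q' b v) = \<bar>b \<bullet> (J q v - J q' v)\<bar>" by (simp add: cmod_def)
  thus ?thesis using Basis_le_norm[OF assms, of "J q v - J q' v"] by (simp add: inner_commute)
qed

lemma norm_jfun_le:
  assumes "b \<in> Basis"
  shows "norm (jfun J q b v) \<le> norm v + norm (J q v)"
proof -
  have "norm (jfun J q b v) \<le> \<bar>b \<bullet> v\<bar> + \<bar>b \<bullet> J q v\<bar>"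
    using cmod_le[of "jfun J q b v"] by (simp add: jfun_def)
  thus ?thesis using Basis_le_norm[OF assms, of v] Basis_le_norm[OF assms, of "J q v"] by (simp add: inner_commute)
qed

lemma norm_le_sum_jfun: "norm v \<le> (\<Sum>b\<in>Basis. norm (jfun J q b v))"
proof -
  have "norm v \<le> (\<Sum>b\<in>Basis. \<bar>v \<bullet> b\<bar>)" by (rule norm_le_l1)
  also have "\<dots> \<le> (\<Sum>b\<in>Basis. norm (jfun J q b v))"
  proof (rule sum_mono)
    fix b :: 'a
    show "\<bar>v \<bullet> b\<bar> \<le> norm (jfun J q b v)" using abs_Re_le_cmod[of "jfun J q b v"] by (simp add: inner_commute)
  qed
  finally show ?thesis .
qed

lemma jcurveD:
  assumes "jcurve J V W u du"
  shows "open W" "z \<in> W \<Longrightarrow> u z \<in> V" "z \<in> W \<Longrightarrow> (u has_derivative du z) (at z)"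
    "continuous_on W (\<lambda>z. du z t)" "z \<in> W \<Longrightarrow> du z (\<i> * t) = J (u z) (du z t)"
    "z \<in> W \<Longrightarrow> linear (du z)"
  using assms by (auto simp: jcurve_def intro: has_derivative_linear)

lemma jcurve_continuous:
  assumes "jcurve J V W u du"
  shows "continuous_on W u"
  using assms unfolding jcurve_def
  by (meson continuous_at_imp_continuous_on has_derivative_continuous)

lemma jcurve_subset: "jcurve J V W u du \<Longrightarrow> open W' \<Longrightarrow> W' \<subseteq> W \<Longrightarrow> jcurve J V W' u du"
  unfolding jcurve_def by (meson continuous_on_subset image_mono subsetD subset_trans)

text \<open>\<open>du z\<close> turns i into \<open>J\<close>, and the functional turns
  \<open>J\<close> back into i. The composite is a complex linear map of the plane, i.e.
  multiplication by its value at 1.\<close>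

lemma jfun_derivative:
  assumes acs: "acs_on J V" and u: "jcurve J V W u du" and z: "z \<in> W"
  shows "jfun J (u z) b (du z t) = t * jfun J (u z) b (du z 1)"
proof -
  have uz: "u z \<in> V" and lin: "linear (du z)" using jcurveD[OF u] z by auto
  have t: "t = Re t *\<^sub>R 1 + Im t *\<^sub>R \<i>" by (simp add: complex_eq_iff)
  have "du z t = Re t *\<^sub>R du z 1 + Im t *\<^sub>R du z \<i>"
    by (subst t) (simp only: linear_add[OF lin] linear_cmul[OF lin])
  moreover have "du z \<i> = J (u z) (du z 1)" using jcurveD(5)[OF u z, of 1] by simp
  ultimately have "jfun J (u z) b (du z t) = Re t *\<^sub>R jfun J (u z) b (du z 1) + Im t *\<^sub>R (\<i> * jfun J (u z) b (du z 1))"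
    using linear_jfun[OF acs uz, of b] jfun_J[OF acs uz, of b "du z 1"] by (simp only: linear_add linear_cmul)
  thus ?thesis by (subst t) (simp add: scaleR_conv_of_real algebra_simps)
qed

lemma jcurve_derivative_eq:
  assumes "jcurve J V W u du" "z \<in> W"
  shows "du z t = Re t *\<^sub>R du z 1 + Im t *\<^sub>R du z \<i>"
proof -
  have lin: "linear (du z)" using jcurveD[OF assms(1)] assms(2) by auto
  have t: "t = Re t *\<^sub>R 1 + Im t *\<^sub>R \<i>" by (simp add: complex_eq_iff)
  show ?thesis by (subst t) (simp only: linear_add[OF lin] linear_cmul[OF lin])
qed

lemma jcurve_jfun_continuous:
  assumes u: "jcurve J V W u du"
  shows "continuous_on W (\<lambda>z. jfun J (u z) b (du z 1))"
proof -
  have "continuous_on W (\<lambda>z. of_real (b \<bullet> du z 1) - \<i> * of_real (b \<bullet> du z \<i>))"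
    by (intro continuous_intros jcurveD(4)[OF u])
  moreover have "of_real (b \<bullet> du z 1) - \<i> * of_real (b \<bullet> du z \<i>) = jfun J (u z) b (du z 1)" if "z \<in> W" for z
    using jcurveD(5)[OF u that, of 1] by (simp add: jfun_def complex_eq_iff)
  ultimately show ?thesis by (simp cong: continuous_on_cong)
qed

lemma jcurve_norm_derivative_le:
  assumes acs: "acs_on J V" and u: "jcurve J V W u du" and z: "z \<in> W"
  shows "norm (du z t) \<le> (\<Sum>b\<in>Basis. norm (jfun J (u z) b (du z 1))) * norm t"
proof -
  have "norm (du z t) \<le> (\<Sum>b\<in>Basis. norm (jfun J (u z) b (du z t)))" by (rule norm_le_sum_jfun)
  also have "\<dots> = (\<Sum>b\<in>Basis. norm (jfun J (u z) b (du z 1)) * norm t)"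
    by (subst jfun_derivative[OF acs u z]) (simp add: norm_mult mult.commute)
  finally show ?thesis by (simp add: sum_distrib_right)
qed

lemma jcurve_derivative_near:
  assumes "jcurve J V W u du" "p \<in> W" "e > 0"
  obtains d where "d > 0" "\<And>z. z \<in> ball p d \<Longrightarrow> z \<in> W" "\<And>z t. z \<in> ball p d \<Longrightarrow> norm (du z t - du p t) \<le> e * norm t"
proof -
  note u = assms(1) and p = assms(2)
  have e2: "e / 2 > 0" using assms(3) by simp
  obtain d0 where d0: "d0 > 0" "ball p d0 \<subseteq> W" using jcurveD(1)[OF u] p openE by blast
  obtain d1 where d1: "d1 > 0" "\<And>x. x \<in> W \<Longrightarrow> dist x p < d1 \<Longrightarrow> dist (du x 1) (du p 1) < e / 2"
    using jcurveD(4)[OF u, unfolded continuous_on_iff, rule_format, OF p e2] by blast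
  obtain d2 where d2: "d2 > 0" "\<And>x. x \<in> W \<Longrightarrow> dist x p < d2 \<Longrightarrow> dist (du x \<i>) (du p \<i>) < e / 2"
    using jcurveD(4)[OF u, unfolded continuous_on_iff, rule_format, OF p e2] by blast
  show ?thesis
  proof (rule that[of "min d0 (min d1 d2)"])
    show zW: "z \<in> W" if "z \<in> ball p (min d0 (min d1 d2))" for z using that d0 by auto
    fix z t assume z: "z \<in> ball p (min d0 (min d1 d2))"
    have n: "norm (du z 1 - du p 1) \<le> e / 2" "norm (du z \<i> - du p \<i>) \<le> e / 2"
      using d1(2)[OF zW[OF z]] d2(2)[OF zW[OF z]] z by (auto simp: dist_norm norm_minus_commute)
    have "du z t - du p t = Re t *\<^sub>R (du z 1 - du p 1) + Im t *\<^sub>R (du z \<i> - du p \<i>)"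
      by (subst jcurve_derivative_eq[OF u zW[OF z]], subst jcurve_derivative_eq[OF u p]) (simp add: algebra_simps)
    also have "norm \<dots> \<le> norm t * (e / 2) + norm t * (e / 2)"
      by (rule order_trans[OF norm_triangle_ineq], unfold norm_scaleR)
        (intro add_mono mult_mono n abs_Re_le_cmod abs_Im_le_cmod; simp)
    finally show "norm (du z t - du p t) \<le> e * norm t" by (simp add: mult.commute)
  qed (use d0 d1 d2 in auto)
qed

text \<open>It suffices to have an exact form \<open>G'\<close> that agrees with f dz up to O(|z -
  p|): this error times the perimeter is of the order of the area, with the factor 9 of
  \<open>fat_rect_area\<close>.\<close>

lemma dbar_boundedI:
  assumes cont: "\<And>i. i \<in> I \<Longrightarrow> continuous_on \<Omega> (f i)" and C: "C \<ge> 0"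
    and H: "\<And>i p e. i \<in> I \<Longrightarrow> p \<in> \<Omega> \<Longrightarrow> e > 0 \<Longrightarrow> \<exists>\<delta>>0. \<exists>G G'. \<forall>z\<in>ball p \<delta> \<inter> \<Omega>. (G has_derivative G' z) (at z) \<and>
      (\<forall>t. norm (f i z * t - G' z t) \<le> (C * (\<Sum>j\<in>I. norm (f j p)) + e) * norm (z - p) * norm t)"
  shows "dbar_bounded I f (9 * C) \<Omega>"
  unfolding dbar_bounded_def
proof (intro conjI ballI allI impI cont)
  fix i p and e :: real assume i: "i \<in> I" and p: "p \<in> \<Omega>" and e: "e > 0"
  define F where "F = (\<Sum>j\<in>I. norm (f j p))"
  have F: "F \<ge> 0" by (simp add: F_def sum_nonneg)
  have "e / 9 > 0" using e by simp
  from H[OF i p this] obtain \<delta> G G' where \<delta>: "\<delta> > 0" and G: "\<And>z. z \<in> ball p \<delta> \<inter> \<Omega> \<Longrightarrow> (G has_derivative G' z) (at z)"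
    "\<And>z t. z \<in> ball p \<delta> \<inter> \<Omega> \<Longrightarrow> norm (f i z * t - G' z t) \<le> (C * F + e / 9) * norm (z - p) * norm t"
    unfolding F_def by metis
  show "\<exists>\<delta>>0. \<forall>a b c d. a < b \<and> c < d \<and> b - a \<le> 2 * (d - c) \<and> d - c \<le> 2 * (b - a) \<and> p \<in> rect a b c d \<and> rect a b c d \<subseteq> ball p \<delta> \<inter> \<Omega> \<longrightarrow>
     norm (rint (f i) a b c d) \<le> (9 * C * (\<Sum>j\<in>I. norm (f j p)) + e) * ((b - a) * (d - c))"
  proof (intro exI[of _ \<delta>] conjI allI impI \<delta>)
    fix a b c d assume "a < b \<and> c < d \<and> b - a \<le> 2 * (d - c) \<and> d - c \<le> 2 * (b - a) \<and> p \<in> rect a b c d \<and> rect a b c d \<subseteq> ball p \<delta> \<inter> \<Omega>"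
    hence ord: "a < b" "c < d" and rat: "b - a \<le> 2 * (d - c)" "d - c \<le> 2 * (b - a)" and pr: "p \<in> rect a b c d" and sub: "rect a b c d \<subseteq> ball p \<delta> \<inter> \<Omega>"
      by auto
    let ?s = "(b - a) + (d - c)"
    have CF: "C * F + e / 9 \<ge> 0" using C F e by simp
    have "norm (rint (f i) a b c d) \<le> 2 * ((C * F + e / 9) * ?s) * ?s"
    proof (rule rint_primitive_bound)
      show "continuous_on (rect a b c d) (f i)" using cont[OF i] sub by (auto intro: continuous_on_subset)
      fix z assume z: "z \<in> rect a b c d"
      show "(G has_derivative G' z) (at z)" using G(1) z sub by blast
      fix t :: complex
      have "norm (z - p) \<le> ?s" using rect_subset_cball[OF pr] z by (auto simp: dist_norm norm_minus_commute)
      hence "(C * F + e / 9) * norm (z - p) * norm t \<le> (C * F + e / 9) * ?s * norm t"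
        using CF by (intro mult_right_mono mult_left_mono) auto
      thus "norm (f i z * t - G' z t) \<le> (C * F + e / 9) * ?s * norm t" using G(2)[of z t] z sub by force
    qed (use ord in auto)
    also have "\<dots> = (C * F + e / 9) * (2 * ?s * ?s)" by (simp only: mult_ac)
    also have "\<dots> \<le> (C * F + e / 9) * (9 * ((b - a) * (d - c)))"
      by (intro mult_left_mono fat_rect_area rat CF)
    finally show "norm (rint (f i) a b c d) \<le> (9 * C * (\<Sum>j\<in>I. norm (f j p)) + e) * ((b - a) * (d - c))"
      by (simp add: F_def algebra_simps)
  qed
qed

text \<open>The coefficient of the complex linear form \<open>jfun J (u z) b \<circ> du z\<close> satisfies the hypothesis of
  \<open>dbar_bounded_order\<close>: freezing the functional at \<open>u p\<close> turns the form into an exact one.\<close>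

lemma jcurve_dbar_bounded:
  assumes acs: "acs_on J V" and u: "jcurve J V W u du" and "z0 \<in> W" "z0 = 0"
  obtains r C where "r > 0" "C \<ge> 0" "ball 0 r \<subseteq> W" "dbar_bounded Basis (\<lambda>b z. jfun J (u z) b (du z 1)) C (ball 0 r)"
proof -
  have 0: "0 \<in> W" using assms by simp
  define f where "f = (\<lambda>b z. jfun J (u z) b (du z 1))"
  define F where "F = (\<lambda>z. \<Sum>b\<in>Basis. norm (f b z))"
  have F0: "F z \<ge> 0" for z by (simp add: F_def sum_nonneg)
  have cf: "continuous_on W (f b)" for b unfolding f_def by (rule jcurve_jfun_continuous[OF u])
  have cF: "continuous_on W F" unfolding F_def by (intro continuous_intros cf)
  have oW: "open W" by (rule jcurveD(1)[OF u])
  obtain r1 L K where r1: "r1 > 0" "L \<ge> 0" "K \<ge> 0" "ball (u 0) r1 \<subseteq> V"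
    and Lip: "\<And>p q v. p \<in> ball (u 0) r1 \<Longrightarrow> q \<in> ball (u 0) r1 \<Longrightarrow> norm (J p v - J q v) \<le> L * norm (p - q) * norm v"
      "\<And>p v. p \<in> ball (u 0) r1 \<Longrightarrow> norm (J p v) \<le> K * norm v"
    using acs_on_local[OF acs jcurveD(2)[OF u 0]] by blast
  obtain d1 where d1: "d1 > 0" "ball 0 d1 \<subseteq> W" using oW 0 openE by blast
  obtain d2 where d2: "d2 > 0" "\<And>z. z \<in> W \<Longrightarrow> dist z 0 < d2 \<Longrightarrow> dist (u z) (u 0) < r1"
    using jcurve_continuous[OF u, unfolded continuous_on_iff, rule_format, OF 0 r1(1)] by auto
  obtain d3 where d3: "d3 > 0" "\<And>z. z \<in> W \<Longrightarrow> dist z 0 < d3 \<Longrightarrow> dist (F z) (F 0) < 1"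
    using cF[unfolded continuous_on_iff, rule_format, OF 0, of 1] by auto
  define r where "r = min d1 (min d2 d3)"
  have r: "r > 0" "ball 0 r \<subseteq> W" using d1 d2 d3 by (auto simp: r_def)
  have ur: "u z \<in> ball (u 0) r1" if "z \<in> ball 0 r" for z
    using d2(2)[of z] that r by (auto simp: r_def dist_commute)
  define B where "B = F 0 + 1"
  have B0: "B \<ge> 0" using F0[of 0] by (simp add: B_def)
  have FB: "F z \<le> B" if "z \<in> ball 0 r" for z
    using d3(2)[of z] that r by (auto simp: r_def dist_real_def B_def dist_commute)
  have duF: "norm (du z t) \<le> F z * norm t" if "z \<in> W" for z t
    using jcurve_norm_derivative_le[OF acs u that] by (simp add: F_def f_def)
  have lipu: "norm (u z - u p) \<le> B * norm (z - p)" if "z \<in> ball 0 r" "p \<in> ball 0 r" for z p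
  proof (rule differentiable_bound[where S="ball 0 r" and f'=du])
    fix x :: complex assume x: "x \<in> ball 0 r"
    show "(u has_derivative du x) (at x within ball 0 r)" using jcurveD(3)[OF u] x r by (blast intro: has_derivative_at_withinI)
    show "onorm (du x) \<le> B"
      by (rule onorm_bound[OF B0]) (use duF[of x] FB[OF x] x r in \<open>meson mult_right_mono norm_ge_zero order_trans subsetD\<close>)
  qed (use that in auto)
  have "dbar_bounded Basis f (9 * (L * B)) (ball 0 r)"
  proof (rule dbar_boundedI)
    show "continuous_on (ball 0 r) (f b)" for b using cf r continuous_on_subset by blast
    show "0 \<le> L * B" using r1 B0 by simp
    fix b :: 'a and p :: complex and e :: real assume b: "b \<in> Basis" and p: "p \<in> ball 0 r" and e: "e > 0"
    have pW: "p \<in> W" using p r by auto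
    \<comment> \<open>The tolerance in the continuity of \<open>F\<close> gets multiplied by
      \<open>L * B\<close> below; the added 1 keeps the denominator positive.\<close>
    define e1 where "e1 = e / (L * B + 1)"
    have e1: "e1 > 0" using e r1 B0 by (simp add: e1_def add_nonneg_pos)
    obtain d4 where d4: "d4 > 0" "\<And>z. z \<in> W \<Longrightarrow> dist z p < d4 \<Longrightarrow> dist (F z) (F p) < e1"
      using cF[unfolded continuous_on_iff, rule_format, OF pW e1] by auto
    show "\<exists>\<delta>>0. \<exists>G G'. \<forall>z\<in>ball p \<delta> \<inter> ball 0 r. (G has_derivative G' z) (at z) \<and>
      (\<forall>t. norm (f b z * t - G' z t) \<le> (L * B * (\<Sum>j\<in>Basis. norm (f j p)) + e) * norm (z - p) * norm t)"
    proof (intro exI[of _ d4] exI[of _ "\<lambda>z. jfun J (u p) b (u z)"] exI[of _ "\<lambda>z t. jfun J (u p) b (du z t)"] conjI ballI allI d4(1))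
      fix z assume z: "z \<in> ball p d4 \<inter> ball 0 r"
      have zW: "z \<in> W" using z r by auto
      show "((\<lambda>z. jfun J (u p) b (u z)) has_derivative (\<lambda>t. jfun J (u p) b (du z t))) (at z)"
        by (rule bounded_linear.has_derivative[OF bounded_linear_jfun[OF acs jcurveD(2)[OF u pW]] jcurveD(3)[OF u zW]])
      fix t
      have "f b z * t = jfun J (u z) b (du z t)" using jfun_derivative[OF acs u zW, of b t] by (simp add: f_def mult.commute)
      hence "norm (f b z * t - jfun J (u p) b (du z t)) \<le> norm (J (u z) (du z t) - J (u p) (du z t))"
        using norm_jfun_diff_le[OF b] by simp
      \<comment> \<open>Here the Lipschitz continuity of \<open>J\<close> enters. Freezing the base
        point costs |u z - u p| |du z|, which is |z - p| times a multiple of \<open>F\<close>; that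
        the error is homogeneous in f is the whole point.\<close>
      also have "\<dots> \<le> L * norm (u z - u p) * norm (du z t)" using z p by (intro Lip ur) auto
      also have "\<dots> \<le> L * (B * norm (z - p)) * ((F p + e1) * norm t)"
      proof (intro mult_mono lipu)
        have "F z \<le> F p + e1" using d4(2)[OF zW] z by (auto simp: dist_real_def dist_commute)
        hence "F z * norm t \<le> (F p + e1) * norm t" by (intro mult_right_mono) auto
        thus "norm (du z t) \<le> (F p + e1) * norm t" using duF[OF zW, of t] by linarith
      qed (use z p r1 B0 in auto)
      also have "\<dots> = (L * B * F p + L * B * e1) * norm (z - p) * norm t" by (simp add: algebra_simps)
      also have "\<dots> \<le> (L * B * F p + e) * norm (z - p) * norm t"
      proof (intro mult_right_mono add_left_mono)
        have "L * B * e1 \<le> (L * B + 1) * e1" using e1 by simp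
        also have "\<dots> = e" using r1 B0 by (simp add: e1_def add_nonneg_eq_0_iff)
        finally show "L * B * e1 \<le> e" .
      qed auto
      finally show "norm (f b z * t - jfun J (u p) b (du z t)) \<le> (L * B * (\<Sum>j\<in>Basis. norm (f j p)) + e) * norm (z - p) * norm t"
        by (simp add: F_def)
    qed
  qed
  thus ?thesis using that[of r "9 * (L * B)"] r r1 B0 by (simp add: f_def)
qed

lemma jcurve_order:
  assumes acs: "acs_on J V" and u: "jcurve J V W u du" and 0: "0 \<in> W"
  obtains \<rho> where "\<rho> > 0" "ball 0 \<rho> \<subseteq> W" "\<And>z t. z \<in> ball 0 \<rho> \<Longrightarrow> du z t = 0"
  | m a b0 where "b0 \<in> Basis" "a b0 \<noteq> 0" "\<And>b. b \<in> Basis \<Longrightarrow> ((\<lambda>z. jfun J (u z) b (du z 1) / z ^ m) \<longlongrightarrow> a b) (at 0)"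
proof -
  obtain r C where r: "r > 0" "C \<ge> 0" "ball 0 r \<subseteq> W" and dbar: "dbar_bounded Basis (\<lambda>b z. jfun J (u z) b (du z 1)) C (ball 0 r)"
    using jcurve_dbar_bounded[OF acs u 0] by blast
  show ?thesis
  proof (rule dbar_bounded_order[OF finite_Basis dbar r(2,1)])
    fix \<rho> :: real assume \<rho>: "\<rho> > 0" "\<And>z i. norm z < \<rho> \<Longrightarrow> i \<in> Basis \<Longrightarrow> jfun J (u z) i (du z 1) = 0"
    have "du z t = 0" if "z \<in> ball 0 (min \<rho> r)" for z t
    proof -
      have "z \<in> W" using that r by auto
      from jcurve_norm_derivative_le[OF acs u this, of t] show ?thesis using \<rho>(2)[of z] that by simp
    qed
    moreover have "ball 0 (min \<rho> r) \<subseteq> W" using r(3) by (auto simp: subset_iff)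
    ultimately show ?thesis using that(1)[of "min \<rho> r"] \<rho>(1) r(1) by (simp add: min_less_iff_conj)
  qed (use that(2) in blast)
qed


text \<open>The coefficient of the derivative for \<open>b0\<close> is close to a z ^ m. Integrated
  along the segment from 0 it gives a z^(m+1) / (m+1) for the functional of u z - u 0, with an error
  of at most half that size. So neither the derivative nor u z - u 0 vanishes near 0.\<close>

lemma jcurve_isolated:
  assumes acs: "acs_on J V" and u: "jcurve J V W u du" and 0: "0 \<in> W"
    and b0: "b0 \<in> Basis" "a \<noteq> 0" "((\<lambda>z. jfun J (u z) b0 (du z 1) / z ^ m) \<longlongrightarrow> a) (at 0)"
    and lim: "\<And>b. b \<in> Basis \<Longrightarrow> \<exists>a. ((\<lambda>z. jfun J (u z) b (du z 1) / z ^ m) \<longlongrightarrow> a) (at 0)"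
  obtains \<rho> where "\<rho> > 0" "ball 0 \<rho> \<subseteq> W" "\<And>z. z \<in> ball 0 \<rho> - {0} \<Longrightarrow> du z 1 \<noteq> 0 \<and> u z \<noteq> u 0"
proof -
  have oW: "open W" by (rule jcurveD(1)[OF u])
  define f where "f = (\<lambda>b z. jfun J (u z) b (du z 1))"
  define F where "F = (\<lambda>z. \<Sum>b\<in>Basis. norm (f b z))"
  have F0: "F z \<ge> 0" for z by (simp add: F_def sum_nonneg)
  have duF: "norm (du z t) \<le> F z * norm t" if "z \<in> W" for z t
    using jcurve_norm_derivative_le[OF acs u that] by (simp add: F_def f_def)
  have u0: "u 0 \<in> V" by (rule jcurveD(2)[OF u 0])
  obtain r1 L K where r1: "r1 > 0" "L \<ge> 0" "K \<ge> 0" "ball (u 0) r1 \<subseteq> V"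
    and Lip: "\<And>p q v. p \<in> ball (u 0) r1 \<Longrightarrow> q \<in> ball (u 0) r1 \<Longrightarrow> norm (J p v - J q v) \<le> L * norm (p - q) * norm v"
      "\<And>p v. p \<in> ball (u 0) r1 \<Longrightarrow> norm (J p v) \<le> K * norm v"
    using acs_on_local[OF acs u0] by blast
  have "\<exists>A. ((\<lambda>z. F z / norm z ^ m) \<longlongrightarrow> A) (at 0)"
  proof -
    obtain al where al: "\<And>b. b \<in> Basis \<Longrightarrow> ((\<lambda>z. f b z / z ^ m) \<longlongrightarrow> al b) (at 0)"
      using lim unfolding f_def by metis
    have "((\<lambda>z. \<Sum>b\<in>Basis. norm (f b z / z ^ m)) \<longlongrightarrow> (\<Sum>b\<in>Basis. norm (al b))) (at 0)"
      by (intro tendsto_intros al)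
    moreover have "(\<Sum>b\<in>Basis. norm (f b z / z ^ m)) = F z / norm z ^ m" for z
      by (simp add: F_def norm_divide norm_power sum_divide_distrib)
    ultimately show ?thesis by auto
  qed
  then obtain A where A: "((\<lambda>z. F z / norm z ^ m) \<longlongrightarrow> A) (at 0)" by blast
  \<comment> \<open>Chosen so that the leading term has size 4 \<epsilon> |z|^(m+1). Replacing f by
    a z ^ m and freezing \<open>J\<close> at u 0 cost \<epsilon> |z| ^ m each in the
    derivative.\<close>
  define \<epsilon> where "\<epsilon> = norm a / (4 * (real m + 1))"
  have \<epsilon>: "\<epsilon> > 0" using b0 by (simp add: \<epsilon>_def)
  have uc: "(u \<longlongrightarrow> u 0) (at 0)"
    using jcurve_continuous[OF u] oW 0 by (simp add: continuous_on_eq_continuous_at isCont_def)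
  have "\<forall>\<^sub>F z in at 0. F z / norm z ^ m < \<bar>A\<bar> + 1"
    by (rule order_tendstoD(2)[OF A]) simp
  moreover have "\<forall>\<^sub>F z in at 0. dist (f b0 z / z ^ m) a < min \<epsilon> (norm a)"
    using b0(3) \<epsilon> b0(2) unfolding f_def by (intro tendstoD) auto
  moreover have "\<forall>\<^sub>F z in at 0. dist (u z) (u 0) < min r1 (\<epsilon> / (L * (\<bar>A\<bar> + 1) + 1))"
    using uc r1 \<epsilon> by (intro tendstoD) (auto simp: add_nonneg_pos)
  moreover have "\<forall>\<^sub>F z in at 0. z \<in> W" using oW 0 by (rule eventually_at_in_open')
  ultimately have "\<forall>\<^sub>F z in at 0. F z / norm z ^ m < \<bar>A\<bar> + 1 \<and> dist (f b0 z / z ^ m) a < min \<epsilon> (norm a) \<and>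
     dist (u z) (u 0) < min r1 (\<epsilon> / (L * (\<bar>A\<bar> + 1) + 1)) \<and> z \<in> W"
    by eventually_elim auto
  then obtain \<rho> where \<rho>: "\<rho> > 0" and H: "\<And>z. z \<noteq> 0 \<Longrightarrow> norm z < \<rho> \<Longrightarrow> F z / norm z ^ m < \<bar>A\<bar> + 1 \<and> dist (f b0 z / z ^ m) a < min \<epsilon> (norm a) \<and>
     dist (u z) (u 0) < min r1 (\<epsilon> / (L * (\<bar>A\<bar> + 1) + 1)) \<and> z \<in> W"
    unfolding eventually_at by auto
  have sub: "ball 0 \<rho> \<subseteq> W" using H 0 by (metis dist_0_norm mem_ball subsetI)
  define U where "U = (\<lambda>z. jfun J (u 0) b0 (u z - u 0) - a * z ^ Suc m / of_nat (Suc m))"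
  define U' where "U' = (\<lambda>z t. jfun J (u 0) b0 (du z t) - a * z ^ m * t)"
  have lin0: "linear (jfun J (u 0) b0)" by (rule linear_jfun[OF acs u0])
  have dU: "(U has_derivative U' z) (at z)" if "z \<in> ball 0 \<rho>" for z
  proof -
    have zW: "z \<in> W" using that sub by blast
    have "((\<lambda>z. jfun J (u 0) b0 (u z - u 0)) has_derivative (\<lambda>t. jfun J (u 0) b0 (du z t - 0))) (at z)"
      by (rule bounded_linear.has_derivative[OF bounded_linear_jfun[OF acs u0]]) (intro derivative_intros jcurveD(3)[OF u zW])
    moreover have "((\<lambda>z. a * z ^ Suc m / of_nat (Suc m)) has_field_derivative a * z ^ m) (at z)"
    proof -
      have "((\<lambda>z. z ^ Suc m) has_field_derivative of_nat (Suc m) * z ^ m) (at z)"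
        using DERIV_power[OF DERIV_ident, where n="Suc m"] by fastforce
      from DERIV_cmult[OF this, of "a / of_nat (Suc m)"] show ?thesis by (simp del: of_nat_Suc)
    qed
    hence "((\<lambda>z. a * z ^ Suc m / of_nat (Suc m)) has_derivative (\<lambda>t. a * z ^ m * t)) (at z)"
      by (simp add: has_field_derivative_def)
    ultimately show ?thesis unfolding U_def U'_def by (intro has_derivative_diff) simp_all
  qed
  have U'le: "norm (U' z t) \<le> 2 * \<epsilon> * norm z ^ m * norm t" if z: "z \<in> ball 0 \<rho>" "z \<noteq> 0" for z t
  proof -
    have zW: "z \<in> W" using z sub by blast
    note h = H[OF z(2)]
    have nz: "norm z < \<rho>" using z by simp
    have F1: "F z \<le> (\<bar>A\<bar> + 1) * norm z ^ m" using h[OF nz] z by (simp add: divide_less_eq)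
    have uu: "norm (u z - u 0) \<le> \<epsilon> / (L * (\<bar>A\<bar> + 1) + 1)" "u z \<in> ball (u 0) r1" using h[OF nz] by (auto simp: dist_norm norm_minus_commute)
    have "norm (f b0 z / z ^ m - a) \<le> \<epsilon>" using h[OF nz] by (auto simp: dist_norm)
    hence "norm (f b0 z / z ^ m - a) * norm z ^ m \<le> \<epsilon> * norm z ^ m" by (intro mult_right_mono) auto
    moreover have "norm (f b0 z / z ^ m - a) * norm z ^ m = norm (f b0 z - a * z ^ m)"
      using z by (simp flip: norm_power norm_mult add: algebra_simps)
    ultimately have 1: "norm (f b0 z - a * z ^ m) \<le> \<epsilon> * norm z ^ m" by simp
    have "U' z t = (f b0 z - a * z ^ m) * t - (jfun J (u z) b0 (du z t) - jfun J (u 0) b0 (du z t))"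
      using jfun_derivative[OF acs u zW, of b0 t] by (simp add: U'_def f_def algebra_simps)
    also have "norm \<dots> \<le> norm (f b0 z - a * z ^ m) * norm t + norm (J (u z) (du z t) - J (u 0) (du z t))"
      by (rule order_trans[OF norm_triangle_ineq4]) (intro add_mono norm_jfun_diff_le b0, simp add: norm_mult)
    also have "\<dots> \<le> \<epsilon> * norm z ^ m * norm t + \<epsilon> * norm z ^ m * norm t"
    proof (intro add_mono mult_right_mono 1)
      have "norm (J (u z) (du z t) - J (u 0) (du z t)) \<le> L * norm (u z - u 0) * norm (du z t)"
        using uu(2) r1 by (intro Lip) auto
      also have "\<dots> \<le> L * (\<epsilon> / (L * (\<bar>A\<bar> + 1) + 1)) * (((\<bar>A\<bar> + 1) * norm z ^ m) * norm t)"
        using uu r1 \<epsilon> F1 duF[OF zW, of t] by (intro mult_mono) (auto intro!: order_trans[OF duF[OF zW]] mult_right_mono)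
      also have "\<dots> = (L * (\<bar>A\<bar> + 1)) / (L * (\<bar>A\<bar> + 1) + 1) * (\<epsilon> * norm z ^ m * norm t)" by simp
      also have "\<dots> \<le> 1 * (\<epsilon> * norm z ^ m * norm t)"
        using r1 \<epsilon> by (intro mult_right_mono) (auto simp: divide_le_eq add_nonneg_pos)
      finally show "norm (J (u z) (du z t) - J (u 0) (du z t)) \<le> \<epsilon> * norm z ^ m * norm t" by simp
    qed auto
    finally show ?thesis by (simp add: mult_ac)
  qed
  show ?thesis
  proof (rule that[OF \<rho> sub])
    fix z :: complex assume z: "z \<in> ball 0 \<rho> - {0}"
    have zW: "z \<in> W" using z sub by blast
    have nz: "norm z < \<rho>" "z \<noteq> 0" using z by auto
    have "f b0 z \<noteq> 0"
      using H[OF nz(2,1)] b0(2) by auto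
    hence d: "du z 1 \<noteq> 0" using linear_0[OF linear_jfun[OF acs jcurveD(2)[OF u zW]]] by (auto simp: f_def)
    have "norm (U (0 + z) - U 0) \<le> norm z * (2 * \<epsilon> * norm z ^ m)"
    proof (rule differentiable_bound_segment[where G="ball 0 \<rho>" and f'=U'])
      show "0 + t *\<^sub>R z \<in> ball 0 \<rho>" if "t \<in> {0..1}" for t
      proof -
        have "\<bar>t\<bar> * norm z \<le> norm z" using that by (intro mult_left_le_one_le) auto
        from le_less_trans[OF this nz(1)] show ?thesis by simp
      qed
      show "(U has_derivative U' x) (at x within ball 0 \<rho>)" if "x \<in> ball 0 \<rho>" for x
        using dU[OF that] by (rule has_derivative_at_withinI)
      show "onorm (U' (0 + t *\<^sub>R z)) \<le> 2 * \<epsilon> * norm z ^ m" if t: "t \<in> {0..1}" for t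
      proof (rule onorm_bound)
        show "0 \<le> 2 * \<epsilon> * norm z ^ m" using \<epsilon> by simp
        fix s :: complex
        let ?x = "0 + t *\<^sub>R z"
        have le: "norm ?x \<le> norm z" using t by (simp add: mult_left_le_one_le)
        have xin: "?x \<in> ball 0 \<rho>" using le_less_trans[OF le nz(1)] by simp
        show "norm (U' ?x s) \<le> 2 * \<epsilon> * norm z ^ m * norm s"
        proof (cases "?x = 0")
          case False
          have "norm (U' ?x s) \<le> 2 * \<epsilon> * norm ?x ^ m * norm s" by (rule U'le[OF xin False])
          also have "\<dots> \<le> 2 * \<epsilon> * norm z ^ m * norm s" using \<epsilon> le by (intro mult_right_mono mult_left_mono power_mono) auto
          finally show ?thesis .
        next
          \<comment> \<open>At 0 the estimate of \<open>U'\<close> is obtained as a limit of the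
            estimates at nearby points; for m = 0 it is not trivial there.\<close>
          case True
          have "norm (U' 0 s) \<le> 2 * \<epsilon> * norm (0::complex) ^ m * norm s"
          proof (rule tendsto_le[of "at (0::complex)"])
            have "isCont (\<lambda>x::complex. 2 * \<epsilon> * norm x ^ m * norm s) 0" by (intro continuous_intros)
            thus "((\<lambda>x::complex. 2 * \<epsilon> * norm x ^ m * norm s) \<longlongrightarrow> 2 * \<epsilon> * norm (0::complex) ^ m * norm s) (at 0)"
              by (simp add: isCont_def)
            have "((\<lambda>x. du x s) \<longlongrightarrow> du 0 s) (at 0)"
              using jcurveD(4)[OF u, of s] oW 0 by (simp add: continuous_on_eq_continuous_at isCont_def)
            hence "((\<lambda>x. jfun J (u 0) b0 (du x s)) \<longlongrightarrow> jfun J (u 0) b0 (du 0 s)) (at 0)"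
              by (rule bounded_linear.tendsto[OF bounded_linear_jfun[OF acs u0]])
            moreover have "isCont (\<lambda>x::complex. a * x ^ m * s) 0" by (intro continuous_intros)
            hence "((\<lambda>x::complex. a * x ^ m * s) \<longlongrightarrow> a * 0 ^ m * s) (at 0)" by (simp add: isCont_def)
            ultimately show "((\<lambda>x. norm (U' x s)) \<longlongrightarrow> norm (U' 0 s)) (at 0)"
              unfolding U'_def by (intro tendsto_norm tendsto_diff)
            show "\<forall>\<^sub>F x in at 0. norm (U' x s) \<le> 2 * \<epsilon> * norm x ^ m * norm s"
              unfolding eventually_at using \<rho> U'le by (intro exI[of _ \<rho>]) auto
          qed simp
          also have "\<dots> \<le> 2 * \<epsilon> * norm z ^ m * norm s" using \<epsilon> by (intro mult_right_mono mult_left_mono power_mono) auto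
          finally show ?thesis unfolding True .
        qed
      qed
    qed
    moreover have "U 0 = 0" using linear_0[OF lin0] by (simp add: U_def)
    ultimately have Uz: "norm (U z) \<le> 2 * \<epsilon> * norm z ^ Suc m" by (simp add: mult_ac)
    have "u z \<noteq> u 0"
    proof
      assume "u z = u 0"
      hence "U z = - (a * z ^ Suc m / of_nat (Suc m))" using linear_0[OF lin0] by (simp add: U_def)
      hence "norm (U z) = norm a / real (Suc m) * norm z ^ Suc m"
        by (simp add: norm_divide norm_mult norm_power del: of_nat_Suc power_Suc)
      also have "norm a / real (Suc m) = 4 * \<epsilon>" by (simp add: \<epsilon>_def field_simps)
      finally have "norm (U z) = 4 * \<epsilon> * norm z ^ Suc m" .
      moreover have "\<epsilon> * norm z ^ Suc m > 0" using \<epsilon> nz by simp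
      ultimately show False using Uz by simp
    qed
    thus "du z 1 \<noteq> 0 \<and> u z \<noteq> u 0" using d by simp
  qed
qed

text \<open>Choose a coordinate direction in which the derivative does not vanish. Its functional,
  divided by its value \<beta>, is a left inverse of \<open>du p\<close>, and the derivative is
  continuous.\<close>

lemma jcurve_locally_injective:
  assumes acs: "acs_on J V" and u: "jcurve J V W u du" and p: "p \<in> W" and imm: "du p 1 \<noteq> 0"
  obtains r where "r > 0" "ball p r \<subseteq> W" "inj_on u (ball p r)"
proof -
  obtain b where b: "b \<in> Basis" "b \<bullet> du p 1 \<noteq> 0"
    using imm by (metis euclidean_all_zero_iff inner_commute)
  define \<beta> where "\<beta> = jfun J (u p) b (du p 1)"
  have \<beta>: "\<beta> \<noteq> 0" using b(2) by (auto simp: \<beta>_def jfun_def complex_eq_iff)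
  have bl: "bounded_linear (jfun J (u p) b)" by (rule bounded_linear_jfun[OF acs jcurveD(2)[OF u p]])
  show ?thesis
  proof (rule has_derivative_locally_injective[where f=u and f'=du and S=W and a=p and g'="\<lambda>v. jfun J (u p) b v / \<beta>"])
    show "bounded_linear (\<lambda>v. jfun J (u p) b v / \<beta>)"
      by (rule bounded_linear_compose[OF bounded_linear_divide bl])
    show "(\<lambda>v. jfun J (u p) b v / \<beta>) \<circ> du p = id"
    proof
      fix t show "((\<lambda>v. jfun J (u p) b v / \<beta>) \<circ> du p) t = id t"
        using jfun_derivative[OF acs u p, of b t] \<beta> by (simp add: \<beta>_def)
    qed
    show "\<exists>d>0. \<forall>x. dist p x < d \<longrightarrow> onorm (\<lambda>v. du x v - du p v) < e" if e: "e > 0" for e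
    proof -
      have e2: "e / 2 > 0" using e by simp
      obtain d where d: "d > 0" "\<And>z t. z \<in> ball p d \<Longrightarrow> norm (du z t - du p t) \<le> e / 2 * norm t"
        using jcurve_derivative_near[OF u p e2] by metis
      show ?thesis
      proof (intro exI[of _ d] conjI allI impI d(1))
        fix x assume "dist p x < d"
        hence "onorm (\<lambda>v. du x v - du p v) \<le> e / 2" using d(2)[of x] e by (intro onorm_bound) auto
        thus "onorm (\<lambda>v. du x v - du p v) < e" using e by simp
      qed
    qed
  qed (use p jcurveD[OF u] that in auto)
qed

subsection \<open>Intersections of curves, and descent along power maps\<close>

lemma jcurve_first_order:
  assumes "jcurve J V W u du" "p \<in> W" "e > 0"
  obtains d where "d > 0" "\<And>z. norm (z - p) < d \<Longrightarrow> norm (u z - u p - du p (z - p)) \<le> e * norm (z - p)"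
  using jcurveD(3)[OF assms(1,2)] assms(3) unfolding has_derivative_at_alt by blast

lemma jcurve_lipschitz_near:
  assumes "jcurve J V W u du" "p \<in> W"
  obtains d D where "d > 0" "D \<ge> 0" "\<And>z t. z \<in> ball p d \<Longrightarrow> z \<in> W \<and> norm (du z t) \<le> D * norm t"
proof -
  obtain d where d: "d > 0" "\<And>z. z \<in> ball p d \<Longrightarrow> z \<in> W" "\<And>z t. z \<in> ball p d \<Longrightarrow> norm (du z t - du p t) \<le> 1 * norm t"
    using jcurve_derivative_near[OF assms zero_less_one] by blast
  have bl: "bounded_linear (du p)" using jcurveD(3)[OF assms] by (rule has_derivative_bounded_linear)
  have "norm (du z t) \<le> (1 + onorm (du p)) * norm t" if "z \<in> ball p d" for z t
    using d(3)[OF that, of t] onorm[OF bl, of t] norm_triangle_sub[of "du z t" "du p t"] by (simp add: algebra_simps)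
  thus ?thesis using that[of d "1 + onorm (du p)"] d onorm_pos_le[OF bl] by auto
qed

lemma jcurve_lipschitz_ball:
  assumes "jcurve J V W u du" "\<And>z t. z \<in> S \<Longrightarrow> z \<in> W \<and> norm (du z t) \<le> D * norm t" "D \<ge> 0" "convex S" "x \<in> S" "y \<in> S"
  shows "norm (u x - u y) \<le> D * norm (x - y)"
proof (rule differentiable_bound[where S=S and f'=du])
  fix z assume z: "z \<in> S"
  show "(u has_derivative du z) (at z within S)" using jcurveD(3)[OF assms(1)] assms(2)[OF z] by (blast intro: has_derivative_at_withinI)
  show "onorm (du z) \<le> D" by (rule onorm_bound[OF assms(3)]) (use assms(2)[OF z] in blast)
qed (use assms in auto)

lemma jcurve_tendsto:
  assumes "acs_on J V" "y \<in> V" "(v \<longlongrightarrow> v0) F" "(p \<longlongrightarrow> y) F"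
  shows "((\<lambda>x. J (p x) (v x)) \<longlongrightarrow> J y v0) F"
proof -
  obtain r L K where r: "r > 0" "L \<ge> 0" "K \<ge> 0" "ball y r \<subseteq> V"
    and Lip: "\<And>p q v. p \<in> ball y r \<Longrightarrow> q \<in> ball y r \<Longrightarrow> norm (J p v - J q v) \<le> L * norm (p - q) * norm v"
    and Kb: "\<And>p v. p \<in> ball y r \<Longrightarrow> norm (J p v) \<le> K * norm v"
    using acs_on_local[OF assms(1,2)] by blast
  have bl: "bounded_linear (J y)" using acs_linear[OF assms(1,2)] linear_conv_bounded_linear by blast
  have "\<forall>\<^sub>F x in F. p x \<in> ball y r" using assms(4) r(1) by (intro topological_tendstoD) auto
  hence "((\<lambda>x. J (p x) (v x) - J y (v x)) \<longlongrightarrow> 0) F"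
  proof (rule Lim_null_comparison[OF eventually_mono])
    show "p x \<in> ball y r \<Longrightarrow> norm (J (p x) (v x) - J y (v x)) \<le> L * norm (p x - y) * norm (v x)" for x
      using r by (intro Lip) auto
    have "((\<lambda>x. L * norm (p x - y) * norm (v x)) \<longlongrightarrow> L * norm (y - y) * norm v0) F"
      by (intro tendsto_intros assms)
    thus "((\<lambda>x. L * norm (p x - y) * norm (v x)) \<longlongrightarrow> 0) F" by simp
  qed
  from tendsto_add[OF this bounded_linear.tendsto[OF bl assms(3)]] show ?thesis by simp
qed

text \<open>Near an immersed point \<open>u1 0\<close> a point \<open>u2 z\<close> is projected to \<open>u1 (\<zeta> z)\<close> along the kernel of the
  \<open>J (u2 z)\<close>-linear functional. As this functional moves with \<open>z\<close> in a Lipschitz manner and is complex linear,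
  the defect \<open>w = u2 - u1 \<circ> \<zeta>\<close> satisfies a homogeneous \<open>\<partial>\<close>-bar inequality.\<close>

lemma jcurve_meet:
  fixes u1 u2 :: "complex \<Rightarrow> 'e::euclidean_space"
  assumes acs: "acs_on J V" and u1: "jcurve J V W1 u1 du1" and u2: "jcurve J V W2 u2 du2"
    and 0: "0 \<in> W1" "0 \<in> W2" and eq: "u1 0 = u2 0" and imm: "du1 0 1 \<noteq> 0" and \<rho>0: "\<rho>0 > 0"
  obtains \<rho> r where "\<rho> > 0" "\<rho> \<le> \<rho>0" "r > 0" "cball 0 \<rho> \<subseteq> W1" "ball 0 r \<subseteq> W2"
    "(\<exists>\<zeta>. \<zeta> holomorphic_on ball 0 r \<and> \<zeta> 0 = 0 \<and> (\<forall>z\<in>ball 0 r. \<zeta> z \<in> cball 0 \<rho> \<and> u2 z = u1 (\<zeta> z))) \<or>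
     (\<forall>z\<in>ball 0 r - {0}. \<forall>x\<in>cball 0 \<rho>. u2 z \<noteq> u1 x)"
proof -
  define y0 where "y0 = u1 0"
  have y0: "y0 \<in> V" "u2 0 = y0" using jcurveD(2)[OF u1 0(1)] eq by (auto simp: y0_def)
  obtain r1 L K where r1: "r1 > 0" "L \<ge> 0" "K \<ge> 0" "ball y0 r1 \<subseteq> V"
    and Lip: "\<And>p q v. p \<in> ball y0 r1 \<Longrightarrow> q \<in> ball y0 r1 \<Longrightarrow> norm (J p v - J q v) \<le> L * norm (p - q) * norm v"
    and Kb: "\<And>p v. p \<in> ball y0 r1 \<Longrightarrow> norm (J p v) \<le> K * norm v"
    using acs_on_local[OF acs y0(1)] by blast
  obtain b0 where b0: "b0 \<in> Basis" "b0 \<bullet> du1 0 1 \<noteq> 0"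
    using imm by (metis euclidean_all_zero_iff inner_commute)
  define l where "l = (\<lambda>q b v. jfun J q b v)"
  have ln: "norm (l q b v) \<le> (1 + K) * norm v" if "q \<in> ball y0 r1" "b \<in> Basis" for q b v
    using norm_jfun_le[OF that(2), of J q v] Kb[OF that(1), of v] by (simp add: l_def algebra_simps)
  have lL: "norm (l p b v - l q b v) \<le> L * norm (p - q) * norm v" if "p \<in> ball y0 r1" "q \<in> ball y0 r1" "b \<in> Basis" for p q b v
    using norm_jfun_diff_le[OF that(3), of J p v q] Lip[OF that(1,2), of v] by (simp add: l_def)
  have llin: "linear (l q b)" if "q \<in> ball y0 r1" for q b
    unfolding l_def using linear_jfun[OF acs] that r1(4) by blast
  \<comment> \<open>The complex slope of \<open>u1\<close> at 0, as seen by the functional at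
    \<open>y0\<close>. Its size enters the radii chosen below.\<close>
  define \<beta> where "\<beta> = l y0 b0 (du1 0 1)"
  have \<beta>: "norm \<beta> > 0" using b0(2) by (auto simp: \<beta>_def l_def jfun_def complex_eq_iff)
  obtain e1 D1 where e1: "e1 > 0" "D1 \<ge> 0" and D1: "\<And>z t. z \<in> ball 0 e1 \<Longrightarrow> z \<in> W1 \<and> norm (du1 z t) \<le> D1 * norm t"
    using jcurve_lipschitz_near[OF u1 0(1)] by blast
  obtain e2 D2 where e2: "e2 > 0" "D2 \<ge> 0" and D2: "\<And>z t. z \<in> ball 0 e2 \<Longrightarrow> z \<in> W2 \<and> norm (du2 z t) \<le> D2 * norm t"
    using jcurve_lipschitz_near[OF u2 0(2)] by blast
  \<comment> \<open>\<open>\<eta>\<close> and \<open>r2\<close> bound the two sources of variation,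
    the derivative of \<open>u1\<close> and the base point of the functional, by |\<beta>| / 4 each.
    This gives the |\<beta>| / 2 of \<open>E0\<close>.\<close>
  define \<eta> where "\<eta> = norm \<beta> / (4 * (1 + K))"
  have \<eta>: "\<eta> > 0" using \<beta> r1 by (simp add: \<eta>_def)
  define r2 where "r2 = min r1 (norm \<beta> / (4 * (L * D1 + 1)))"
  have r2: "r2 > 0" "r2 \<le> r1" "r2 \<le> norm \<beta> / (4 * (L * D1 + 1))" using r1 \<beta> e1 by (auto simp: r2_def add_nonneg_pos)
  obtain e3 where e3: "e3 > 0" "\<And>x. x \<in> ball 0 e3 \<Longrightarrow> x \<in> W1" "\<And>x t. x \<in> ball 0 e3 \<Longrightarrow> norm (du1 x t - du1 0 t) \<le> \<eta> * norm t"
    using jcurve_derivative_near[OF u1 0(1) \<eta>] by blast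
  obtain e4 where e4: "e4 > 0" "\<And>x. x \<in> W1 \<Longrightarrow> dist x 0 < e4 \<Longrightarrow> dist (u1 x) (u1 0) < r2"
    using jcurve_continuous[OF u1, unfolded continuous_on_iff, rule_format, OF 0(1) r2(1)] by blast
  define \<rho> where "\<rho> = min \<rho>0 (min (min e1 e3) e4) / 2"
  have \<rho>: "\<rho> > 0" "\<rho> \<le> \<rho>0" "\<rho> < e1" "\<rho> < e3" "\<rho> < e4" using \<rho>0 e1 e3 e4 by (auto simp: \<rho>_def)
  define X where "X = cball (0::complex) \<rho>"
  have X0: "0 \<in> X" using \<rho> by (simp add: X_def)
  have XW: "x \<in> W1" if "x \<in> X" for x using D1 \<rho> that by (auto simp: X_def)
  have duX: "norm (du1 x t) \<le> D1 * norm t" if "x \<in> X" for x t using D1 \<rho> that by (auto simp: X_def)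
  have r21: "q \<in> ball y0 r1" if "q \<in> ball y0 r2" for q using that r2 by auto
  have u1r: "u1 x \<in> ball y0 r2" if "x \<in> X" for x
    using e4(2)[OF XW[OF that]] that \<rho> by (auto simp: y0_def dist_commute X_def)
  \<comment> \<open>This makes |T 0| \<le> \<rho> / 2 for the contraction \<open>T\<close> below, so
    that \<open>T\<close> maps the closed disc into itself.\<close>
  define r3 where "r3 = min r2 (\<rho> * norm \<beta> / (2 * (1 + K)))"
  have r3: "r3 > 0" "r3 \<le> r2" "r3 \<le> \<rho> * norm \<beta> / (2 * (1 + K))" using r2 \<rho> \<beta> r1 by (auto simp: r3_def)
  obtain e5 where e5: "e5 > 0" "\<And>x. x \<in> W2 \<Longrightarrow> dist x 0 < e5 \<Longrightarrow> dist (u2 x) (u2 0) < r3"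
    using jcurve_continuous[OF u2, unfolded continuous_on_iff, rule_format, OF 0(2) r3(1)] by blast
  define r where "r = min e2 e5"
  have r: "r > 0" "r \<le> e2" "r \<le> e5" using e2 e5 by (auto simp: r_def)
  define B where "B = ball (0::complex) r"
  have B0: "0 \<in> B" using r by (simp add: B_def)
  have BW: "z \<in> W2" if "z \<in> B" for z using D2 r that by (auto simp: B_def)
  have duB: "norm (du2 z t) \<le> D2 * norm t" if "z \<in> B" for z t using D2 r that by (auto simp: B_def)
  have u2r: "norm (u2 z - y0) < r3" "u2 z \<in> ball y0 r2" if "z \<in> B" for z
    using e5(2)[OF BW[OF that]] that r r3 y0 by (auto simp: dist_norm norm_minus_commute B_def)
  have E0: "norm (l q b0 (du1 x t) - \<beta> * t) \<le> norm \<beta> / 2 * norm t" if q: "q \<in> ball y0 r2" and x: "x \<in> X" for q x t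
  proof -
    have q1: "q \<in> ball y0 r1" and y1: "y0 \<in> ball y0 r1" using r21[OF q] r1 by auto
    have bt: "\<beta> * t = l y0 b0 (du1 0 t)"
      using jfun_derivative[OF acs u1 0(1), of b0 t] by (simp add: \<beta>_def l_def y0_def mult.commute)
    have "l q b0 (du1 x t) - \<beta> * t = l q b0 (du1 x t - du1 0 t) + (l q b0 (du1 0 t) - l y0 b0 (du1 0 t))"
      by (simp add: bt linear_diff[OF llin[OF q1]])
    also have "norm \<dots> \<le> (1 + K) * norm (du1 x t - du1 0 t) + L * norm (q - y0) * norm (du1 0 t)"
      by (intro order_trans[OF norm_triangle_ineq] add_mono ln lL q1 y1 b0)
    also have "\<dots> \<le> (1 + K) * (\<eta> * norm t) + L * (norm \<beta> / (4 * (L * D1 + 1))) * (D1 * norm t)"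
    proof (intro add_mono mult_left_mono mult_mono)
      show "norm (du1 x t - du1 0 t) \<le> \<eta> * norm t" using x \<rho> by (intro e3(3)) (auto simp: X_def)
      show "norm (q - y0) \<le> norm \<beta> / (4 * (L * D1 + 1))" using q r2 by (auto simp: dist_norm norm_minus_commute)
    qed (use r1 duX[OF X0] \<beta> e1 in auto)
    also have "(1 + K) * (\<eta> * norm t) = norm \<beta> / 4 * norm t"
    proof -
      have "s * (a / (4 * s) * c) = a / 4 * c" if "s > 0" for s a c :: real using that by simp
      from this[of "1 + K"] show ?thesis using r1 by (simp only: \<eta>_def)
    qed
    also have "L * (norm \<beta> / (4 * (L * D1 + 1))) * (D1 * norm t) = (L * D1 / (L * D1 + 1)) * (norm \<beta> / 4 * norm t)" by (simp add: mult_ac)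
    also have "\<dots> \<le> 1 * (norm \<beta> / 4 * norm t)" using r1 e1 by (intro mult_right_mono) (auto simp: divide_le_eq add_nonneg_pos)
    finally show ?thesis by simp
  qed
  have E1: "norm (l q b0 (u1 x - u1 x') - \<beta> * (x - x')) \<le> norm \<beta> / 2 * norm (x - x')" if q: "q \<in> ball y0 r2" and x: "x \<in> X" "x' \<in> X" for q x x'
  proof -
    have "norm ((l q b0 (u1 x) - \<beta> * x) - (l q b0 (u1 x') - \<beta> * x')) \<le> norm \<beta> / 2 * norm (x - x')"
    proof (rule differentiable_bound[where S=X and f'="\<lambda>z t. l q b0 (du1 z t) - \<beta> * t"])
      fix z assume z: "z \<in> X"
      have bl: "bounded_linear (l q b0)" using llin[OF r21[OF q]] linear_conv_bounded_linear by blast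
      have "((\<lambda>x. l q b0 (u1 x)) has_derivative (\<lambda>t. l q b0 (du1 z t))) (at z)"
        by (rule bounded_linear.has_derivative[OF bl jcurveD(3)[OF u1 XW[OF z]]])
      moreover have "((*) \<beta> has_derivative (*) \<beta>) (at z)" by (rule bounded_linear_imp_has_derivative[OF bounded_linear_mult_right])
      ultimately show "((\<lambda>x. l q b0 (u1 x) - \<beta> * x) has_derivative (\<lambda>t. l q b0 (du1 z t) - \<beta> * t)) (at z within X)"
        by (intro has_derivative_at_withinI[OF has_derivative_diff])
      show "onorm (\<lambda>t. l q b0 (du1 z t) - \<beta> * t) \<le> norm \<beta> / 2" by (rule onorm_bound) (use E0[OF q z] \<beta> in auto)
    qed (use x in \<open>auto simp: X_def\<close>)
    thus ?thesis by (simp add: linear_diff[OF llin[OF r21[OF q]]] algebra_simps)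
  qed
  \<comment> \<open>Hence the functional is injective along \<open>u1\<close>, and the projection
    point is unique and depends on z in a Lipschitz manner.\<close>
  have E2: "norm (x - x') \<le> 2 / norm \<beta> * norm (l q b0 (u1 x - u1 x'))" if q: "q \<in> ball y0 r2" and x: "x \<in> X" "x' \<in> X" for q x x'
  proof -
    have "norm (\<beta> * (x - x')) \<le> norm (l q b0 (u1 x - u1 x')) + norm \<beta> / 2 * norm (x - x')"
      using E1[OF that] norm_triangle_sub[of "\<beta> * (x - x')" "l q b0 (u1 x - u1 x')"] by (simp add: norm_minus_commute)
    hence "norm \<beta> * norm (x - x') \<le> 2 * norm (l q b0 (u1 x - u1 x'))" by (simp add: norm_mult)
    thus ?thesis using \<beta> by (simp add: field_simps)
  qed
  have ex: "\<exists>x\<in>X. l (u2 z) b0 (u2 z - u1 x) = 0" if z: "z \<in> B" for z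
  proof -
    let ?l = "l (u2 z) b0"
    have lin: "linear ?l" using llin[OF r21[OF u2r(2)[OF z]]] .
    define T where "T = (\<lambda>x. x + ?l (u2 z - u1 x) / \<beta>)"
    have contr: "dist (T x) (T x') \<le> 1 / 2 * dist x x'" if "x \<in> X" "x' \<in> X" for x x'
    proof -
      have "T x - T x' = - ((?l (u1 x - u1 x') - \<beta> * (x - x')) / \<beta>)"
        using \<beta> by (simp add: T_def linear_diff[OF lin] field_simps)
      hence "norm (T x - T x') = norm (?l (u1 x - u1 x') - \<beta> * (x - x')) / norm \<beta>" by (simp add: norm_divide)
      also have "\<dots> \<le> (norm \<beta> / 2 * norm (x - x')) / norm \<beta>" by (intro divide_right_mono E1 u2r z that) simp
      finally show ?thesis using \<beta> by (simp add: dist_norm)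
    qed
    have TX: "T ` X \<subseteq> X"
    proof
      fix y assume "y \<in> T ` X"
      then obtain x where x: "x \<in> X" "y = T x" by blast
      have "norm (T 0) = norm (?l (u2 z - y0)) / norm \<beta>" by (simp add: T_def norm_divide y0_def)
      also have "\<dots> \<le> ((1 + K) * norm (u2 z - y0)) / norm \<beta>" by (intro divide_right_mono ln b0 r21 u2r z) simp
      also have "\<dots> \<le> ((1 + K) * (\<rho> * norm \<beta> / (2 * (1 + K)))) / norm \<beta>"
        using u2r(1)[OF z] r3 r1 by (intro divide_right_mono mult_left_mono) auto
      also have "\<dots> = \<rho> / 2"
      proof -
        have "s * (a * c / (2 * s)) / c = a / 2" if "s > 0" "c > 0" for s a c :: real using that by simp
        from this[of "1 + K" "norm \<beta>" \<rho>] show ?thesis using r1 \<beta> by (simp only:)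
      qed
      finally have "norm (T 0) \<le> \<rho> / 2" .
      moreover have "norm (T x - T 0) \<le> \<rho> / 2" using contr[OF x(1) X0] x(1) by (simp add: dist_norm X_def)
      ultimately have "norm (T x) \<le> \<rho>" using norm_triangle_sub[of "T x" "T 0"] by linarith
      thus "y \<in> X" by (simp add: x X_def)
    qed
    have "\<exists>!x\<in>X. T x = x"
    proof (rule Banach_fix[where c="1 / 2"])
      show "complete X" by (simp add: X_def complete_eq_closed)
    qed (use X0 TX contr in auto)
    then obtain x where "x \<in> X" "T x = x" by blast
    thus ?thesis using \<beta> by (intro bexI[of _ x]) (auto simp: T_def)
  qed
  then obtain \<zeta> where \<zeta>: "\<And>z. z \<in> B \<Longrightarrow> \<zeta> z \<in> X" "\<And>z. z \<in> B \<Longrightarrow> l (u2 z) b0 (u2 z - u1 (\<zeta> z)) = 0" by metis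
  have uniq: "x = \<zeta> z" if "z \<in> B" "x \<in> X" "l (u2 z) b0 (u2 z - u1 x) = 0" for z x
  proof -
    have lin: "linear (l (u2 z) b0)" using llin[OF r21[OF u2r(2)[OF that(1)]]] .
    have "l (u2 z) b0 (u1 x - u1 (\<zeta> z)) = l (u2 z) b0 (u2 z - u1 (\<zeta> z)) - l (u2 z) b0 (u2 z - u1 x)" by (simp add: linear_diff[OF lin])
    hence "l (u2 z) b0 (u1 x - u1 (\<zeta> z)) = 0" using \<zeta>(2)[OF that(1)] that(3) by simp
    with E2[OF u2r(2)[OF that(1)] that(2) \<zeta>(1)[OF that(1)]] show ?thesis by simp
  qed
  have \<zeta>0: "\<zeta> 0 = 0"
    using uniq[OF B0 X0] linear_0[OF llin[OF r21[OF u2r(2)[OF B0]]]] eq by simp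
  define w where "w = (\<lambda>z. u2 z - u1 (\<zeta> z))"
  define f where "f = (\<lambda>b z. l (u2 z) b (w z))"
  define F where "F = (\<lambda>z. \<Sum>b\<in>Basis. norm (f b z))"
  have F0: "F z \<ge> 0" for z by (simp add: F_def sum_nonneg)
  have wF: "norm (w z) \<le> F z" for z unfolding F_def f_def l_def by (rule norm_le_sum_jfun)
  have lipu2: "norm (u2 z - u2 p) \<le> D2 * norm (z - p)" if "z \<in> B" "p \<in> B" for z p
    by (rule jcurve_lipschitz_ball[OF u2, where S=B]) (use that BW duB e2 in \<open>auto simp: B_def\<close>)
  have lipu1: "norm (u1 z - u1 p) \<le> D1 * norm (z - p)" if "z \<in> X" "p \<in> X" for z p
    by (rule jcurve_lipschitz_ball[OF u1, where S=X]) (use that XW duX e1 in \<open>auto simp: X_def\<close>)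
  have wr: "norm (w z) \<le> 2 * r1" if "z \<in> B" for z
    using r21[OF u2r(2)[OF that]] r21[OF u1r[OF \<zeta>(1)[OF that]]] norm_triangle_ineq4[of "u2 z - y0" "u1 (\<zeta> z) - y0"]
    by (auto simp: w_def dist_norm norm_minus_commute)
  define C1 where "C1 = 2 / norm \<beta> * ((1 + K) * D2 + L * D2 * (2 * r1))"
  have C1: "C1 \<ge> 0" using \<beta> r1 e2 by (simp add: C1_def)
  have lip\<zeta>: "norm (\<zeta> z - \<zeta> p) \<le> C1 * norm (z - p)" if z: "z \<in> B" and p: "p \<in> B" for z p
  proof -
    let ?l = "l (u2 z) b0"
    have zr: "u2 z \<in> ball y0 r1" and pr: "u2 p \<in> ball y0 r1" using r21[OF u2r(2)] z p by auto
    have lin: "linear ?l" using llin[OF zr] .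
    have "?l (u1 (\<zeta> z) - u1 (\<zeta> p)) = ?l (u2 z - u2 p) + (?l (w p) - l (u2 p) b0 (w p)) - ?l (u2 z - u1 (\<zeta> z)) + l (u2 p) b0 (w p)"
      by (simp add: linear_diff[OF lin] w_def)
    also have "\<dots> = ?l (u2 z - u2 p) + (?l (w p) - l (u2 p) b0 (w p))" using \<zeta>(2)[OF z] \<zeta>(2)[OF p] by (simp add: w_def)
    also have "norm \<dots> \<le> (1 + K) * norm (u2 z - u2 p) + L * norm (u2 z - u2 p) * norm (w p)"
      by (intro order_trans[OF norm_triangle_ineq] add_mono ln lL zr pr b0)
    also have "\<dots> \<le> (1 + K) * (D2 * norm (z - p)) + L * (D2 * norm (z - p)) * (2 * r1)"
      using r1 e2 wr[OF p] lipu2[OF z p] by (intro add_mono mult_left_mono mult_mono) auto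
    also have "\<dots> = ((1 + K) * D2 + L * D2 * (2 * r1)) * norm (z - p)" by (simp add: algebra_simps)
    finally have *: "norm (?l (u1 (\<zeta> z) - u1 (\<zeta> p))) \<le> ((1 + K) * D2 + L * D2 * (2 * r1)) * norm (z - p)" .
    have "norm (\<zeta> z - \<zeta> p) \<le> 2 / norm \<beta> * norm (?l (u1 (\<zeta> z) - u1 (\<zeta> p)))" by (rule E2[OF u2r(2)[OF z] \<zeta>(1)[OF z] \<zeta>(1)[OF p]])
    also have "\<dots> \<le> 2 / norm \<beta> * (((1 + K) * D2 + L * D2 * (2 * r1)) * norm (z - p))" using * by (intro mult_left_mono) auto
    finally show ?thesis by (simp only: C1_def mult.assoc)
  qed
  have lipw: "norm (w z - w p) \<le> (D2 + D1 * C1) * norm (z - p)" if z: "z \<in> B" and p: "p \<in> B" for z p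
  proof -
    have "norm (w z - w p) \<le> norm (u2 z - u2 p) + norm (u1 (\<zeta> z) - u1 (\<zeta> p))"
      using norm_triangle_ineq4[of "u2 z - u2 p" "u1 (\<zeta> z) - u1 (\<zeta> p)"] by (simp add: w_def algebra_simps)
    also have "\<dots> \<le> D2 * norm (z - p) + D1 * (C1 * norm (z - p))"
      using lipu1[OF \<zeta>(1)[OF z] \<zeta>(1)[OF p]] lip\<zeta>[OF z p] e1 lipu2[OF z p] by (intro add_mono) (auto intro: order_trans mult_left_mono)
    finally show ?thesis by (simp add: algebra_simps)
  qed
  define \<gamma> where "\<gamma> = (\<lambda>b p. l (u1 (\<zeta> p)) b (du1 (\<zeta> p) 1))"
  define \<kappa> where "\<kappa> = (\<lambda>b p. l (u2 p) b (du2 p 1))"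
  define C4 where "C4 = L * D1 * C1 + L * D2"
  have C4: "C4 \<ge> 0" using C1 r1 e1 e2 by (simp add: C4_def)
  \<comment> \<open>The two derivatives are complex linear at the different base points u2 p and u1
    (\<zeta> p). Using the functional at the wrong one costs a multiple of |w p|, and so does
    letting the functional move with z, up to o(1). Both errors are homogeneous in
    \<open>w\<close>.\<close>
  have expand: "\<exists>\<delta>>0. \<forall>z\<in>ball p \<delta> \<inter> B. norm (f b z - f b p - (\<kappa> b p * (z - p) - \<gamma> b p * (\<zeta> z - \<zeta> p))) \<le> (C4 * norm (w p) + e) * norm (z - p)"
    if b: "b \<in> Basis" and p: "p \<in> B" and e: "e > 0" for b p e
  proof -
    define e' where "e' = e / ((1 + K) * (1 + C1) + L * D2 * (D2 + D1 * C1) + 1)"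
    have den: "(1 + K) * (1 + C1) + L * D2 * (D2 + D1 * C1) + 1 > 0" using r1 C1 e1 e2 by (simp add: add_nonneg_pos)
    have e': "e' > 0" using e den by (simp add: e'_def)
    obtain d1 where d1: "d1 > 0" "\<And>z. norm (z - p) < d1 \<Longrightarrow> norm (u2 z - u2 p - du2 p (z - p)) \<le> e' * norm (z - p)"
      using jcurve_first_order[OF u2 BW[OF p] e'] by blast
    obtain d2 where d2: "d2 > 0" "\<And>x. norm (x - \<zeta> p) < d2 \<Longrightarrow> norm (u1 x - u1 (\<zeta> p) - du1 (\<zeta> p) (x - \<zeta> p)) \<le> e' * norm (x - \<zeta> p)"
      using jcurve_first_order[OF u1 XW[OF \<zeta>(1)[OF p]] e'] by blast
    define \<delta> where "\<delta> = min (min d1 (d2 / (C1 + 1))) e'"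
    have \<delta>: "\<delta> > 0" using d1 d2 e' C1 by (simp add: \<delta>_def)
    show ?thesis
    proof (intro exI[of _ \<delta>] conjI \<delta> ballI)
      fix z assume zz: "z \<in> ball p \<delta> \<inter> B"
      hence z: "z \<in> B" and zd: "norm (z - p) < \<delta>" by (auto simp: dist_norm norm_minus_commute)
      let ?h = "z - p" and ?\<Delta> = "\<zeta> z - \<zeta> p"
      let ?lp = "l (u2 p) b"
      have pr: "u2 p \<in> ball y0 r1" and zr: "u2 z \<in> ball y0 r1" and qr: "u1 (\<zeta> p) \<in> ball y0 r1"
        using r21[OF u2r(2)] r21[OF u1r[OF \<zeta>(1)]] z p by auto
      have lin: "linear ?lp" by (rule llin[OF pr])
      have \<Delta>: "norm ?\<Delta> \<le> C1 * norm ?h" by (rule lip\<zeta>[OF z p])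
      have \<Delta>d: "norm ?\<Delta> < d2"
      proof -
        have "norm ?h < d2 / (C1 + 1)" using zd by (simp add: \<delta>_def)
        hence "(C1 + 1) * norm ?h < d2" using C1 by (simp add: field_simps)
        moreover have "C1 * norm ?h \<le> (C1 + 1) * norm ?h" by (intro mult_right_mono) auto
        ultimately show ?thesis using \<Delta> by linarith
      qed
      define R2 where "R2 = u2 z - u2 p - du2 p ?h"
      define R1 where "R1 = u1 (\<zeta> z) - u1 (\<zeta> p) - du1 (\<zeta> p) ?\<Delta>"
      have nR2: "norm R2 \<le> e' * norm ?h" unfolding R2_def using zd by (intro d1(2)) (simp add: \<delta>_def)
      have "norm R1 \<le> e' * norm ?\<Delta>" unfolding R1_def by (intro d2(2) \<Delta>d)
      also have "\<dots> \<le> e' * (C1 * norm ?h)" using \<Delta> e' by (intro mult_left_mono) auto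
      finally have nR1: "norm R1 \<le> e' * (C1 * norm ?h)" .
      have k: "?lp (du2 p ?h) = \<kappa> b p * ?h"
        using jfun_derivative[OF acs u2 BW[OF p], of b ?h] by (simp add: \<kappa>_def l_def mult.commute)
      have g: "l (u1 (\<zeta> p)) b (du1 (\<zeta> p) ?\<Delta>) = \<gamma> b p * ?\<Delta>"
        using jfun_derivative[OF acs u1 XW[OF \<zeta>(1)[OF p]], of b ?\<Delta>] by (simp add: \<gamma>_def l_def mult.commute)
      have w: "w z - w p = du2 p ?h - du1 (\<zeta> p) ?\<Delta> + (R2 - R1)" by (simp add: w_def R1_def R2_def)
      have "f b z - f b p = ?lp (w z - w p) + (l (u2 z) b (w z) - ?lp (w z))"
        by (simp add: f_def linear_diff[OF lin])
      also have "?lp (w z - w p) = \<kappa> b p * ?h - ?lp (du1 (\<zeta> p) ?\<Delta>) + ?lp (R2 - R1)"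
        unfolding w by (simp only: linear_add[OF lin] linear_diff[OF lin] k)
      finally have "f b z - f b p - (\<kappa> b p * ?h - \<gamma> b p * ?\<Delta>)
        = (l (u1 (\<zeta> p)) b (du1 (\<zeta> p) ?\<Delta>) - ?lp (du1 (\<zeta> p) ?\<Delta>)) + ?lp (R2 - R1) + (l (u2 z) b (w z) - ?lp (w z))"
        by (simp add: g)
      also have "norm \<dots> \<le> L * norm (u1 (\<zeta> p) - u2 p) * norm (du1 (\<zeta> p) ?\<Delta>) + (1 + K) * norm (R2 - R1) + L * norm (u2 z - u2 p) * norm (w z)"
        by (intro order_trans[OF norm_triangle_ineq] add_mono lL ln pr zr qr b)
      also have "\<dots> \<le> L * norm (w p) * (D1 * (C1 * norm ?h)) + (1 + K) * (e' * norm ?h + e' * (C1 * norm ?h))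
          + L * (D2 * norm ?h) * (norm (w p) + (D2 + D1 * C1) * e')"
      proof (intro add_mono mult_mono mult_left_mono)
        show "norm (u1 (\<zeta> p) - u2 p) \<le> norm (w p)" by (simp add: w_def norm_minus_commute)
        have "norm (du1 (\<zeta> p) ?\<Delta>) \<le> D1 * norm ?\<Delta>" by (rule duX[OF \<zeta>(1)[OF p]])
        also have "\<dots> \<le> D1 * (C1 * norm ?h)" using \<Delta> e1 by (intro mult_left_mono) auto
        finally show "norm (du1 (\<zeta> p) ?\<Delta>) \<le> D1 * (C1 * norm ?h)" .
        show "norm (R2 - R1) \<le> e' * norm ?h + e' * (C1 * norm ?h)" using nR1 nR2 norm_triangle_ineq4[of R2 R1] by linarith
        have "norm (w z - w p) \<le> (D2 + D1 * C1) * norm ?h" by (rule lipw[OF z p])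
        also have "\<dots> \<le> (D2 + D1 * C1) * e'" using zd e1 e2 C1 by (intro mult_left_mono) (auto simp: \<delta>_def)
        finally show "norm (w z) \<le> norm (w p) + (D2 + D1 * C1) * e'" using norm_triangle_sub[of "w z" "w p"] by linarith
        show "norm (u2 z - u2 p) \<le> D2 * norm ?h" by (rule lipu2[OF z p])
      qed (use r1 e1 e2 C1 in auto)
      also have "\<dots> = (C4 * norm (w p) + ((1 + K) * (1 + C1) + L * D2 * (D2 + D1 * C1)) * e') * norm ?h"
        by (simp add: C4_def algebra_simps)
      also have "\<dots> \<le> (C4 * norm (w p) + e) * norm ?h"
      proof (intro mult_right_mono add_left_mono)
        have "((1 + K) * (1 + C1) + L * D2 * (D2 + D1 * C1)) * e' \<le> ((1 + K) * (1 + C1) + L * D2 * (D2 + D1 * C1) + 1) * e'"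
          using e' by (intro mult_right_mono) auto
        also have "\<dots> = e" using den by (simp add: e'_def)
        finally show "((1 + K) * (1 + C1) + L * D2 * (D2 + D1 * C1)) * e' \<le> e" .
      qed auto
      finally show "norm (f b z - f b p - (\<kappa> b p * ?h - \<gamma> b p * ?\<Delta>)) \<le> (C4 * norm (w p) + e) * norm ?h" .
    qed
  qed
  \<comment> \<open>By the choice of \<zeta> this component vanishes identically. Its expansion can
    thus be solved for the increment of \<zeta>, which shows that \<zeta> is complex differentiable
    up to a multiple of |w|.\<close>
  have f0: "f b0 z = 0" if "z \<in> B" for z using \<zeta>(2)[OF that] by (simp add: f_def w_def)
  have \<gamma>0: "norm (\<gamma> b0 p) \<ge> norm \<beta> / 2" if "p \<in> B" for p
  proof -
    have "norm (\<gamma> b0 p - \<beta>) \<le> norm \<beta> / 2" using E0[OF u1r[OF \<zeta>(1)[OF that]] \<zeta>(1)[OF that], of 1] by (simp add: \<gamma>_def)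
    thus ?thesis using norm_triangle_ineq2[of \<beta> "\<gamma> b0 p"] by (simp add: norm_minus_commute)
  qed
  have \<gamma>n: "norm (\<gamma> b p) \<le> (1 + K) * D1" if "p \<in> B" "b \<in> Basis" for p b
  proof -
    have "norm (\<gamma> b p) \<le> (1 + K) * norm (du1 (\<zeta> p) 1)" unfolding \<gamma>_def by (rule ln[OF r21[OF u1r[OF \<zeta>(1)[OF that(1)]]] that(2)])
    also have "\<dots> \<le> (1 + K) * (D1 * norm (1::complex))" using r1 by (intro mult_left_mono duX \<zeta> that) auto
    finally show ?thesis by simp
  qed
  have expand\<zeta>: "\<exists>\<delta>>0. \<forall>z\<in>ball p \<delta> \<inter> B. norm (\<zeta> z - \<zeta> p - \<kappa> b0 p / \<gamma> b0 p * (z - p)) \<le> 2 / norm \<beta> * ((C4 * norm (w p) + e) * norm (z - p))"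
    if p: "p \<in> B" and e: "e > 0" for p e
  proof -
    obtain \<delta> where \<delta>: "\<delta> > 0" "\<And>z. z \<in> ball p \<delta> \<inter> B \<Longrightarrow> norm (f b0 z - f b0 p - (\<kappa> b0 p * (z - p) - \<gamma> b0 p * (\<zeta> z - \<zeta> p))) \<le> (C4 * norm (w p) + e) * norm (z - p)"
      using expand[OF b0(1) p e] by blast
    show ?thesis
    proof (intro exI[of _ \<delta>] conjI \<delta>(1) ballI)
      fix z assume z: "z \<in> ball p \<delta> \<inter> B"
      have \<gamma>p: "norm (\<gamma> b0 p) > 0" "norm (\<gamma> b0 p) \<ge> norm \<beta> / 2" using \<gamma>0[OF p] \<beta> by linarith+
      have *: "norm (\<kappa> b0 p * (z - p) - \<gamma> b0 p * (\<zeta> z - \<zeta> p)) \<le> (C4 * norm (w p) + e) * norm (z - p)"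
        using \<delta>(2)[OF z] f0[OF p] f0[of z] z by (simp add: norm_minus_commute)
      have "\<zeta> z - \<zeta> p - \<kappa> b0 p / \<gamma> b0 p * (z - p) = - ((\<kappa> b0 p * (z - p) - \<gamma> b0 p * (\<zeta> z - \<zeta> p)) / \<gamma> b0 p)"
        using \<gamma>p by (simp add: diff_divide_distrib)
      also have "norm \<dots> = norm (\<kappa> b0 p * (z - p) - \<gamma> b0 p * (\<zeta> z - \<zeta> p)) / norm (\<gamma> b0 p)"
        by (simp add: norm_divide)
      also have "\<dots> \<le> ((C4 * norm (w p) + e) * norm (z - p)) / (norm \<beta> / 2)"
        using * \<gamma>p \<beta> C4 e by (intro frac_le) auto
      also have "a / (c / 2) = 2 / c * a" for a c :: real by simp
      finally show "norm (\<zeta> z - \<zeta> p - \<kappa> b0 p / \<gamma> b0 p * (z - p)) \<le> 2 / norm \<beta> * ((C4 * norm (w p) + e) * norm (z - p))" .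
    qed
  qed
  define M where "M = 1 + (1 + K) * D1 * (2 / norm \<beta>)"
  have M: "M > 0" using r1 e1 \<beta> by (simp add: M_def add_pos_nonneg)
  have fcont: "continuous_on B (f b)" for b
  proof -
    have cu: "continuous_on B u2" using jcurve_continuous[OF u2] BW continuous_on_subset by blast
    have cw: "continuous_on B w"
      by (rule lipschitz_on_continuous_on[of "D2 + D1 * C1"], rule lipschitz_onI) (use lipw e1 e2 C1 in \<open>auto simp: dist_norm\<close>)
    show ?thesis
      unfolding f_def l_def jfun_def continuous_on
      by (intro ballI tendsto_intros jcurve_tendsto[OF acs jcurveD(2)[OF u2 BW]] cu[unfolded continuous_on, rule_format] cw[unfolded continuous_on, rule_format])
  qed
  have dbar: "dbar_bounded Basis f (9 * (C4 * M)) (ball 0 r)"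
  proof (rule dbar_boundedI)
    show "continuous_on (ball 0 r) (f b)" for b using fcont[of b] by (simp add: B_def)
    show "0 \<le> C4 * M" using C4 M by simp
    fix b :: 'e and p :: complex and e :: real assume b: "b \<in> Basis" and p': "p \<in> ball 0 r" and e: "e > 0"
    have p: "p \<in> B" using p' by (simp add: B_def)
    have eM: "e / M > 0" using e M by simp
    obtain \<delta>1 where \<delta>1: "\<delta>1 > 0" "\<And>z. z \<in> ball p \<delta>1 \<inter> B \<Longrightarrow> norm (f b z - f b p - (\<kappa> b p * (z - p) - \<gamma> b p * (\<zeta> z - \<zeta> p))) \<le> (C4 * norm (w p) + e / M) * norm (z - p)"
      using expand[OF b p eM] by blast
    obtain \<delta>2 where \<delta>2: "\<delta>2 > 0" "\<And>z. z \<in> ball p \<delta>2 \<inter> B \<Longrightarrow> norm (\<zeta> z - \<zeta> p - \<kappa> b0 p / \<gamma> b0 p * (z - p)) \<le> 2 / norm \<beta> * ((C4 * norm (w p) + e / M) * norm (z - p))"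
      using expand\<zeta>[OF p eM] by blast
    \<comment> \<open>Substituting the expansion of \<zeta> into that of \<open>f b\<close> leaves
      the complex linear increment A (z - p), and a complex affine function has the quadratic
      primitive used next.\<close>
    define A where "A = \<kappa> b p - \<gamma> b p * (\<kappa> b0 p / \<gamma> b0 p)"
    show "\<exists>\<delta>>0. \<exists>G G'. \<forall>z\<in>ball p \<delta> \<inter> ball 0 r. (G has_derivative G' z) (at z) \<and>
      (\<forall>t. norm (f b z * t - G' z t) \<le> (C4 * M * (\<Sum>j\<in>Basis. norm (f j p)) + e) * norm (z - p) * norm t)"
    proof (intro exI[of _ "min \<delta>1 \<delta>2"] exI[of _ "\<lambda>z. f b p * z + A * (z - p)\<^sup>2 / 2"] exI[of _ "\<lambda>z t. (f b p + A * (z - p)) * t"] conjI ballI allI)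
      show "0 < min \<delta>1 \<delta>2" using \<delta>1 \<delta>2 by simp
      fix z assume z': "z \<in> ball p (min \<delta>1 \<delta>2) \<inter> ball 0 r"
      have z: "z \<in> ball p \<delta>1 \<inter> B" "z \<in> ball p \<delta>2 \<inter> B" using z' by (auto simp: B_def)
      have "((\<lambda>z. f b p * z + A * (z - p)\<^sup>2 / 2) has_field_derivative (f b p + A * (z - p))) (at z)"
        by (auto intro!: derivative_eq_intros)
      thus "((\<lambda>z. f b p * z + A * (z - p)\<^sup>2 / 2) has_derivative (\<lambda>t. (f b p + A * (z - p)) * t)) (at z)"
        by (simp add: has_field_derivative_def)
      fix t :: complex
      define Q where "Q = (C4 * norm (w p) + e / M) * norm (z - p)"
      have Q0: "Q \<ge> 0" using C4 eM by (simp add: Q_def)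
      have "f b z - f b p - A * (z - p) = (f b z - f b p - (\<kappa> b p * (z - p) - \<gamma> b p * (\<zeta> z - \<zeta> p))) - \<gamma> b p * (\<zeta> z - \<zeta> p - \<kappa> b0 p / \<gamma> b0 p * (z - p))"
        by (simp add: A_def algebra_simps)
      also have "norm \<dots> \<le> Q + (1 + K) * D1 * (2 / norm \<beta> * Q)"
      proof (rule order_trans[OF norm_triangle_ineq4], rule add_mono)
        show "norm (f b z - f b p - (\<kappa> b p * (z - p) - \<gamma> b p * (\<zeta> z - \<zeta> p))) \<le> Q" unfolding Q_def by (rule \<delta>1(2)[OF z(1)])
        show "norm (\<gamma> b p * (\<zeta> z - \<zeta> p - \<kappa> b0 p / \<gamma> b0 p * (z - p))) \<le> (1 + K) * D1 * (2 / norm \<beta> * Q)"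
          unfolding norm_mult using \<gamma>n[OF p b] \<delta>2(2)[OF z(2)] r1 e1 by (intro mult_mono) (auto simp: Q_def)
      qed
      also have "\<dots> = M * Q" by (simp add: M_def algebra_simps)
      also have "\<dots> = (C4 * M * norm (w p) + e) * norm (z - p)" using M by (simp add: Q_def field_simps)
      also have "\<dots> \<le> (C4 * M * F p + e) * norm (z - p)"
        using wF[of p] C4 M by (intro mult_right_mono add_right_mono mult_left_mono) auto
      finally have "norm (f b z - f b p - A * (z - p)) * norm t \<le> (C4 * M * F p + e) * norm (z - p) * norm t" by (intro mult_right_mono) auto
      thus "norm (f b z * t - (f b p + A * (z - p)) * t) \<le> (C4 * M * (\<Sum>j\<in>Basis. norm (f j p)) + e) * norm (z - p) * norm t"
        by (simp add: F_def norm_mult[symmetric] algebra_simps)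
    qed
  qed
  have C9: "0 \<le> 9 * (C4 * M)" using C4 M by simp
  have XW1: "cball 0 \<rho> \<subseteq> W1" using XW by (auto simp: X_def)
  show ?thesis
  \<comment> \<open>If \<open>w\<close> vanishes near 0, the error in \<open>expand\<zeta>\<close>
    is o(|z - p|) and \<zeta> is holomorphic. Otherwise some component is nonzero off 0; as a common
    point u2 z = u1 x forces x = \<zeta> z and w z = 0, the curves then meet only at the
    centre.\<close>
  proof (rule dbar_bounded_order[OF finite_Basis dbar C9 r(1)])
    fix \<rho>' :: real assume \<rho>': "\<rho>' > 0" "\<And>z b. norm z < \<rho>' \<Longrightarrow> b \<in> Basis \<Longrightarrow> f b z = 0"
    define r' where "r' = min r \<rho>'"
    have r': "r' > 0" using r \<rho>' by (simp add: r'_def)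
    have wz: "w z = 0" if "z \<in> ball 0 r'" for z using wF[of z] \<rho>'(2)[of z] that by (simp add: F_def r'_def)
    have B': "z \<in> B" if "z \<in> ball 0 r'" for z using that by (simp add: B_def r'_def)
    have "(\<zeta> has_field_derivative \<kappa> b0 p / \<gamma> b0 p) (at p)" if p: "p \<in> ball 0 r'" for p
      unfolding has_field_derivative_def has_derivative_at_alt
    proof (intro conjI allI impI)
      show "bounded_linear ((*) (\<kappa> b0 p / \<gamma> b0 p))" by (rule bounded_linear_mult_right)
      fix e :: real assume e: "e > 0"
      have "e * norm \<beta> / 2 > 0" using e \<beta> by simp
      from expand\<zeta>[OF B'[OF p] this] obtain \<delta> where \<delta>: "\<delta> > 0" "\<And>z. z \<in> ball p \<delta> \<inter> B \<Longrightarrow> norm (\<zeta> z - \<zeta> p - \<kappa> b0 p / \<gamma> b0 p * (z - p)) \<le> 2 / norm \<beta> * ((C4 * norm (w p) + e * norm \<beta> / 2) * norm (z - p))"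
        by blast
      obtain d where d: "d > 0" "ball p d \<subseteq> ball 0 r'" using p open_ball openE by blast
      show "\<exists>d>0. \<forall>z. norm (z - p) < d \<longrightarrow> norm (\<zeta> z - \<zeta> p - \<kappa> b0 p / \<gamma> b0 p * (z - p)) \<le> e * norm (z - p)"
      proof (intro exI[of _ "min d \<delta>"] conjI allI impI)
        fix z assume "norm (z - p) < min d \<delta>"
        hence "z \<in> ball p \<delta> \<inter> B" using d B' by (auto simp: dist_norm norm_minus_commute subset_iff)
        from \<delta>(2)[OF this] show "norm (\<zeta> z - \<zeta> p - \<kappa> b0 p / \<gamma> b0 p * (z - p)) \<le> e * norm (z - p)"
          using wz[OF p] \<beta> by simp
      qed (use d \<delta> in auto)
    qed
    hence "\<zeta> holomorphic_on ball 0 r'" unfolding holomorphic_on_open[OF open_ball] by blast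
    moreover have "u2 z = u1 (\<zeta> z)" if "z \<in> ball 0 r'" for z using wz[OF that] by (simp add: w_def)
    ultimately show ?thesis
      using that[of \<rho> r'] \<rho> r' XW1 B' BW \<zeta>0 \<zeta>(1) unfolding X_def by blast
  next
    fix m a i0 assume i0: "i0 \<in> Basis" "a i0 \<noteq> 0" "\<And>i. i \<in> Basis \<Longrightarrow> ((\<lambda>z. f i z / z ^ m) \<longlongrightarrow> a i) (at 0)"
    have "\<forall>\<^sub>F z in at 0. f i0 z / z ^ m \<noteq> 0" using i0(3)[OF i0(1)] i0(2) by (rule tendsto_imp_eventually_ne)
    then obtain d where d: "d > 0" "\<And>z. z \<noteq> 0 \<Longrightarrow> norm z < d \<Longrightarrow> f i0 z \<noteq> 0"
      unfolding eventually_at by (auto simp: dist_norm)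
    define r' where "r' = min r d"
    have r': "r' > 0" using r d by (simp add: r'_def)
    have B': "z \<in> B" if "z \<in> ball 0 r'" for z using that by (simp add: B_def r'_def)
    have "u2 z \<noteq> u1 x" if z: "z \<in> ball 0 r' - {0}" and x: "x \<in> cball 0 \<rho>" for z x
    proof
      assume e: "u2 z = u1 x"
      have zB: "z \<in> B" using B' z by blast
      have lin: "linear (l (u2 z) b)" for b using llin[OF r21[OF u2r(2)[OF zB]]] .
      have "x = \<zeta> z" using uniq[OF zB, of x] x e linear_0[OF lin] by (simp add: X_def)
      hence "w z = 0" using e by (simp add: w_def)
      hence "f i0 z = 0" using linear_0[OF lin] by (simp add: f_def)
      thus False using d(2)[of z] z by (simp add: r'_def)
    qed
    moreover have "ball 0 r' \<subseteq> W2" using B' BW by blast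
    ultimately show ?thesis using that[of \<rho> r'] \<rho> r' XW1 by blast
  qed
qed


section \<open>Roots, and curves invariant under roots of unity\<close>

definition root_near :: "complex \<Rightarrow> nat \<Rightarrow> complex \<Rightarrow> complex" where
  "root_near y k x = y * exp (Ln (x / y ^ k) / of_nat k)"

text \<open>The branch of the k-th root with value \<open>y\<close> at y ^ k. Passing to the
  quotient x / y ^ k moves the base point to 1, away from the slit of \<open>Ln\<close>.\<close>

lemma root_near:
  assumes "y \<noteq> 0" "k \<ge> 1"
  obtains S where "open S" "y ^ k \<in> S" "0 \<notin> S" "root_near y k (y ^ k) = y" "\<And>x. x \<in> S \<Longrightarrow> root_near y k x ^ k = x"
    "\<And>x. x \<in> S \<Longrightarrow> (root_near y k has_field_derivative 1 / (of_nat k * root_near y k x ^ (k - 1))) (at x)"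
proof -
  define S where "S = (\<lambda>x. x / y ^ k) -` (- \<real>\<^sub>\<le>\<^sub>0)"
  have oS: "open S" unfolding S_def
    by (rule open_vimage) (use assms in \<open>auto intro!: continuous_intros closed_nonpos_Reals_complex\<close>)
  have pw: "root_near y k x ^ k = x" if "x \<in> S" for x
  proof -
    have "exp (Ln (x / y ^ k) / of_nat k) ^ k = exp (Ln (x / y ^ k))"
      using assms by (simp flip: exp_of_nat_mult)
    also have "\<dots> = x / y ^ k" using that assms by (intro exp_Ln) (auto simp: S_def power_0_left)
    finally show ?thesis using assms by (simp add: root_near_def power_mult_distrib)
  qed
  have d: "(root_near y k has_field_derivative 1 / (of_nat k * root_near y k x ^ (k - 1))) (at x)" if x: "x \<in> S" for x
  proof -
    have x0: "x \<noteq> 0" using x by (auto simp: S_def)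
    let ?g = "root_near y k x"
    have g0: "?g \<noteq> 0" using assms by (simp add: root_near_def)
    have "(root_near y k has_field_derivative ?g / (of_nat k * x)) (at x)"
      unfolding root_near_def
      using x assms x0 by (auto intro!: derivative_eq_intros simp: S_def mult_ac)
    moreover have "?g / (of_nat k * x) = 1 / (of_nat k * ?g ^ (k - 1))"
    proof -
      have "x = ?g * ?g ^ (k - 1)" using pw[OF x] assms(2) by (metis power_eq_if not_one_le_zero)
      hence "?g / (of_nat k * x) = ?g / (of_nat k * (?g * ?g ^ (k - 1)))" by simp
      thus ?thesis using g0 by simp
    qed
    ultimately show ?thesis by simp
  qed
  show ?thesis
    by (rule that[OF oS _ _ _ pw d]) (use assms in \<open>auto simp: S_def root_near_def\<close>)
qed

lemma ex_nth_root:
  assumes "k \<ge> (1::nat)"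
  obtains y :: complex where "y ^ k = x" "norm y ^ k = norm x"
proof (cases "x = 0")
  case True
  thus ?thesis using that[of 0] assms by simp
next
  case False
  have "exp (Ln x / of_nat k) ^ k = x" using assms False by (simp flip: exp_of_nat_mult)
  thus ?thesis using that by (metis norm_power)
qed

lemma norm_root_less:
  assumes "k \<ge> (1::nat)" "y ^ k = (x::complex)" "norm x < \<rho> ^ k" "\<rho> > 0"
  shows "norm y < \<rho>"
  using assms by (metis norm_power power_less_imp_less_base less_imp_le)

text \<open>Let \<omega> be a primitive k-th root of unity. Differentiating u (\<omega> y) = u y
  gives f y = \<omega> f (\<omega> y) for the coefficient of the derivative; comparing leading terms
  a z ^ m yields \<omega>^(m+1) = 1.\<close>

lemma jcurve_symmetric_order:
  assumes acs: "acs_on J V" and u: "jcurve J V (ball 0 \<rho>) u du" and \<rho>: "\<rho> > 0" and k: "k \<ge> 1"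
    and sym: "\<And>y y'. y \<in> ball 0 \<rho> \<Longrightarrow> y' \<in> ball 0 \<rho> \<Longrightarrow> y ^ k = y' ^ k \<Longrightarrow> u y = u y'"
    and a: "((\<lambda>z. jfun J (u z) b (du z 1) / z ^ m) \<longlongrightarrow> a) (at 0)" "a \<noteq> 0"
  shows "k dvd Suc m"
proof -
  define \<omega> where "\<omega> = exp (2 * of_real pi * \<i> * of_nat 1 / of_nat k)"
  have w1: "\<omega> ^ k = 1" using k by (simp add: \<omega>_def flip: exp_of_nat_mult)
  have nw: "norm \<omega> = 1" by (simp add: \<omega>_def)
  have w0: "\<omega> \<noteq> 0" by (simp add: \<omega>_def)
  define f where "f = (\<lambda>z. jfun J (u z) b (du z 1))"
  have fw: "f y = \<omega> * f (\<omega> * y)" if y: "y \<in> ball 0 \<rho>" for y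
  proof -
    have wy: "\<omega> * y \<in> ball 0 \<rho>" using y by (simp add: norm_mult nw)
    have "((\<lambda>z. \<omega> * z) has_derivative (\<lambda>t. \<omega> * t)) (at y)" by (auto intro!: derivative_eq_intros)
    from has_derivative_compose[OF this jcurveD(3)[OF u wy]]
    have "((\<lambda>z. u (\<omega> * z)) has_derivative (\<lambda>t. du (\<omega> * y) (\<omega> * t))) (at y)" .
    moreover have "u (\<omega> * z) = u z" if "z \<in> ball 0 \<rho>" for z
      using that by (intro sym) (auto simp: norm_mult nw power_mult_distrib w1)
    ultimately have "(u has_derivative (\<lambda>t. du (\<omega> * y) (\<omega> * t))) (at y)"
      by (rule has_derivative_transform_within_open[OF _ open_ball y]) auto
    from has_derivative_unique[OF this jcurveD(3)[OF u y]] have "du y 1 = du (\<omega> * y) (\<omega> * 1)" by metis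
    moreover have "u (\<omega> * y) = u y" using y wy by (intro sym) (auto simp: power_mult_distrib w1)
    ultimately show ?thesis using jfun_derivative[OF acs u wy, of b "\<omega> * 1"] by (simp add: f_def)
  qed
  have "((\<lambda>z. \<omega> ^ Suc m * (f (\<omega> * z) / (\<omega> * z) ^ m)) \<longlongrightarrow> \<omega> ^ Suc m * a) (at 0)"
  proof (intro tendsto_intros)
    have "filterlim (\<lambda>z. \<omega> * z) (at 0) (at 0)"
      unfolding filterlim_at using w0 by (auto intro!: tendsto_eq_intros simp: eventually_at_filter)
    from filterlim_compose[OF a(1) this] show "((\<lambda>z. f (\<omega> * z) / (\<omega> * z) ^ m) \<longlongrightarrow> a) (at 0)" by (simp add: f_def)
  qed
  moreover have "\<forall>\<^sub>F z in at 0. \<omega> ^ Suc m * (f (\<omega> * z) / (\<omega> * z) ^ m) = f z / z ^ m"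
    unfolding eventually_at using \<rho> fw w0 by (intro exI[of _ \<rho>]) (auto simp: power_mult_distrib)
  ultimately have "((\<lambda>z. f z / z ^ m) \<longlongrightarrow> \<omega> ^ Suc m * a) (at 0)" by (rule Lim_transform_eventually)
  with a(1) have "\<omega> ^ Suc m * a = a" unfolding f_def by (rule LIM_unique[rotated])
  hence "\<omega> ^ Suc m = 1" using a(2) by simp
  moreover have "\<omega> ^ Suc m = exp (2 * of_real pi * \<i> * of_nat (Suc m) / of_nat k)"
    unfolding \<omega>_def exp_of_nat_mult[symmetric] by (simp add: field_simps)
  ultimately show ?thesis using complex_root_unity_eq_1[of k "Suc m"] k by simp
qed

text \<open>Off 0 the derivative of \<open>v\<close> at y ^ k is that of \<open>u\<close> at
  \<open>y\<close> divided by k y^(k-1). The numerator has order m with k | m + 1, hence m \<ge> k -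
  1, so the quotient has a limit at 0, which is the derivative there.\<close>

lemma jcurve_descend:
  assumes acs: "acs_on J V" and u: "jcurve J V (ball 0 \<rho>) u du" and \<rho>: "\<rho> > 0" and k: "k \<ge> 1"
    and v: "\<And>y. y \<in> ball 0 \<rho> \<Longrightarrow> v (y ^ k) = u y"
    and b0: "b0 \<in> Basis" "a b0 \<noteq> 0" and a: "\<And>b. b \<in> Basis \<Longrightarrow> ((\<lambda>z. jfun J (u z) b (du z 1) / z ^ m) \<longlongrightarrow> a b) (at 0)"
  obtains dv where "jcurve J V (ball 0 (\<rho> ^ k)) v dv"
proof -
  let ?D = "ball (0::complex) (\<rho> ^ k)"
  have "k dvd Suc m"
  proof (rule jcurve_symmetric_order[OF acs u \<rho> k _ a[OF b0(1)] b0(2)])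
    show "u y = u y'" if "y \<in> ball 0 \<rho>" "y' \<in> ball 0 \<rho>" "y ^ k = y' ^ k" for y y' using v that by metis
  qed
  hence "k \<le> Suc m" by (rule dvd_imp_le) simp
  hence km: "k - 1 \<le> m" by simp
  define f where "f = (\<lambda>b z. jfun J (u z) b (du z 1))"
  have "\<exists>c. ((\<lambda>y. f b y / (of_nat k * y ^ (k - 1))) \<longlongrightarrow> c) (at 0)" if b: "b \<in> Basis" for b
  proof -
    have "((\<lambda>y. f b y / y ^ m * y ^ (m - (k - 1)) / of_nat k) \<longlongrightarrow> a b * 0 ^ (m - (k - 1)) / of_nat k) (at 0)"
      unfolding f_def using k by (intro tendsto_intros a b) auto
    moreover have "\<forall>\<^sub>F y in at (0::complex). f b y / y ^ m * y ^ (m - (k - 1)) / of_nat k = f b y / (of_nat k * y ^ (k - 1))"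
      unfolding eventually_at
    proof (intro exI[of _ 1] conjI ballI impI)
      fix y :: complex assume "y \<noteq> 0 \<and> dist y 0 < 1"
      moreover have "y ^ m = y ^ (m - (k - 1)) * y ^ (k - 1)" using km by (simp flip: power_add)
      ultimately show "f b y / y ^ m * y ^ (m - (k - 1)) / of_nat k = f b y / (of_nat k * y ^ (k - 1))" by simp
    qed simp
    ultimately have "((\<lambda>y. f b y / (of_nat k * y ^ (k - 1))) \<longlongrightarrow> a b * 0 ^ (m - (k - 1)) / of_nat k) (at 0)"
      by (rule Lim_transform_eventually)
    thus ?thesis by (rule exI)
  qed
  then obtain c where c: "\<And>b. b \<in> Basis \<Longrightarrow> ((\<lambda>y. f b y / (of_nat k * y ^ (k - 1))) \<longlongrightarrow> c b) (at 0)" by metis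
  have "\<exists>y. y ^ k = x" for x :: complex by (rule ex_nth_root[OF k, of x]) blast
  \<comment> \<open>An arbitrary choice of roots without any continuity. Near x \<noteq> 0 it is
    replaced by the branches of \<open>loc\<close>; near 0 it is small and off 0 it is
    nonzero.\<close>
  then obtain rt :: "complex \<Rightarrow> complex" where rt: "\<And>x. rt x ^ k = x" by metis
  have rtin: "rt x \<in> ball 0 \<rho>" if "x \<in> ?D" for x
    using norm_root_less[OF k rt[of x] _ \<rho>] that by simp
  have rt0: "rt x \<noteq> 0" if "x \<noteq> 0" for x using rt[of x] that k by (metis power_0_left not_one_le_zero)
  define dv where "dv = (\<lambda>x t. \<Sum>b\<in>Basis. Re ((if x = 0 then c b else f b (rt x) / (of_nat k * rt x ^ (k - 1))) * t) *\<^sub>R b)"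
  have rep: "du y t = (\<Sum>b\<in>Basis. Re (f b y * t) *\<^sub>R b)" if "y \<in> ball 0 \<rho>" for y t
  proof -
    have "du y t = (\<Sum>b\<in>Basis. (du y t \<bullet> b) *\<^sub>R b)" by (simp add: euclidean_representation)
    moreover have "du y t \<bullet> b = Re (f b y * t)" for b
      using arg_cong[OF jfun_derivative[OF acs u that, of b t], of Re] by (simp add: f_def inner_commute mult.commute)
    ultimately show ?thesis by simp
  qed
  have dvrt: "dv x t = du (rt x) (t / (of_nat k * rt x ^ (k - 1)))" if "x \<in> ?D" "x \<noteq> 0" for x t
    unfolding rep[OF rtin[OF that(1)]] dv_def using that(2) by (simp only: if_False times_divide_eq_left times_divide_eq_right)
  have loc: "\<exists>S. open S \<and> x \<in> S \<and> S \<subseteq> ?D - {0} \<and> (\<exists>g. g x = rt x \<and> (\<forall>x'\<in>S. g x' ^ k = x' \<and> g x' \<in> ball 0 \<rho> \<and>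
      (g has_field_derivative 1 / (of_nat k * g x' ^ (k - 1))) (at x')))" if x: "x \<in> ?D" "x \<noteq> 0" for x
  proof -
    obtain S where S: "open S" "rt x ^ k \<in> S" "0 \<notin> S" "root_near (rt x) k (rt x ^ k) = rt x" "\<And>x'. x' \<in> S \<Longrightarrow> root_near (rt x) k x' ^ k = x'"
      "\<And>x'. x' \<in> S \<Longrightarrow> (root_near (rt x) k has_field_derivative 1 / (of_nat k * root_near (rt x) k x' ^ (k - 1))) (at x')"
      using root_near[OF rt0[OF x(2)] k] by blast
    show ?thesis
    proof (intro exI[of _ "S \<inter> ?D"] exI[of _ "root_near (rt x) k"] conjI ballI)
      fix x' assume x': "x' \<in> S \<inter> ?D"
      show "root_near (rt x) k x' \<in> ball 0 \<rho>"
        using norm_root_less[OF k S(5) _ \<rho>] x' by auto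
    qed (use S x rt in auto)
  qed
  have der: "(v has_derivative (\<lambda>t. du y (t / (of_nat k * y ^ (k - 1))))) (at x)"
    if g: "open S" "x \<in> S" "S \<subseteq> ?D - {0}" "\<And>x'. x' \<in> S \<Longrightarrow> g x' ^ k = x' \<and> g x' \<in> ball 0 \<rho>"
      "(g has_field_derivative 1 / (of_nat k * g x ^ (k - 1))) (at x)" "y = g x" for S g x y
  proof -
    have gx: "g x \<in> ball 0 \<rho>" using g(2,4) by blast
    from has_derivative_compose[OF g(5)[unfolded has_field_derivative_def] jcurveD(3)[OF u gx]]
    have "((\<lambda>x. u (g x)) has_derivative (\<lambda>t. du (g x) (1 / (of_nat k * g x ^ (k - 1)) * t))) (at x)" .
    hence "(v has_derivative (\<lambda>t. du (g x) (1 / (of_nat k * g x ^ (k - 1)) * t))) (at x)"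
      by (rule has_derivative_transform_within_open[OF _ g(1,2)]) (use v g(4) in metis)
    thus ?thesis by (simp add: g(6))
  qed
  have der1: "(v has_derivative dv x) (at x)" if x: "x \<in> ?D" "x \<noteq> 0" for x
  proof -
    obtain S g where g: "open S" "x \<in> S" "S \<subseteq> ?D - {0}" "g x = rt x" "\<And>x'. x' \<in> S \<Longrightarrow> g x' ^ k = x' \<and> g x' \<in> ball 0 \<rho> \<and>
      (g has_field_derivative 1 / (of_nat k * g x' ^ (k - 1))) (at x')" using loc[OF x] by blast
    have "(v has_derivative (\<lambda>t. du (rt x) (t / (of_nat k * rt x ^ (k - 1))))) (at x)"
      by (rule der[OF g(1-3), of g]) (use g(4) g(5)[OF g(2)] g(5) in simp_all)
    moreover have "dv x = (\<lambda>t. du (rt x) (t / (of_nat k * rt x ^ (k - 1))))" by (rule ext) (rule dvrt[OF x])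
    ultimately show ?thesis by (simp only:)
  qed
  have lim0: "((\<lambda>x. dv x t) \<longlongrightarrow> dv 0 t) (at 0)" for t
  proof -
    have rtlim: "filterlim rt (at 0) (at 0)"
      unfolding filterlim_at
    proof (intro conjI)
      show "(rt \<longlongrightarrow> 0) (at 0)"
      proof (rule tendstoI)
        fix e :: real assume e: "e > 0"
        show "\<forall>\<^sub>F x in at 0. dist (rt x) 0 < e"
          unfolding eventually_at using e norm_root_less[OF k rt _ e] by (intro exI[of _ "e ^ k"]) auto
      qed
      show "\<forall>\<^sub>F x in at 0. rt x \<in> UNIV \<and> rt x \<noteq> 0" unfolding eventually_at using rt0 by (intro exI[of _ 1]) auto
    qed
    have "((\<lambda>x. \<Sum>b\<in>Basis. Re (f b (rt x) / (of_nat k * rt x ^ (k - 1)) * t) *\<^sub>R b) \<longlongrightarrow> (\<Sum>b\<in>Basis. Re (c b * t) *\<^sub>R b)) (at 0)"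
      by (intro tendsto_intros filterlim_compose[OF c rtlim])
    hence "((\<lambda>x. \<Sum>b\<in>Basis. Re (f b (rt x) / (of_nat k * rt x ^ (k - 1)) * t) *\<^sub>R b) \<longlongrightarrow> dv 0 t) (at 0)" by (simp add: dv_def)
    thus ?thesis
    proof (rule Lim_transform_eventually, unfold eventually_at, intro exI[of _ 1] conjI ballI impI)
      fix x :: complex assume "x \<noteq> 0 \<and> dist x 0 < 1"
      hence "x \<noteq> 0" by simp
      thus "(\<Sum>b\<in>Basis. Re (f b (rt x) / (of_nat k * rt x ^ (k - 1)) * t) *\<^sub>R b) = dv x t" by (simp only: dv_def if_False)
    qed simp
  qed
  have vV: "v x \<in> V" if "x \<in> ?D" for x using v[OF rtin[OF that]] rt[of x] jcurveD(2)[OF u rtin[OF that]] by simp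
  have 0: "0 \<in> ?D" using \<rho> by simp
  have cont0: "(v \<longlongrightarrow> v 0) (at 0)"
  proof -
    have "(u \<longlongrightarrow> u 0) (at 0)"
      using jcurve_continuous[OF u] \<rho> by (simp add: continuous_on_eq_continuous_at isCont_def)
    show ?thesis
    proof (rule tendstoI)
      fix e :: real assume "e > 0"
      hence "\<forall>\<^sub>F y in at 0. dist (u y) (u 0) < e" using \<open>(u \<longlongrightarrow> u 0) (at 0)\<close> by (rule tendstoD[rotated])
      then obtain d where d: "d > 0" "\<And>y. y \<noteq> 0 \<Longrightarrow> norm y < d \<Longrightarrow> dist (u y) (u 0) < e" unfolding eventually_at by auto
      show "\<forall>\<^sub>F x in at 0. dist (v x) (v 0) < e"
        unfolding eventually_at
      proof (intro exI[of _ "min (d ^ k) (\<rho> ^ k)"] conjI ballI impI)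
        fix x :: complex assume x: "x \<noteq> 0 \<and> dist x 0 < min (d ^ k) (\<rho> ^ k)"
        have "norm (rt x) < d" using x by (intro norm_root_less[OF k rt _ d(1)]) auto
        moreover have "v x = u (rt x)" using v[OF rtin[of x]] rt[of x] x by simp
        moreover have "v 0 = u 0" using v[of 0] \<rho> k by (simp add: power_0_left)
        ultimately show "dist (v x) (v 0) < e" using d(2) rt0 x by simp
      qed (use d \<rho> in auto)
    qed
  qed
  have lindv: "linear (dv x)" for x
  proof (rule linearI)
    fix s t :: complex and q :: real
    show "dv x (s + t) = dv x s + dv x t"
      by (simp only: dv_def distrib_left plus_complex.sel scaleR_add_left sum.distrib)
    show "dv x (q *\<^sub>R s) = q *\<^sub>R dv x s"
      by (simp only: dv_def mult_scaleR_right scaleR_complex.sel scaleR_sum_right scaleR_scaleR)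
  qed
  \<comment> \<open>Differentiability at 0 follows from the limit of the derivatives, by the mean
    value theorem on the segment from 0 to x: it asks for derivatives at interior points only, and
    these avoid 0.\<close>
  have der0: "(v has_derivative dv 0) (at 0)"
    unfolding has_derivative_at_alt
  proof (intro conjI allI impI)
    show "bounded_linear (dv 0)" using lindv linear_conv_bounded_linear by blast
    fix e :: real assume e: "e > 0"
    have "\<forall>\<^sub>F x in at 0. dist (dv x 1) (dv 0 1) < e / 2 \<and> dist (dv x \<i>) (dv 0 \<i>) < e / 2"
      using e by (intro eventually_conj tendstoD[OF lim0]) auto
    then obtain d where d: "d > 0" "\<And>x. x \<noteq> 0 \<Longrightarrow> norm x < d \<Longrightarrow> dist (dv x 1) (dv 0 1) < e / 2 \<and> dist (dv x \<i>) (dv 0 \<i>) < e / 2"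
      unfolding eventually_at by auto
    have near: "norm (dv x t - dv 0 t) \<le> e * norm t" if x: "x \<noteq> 0" "norm x < d" for x t
    proof -
      have dec: "dv x t = Re t *\<^sub>R dv x 1 + Im t *\<^sub>R dv x \<i>" for x
      proof -
        have t: "t = Re t *\<^sub>R 1 + Im t *\<^sub>R \<i>" by (simp add: complex_eq_iff)
        show ?thesis by (subst t) (simp only: linear_add[OF lindv] linear_cmul[OF lindv])
      qed
      have n: "norm (dv x 1 - dv 0 1) \<le> e / 2" "norm (dv x \<i> - dv 0 \<i>) \<le> e / 2" using d(2)[OF x] by (auto simp: dist_norm)
      have "dv x t - dv 0 t = Re t *\<^sub>R (dv x 1 - dv 0 1) + Im t *\<^sub>R (dv x \<i> - dv 0 \<i>)"
        by (simp add: dec[of x] dec[of 0] algebra_simps)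
      also have "norm \<dots> \<le> norm t * (e / 2) + norm t * (e / 2)"
        by (rule order_trans[OF norm_triangle_ineq], unfold norm_scaleR)
          (intro add_mono mult_mono n abs_Re_le_cmod abs_Im_le_cmod; simp)
      finally show ?thesis by (simp add: mult.commute)
    qed
    show "\<exists>d>0. \<forall>x. norm (x - 0) < d \<longrightarrow> norm (v x - v 0 - dv 0 (x - 0)) \<le> e * norm (x - 0)"
    proof (intro exI[of _ "min d (\<rho> ^ k)"] conjI allI impI)
      fix x :: complex assume x: "norm (x - 0) < min d (\<rho> ^ k)"
      show "norm (v x - v 0 - dv 0 (x - 0)) \<le> e * norm (x - 0)"
      proof (cases "x = 0")
        case False
        define h where "h = (\<lambda>s::real. v (s *\<^sub>R x) - s *\<^sub>R dv 0 x)"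
        have sx: "norm (s *\<^sub>R x) < min d (\<rho> ^ k)" if "s \<in> {0..1}" for s
        proof -
          have "norm (s *\<^sub>R x) \<le> norm x" using that by (simp add: mult_left_le_one_le)
          thus ?thesis using x by simp
        qed
        have dh: "(h has_derivative (\<lambda>t. t *\<^sub>R (dv (s *\<^sub>R x) x - dv 0 x))) (at s)" if s: "s \<in> {0<..<1}" for s
        proof -
          have s0: "s *\<^sub>R x \<noteq> 0" "s *\<^sub>R x \<in> ?D" using s False sx[of s] by auto
          have "((\<lambda>s. s *\<^sub>R x) has_derivative (\<lambda>t. t *\<^sub>R x)) (at s)" by (auto intro!: derivative_eq_intros)
          from has_derivative_compose[OF this der1[OF s0(2,1)]]
          have "((\<lambda>s. v (s *\<^sub>R x)) has_derivative (\<lambda>t. t *\<^sub>R dv (s *\<^sub>R x) x)) (at s)" by (simp add: linear_cmul[OF lindv])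
          moreover have "((\<lambda>s. s *\<^sub>R dv 0 x) has_derivative (\<lambda>t. t *\<^sub>R dv 0 x)) (at s)" by (auto intro!: derivative_eq_intros)
          ultimately have "(h has_derivative (\<lambda>t. t *\<^sub>R dv (s *\<^sub>R x) x - t *\<^sub>R dv 0 x)) (at s)" unfolding h_def by (rule has_derivative_diff)
          thus ?thesis by (simp add: scaleR_diff_right)
        qed
        have ch: "continuous_on {0..1} h"
          unfolding h_def
        proof (intro continuous_intros)
          have "continuous_on ?D v"
            using der1 cont0 by (intro continuous_at_imp_continuous_on ballI) (metis has_derivative_continuous isCont_def)
          thus "continuous_on {0..1} (\<lambda>s. v (s *\<^sub>R x))"
            by (rule continuous_on_compose2) (use sx in \<open>auto intro!: continuous_intros\<close>)
        qed
        obtain s where s: "s \<in> {0<..<1}" "norm (h 1 - h 0) \<le> norm ((1 - 0) *\<^sub>R (dv (s *\<^sub>R x) x - dv 0 x))"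
        proof -
          have "\<exists>s\<in>{0<..<1}. norm (h 1 - h 0) \<le> norm ((\<lambda>s t. t *\<^sub>R (dv (s *\<^sub>R x) x - dv 0 x)) s (1 - 0))"
            by (rule mvt_general[OF zero_less_one ch]) (use dh in auto)
          thus ?thesis using that by auto
        qed
        have "norm (dv (s *\<^sub>R x) x - dv 0 x) \<le> e * norm x" using s(1) False sx[of s] by (intro near) auto
        moreover have "h 1 - h 0 = v x - v 0 - dv 0 (x - 0)" by (simp add: h_def)
        ultimately show ?thesis using s(2) by simp
      next
        case True thus ?thesis by (simp add: linear_0[OF lindv])
      qed
    qed (use d \<rho> in auto)
  qed
  have derv: "(v has_derivative dv x) (at x)" if "x \<in> ?D" for x using der0 der1[OF that] by (cases "x = 0") auto
  have cdv: "((\<lambda>x'. dv x' t) \<longlongrightarrow> dv x t) (at x)" if x: "x \<in> ?D" for x t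
  proof (cases "x = 0")
    case True thus ?thesis using lim0 by simp
  next
    case False
    obtain S g where g: "open S" "x \<in> S" "S \<subseteq> ?D - {0}" "g x = rt x" "\<And>x'. x' \<in> S \<Longrightarrow> g x' ^ k = x' \<and> g x' \<in> ball 0 \<rho> \<and>
      (g has_field_derivative 1 / (of_nat k * g x' ^ (k - 1))) (at x')" using loc[OF x False] by blast
    have eq: "dv x' t = Re (t / (of_nat k * g x' ^ (k - 1))) *\<^sub>R du (g x') 1 + Im (t / (of_nat k * g x' ^ (k - 1))) *\<^sub>R du (g x') \<i>" if x': "x' \<in> S" for x'
    proof -
      have "(v has_derivative (\<lambda>t. du (g x') (t / (of_nat k * g x' ^ (k - 1))))) (at x')" by (rule der[OF g(1) x' g(3)]) (use g(5) x' in auto)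
      from has_derivative_unique[OF this der1[of x']] g(3) x'
      have e: "dv x' t = du (g x') (t / (of_nat k * g x' ^ (k - 1)))" by (metis Diff_iff singletonI subsetD)
      have "g x' \<in> ball 0 \<rho>" using g(5)[OF x'] by blast
      from trans[OF e jcurve_derivative_eq[OF u this]] show ?thesis .
    qed
    have gc: "(g \<longlongrightarrow> g x) (at x)" using g(5)[OF g(2)] DERIV_isCont isCont_def by blast
    have gx0: "g x \<noteq> 0" using rt0[OF False] g(4) by simp
    have gin: "g x \<in> ball 0 \<rho>" using g(5)[OF g(2)] by blast
    have duc: "((\<lambda>x'. du (g x') s) \<longlongrightarrow> du (g x) s) (at x)" for s
    proof -
      have "isCont (\<lambda>z. du z s) (g x)" using jcurveD(4)[OF u, of s] gin by (simp add: continuous_on_eq_continuous_at)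
      thus ?thesis using gc isCont_tendsto_compose by blast
    qed
    have "((\<lambda>x'. Re (t / (of_nat k * g x' ^ (k - 1))) *\<^sub>R du (g x') 1 + Im (t / (of_nat k * g x' ^ (k - 1))) *\<^sub>R du (g x') \<i>) \<longlongrightarrow> dv x t) (at x)"
      unfolding eq[OF g(2)] by (intro tendsto_intros gc duc) (use gx0 k in auto)
    moreover have "\<forall>\<^sub>F x' in at x. Re (t / (of_nat k * g x' ^ (k - 1))) *\<^sub>R du (g x') 1 + Im (t / (of_nat k * g x' ^ (k - 1))) *\<^sub>R du (g x') \<i> = dv x' t"
      unfolding eventually_at_topological using g(1,2) eq by (intro exI[of _ S]) auto
    ultimately show ?thesis by (rule Lim_transform_eventually)
  qed
  have J1: "dv x (\<i> * t) = J (v x) (dv x t)" if "x \<in> ?D" "x \<noteq> 0" for x t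
    using dvrt[OF that] jcurveD(5)[OF u rtin[OF that(1)], of "t / (of_nat k * rt x ^ (k - 1))"] v[OF rtin[OF that(1)]] rt[of x]
    by simp
  have J0: "dv 0 (\<i> * t) = J (v 0) (dv 0 t)" for t
  proof (rule tendsto_unique)
    show "((\<lambda>x. dv x (\<i> * t)) \<longlongrightarrow> dv 0 (\<i> * t)) (at 0)" by (rule lim0)
    have "((\<lambda>x. J (v x) (dv x t)) \<longlongrightarrow> J (v 0) (dv 0 t)) (at 0)" by (rule jcurve_tendsto[OF acs vV[OF 0] lim0 cont0])
    thus "((\<lambda>x. dv x (\<i> * t)) \<longlongrightarrow> J (v 0) (dv 0 t)) (at 0)"
      by (rule Lim_transform_eventually) (use J1 \<rho> in \<open>auto simp: eventually_at intro!: exI[of _ "\<rho> ^ k"]\<close>)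
  qed simp
  show ?thesis
  proof (rule that[of dv])
    show "jcurve J V ?D v dv"
      unfolding jcurve_def
    proof (intro conjI ballI allI)
      show "continuous_on ?D (\<lambda>z. dv z t)" for t using cdv by (auto simp: continuous_on_eq_continuous_at isCont_def)
      show "dv z (\<i> * t) = J (v z) (dv z t)" if "z \<in> ?D" for z t using J0 J1[OF that] by (cases "z = 0") auto
    qed (use vV derv in auto)
  qed
qed

subsection \<open>Charts and tangent spaces\<close>

lemma jcurve_frechet:
  assumes "jcurve J V W u du"
  shows "jcurve J V W u (\<lambda>z. frechet_derivative u (at z))" "z \<in> W \<Longrightarrow> frechet_derivative u (at z) = du z"
proof -
  have *: "frechet_derivative u (at z) = du z" if "z \<in> W" for z
    using frechet_derivative_at[OF jcurveD(3)[OF assms that]] by simp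
  thus "z \<in> W \<Longrightarrow> frechet_derivative u (at z) = du z" .
  show "jcurve J V W u (\<lambda>z. frechet_derivative u (at z))"
    using assms * unfolding jcurve_def by (auto cong: continuous_on_cong)
qed

text \<open>\<open>frechet_derivative\<close> selects the derivative independently of the local
  piece, so the pieces fit together.\<close>

lemma jcurve_glue:
  assumes "\<And>z. z \<in> W \<Longrightarrow> \<exists>W' v dv. z \<in> W' \<and> W' \<subseteq> W \<and> jcurve J V W' v dv \<and> (\<forall>x\<in>W'. v x = u x)"
  shows "jcurve J V W u (\<lambda>z. frechet_derivative u (at z))"
proof -
  have loc: "\<exists>W'. z \<in> W' \<and> W' \<subseteq> W \<and> jcurve J V W' u (\<lambda>z. frechet_derivative u (at z))" if z: "z \<in> W" for z
  proof -
    obtain W' v dv where W': "z \<in> W'" "W' \<subseteq> W" "jcurve J V W' v dv" "\<And>x. x \<in> W' \<Longrightarrow> v x = u x" using assms[OF z] by blast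
    have "jcurve J V W' u dv"
      unfolding jcurve_def
    proof (intro conjI ballI allI)
      show "(u has_derivative dv x) (at x)" if "x \<in> W'" for x
        by (rule has_derivative_transform_within_open[OF jcurveD(3)[OF W'(3) that] jcurveD(1)[OF W'(3)] that W'(4)])
      show "open W'" by (rule jcurveD(1)[OF W'(3)])
      show "u ` W' \<subseteq> V"
      proof (rule image_subsetI)
        fix x assume x: "x \<in> W'"
        show "u x \<in> V" using jcurveD(2)[OF W'(3) x] W'(4)[OF x] by simp
      qed
      show "continuous_on W' (\<lambda>z. dv z t)" for t by (rule jcurveD(4)[OF W'(3)])
      show "dv x (\<i> * t) = J (u x) (dv x t)" if "x \<in> W'" for x t
        using jcurveD(5)[OF W'(3) that, of t] unfolding W'(4)[OF that] .
    qed
    thus ?thesis using jcurve_frechet(1) W'(1,2) by blast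
  qed
  then obtain Wf where Wf: "\<And>z. z \<in> W \<Longrightarrow> z \<in> Wf z" "\<And>z. z \<in> W \<Longrightarrow> Wf z \<subseteq> W"
    "\<And>z. z \<in> W \<Longrightarrow> jcurve J V (Wf z) u (\<lambda>z. frechet_derivative u (at z))"
    by metis
  show ?thesis
    unfolding jcurve_def
  proof (intro conjI ballI allI)
    have "\<exists>T. open T \<and> z \<in> T \<and> T \<subseteq> W" if "z \<in> W" for z
      using Wf[OF that] jcurveD(1)[OF Wf(3)[OF that]] by blast
    thus "open W" by (subst open_subopen) blast
    show "u ` W \<subseteq> V" by (rule image_subsetI) (rule jcurveD(2)[OF Wf(3) Wf(1)])
    show "(u has_derivative frechet_derivative u (at z)) (at z)" if "z \<in> W" for z
      by (rule jcurveD(3)[OF Wf(3)[OF that] Wf(1)[OF that]])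
    show "frechet_derivative u (at z) (\<i> * t) = J (u z) (frechet_derivative u (at z) t)" if "z \<in> W" for z t
      by (rule jcurveD(5)[OF Wf(3)[OF that] Wf(1)[OF that]])
    show "continuous_on W (\<lambda>z. frechet_derivative u (at z) t)" for t
    proof (rule continuous_at_imp_continuous_on, rule ballI)
      fix z assume z: "z \<in> W"
      show "isCont (\<lambda>z. frechet_derivative u (at z) t) z"
        using jcurveD(4)[OF Wf(3)[OF z], of t] jcurveD(1)[OF Wf(3)[OF z]] Wf(1)[OF z] by (simp add: continuous_on_eq_continuous_at)
    qed
  qed
qed

lemma jcurve_compose:
  assumes u: "jcurve J V W u du" and "open W'" "h holomorphic_on W'" "h ` W' \<subseteq> W"
  shows "jcurve J V W' (u \<circ> h) (\<lambda>z t. du (h z) (deriv h z * t))"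
  unfolding jcurve_def
proof (intro conjI ballI allI)
  show "open W'" by fact
  show "(u \<circ> h) ` W' \<subseteq> V" using jcurveD(2)[OF u] assms(4) by auto
  fix z assume z: "z \<in> W'"
  have hz: "h z \<in> W" using z assms(4) by blast
  have "(h has_derivative (\<lambda>t. deriv h z * t)) (at z)"
    using holomorphic_derivI[OF assms(3,2) z] by (simp add: has_field_derivative_def)
  from has_derivative_compose[OF this jcurveD(3)[OF u hz]]
  show "((u \<circ> h) has_derivative (\<lambda>t. du (h z) (deriv h z * t))) (at z)" by (simp add: o_def)
  show "du (h z) (deriv h z * (\<i> * t)) = J ((u \<circ> h) z) (du (h z) (deriv h z * t))" for t
    using jcurveD(5)[OF u hz, of "deriv h z * t"] by (simp add: mult_ac)
next
  fix t
  have ch: "continuous_on W' h" by (rule holomorphic_on_imp_continuous_on[OF assms(3)])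
  have cd: "continuous_on W' (deriv h)" by (rule holomorphic_on_imp_continuous_on[OF holomorphic_deriv[OF assms(3,2)]])
  have "continuous_on W' (\<lambda>z. Re (deriv h z * t) *\<^sub>R du (h z) 1 + Im (deriv h z * t) *\<^sub>R du (h z) \<i>)"
    by (intro continuous_intros cd continuous_on_compose2[OF jcurveD(4)[OF u] ch] assms)
  moreover have "Re (deriv h z * t) *\<^sub>R du (h z) 1 + Im (deriv h z * t) *\<^sub>R du (h z) \<i> = du (h z) (deriv h z * t)" if "z \<in> W'" for z
    using jcurve_derivative_eq[OF u, of "h z" "deriv h z * t"] that assms(4) by auto
  ultimately show "continuous_on W' (\<lambda>z. du (h z) (deriv h z * t))" by (simp cong: continuous_on_cong)
qed

section \<open>Charts and the domains of coordinate expressions\<close>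

lemma is_chart_subset: "is_chart M c \<Longrightarrow> fst c \<subseteq> topspace M"
  by (simp add: is_chart_def openin_subset)

lemma is_chart_inj: "is_chart M c \<Longrightarrow> inj_on (snd c) (fst c)"
  using homeomorphic_imp_injective_map[of "subtopology M (fst c)" "top_of_set (snd c ` fst c)" "snd c"] is_chart_subset[of M c]
  by (simp add: is_chart_def Int_absorb1)

lemma chart_inv_in: "y \<in> snd c ` fst c \<Longrightarrow> chart_inv c y \<in> fst c"
  and chart_chart_inv: "y \<in> snd c ` fst c \<Longrightarrow> snd c (chart_inv c y) = y"
  by (auto simp: chart_inv_def inv_into_into f_inv_into_f)

lemma chart_inv_chart: "is_chart M c \<Longrightarrow> p \<in> fst c \<Longrightarrow> chart_inv c (snd c p) = p"
  by (simp add: chart_inv_def is_chart_inj)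

lemma is_chart_continuous: "is_chart M c \<Longrightarrow> continuous_map (subtopology M (fst c)) euclidean (snd c)"
  unfolding is_chart_def using homeomorphic_imp_continuous_map continuous_map_in_subtopology by blast

text \<open>\<open>chart_inv\<close> has arbitrary values off the image of the chart; on the image
  it agrees with the inverse homeomorphism.\<close>

lemma chart_inv_continuous:
  assumes "is_chart M c"
  shows "continuous_map (top_of_set (snd c ` fst c)) M (chart_inv c)"
proof -
  have "homeomorphic_map (subtopology M (fst c)) (top_of_set (snd c ` fst c)) (snd c)" using assms by (simp add: is_chart_def)
  then obtain g where g: "homeomorphic_maps (subtopology M (fst c)) (top_of_set (snd c ` fst c)) (snd c) g"
    by (auto simp: homeomorphic_map_maps)
  have "continuous_map (top_of_set (snd c ` fst c)) (subtopology M (fst c)) g" using g by (simp add: homeomorphic_maps_def)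
  hence "continuous_map (top_of_set (snd c ` fst c)) M g" using continuous_map_in_subtopology by blast
  moreover have "g y = chart_inv c y" if y: "y \<in> topspace (top_of_set (snd c ` fst c))" for y
  proof -
    obtain p where p: "p \<in> fst c" "y = snd c p" using y by auto
    have "g (snd c p) = p" using g p is_chart_subset[OF assms] by (auto simp: homeomorphic_maps_def topspace_subtopology_subset)
    thus ?thesis using p chart_inv_chart[OF assms] by simp
  qed
  ultimately show ?thesis by (rule continuous_map_eq)
qed

lemma local_dom_eq: "is_chart M c \<Longrightarrow> local_dom c d f = {y \<in> snd c ` fst c. f (chart_inv c y) \<in> fst d}"
  by (auto simp: local_dom_def chart_inv_chart)

lemma open_local_dom:
  assumes "is_chart M c" "is_chart N d" "continuous_map M N f"
  shows "open (local_dom c d f)"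
proof -
  have "continuous_map (top_of_set (snd c ` fst c)) N (f \<circ> chart_inv c)"
    by (rule continuous_map_compose[OF chart_inv_continuous[OF assms(1)] assms(3)])
  moreover have "openin N (fst d)" using assms(2) by (simp add: is_chart_def)
  ultimately have "openin (top_of_set (snd c ` fst c)) {y \<in> topspace (top_of_set (snd c ` fst c)). (f \<circ> chart_inv c) y \<in> fst d}"
    by (rule openin_continuous_map_preimage)
  hence "openin (top_of_set (snd c ` fst c)) (local_dom c d f)" by (simp add: local_dom_eq[OF assms(1)])
  thus ?thesis using assms(1) openin_open_eq unfolding is_chart_def by blast
qed

lemma Ck_on_1: "Ck_on 1 f U \<longleftrightarrow> (\<forall>x\<in>U. f differentiable (at x)) \<and> (\<forall>v. continuous_on U (\<lambda>x. frechet_derivative f (at x) v))"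
  by (simp add: One_nat_def del: One_nat_def[symmetric])

text \<open>The part of the smoothness of an atlas that the tangent space formalism uses.\<close>

definition diff_atlas :: "'a topology \<Rightarrow> ('a, 'e::euclidean_space) chart set \<Rightarrow> bool" where
  "diff_atlas M A \<longleftrightarrow> (\<forall>c\<in>A. is_chart M c) \<and>
     (\<forall>c\<in>A. \<forall>d\<in>A. \<forall>x\<in>local_dom c d id. (local_rep c d id) differentiable (at x))"

lemma diff_atlas_smooth: "smooth_manifold M A \<Longrightarrow> diff_atlas M A"
  unfolding smooth_manifold_def topological_manifold_def diff_atlas_def by (metis Ck_on.simps(2))

lemma open_transition_dom: "is_chart M c \<Longrightarrow> is_chart M d \<Longrightarrow> open (local_dom c d id)"
  by (rule open_local_dom) (auto intro: continuous_map_id[unfolded id_def] simp: id_def)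

lemma diff_atlas_riemann:
  assumes "riemann_surface M A"
  shows "diff_atlas M A"
proof -
  have ch: "is_chart M c" if "c \<in> A" for c using assms that by (auto simp: riemann_surface_def topological_manifold_def)
  have "(local_rep c d id) differentiable (at x)" if cd: "c \<in> A" "d \<in> A" and x: "x \<in> local_dom c d id" for c d x
  proof -
    have "(local_rep c d id) holomorphic_on (local_dom c d id)" using assms cd by (auto simp: riemann_surface_def)
    from holomorphic_on_imp_differentiable_at[OF this open_transition_dom[OF ch ch] x] cd
    show ?thesis using field_differentiable_imp_differentiable by blast
  qed
  thus ?thesis using ch by (auto simp: diff_atlas_def)
qed

text \<open>The chain rule on the open set where the composite of the coordinate expressions agrees
  with the new one; elsewhere \<open>local_rep\<close> has no meaning.\<close>

lemma frechet_change_target: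
  assumes B: "diff_atlas N B" and c: "is_chart M c" and de: "d \<in> B" "e \<in> B"
    and p: "p \<in> fst c" "f p \<in> fst d" "f p \<in> fst e" and cont: "continuous_map M N f"
    and diff: "(local_rep c d f) differentiable (at (snd c p))"
  shows "frechet_derivative (local_rep c e f) (at (snd c p)) v
    = frechet_derivative (local_rep d e id) (at (snd d (f p))) (frechet_derivative (local_rep c d f) (at (snd c p)) v)"
proof -
  have ch: "is_chart N d" "is_chart N e" using B de by (auto simp: diff_atlas_def)
  have pd: "local_rep c d f (snd c p) = snd d (f p)" using p c by (simp add: local_rep_def chart_inv_chart)
  have "snd d (f p) \<in> local_dom d e id" using p by (auto simp: local_dom_def)
  hence d1: "(local_rep d e id has_derivative frechet_derivative (local_rep d e id) (at (snd d (f p)))) (at (local_rep c d f (snd c p)))"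
    using B de by (auto simp: diff_atlas_def pd frechet_derivative_works[symmetric])
  have d2: "(local_rep c d f has_derivative frechet_derivative (local_rep c d f) (at (snd c p))) (at (snd c p))"
    using diff frechet_derivative_works by blast
  have comp: "((\<lambda>x. local_rep d e id (local_rep c d f x)) has_derivative
    (\<lambda>v. frechet_derivative (local_rep d e id) (at (snd d (f p))) (frechet_derivative (local_rep c d f) (at (snd c p)) v))) (at (snd c p))"
    by (rule has_derivative_compose[OF d2 d1])
  have "(local_rep c e f has_derivative
    (\<lambda>v. frechet_derivative (local_rep d e id) (at (snd d (f p))) (frechet_derivative (local_rep c d f) (at (snd c p)) v))) (at (snd c p))"
  proof (rule has_derivative_transform_within_open[OF comp open_local_dom[OF c ch(1) cont]])
    show "snd c p \<in> local_dom c d f" using p by (auto simp: local_dom_def)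
    show "local_rep d e id (local_rep c d f x) = local_rep c e f x" if "x \<in> local_dom c d f" for x
      using that chart_inv_chart[OF ch(1)] by (auto simp: local_dom_eq[OF c] local_rep_def)
  qed
  from frechet_derivative_at[OF this] show ?thesis by metis
qed

lemma frechet_change_source:
  assumes A: "diff_atlas M A" and cc: "c \<in> A" "c' \<in> A" and d: "is_chart N d"
    and p: "p \<in> fst c" "p \<in> fst c'" "f p \<in> fst d"
    and diff: "(local_rep c' d f) differentiable (at (snd c' p))"
  shows "frechet_derivative (local_rep c d f) (at (snd c p)) v
    = frechet_derivative (local_rep c' d f) (at (snd c' p)) (frechet_derivative (local_rep c c' id) (at (snd c p)) v)"
proof -
  have ch: "is_chart M c" "is_chart M c'" using A cc by (auto simp: diff_atlas_def)
  have pd: "local_rep c c' id (snd c p) = snd c' p" using p ch by (simp add: local_rep_def chart_inv_chart)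
  have "snd c p \<in> local_dom c c' id" using p by (auto simp: local_dom_def)
  hence d1: "(local_rep c c' id has_derivative frechet_derivative (local_rep c c' id) (at (snd c p))) (at (snd c p))"
    using A cc by (auto simp: diff_atlas_def frechet_derivative_works[symmetric])
  have d2: "(local_rep c' d f has_derivative frechet_derivative (local_rep c' d f) (at (snd c' p))) (at (local_rep c c' id (snd c p)))"
    unfolding pd using diff frechet_derivative_works by blast
  have comp: "((\<lambda>x. local_rep c' d f (local_rep c c' id x)) has_derivative
    (\<lambda>v. frechet_derivative (local_rep c' d f) (at (snd c' p)) (frechet_derivative (local_rep c c' id) (at (snd c p)) v))) (at (snd c p))"
    by (rule has_derivative_compose[OF d1 d2])
  have "(local_rep c d f has_derivative
    (\<lambda>v. frechet_derivative (local_rep c' d f) (at (snd c' p)) (frechet_derivative (local_rep c c' id) (at (snd c p)) v))) (at (snd c p))"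
  proof (rule has_derivative_transform_within_open[OF comp open_transition_dom[OF ch]])
    show "snd c p \<in> local_dom c c' id" using p by (auto simp: local_dom_def)
    show "local_rep c' d f (local_rep c c' id x) = local_rep c d f x" if "x \<in> local_dom c c' id" for x
      using that chart_inv_chart[OF ch(2)] by (auto simp: local_dom_eq[OF ch(1)] local_rep_def)
  qed
  from frechet_derivative_at[OF this] show ?thesis by metis
qed

section \<open>Tangent vectors, the differential and J in coordinates\<close>

lemma charts_atD: "c \<in> charts_at A p \<Longrightarrow> c \<in> A \<and> p \<in> fst c"
  by (simp add: charts_at_def)

lemma transition_has_derivative:
  assumes A: "diff_atlas M A" and "c \<in> charts_at A p" "d \<in> charts_at A p"
  shows "(local_rep c d id has_derivative frechet_derivative (local_rep c d id) (at (snd c p))) (at (snd c p))"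
proof -
  have "snd c p \<in> local_dom c d id" using assms by (auto simp: local_dom_def charts_at_def)
  thus ?thesis using assms by (auto simp: diff_atlas_def charts_at_def frechet_derivative_works[symmetric])
qed

lemma tangent_of_coord_same:
  assumes A: "diff_atlas M A" and c: "c \<in> charts_at A p"
  shows "tangent_of_coord A p c v c = v"
proof -
  have ch: "is_chart M c" using A c by (auto simp: diff_atlas_def charts_at_def)
  have "((\<lambda>x. x) has_derivative (\<lambda>v. v)) (at (snd c p))" by (rule has_derivative_ident)
  hence "(local_rep c c id has_derivative (\<lambda>v. v)) (at (snd c p))"
  proof (rule has_derivative_transform_within_open)
    show "open (snd c ` fst c)" using ch by (simp add: is_chart_def)
    show "snd c p \<in> snd c ` fst c" using c by (auto simp: charts_at_def)
    show "x = local_rep c c id x" if "x \<in> snd c ` fst c" for x using that by (simp add: local_rep_def chart_chart_inv)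
  qed
  from frechet_derivative_at[OF this] show ?thesis using c by (simp add: tangent_of_coord_def) metis
qed

lemma tangent_of_coord_in:
  assumes A: "diff_atlas M A" and c: "c \<in> charts_at A p"
  shows "tangent_of_coord A p c v \<in> tangent_space A p"
  unfolding tangent_space_def
proof (intro CollectI conjI allI impI ballI)
  show "tangent_of_coord A p c v d = 0" if "d \<notin> charts_at A p" for d using that by (simp add: tangent_of_coord_def)
  fix d e assume de: "d \<in> charts_at A p" "e \<in> charts_at A p"
  have "(local_rep c d id) differentiable (at (snd c p))"
    using transition_has_derivative[OF A c de(1)] differentiable_def by blast
  thus "tangent_of_coord A p c v e = frechet_derivative (local_rep d e id) (at (snd d p)) (tangent_of_coord A p c v d)"
    using frechet_change_target[OF A, of M c d e p id v] A c de
    by (auto simp: tangent_of_coord_def charts_at_def diff_atlas_def)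
qed

lemma tangent_spaceD:
  assumes "\<xi> \<in> tangent_space A p"
  shows "c \<notin> charts_at A p \<Longrightarrow> \<xi> c = 0"
    "c \<in> charts_at A p \<Longrightarrow> d \<in> charts_at A p \<Longrightarrow> \<xi> d = frechet_derivative (local_rep c d id) (at (snd c p)) (\<xi> c)"
  using assms unfolding tangent_space_def by blast+

lemma tangent_space_eq:
  assumes "\<xi> \<in> tangent_space A p" "c \<in> charts_at A p"
  shows "\<xi> = tangent_of_coord A p c (\<xi> c)"
proof
  fix d show "\<xi> d = tangent_of_coord A p c (\<xi> c) d"
    using tangent_spaceD(1)[OF assms(1), of d] tangent_spaceD(2)[OF assms, of d] by (cases "d \<in> charts_at A p") (simp_all add: tangent_of_coord_def)
qed

lemma linear_tangent_of_coord:
  assumes A: "diff_atlas M A" and c: "c \<in> charts_at A p"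
  shows "tangent_of_coord A p c (a *\<^sub>R v + b *\<^sub>R w) = (\<lambda>d. a *\<^sub>R tangent_of_coord A p c v d + b *\<^sub>R tangent_of_coord A p c w d)"
proof
  fix d
  show "tangent_of_coord A p c (a *\<^sub>R v + b *\<^sub>R w) d = a *\<^sub>R tangent_of_coord A p c v d + b *\<^sub>R tangent_of_coord A p c w d"
  proof (cases "d \<in> charts_at A p")
    case True
    have "linear (frechet_derivative (local_rep c d id) (at (snd c p)))"
      using transition_has_derivative[OF A c True] by (rule has_derivative_linear)
    thus ?thesis using True by (simp add: tangent_of_coord_def linear_add linear_cmul)
  qed (simp add: tangent_of_coord_def)
qed

text \<open>The plain function inside \<open>coord_endomorphism\<close>. \<open>Blinfun\<close> of
  it is meaningful only once boundedness is known, so the linear algebra is done with this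
  version.\<close>

definition coord_J :: "('a, 'e::euclidean_space) chart set \<Rightarrow> ('a \<Rightarrow> ('a, 'e) tangent \<Rightarrow> ('a, 'e) tangent) \<Rightarrow> ('a, 'e) chart \<Rightarrow> 'e \<Rightarrow> 'e \<Rightarrow> 'e" where
  "coord_J A J c y v = J (chart_inv c y) (tangent_of_coord A (chart_inv c y) c v) c"

lemma acs_on_coord_J:
  assumes A: "diff_atlas M A" and J: "almost_complex_structure M A J" and L: "lipschitz_structure A J" and c: "c \<in> A"
  shows "acs_on (coord_J A J c) (snd c ` fst c)"
  unfolding acs_on_def
proof (intro conjI ballI allI)
  have ch: "is_chart M c" using A c by (auto simp: diff_atlas_def)
  show "open (snd c ` fst c)" using ch by (simp add: is_chart_def)
  have lin: "linear (coord_J A J c y)" and sq: "coord_J A J c y (coord_J A J c y v) = - v" if y: "y \<in> snd c ` fst c" for y v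
  proof -
    define p where "p = chart_inv c y"
    have cp: "c \<in> charts_at A p" using chart_inv_in[OF y] c by (simp add: charts_at_def p_def)
    have pM: "p \<in> topspace M" using cp is_chart_subset[OF ch] by (auto simp: charts_at_def)
    have te: "tangent_endomorphism A p (J p)" and sq: "\<And>\<xi>. \<xi> \<in> tangent_space A p \<Longrightarrow> J p (J p \<xi>) = (\<lambda>c. - \<xi> c)"
      using J pM by (auto simp: almost_complex_structure_def)
    note tin = tangent_of_coord_in[OF A cp]
    have add: "coord_J A J c y (a *\<^sub>R v + b *\<^sub>R w) = a *\<^sub>R coord_J A J c y v + b *\<^sub>R coord_J A J c y w" for a b v w
      using te tin unfolding tangent_endomorphism_def coord_J_def p_def[symmetric] linear_tangent_of_coord[OF A cp] by simp
    show "linear (coord_J A J c y)"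
    proof (rule linearI)
      show "coord_J A J c y (v + w) = coord_J A J c y v + coord_J A J c y w" for v w using add[of 1 v 1 w] by simp
      show "coord_J A J c y (r *\<^sub>R v) = r *\<^sub>R coord_J A J c y v" for r v using add[of r v 0 v] by simp
    qed
    have "J p (tangent_of_coord A p c v) \<in> tangent_space A p" using te tin by (simp add: tangent_endomorphism_def)
    from tangent_space_eq[OF this cp]
    have "tangent_of_coord A p c (coord_J A J c y v) = J p (tangent_of_coord A p c v)" by (simp add: coord_J_def p_def)
    hence "coord_J A J c y (coord_J A J c y v) = J p (J p (tangent_of_coord A p c v)) c"
      by (subst coord_J_def) (simp add: p_def)
    thus "coord_J A J c y (coord_J A J c y v) = - v" using sq[OF tin] tangent_of_coord_same[OF A cp] by simp
  qed
  show "linear (coord_J A J c y)" "\<And>v. coord_J A J c y (coord_J A J c y v) = - v" if "y \<in> snd c ` fst c" for y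
    using lin[OF that] sq[OF that] by auto
  fix y assume y: "y \<in> snd c ` fst c"
  obtain r L where r: "r > 0" and Lip: "L-lipschitz_on (ball y r \<inter> snd c ` fst c) (coord_endomorphism A J c)"
    using L c y unfolding lipschitz_structure_def by blast
  have ap: "blinfun_apply (coord_endomorphism A J c p) = coord_J A J c p" if "p \<in> snd c ` fst c" for p
  proof -
    have "bounded_linear (coord_J A J c p)" using lin[OF that] linear_conv_bounded_linear by blast
    hence "blinfun_apply (Blinfun (coord_J A J c p)) = coord_J A J c p" by (rule bounded_linear_Blinfun_apply)
    moreover have "coord_endomorphism A J c p = Blinfun (coord_J A J c p)" by (simp add: coord_endomorphism_def coord_J_def[abs_def] Let_def)
    ultimately show ?thesis by simp
  qed
  show "\<exists>r>0. \<exists>L. \<forall>p\<in>ball y r \<inter> snd c ` fst c. \<forall>q\<in>ball y r \<inter> snd c ` fst c. \<forall>v.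
     norm (coord_J A J c p v - coord_J A J c q v) \<le> L * norm (p - q) * norm v"
  proof (rule exI[of _ r], rule conjI[OF r], rule exI[of _ L], intro ballI allI)
    fix p q v assume p: "p \<in> ball y r \<inter> snd c ` fst c" and q: "q \<in> ball y r \<inter> snd c ` fst c"
    have "norm (coord_J A J c p v - coord_J A J c q v) = norm (blinfun_apply (coord_endomorphism A J c p - coord_endomorphism A J c q) v)"
      using ap p q by (simp add: blinfun.diff_left)
    also have "\<dots> \<le> norm (coord_endomorphism A J c p - coord_endomorphism A J c q) * norm v" by (rule norm_blinfun)
    also have "\<dots> \<le> (L * norm (p - q)) * norm v"
      using lipschitz_onD[OF Lip p q] by (intro mult_right_mono) (auto simp: dist_norm)
    finally show "norm (coord_J A J c p v - coord_J A J c q v) \<le> L * norm (p - q) * norm v" .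
  qed
qed

text \<open>\<open>differential\<close> works in a chart picked by \<open>SOME\<close>; the chain
  rule makes the choice immaterial.\<close>

lemma differential_chart:
  assumes A: "diff_atlas M A" and B: "diff_atlas N B" and f: "C1_map M A N B f" and c: "c \<in> charts_at A s" and d: "d \<in> charts_at B (f s)"
    and \<xi>: "\<xi> \<in> tangent_space A s"
  shows "differential A B f s \<xi> = tangent_of_coord B (f s) d (frechet_derivative (local_rep c d f) (at (snd c s)) (\<xi> c))"
proof
  fix e
  define c0 where "c0 = (SOME c. c \<in> charts_at A s)"
  have c0: "c0 \<in> charts_at A s" unfolding c0_def using c by (rule someI)
  have diff: "(local_rep c' d' f) differentiable (at (snd c' s))" if "c' \<in> charts_at A s" "d' \<in> charts_at B (f s)" for c' d'
  proof -
    have "snd c' s \<in> local_dom c' d' f" using that by (auto simp: local_dom_def charts_at_def)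
    thus ?thesis using f that unfolding C1_map_def Ck_on_1 by (auto simp: charts_at_def)
  qed
  have cont: "continuous_map M N f" using f by (simp add: C1_map_def)
  show "differential A B f s \<xi> e = tangent_of_coord B (f s) d (frechet_derivative (local_rep c d f) (at (snd c s)) (\<xi> c)) e"
  proof (cases "e \<in> charts_at B (f s)")
    case True
    have "\<xi> c0 = frechet_derivative (local_rep c c0 id) (at (snd c s)) (\<xi> c)" by (rule tangent_spaceD(2)[OF \<xi> c c0])
    hence "frechet_derivative (local_rep c0 e f) (at (snd c0 s)) (\<xi> c0) = frechet_derivative (local_rep c e f) (at (snd c s)) (\<xi> c)"
      using frechet_change_source[OF A, of c c0 N e s f "\<xi> c"] diff[OF c0 True] charts_atD[OF c] charts_atD[OF c0] charts_atD[OF True] B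
      by (auto simp: diff_atlas_def)
    also have "\<dots> = frechet_derivative (local_rep d e id) (at (snd d (f s))) (frechet_derivative (local_rep c d f) (at (snd c s)) (\<xi> c))"
      using charts_atD[OF c] charts_atD[OF d] charts_atD[OF True] diff[OF c d] A by (intro frechet_change_target[OF B _ _ _ _ _ _ cont]) (auto simp: diff_atlas_def)
    finally show ?thesis using True by (simp add: differential_def tangent_of_coord_def c0_def Let_def)
  qed (simp add: differential_def tangent_of_coord_def Let_def)
qed

lemma J_holomorphic_imp_jcurve:
  assumes S: "riemann_surface S A" and B: "diff_atlas X B"
    and u: "J_holomorphic S A X B J u" and c: "c \<in> A" and d: "d \<in> B"
  shows "jcurve (coord_J B J d) (snd d ` fst d) (local_dom c d u) (local_rep c d u) (\<lambda>z. frechet_derivative (local_rep c d u) (at z))"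
proof -
  have A: "diff_atlas S A" by (rule diff_atlas_riemann[OF S])
  have ch: "is_chart S c" "is_chart X d" using A B c d by (auto simp: diff_atlas_def)
  have C1: "C1_map S A X B u" using u by (simp add: J_holomorphic_def)
  have cont: "continuous_map S X u" using C1 by (simp add: C1_map_def)
  have Ck: "Ck_on 1 (local_rep c d u) (local_dom c d u)" using C1 c d by (simp add: C1_map_def)
  show ?thesis
    unfolding jcurve_def
  proof (intro conjI ballI allI)
    show "open (local_dom c d u)" by (rule open_local_dom[OF ch cont])
    show "local_rep c d u ` local_dom c d u \<subseteq> snd d ` fst d" using chart_inv_chart[OF ch(1)] by (auto simp: local_dom_def local_rep_def)
    show "(local_rep c d u has_derivative frechet_derivative (local_rep c d u) (at z)) (at z)" if "z \<in> local_dom c d u" for z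
      using Ck that unfolding Ck_on_1 frechet_derivative_works by blast
    show "continuous_on (local_dom c d u) (\<lambda>z. frechet_derivative (local_rep c d u) (at z) t)" for t using Ck unfolding Ck_on_1 by blast
    fix z t assume "z \<in> local_dom c d u"
    then obtain s where s: "s \<in> fst c" "u s \<in> fst d" "z = snd c s" by (auto simp: local_dom_def)
    have cs: "c \<in> charts_at A s" and du: "d \<in> charts_at B (u s)" using s c d by (auto simp: charts_at_def)
    have sS: "s \<in> topspace S" using s is_chart_subset[OF ch(1)] by blast
    have lr: "local_rep c d u z = snd d (u s)" using s chart_inv_chart[OF ch(1)] by (simp add: local_rep_def)
    have ci: "chart_inv d (snd d (u s)) = u s" using s chart_inv_chart[OF ch(2)] by simp
    define \<xi> where "\<xi> = tangent_of_coord A s c t"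
    have \<xi>: "\<xi> \<in> tangent_space A s" "\<xi> c = t" unfolding \<xi>_def by (rule tangent_of_coord_in[OF A cs], rule tangent_of_coord_same[OF A cs])
    \<comment> \<open>Multiplying all coordinates by i at once yields a tangent vector because the
      transition derivatives are complex linear.\<close>
    have "complex_structure \<xi> = tangent_of_coord A s c (\<i> * t)"
    proof
      fix e
      show "complex_structure \<xi> e = tangent_of_coord A s c (\<i> * t) e"
      proof (cases "e \<in> charts_at A s")
        case True
        have "(local_rep c e id) holomorphic_on (local_dom c e id)" using S c True by (auto simp: riemann_surface_def charts_at_def)
        moreover have "open (local_dom c e id)" using A c True by (intro open_transition_dom) (auto simp: diff_atlas_def charts_at_def)
        moreover have "snd c s \<in> local_dom c e id" using s True by (auto simp: local_dom_def charts_at_def)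
        ultimately have "(local_rep c e id has_field_derivative deriv (local_rep c e id) (snd c s)) (at (snd c s))" by (rule holomorphic_derivI)
        hence "frechet_derivative (local_rep c e id) (at (snd c s)) = (*) (deriv (local_rep c e id) (snd c s))"
          using frechet_derivative_at has_field_derivative_def by metis
        thus ?thesis using True by (simp add: complex_structure_def \<xi>_def tangent_of_coord_def)
      qed (simp add: complex_structure_def \<xi>_def tangent_of_coord_def)
    qed
    hence cs\<xi>: "complex_structure \<xi> \<in> tangent_space A s" "complex_structure \<xi> c = \<i> * t"
      using tangent_of_coord_in[OF A cs] tangent_of_coord_same[OF A cs] by auto
    have "differential A B u s (complex_structure \<xi>) = J (u s) (differential A B u s \<xi>)"
      using u sS \<xi>(1) by (simp add: J_holomorphic_def)
    hence "tangent_of_coord B (u s) d (frechet_derivative (local_rep c d u) (at z) (\<i> * t)) d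
       = J (u s) (tangent_of_coord B (u s) d (frechet_derivative (local_rep c d u) (at z) t)) d"
      by (simp add: differential_chart[OF A B C1 cs du] \<xi> cs\<xi> s(3))
    thus "frechet_derivative (local_rep c d u) (at z) (\<i> * t) = coord_J B J d (local_rep c d u z) (frechet_derivative (local_rep c d u) (at z) t)"
      by (simp add: tangent_of_coord_same[OF B du] coord_J_def lr ci)
  qed
qed

lemma jcurve_imp_J_holomorphic:
  assumes S: "riemann_surface S A" and B: "diff_atlas X B" and cov: "\<Union> (fst ` B) = topspace X"
    and J: "almost_complex_structure X B J" and cont: "continuous_map S X u"
    and H: "\<And>c d. c \<in> A \<Longrightarrow> d \<in> B \<Longrightarrow>
      jcurve (coord_J B J d) (snd d ` fst d) (local_dom c d u) (local_rep c d u) (\<lambda>z. frechet_derivative (local_rep c d u) (at z))"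
  shows "J_holomorphic S A X B J u"
proof -
  have A: "diff_atlas S A" by (rule diff_atlas_riemann[OF S])
  have C1: "C1_map S A X B u"
    unfolding C1_map_def Ck_on_1 using cont jcurveD(3,4)[OF H] differentiable_def by blast
  show ?thesis
    unfolding J_holomorphic_def
  proof (intro conjI C1 ballI)
    fix s \<xi> assume s: "s \<in> topspace S" and \<xi>: "\<xi> \<in> tangent_space A s"
    have "s \<in> \<Union> (fst ` A)" using S s by (simp add: riemann_surface_def topological_manifold_def)
    then obtain c1 where "c1 \<in> charts_at A s" unfolding charts_at_def by blast
    define c where "c = (SOME c. c \<in> charts_at A s)"
    have c: "c \<in> charts_at A s" unfolding c_def using \<open>c1 \<in> charts_at A s\<close> by (rule someI)
    have chc: "is_chart S c" using A c by (auto simp: diff_atlas_def charts_at_def)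
    have us: "u s \<in> topspace X" using cont s by (auto simp: continuous_map_def)
    hence "u s \<in> \<Union> (fst ` B)" by (simp add: cov)
    then obtain d where d: "d \<in> charts_at B (u s)" unfolding charts_at_def by blast
    have te: "tangent_endomorphism B (u s) (J (u s))" using J us by (auto simp: almost_complex_structure_def)
    show "differential A B u s (complex_structure \<xi>) = J (u s) (differential A B u s \<xi>)"
    proof
      fix e
      show "differential A B u s (complex_structure \<xi>) e = J (u s) (differential A B u s \<xi>) e"
      proof (cases "e \<in> charts_at B (u s)")
        case True
        have che: "is_chart X e" using B True by (auto simp: diff_atlas_def charts_at_def)
        have z: "snd c s \<in> local_dom c e u" using c True by (auto simp: local_dom_def charts_at_def)
        have lr: "local_rep c e u (snd c s) = snd e (u s)" using c chart_inv_chart[OF chc] by (simp add: local_rep_def charts_at_def)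
        have ci: "chart_inv e (snd e (u s)) = u s" using True chart_inv_chart[OF che] by (simp add: charts_at_def)
        have "differential A B u s (complex_structure \<xi>) e = frechet_derivative (local_rep c e u) (at (snd c s)) (\<i> * \<xi> c)"
          using True by (simp add: differential_def c_def complex_structure_def Let_def)
        also have "\<dots> = coord_J B J e (local_rep c e u (snd c s)) (frechet_derivative (local_rep c e u) (at (snd c s)) (\<xi> c))"
          using jcurveD(5)[OF H z] c True by (auto simp: charts_at_def)
        also have "\<dots> = J (u s) (tangent_of_coord B (u s) e (frechet_derivative (local_rep c e u) (at (snd c s)) (\<xi> c))) e"
          by (simp add: coord_J_def lr ci)
        also have "tangent_of_coord B (u s) e (frechet_derivative (local_rep c e u) (at (snd c s)) (\<xi> c)) = differential A B u s \<xi>"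
          by (rule differential_chart[OF A B C1 c True \<xi>, symmetric])
        finally show ?thesis .
      next
        \<comment> \<open>A chart that misses u s: both sides are 0 by the convention for tangent
          vectors, the right one because J preserves the tangent space.\<close>
        case False
        have "differential A B u s \<xi> \<in> tangent_space B (u s)"
          unfolding differential_chart[OF A B C1 c d \<xi>] by (rule tangent_of_coord_in[OF B d])
        hence "J (u s) (differential A B u s \<xi>) \<in> tangent_space B (u s)" using te by (simp add: tangent_endomorphism_def)
        hence "J (u s) (differential A B u s \<xi>) e = 0" using False by (rule tangent_spaceD(1))
        thus ?thesis using False by (simp add: differential_def Let_def)
      qed
    qed
  qed
qed

subsection \<open>Holomorphic discs in the surface\<close>

text \<open>A holomorphic parametrization of an open set, centred at the image of 0. The atlas need
  not be maximal, so such discs are in general not charts of \<open>A\<close>. The notion is closed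
  under recentring and injective holomorphic reparametrization.\<close>

definition hol_disc :: "'s topology \<Rightarrow> ('s, complex) chart set \<Rightarrow> (complex \<Rightarrow> 's) \<Rightarrow> real \<Rightarrow> bool" where
  "hol_disc S A g r \<longleftrightarrow> r > 0 \<and> inj_on g (ball 0 r) \<and> continuous_map (top_of_set (ball 0 r)) S g \<and>
     (\<forall>W. open W \<longrightarrow> W \<subseteq> ball 0 r \<longrightarrow> openin S (g ` W)) \<and>
     (\<forall>c\<in>A. (snd c \<circ> g) holomorphic_on {z \<in> ball 0 r. g z \<in> fst c})"

lemma hol_discD:
  assumes "hol_disc S A g r"
  shows "r > 0" "inj_on g (ball 0 r)" "continuous_map (top_of_set (ball 0 r)) S g"
    "open W \<Longrightarrow> W \<subseteq> ball 0 r \<Longrightarrow> openin S (g ` W)"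
    "c \<in> A \<Longrightarrow> (snd c \<circ> g) holomorphic_on {z \<in> ball 0 r. g z \<in> fst c}"
    "z \<in> ball 0 r \<Longrightarrow> g z \<in> topspace S"
  using assms by (auto simp: hol_disc_def continuous_map_def Pi_iff)

lemma open_disc_preimage:
  assumes "continuous_map (top_of_set (ball (0::complex) r)) M f" "openin M U"
  shows "open {z \<in> ball 0 r. f z \<in> U}"
proof -
  have "openin (top_of_set (ball 0 r)) {z \<in> topspace (top_of_set (ball 0 r)). f z \<in> U}"
    by (rule openin_continuous_map_preimage[OF assms])
  hence "open {z \<in> topspace (top_of_set (ball 0 r)). f z \<in> U}" using openin_open_eq[OF open_ball] by blast
  thus ?thesis by simp
qed

lemma hol_disc_compose:
  assumes g: "hol_disc S A g r" and "r' > 0" "h holomorphic_on ball 0 r'" "inj_on h (ball 0 r')" "h ` ball 0 r' \<subseteq> ball 0 r"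
  shows "hol_disc S A (g \<circ> h) r'"
  unfolding hol_disc_def
proof (intro conjI ballI allI impI)
  show "r' > 0" by fact
  show "inj_on (g \<circ> h) (ball 0 r')" using assms(4,5) hol_discD(2)[OF g] by (meson comp_inj_on inj_on_subset)
  have "continuous_map (top_of_set (ball 0 r')) (top_of_set (ball 0 r)) h"
    using holomorphic_on_imp_continuous_on[OF assms(3)] assms(5) by (simp add: image_subset_iff_funcset)
  thus "continuous_map (top_of_set (ball 0 r')) S (g \<circ> h)" using hol_discD(3)[OF g] continuous_map_compose by blast
  fix W assume W: "open W" "W \<subseteq> ball (0::complex) r'"
  have "open (h ` W)"
    using W assms(3,4) by (intro open_mapping_thm3) (auto intro: holomorphic_on_subset inj_on_subset)
  moreover have "h ` W \<subseteq> ball 0 r" using W assms(5) by blast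
  ultimately have "openin S (g ` (h ` W))" by (rule hol_discD(4)[OF g])
  thus "openin S ((g \<circ> h) ` W)" by (simp only: image_comp)
next
  fix c assume c: "c \<in> A"
  have hb: "norm (h z) < r" if "norm z < r'" for z using assms(5) that by force
  have "(snd c \<circ> g) \<circ> h holomorphic_on {z \<in> ball 0 r'. (g \<circ> h) z \<in> fst c}"
    by (intro holomorphic_on_compose_gen[OF _ hol_discD(5)[OF g c]] holomorphic_on_subset[OF assms(3)]) (auto simp: hb)
  thus "(snd c \<circ> (g \<circ> h)) holomorphic_on {z \<in> ball 0 r'. (g \<circ> h) z \<in> fst c}" by (simp add: o_assoc)
qed

lemma hol_disc_shrink: "hol_disc S A g r \<Longrightarrow> 0 < r' \<Longrightarrow> r' \<le> r \<Longrightarrow> hol_disc S A g r'"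
  using hol_disc_compose[of S A g r r' "\<lambda>z. z"] subset_ball[of r' r "0::complex"] by (simp add: o_def inj_on_def)

lemma hol_disc_recenter:
  assumes g: "hol_disc S A g r" and z: "z \<in> ball 0 r"
  shows "hol_disc S A (\<lambda>w. g (z + w)) (r - norm z)"
proof -
  have "hol_disc S A (g \<circ> (+) z) (r - norm z)"
  proof (rule hol_disc_compose[OF g])
    show "(+) z ` ball 0 (r - norm z) \<subseteq> ball 0 r"
    proof
      fix y assume "y \<in> (+) z ` ball 0 (r - norm z)"
      then obtain w where "w \<in> ball 0 (r - norm z)" "y = z + w" by blast
      thus "y \<in> ball 0 r" using norm_triangle_ineq[of z w] by simp
    qed
  qed (use z in \<open>auto intro!: holomorphic_intros\<close>)
  thus ?thesis by (simp add: o_def)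
qed

lemma hol_disc_chart:
  assumes S: "riemann_surface S A" and c: "c \<in> A" "z0 \<in> snd c ` fst c"
  obtains r where "hol_disc S A (\<lambda>z. chart_inv c (z0 + z)) r"
proof -
  have A: "diff_atlas S A" by (rule diff_atlas_riemann[OF S])
  have ch: "is_chart S c" using A c by (auto simp: diff_atlas_def)
  have op: "open (snd c ` fst c)" using ch by (simp add: is_chart_def)
  obtain r where r: "r > 0" "ball z0 r \<subseteq> snd c ` fst c" using op c openE by blast
  define h where "h = (\<lambda>z. z0 + z)"
  have hin: "h z \<in> snd c ` fst c" if "z \<in> ball 0 r" for z
  proof -
    have "h z \<in> ball z0 r" using that by (simp add: h_def dist_norm)
    thus ?thesis using r by blast
  qed
  define g where "g = chart_inv c \<circ> h"
  have "hol_disc S A g r"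
    unfolding hol_disc_def
  proof (intro conjI ballI allI impI r(1))
    show "inj_on g (ball 0 r)"
    proof (rule inj_onI)
      fix x y assume xy: "x \<in> ball 0 r" "y \<in> ball 0 r" "g x = g y"
      have "snd c (g x) = h x" "snd c (g y) = h y" using chart_chart_inv[OF hin[OF xy(1)]] chart_chart_inv[OF hin[OF xy(2)]] by (simp_all add: g_def)
      hence "h x = h y" using xy(3) by metis
      thus "x = y" by (simp add: h_def)
    qed
    have "continuous_map (top_of_set (ball 0 r)) (top_of_set (snd c ` fst c)) h"
      using hin by (auto simp: h_def intro!: continuous_intros)
    thus "continuous_map (top_of_set (ball 0 r)) S g"
      unfolding g_def using chart_inv_continuous[OF ch] by (rule continuous_map_compose)
    fix W assume W: "open W" "W \<subseteq> ball (0::complex) r"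
    have "g ` W = {p \<in> topspace (subtopology S (fst c)). snd c p \<in> h ` W}"
    proof (intro equalityI subsetI)
      fix p assume "p \<in> g ` W"
      then obtain z where z: "z \<in> W" "p = g z" by blast
      have "h z \<in> snd c ` fst c" using hin z W by blast
      thus "p \<in> {p \<in> topspace (subtopology S (fst c)). snd c p \<in> h ` W}"
        using z chart_inv_in[of "h z" c] chart_chart_inv[of "h z" c] is_chart_subset[OF ch] by (auto simp: g_def)
    next
      fix p assume "p \<in> {p \<in> topspace (subtopology S (fst c)). snd c p \<in> h ` W}"
      then obtain z where z: "z \<in> W" "snd c p = h z" "p \<in> fst c" by auto
      hence "p = g z" using chart_inv_chart[OF ch, of p] by (simp add: g_def)
      thus "p \<in> g ` W" using z by blast
    qed
    moreover have "open (h ` W)" using open_translation[OF W(1), of z0] by (simp add: h_def)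
    ultimately have "openin (subtopology S (fst c)) (g ` W)"
      using openin_continuous_map_preimage[OF is_chart_continuous[OF ch]] by simp
    thus "openin S (g ` W)" using ch openin_open_subtopology unfolding is_chart_def by blast
  next
    fix d assume d: "d \<in> A"
    have "local_rep c d id holomorphic_on local_dom c d id" using S c d by (auto simp: riemann_surface_def)
    hence "local_rep c d id \<circ> h holomorphic_on {z \<in> ball 0 r. g z \<in> fst d}"
    proof (rule holomorphic_on_compose_gen[rotated])
      show "h holomorphic_on {z \<in> ball 0 r. g z \<in> fst d}" unfolding h_def by (intro holomorphic_intros)
      show "h ` {z \<in> ball 0 r. g z \<in> fst d} \<subseteq> local_dom c d id"
        using hin by (auto simp: local_dom_eq[OF ch] g_def)
    qed
    thus "(snd d \<circ> g) holomorphic_on {z \<in> ball 0 r. g z \<in> fst d}" by (simp add: local_rep_def g_def o_assoc)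
  qed
  thus ?thesis using that by (simp add: g_def h_def o_def)
qed

lemma hol_disc_exists:
  assumes S: "riemann_surface S A" and s: "s \<in> topspace S"
  obtains g r where "hol_disc S A g r" "g 0 = s"
proof -
  have "s \<in> \<Union> (fst ` A)" using S s by (simp add: riemann_surface_def topological_manifold_def)
  then obtain c where c: "c \<in> A" "s \<in> fst c" by blast
  have "is_chart S c" using diff_atlas_riemann[OF S] c by (simp add: diff_atlas_def)
  hence "chart_inv c (snd c s + 0) = s" using chart_inv_chart[of S c s] c by simp
  thus ?thesis using hol_disc_chart[OF S c(1), of "snd c s"] that c(2) by blast
qed

section \<open>A nonconstant curve: immersed points and local factorization\<close>

locale jcurve_setup =
  fixes X :: "'x topology" and B :: "('x, 'e::euclidean_space) chart set"
    and J :: "'x \<Rightarrow> ('x, 'e) tangent \<Rightarrow> ('x, 'e) tangent"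
    and S :: "'s topology" and A :: "('s, complex) chart set" and u :: "'s \<Rightarrow> 'x"
  assumes X: "smooth_manifold X B" and J: "almost_complex_structure X B J" and L: "lipschitz_structure B J"
    and S: "riemann_surface S A" and conn: "connected_space S" and u: "J_holomorphic S A X B J u"
    and nonconst: "\<not> u constant_on topspace S"
begin

abbreviation "disc \<equiv> hol_disc S A"
abbreviation "JJ \<equiv> coord_J B J"

lemma atlas_B: "diff_atlas X B" by (rule diff_atlas_smooth[OF X])
lemma atlas_A: "diff_atlas S A" by (rule diff_atlas_riemann[OF S])

lemma chart_B: "d \<in> B \<Longrightarrow> is_chart X d" using atlas_B by (simp add: diff_atlas_def)
lemma chart_A: "c \<in> A \<Longrightarrow> is_chart S c" using atlas_A by (simp add: diff_atlas_def)

lemma cover_B: "\<Union> (fst ` B) = topspace X" using X by (simp add: smooth_manifold_def topological_manifold_def)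
lemma cover_A: "\<Union> (fst ` A) = topspace S" using S by (simp add: riemann_surface_def topological_manifold_def)
lemma Hausdorff_X: "Hausdorff_space X" using X by (simp add: smooth_manifold_def topological_manifold_def)
lemma Hausdorff_S: "Hausdorff_space S" using S by (simp add: riemann_surface_def topological_manifold_def)

lemma cont_u: "continuous_map S X u" using u by (simp add: J_holomorphic_def C1_map_def)

lemma acs: "d \<in> B \<Longrightarrow> acs_on (JJ d) (snd d ` fst d)" by (rule acs_on_coord_J[OF atlas_B J L])

lemma chart_B_at: "s \<in> topspace S \<Longrightarrow> \<exists>d\<in>B. u s \<in> fst d"
  using cont_u cover_B by (fastforce simp: continuous_map_def Pi_iff)

lemma chart_A_at: "s \<in> topspace S \<Longrightarrow> \<exists>c\<in>A. s \<in> fst c"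
  using cover_A by blast

lemma disc_jcurve:
  assumes g: "disc g r" and d: "d \<in> B"
  shows "jcurve (JJ d) (snd d ` fst d) {z \<in> ball 0 r. u (g z) \<in> fst d} (snd d \<circ> u \<circ> g) (\<lambda>z. frechet_derivative (snd d \<circ> u \<circ> g) (at z))"
proof (rule jcurve_glue)
  have cg: "continuous_map (top_of_set (ball 0 r)) S g" by (rule hol_discD(3)[OF g])
  fix z assume z: "z \<in> {z \<in> ball 0 r. u (g z) \<in> fst d}"
  obtain c where c: "c \<in> A" "g z \<in> fst c" using chart_A_at hol_discD(6)[OF g] z by blast
  define W' where "W' = {w \<in> ball 0 r. g w \<in> fst c} \<inter> {w \<in> ball 0 r. u (g w) \<in> fst d}"
  have "open {w \<in> ball 0 r. g w \<in> fst c}" using chart_A[OF c(1)] unfolding is_chart_def by (intro open_disc_preimage[OF cg]) auto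
  moreover have "open {w \<in> ball 0 r. (u \<circ> g) w \<in> fst d}"
    using chart_B[OF d] unfolding is_chart_def by (intro open_disc_preimage[OF continuous_map_compose[OF cg cont_u]]) auto
  ultimately have oW: "open W'" unfolding W'_def o_def by (rule open_Int)
  have "jcurve (JJ d) (snd d ` fst d) W' (local_rep c d u \<circ> (snd c \<circ> g)) (\<lambda>z t. frechet_derivative (local_rep c d u) (at ((snd c \<circ> g) z)) (deriv (snd c \<circ> g) z * t))"
    by (rule jcurve_compose[OF J_holomorphic_imp_jcurve[OF S atlas_B u c(1) d] oW holomorphic_on_subset[OF hol_discD(5)[OF g c(1)]]])
      (auto simp: W'_def local_dom_def)
  moreover have "(local_rep c d u \<circ> (snd c \<circ> g)) x = (snd d \<circ> u \<circ> g) x" if "x \<in> W'" for x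
    using that chart_inv_chart[OF chart_A[OF c(1)]] by (simp add: local_rep_def W'_def)
  ultimately show "\<exists>W' v dv. z \<in> W' \<and> W' \<subseteq> {z \<in> ball 0 r. u (g z) \<in> fst d} \<and> jcurve (JJ d) (snd d ` fst d) W' v dv \<and> (\<forall>x\<in>W'. v x = (snd d \<circ> u \<circ> g) x)"
    using z c by (intro exI[of _ W'] exI conjI) (auto simp: W'_def)
qed

text \<open>One disc and one chart are enough, since the condition serves to obtain a coordinate
  curve with nonzero derivative.\<close>

definition imm :: "'s \<Rightarrow> bool" where
  "imm s \<longleftrightarrow> (\<exists>g r d. disc g r \<and> g 0 = s \<and> d \<in> B \<and> u s \<in> fst d \<and> frechet_derivative (snd d \<circ> u \<circ> g) (at 0) 1 \<noteq> 0)"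

lemma frechet_recenter:
  assumes g: "disc g r" and d: "d \<in> B" and z: "z \<in> ball 0 r" "u (g z) \<in> fst d"
  shows "frechet_derivative (snd d \<circ> u \<circ> (\<lambda>w. g (z + w))) (at 0) = frechet_derivative (snd d \<circ> u \<circ> g) (at z)"
proof -
  define D where "D = frechet_derivative (snd d \<circ> u \<circ> g) (at z)"
  have D: "((snd d \<circ> u \<circ> g) has_derivative D) (at (z + 0))"
    using jcurveD(3)[OF disc_jcurve[OF g d], of z] z by (simp add: D_def)
  have "((\<lambda>w. z + w) has_derivative (\<lambda>t. t)) (at 0)" by (auto intro!: derivative_eq_intros)
  from has_derivative_compose[OF this D]
  have "((\<lambda>w. (snd d \<circ> u \<circ> g) (z + w)) has_derivative (\<lambda>t. D t)) (at 0)" .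
  hence "D = frechet_derivative (\<lambda>w. (snd d \<circ> u \<circ> g) (z + w)) (at 0)" by (rule frechet_derivative_at)
  thus ?thesis by (simp add: D_def o_def)
qed

lemma immI:
  assumes g: "disc g r" and d: "d \<in> B" and z: "z \<in> ball 0 r" "u (g z) \<in> fst d"
    and "frechet_derivative (snd d \<circ> u \<circ> g) (at z) 1 \<noteq> 0"
  shows "imm (g z)"
  unfolding imm_def
  by (intro exI[of _ "\<lambda>w. g (z + w)"] exI[of _ "r - norm z"] exI[of _ d])
    (use assms hol_disc_recenter[OF g z(1)] frechet_recenter[OF g d z] in simp)

lemma disc_zero_in: "disc g r \<Longrightarrow> (0::complex) \<in> ball 0 r"
  using hol_discD(1) by simp

definition loc_const :: "'s set" where
  "loc_const = {s \<in> topspace S. \<exists>g r. disc g r \<and> g 0 = s \<and> (\<forall>z\<in>ball 0 r. u (g z) = u s)}"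

text \<open>This is \<open>jcurve_order\<close> at the centre: either the derivative vanishes nearby
  and \<open>u\<close> is constant there, or there is a leading term and
  \<open>jcurve_isolated\<close> applies.\<close>

lemma disc_dichotomy:
  assumes g: "disc g r"
  obtains \<rho> where "0 < \<rho>" "\<rho> \<le> r" "\<And>z. z \<in> ball 0 \<rho> \<Longrightarrow> u (g z) = u (g 0)"
  | \<rho> where "0 < \<rho>" "\<rho> \<le> r" "\<And>z. z \<in> ball 0 \<rho> - {0} \<Longrightarrow> imm (g z) \<and> u (g z) \<noteq> u (g 0)"
proof -
  have s: "g 0 \<in> topspace S" using hol_discD(6)[OF g disc_zero_in[OF g]] .
  obtain d where d: "d \<in> B" "u (g 0) \<in> fst d" using chart_B_at[OF s] by blast
  define W where "W = {z \<in> ball 0 r. u (g z) \<in> fst d}"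
  define v where "v = snd d \<circ> u \<circ> g"
  define dv where "dv = (\<lambda>z. frechet_derivative v (at z))"
  have jc: "jcurve (JJ d) (snd d ` fst d) W v dv" unfolding W_def v_def dv_def by (rule disc_jcurve[OF g d(1)])
  have 0: "0 \<in> W" using d disc_zero_in[OF g] by (simp add: W_def)
  have vu: "u (g z) = u (g 0)" if "z \<in> W" "v z = v 0" for z
    using that 0 inj_onD[OF is_chart_inj[OF chart_B[OF d(1)]]] by (auto simp: v_def W_def)
  show ?thesis
  proof (rule jcurve_order[OF acs[OF d(1)] jc 0])
    fix \<rho> assume \<rho>: "\<rho> > 0" "ball 0 \<rho> \<subseteq> W" "\<And>z t. z \<in> ball 0 \<rho> \<Longrightarrow> dv z t = 0"
    have vc: "v z = v 0" if z: "z \<in> ball 0 \<rho>" for z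
    proof -
      have "norm (v z - v 0) \<le> 0 * norm (z - 0)"
        by (rule jcurve_lipschitz_ball[OF jc, where S="ball 0 \<rho>"]) (use \<rho> z in auto)
      thus ?thesis by simp
    qed
    have ug: "u (g z) = u (g 0)" if "z \<in> ball 0 (min \<rho> r)" for z
    proof -
      have z: "z \<in> ball 0 \<rho>" using that by simp
      show ?thesis by (rule vu[OF subsetD[OF \<rho>(2) z] vc[OF z]])
    qed
    show ?thesis
    proof (rule that(1)[of "min \<rho> r"])
      show "0 < min \<rho> r" "min \<rho> r \<le> r" using \<rho>(1) hol_discD(1)[OF g] by simp_all
    qed (rule ug)
  next
    fix m a b0 assume a: "b0 \<in> Basis" "a b0 \<noteq> 0" "\<And>b. b \<in> Basis \<Longrightarrow> ((\<lambda>z. jfun (JJ d) (v z) b (dv z 1) / z ^ m) \<longlongrightarrow> a b) (at 0)"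
    obtain \<rho> where \<rho>: "\<rho> > 0" "ball 0 \<rho> \<subseteq> W" "\<And>z. z \<in> ball 0 \<rho> - {0} \<Longrightarrow> dv z 1 \<noteq> 0 \<and> v z \<noteq> v 0"
      using jcurve_isolated[OF acs[OF d(1)] jc 0 a(1,2) a(3)[OF a(1)]] a(3) by blast
    have "imm (g z) \<and> u (g z) \<noteq> u (g 0)" if z: "z \<in> ball 0 (min \<rho> r) - {0}" for z
    proof -
      have "z \<in> W" "dv z 1 \<noteq> 0" "v z \<noteq> v 0" using \<rho> z by auto
      thus ?thesis using immI[OF g d(1), of z] by (auto simp: W_def dv_def v_def)
    qed
    thus ?thesis using \<rho>(1) hol_discD(1)[OF g] by (intro that(2)[of "min \<rho> r"]) auto
  qed
qed

lemma imm_not_loc_const: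
  assumes "imm s"
  shows "s \<notin> loc_const"
proof
  assume "s \<in> loc_const"
  then obtain g' r' where g': "disc g' r'" "g' 0 = s" "\<And>z. z \<in> ball 0 r' \<Longrightarrow> u (g' z) = u s" by (auto simp: loc_const_def)
  obtain g r d where g: "disc g r" "g 0 = s" "d \<in> B" "u s \<in> fst d" "frechet_derivative (snd d \<circ> u \<circ> g) (at 0) 1 \<noteq> 0"
    using assms by (auto simp: imm_def)
  have op: "openin S (g' ` ball 0 r')" by (rule hol_discD(4)[OF g'(1)]) auto
  define W where "W = {z \<in> ball 0 r. g z \<in> g' ` ball 0 r'}"
  have oW: "open W" unfolding W_def by (rule open_disc_preimage[OF hol_discD(3)[OF g(1)] op])
  have 0: "0 \<in> W" using g(2) g'(2) disc_zero_in[OF g(1)] disc_zero_in[OF g'(1)] unfolding W_def by (metis (mono_tags, lifting) image_eqI mem_Collect_eq)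
  have "((\<lambda>z. snd d (u s)) has_derivative (\<lambda>t. 0)) (at (0::complex))" by simp
  hence "((snd d \<circ> u \<circ> g) has_derivative (\<lambda>t. 0)) (at 0)"
    by (rule has_derivative_transform_within_open[OF _ oW 0]) (auto simp: W_def g'(3))
  from frechet_derivative_at[OF this] g(5) show False by metis
qed

text \<open>The set is open by recentring, and closed by \<open>disc_dichotomy\<close>, whose second
  alternative surrounds a point by immersed ones. If it were all of \<open>S\<close>, the fibres of
  \<open>u\<close> would be open and closed, so \<open>u\<close> would be constant on the connected
  surface.\<close>

lemma loc_const_empty: "loc_const = {}"
proof (rule ccontr)
  assume ne: "loc_const \<noteq> {}"
  have "openin S loc_const"
  proof (subst openin_subopen, intro ballI)
    fix s assume "s \<in> loc_const"
    then obtain g r where g: "disc g r" "g 0 = s" "\<And>z. z \<in> ball 0 r \<Longrightarrow> u (g z) = u s" by (auto simp: loc_const_def)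
    have "g z \<in> loc_const" if z: "z \<in> ball 0 r" for z
      unfolding loc_const_def
    proof (intro CollectI conjI exI)
      show "g z \<in> topspace S" by (rule hol_discD(6)[OF g(1) z])
      show "disc (\<lambda>w. g (z + w)) (r - norm z)" by (rule hol_disc_recenter[OF g(1) z])
      show "\<forall>w\<in>ball 0 (r - norm z). u (g (z + w)) = u (g z)"
      proof
        fix w :: complex assume "w \<in> ball 0 (r - norm z)"
        hence "z + w \<in> ball 0 r" using norm_triangle_ineq[of z w] by simp
        thus "u (g (z + w)) = u (g z)" using g(3) z by simp
      qed
    qed simp
    moreover have "openin S (g ` ball 0 r)" by (rule hol_discD(4)[OF g(1)]) auto
    moreover have "s \<in> g ` ball 0 r" using g(2) disc_zero_in[OF g(1)] by blast
    ultimately show "\<exists>T. openin S T \<and> s \<in> T \<and> T \<subseteq> loc_const" by blast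
  qed
  moreover have "openin S (topspace S - loc_const)"
  proof (subst openin_subopen, intro ballI)
    fix s assume s: "s \<in> topspace S - loc_const"
    then obtain g r where g: "disc g r" "g 0 = s" using hol_disc_exists[OF S] by blast
    show "\<exists>T. openin S T \<and> s \<in> T \<and> T \<subseteq> topspace S - loc_const"
    proof (rule disc_dichotomy[OF g(1)])
      fix \<rho> assume \<rho>: "0 < \<rho>" "\<rho> \<le> r" "\<And>z. z \<in> ball 0 \<rho> \<Longrightarrow> u (g z) = u (g 0)"
      have "s \<in> loc_const" unfolding loc_const_def using s g(2) \<rho>(3) hol_disc_shrink[OF g(1) \<rho>(1,2)] by blast
      thus ?thesis using s by blast
    next
      fix \<rho> assume \<rho>: "0 < \<rho>" "\<rho> \<le> r" "\<And>z. z \<in> ball 0 \<rho> - {0} \<Longrightarrow> imm (g z) \<and> u (g z) \<noteq> u (g 0)"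
      have sub: "ball (0::complex) \<rho> \<subseteq> ball 0 r" using \<rho> by auto
      have "g ` ball 0 \<rho> \<subseteq> topspace S - loc_const"
        using \<rho>(3) imm_not_loc_const hol_discD(6)[OF g(1)] sub s g(2) by blast
      moreover have "openin S (g ` ball 0 \<rho>)" by (rule hol_discD(4)[OF g(1)]) (use sub in auto)
      ultimately show ?thesis using \<rho>(1) g(2) by (intro exI[of _ "g ` ball 0 \<rho>"]) auto
    qed
  qed
  ultimately have "closedin S loc_const" "openin S loc_const" by (auto simp: closedin_def loc_const_def)
  hence all: "loc_const = topspace S" using conn ne by (auto simp: connected_space_clopen_in)
  obtain s0 where s0: "s0 \<in> topspace S" using ne all by blast
  have op: "openin S {s \<in> topspace S. P (u s)}" for P
  proof (subst openin_subopen, intro ballI)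
    fix s assume s: "s \<in> {s \<in> topspace S. P (u s)}"
    hence "s \<in> loc_const" using all by simp
    then obtain g r where g: "disc g r" "g 0 = s" "\<And>z. z \<in> ball 0 r \<Longrightarrow> u (g z) = u s" by (auto simp: loc_const_def)
    have "g ` ball 0 r \<subseteq> {s \<in> topspace S. P (u s)}" using g(3) s hol_discD(6)[OF g(1)] by auto
    moreover have "openin S (g ` ball 0 r)" by (rule hol_discD(4)[OF g(1)]) auto
    moreover have "s \<in> g ` ball 0 r" using g(2) disc_zero_in[OF g(1)] by blast
    ultimately show "\<exists>T. openin S T \<and> s \<in> T \<and> T \<subseteq> {s \<in> topspace S. P (u s)}" by blast
  qed
  have "topspace S - {s \<in> topspace S. u s = u s0} = {s \<in> topspace S. u s \<noteq> u s0}" by auto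
  hence "closedin S {s \<in> topspace S. u s = u s0}" using op[of "\<lambda>x. x \<noteq> u s0"] by (auto simp: closedin_def)
  hence "{s \<in> topspace S. u s = u s0} = topspace S" using conn op[of "\<lambda>x. x = u s0"] s0 by (auto simp: connected_space_clopen_in)
  hence "u constant_on topspace S" unfolding constant_on_def by blast
  thus False using nonconst by blast
qed

lemma disc_isolated:
  assumes g: "disc g r"
  obtains \<rho> where "0 < \<rho>" "\<rho> \<le> r" "\<And>z. z \<in> ball 0 \<rho> - {0} \<Longrightarrow> imm (g z) \<and> u (g z) \<noteq> u (g 0)"
proof (rule disc_dichotomy[OF g])
  fix \<rho> assume \<rho>: "0 < \<rho>" "\<rho> \<le> r" "\<And>z. z \<in> ball 0 \<rho> \<Longrightarrow> u (g z) = u (g 0)"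
  have "g 0 \<in> loc_const" unfolding loc_const_def
    using \<rho>(3) hol_disc_shrink[OF g \<rho>(1,2)] hol_discD(6)[OF g disc_zero_in[OF g]] by blast
  thus ?thesis using loc_const_empty by blast
qed (use that in blast)

text \<open>\<open>jcurve_meet\<close> freed from coordinates in \<open>X\<close>. The disc around
  the immersed point is fixed first and serves for all second discs.\<close>

lemma imm_disc:
  assumes "imm s"
  obtains g r where "disc g r" "g 0 = s" "inj_on (u \<circ> g) (ball 0 r)"
    "\<And>g2 r2 \<rho>0. disc g2 r2 \<Longrightarrow> u (g2 0) = u s \<Longrightarrow> \<rho>0 > 0 \<Longrightarrow>
       \<exists>\<rho> r'. 0 < \<rho> \<and> \<rho> \<le> \<rho>0 \<and> \<rho> < r \<and> 0 < r' \<and> r' \<le> r2 \<and>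
        ((\<exists>\<zeta>. \<zeta> holomorphic_on ball 0 r' \<and> \<zeta> 0 = 0 \<and> (\<forall>z\<in>ball 0 r'. \<zeta> z \<in> cball 0 \<rho> \<and> u (g2 z) = u (g (\<zeta> z)))) \<or>
         (\<forall>z\<in>ball 0 r' - {0}. \<forall>x\<in>cball 0 \<rho>. u (g2 z) \<noteq> u (g x)))"
proof -
  obtain g0 r0 d where g0: "disc g0 r0" "g0 0 = s" "d \<in> B" "u s \<in> fst d" "frechet_derivative (snd d \<circ> u \<circ> g0) (at 0) 1 \<noteq> 0"
    using assms by (auto simp: imm_def)
  define W where "W = {z \<in> ball 0 r0. u (g0 z) \<in> fst d}"
  have jc: "jcurve (JJ d) (snd d ` fst d) W (snd d \<circ> u \<circ> g0) (\<lambda>z. frechet_derivative (snd d \<circ> u \<circ> g0) (at z))"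
    unfolding W_def by (rule disc_jcurve[OF g0(1,3)])
  have 0: "0 \<in> W" using g0 disc_zero_in[OF g0(1)] by (simp add: W_def)
  obtain r where r: "r > 0" "ball 0 r \<subseteq> W" "inj_on (snd d \<circ> u \<circ> g0) (ball 0 r)"
    using jcurve_locally_injective[OF acs[OF g0(3)] jc 0 g0(5)] by blast
  \<comment> \<open>The ball of radius \<open>r\<close> lies in \<open>W\<close>, hence in the ball
    of radius \<open>r0\<close>; testing the boundary point r0 compares the radii.\<close>
  have rr0: "r \<le> r0"
  proof (rule ccontr)
    assume "\<not> r \<le> r0"
    hence "of_real r0 \<in> ball (0::complex) r" using hol_discD(1)[OF g0(1)] by simp
    hence "of_real r0 \<in> W" using r(2) by blast
    thus False using hol_discD(1)[OF g0(1)] by (simp add: W_def)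
  qed
  show ?thesis
  proof (rule that[of g0 r])
    show "disc g0 r" by (rule hol_disc_shrink[OF g0(1) r(1) rr0])
    show "inj_on (u \<circ> g0) (ball 0 r)" using r(3) by (metis inj_on_imageI2 comp_assoc)
    fix g2 r2 and \<rho>0 :: real assume g2: "disc g2 r2" and eq: "u (g2 0) = u s" and \<rho>0: "\<rho>0 > 0"
    define W2 where "W2 = {z \<in> ball 0 r2. u (g2 z) \<in> fst d}"
    have jc2: "jcurve (JJ d) (snd d ` fst d) W2 (snd d \<circ> u \<circ> g2) (\<lambda>z. frechet_derivative (snd d \<circ> u \<circ> g2) (at z))"
      unfolding W2_def by (rule disc_jcurve[OF g2 g0(3)])
    have 02: "0 \<in> W2" using eq g0(4) disc_zero_in[OF g2] by (simp add: W2_def)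
    have eq': "(snd d \<circ> u \<circ> g0) 0 = (snd d \<circ> u \<circ> g2) 0" using eq g0(2) by simp
    have "min \<rho>0 (r / 2) > 0" using \<rho>0 r by simp
    from jcurve_meet[OF acs[OF g0(3)] jc jc2 0 02 eq' g0(5) this]
    obtain \<rho> r' where \<rho>: "\<rho> > 0" "\<rho> \<le> min \<rho>0 (r / 2)" "r' > 0" "cball 0 \<rho> \<subseteq> W" "ball 0 r' \<subseteq> W2"
      and dich: "(\<exists>\<zeta>. \<zeta> holomorphic_on ball 0 r' \<and> \<zeta> 0 = 0 \<and> (\<forall>z\<in>ball 0 r'. \<zeta> z \<in> cball 0 \<rho> \<and> (snd d \<circ> u \<circ> g2) z = (snd d \<circ> u \<circ> g0) (\<zeta> z))) \<or>
     (\<forall>z\<in>ball 0 r' - {0}. \<forall>x\<in>cball 0 \<rho>. (snd d \<circ> u \<circ> g2) z \<noteq> (snd d \<circ> u \<circ> g0) x)" by blast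
    have r'r2: "r' \<le> r2"
    proof (rule ccontr)
      assume "\<not> r' \<le> r2"
      hence "of_real r2 \<in> ball (0::complex) r'" using hol_discD(1)[OF g2] by simp
      hence "of_real r2 \<in> W2" using \<rho>(5) by blast
      thus False using hol_discD(1)[OF g2] by (simp add: W2_def)
    qed
    have inj: "(snd d \<circ> u \<circ> g2) z = (snd d \<circ> u \<circ> g0) x \<longleftrightarrow> u (g2 z) = u (g0 x)" if "z \<in> ball 0 r'" "x \<in> cball 0 \<rho>" for z x
    proof -
      have "u (g2 z) \<in> fst d" "u (g0 x) \<in> fst d" using that \<rho>(4,5) by (auto simp: W_def W2_def)
      thus ?thesis using inj_on_eq_iff[OF is_chart_inj[OF chart_B[OF g0(3)]]] by simp
    qed
    show "\<exists>\<rho> r'. 0 < \<rho> \<and> \<rho> \<le> \<rho>0 \<and> \<rho> < r \<and> 0 < r' \<and> r' \<le> r2 \<and>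
        ((\<exists>\<zeta>. \<zeta> holomorphic_on ball 0 r' \<and> \<zeta> 0 = 0 \<and> (\<forall>z\<in>ball 0 r'. \<zeta> z \<in> cball 0 \<rho> \<and> u (g2 z) = u (g0 (\<zeta> z)))) \<or>
         (\<forall>z\<in>ball 0 r' - {0}. \<forall>x\<in>cball 0 \<rho>. u (g2 z) \<noteq> u (g0 x)))"
    proof (rule exI[of _ \<rho>], rule exI[of _ r'], intro conjI)
      show "(\<exists>\<zeta>. \<zeta> holomorphic_on ball 0 r' \<and> \<zeta> 0 = 0 \<and> (\<forall>z\<in>ball 0 r'. \<zeta> z \<in> cball 0 \<rho> \<and> u (g2 z) = u (g0 (\<zeta> z)))) \<or>
         (\<forall>z\<in>ball 0 r' - {0}. \<forall>x\<in>cball 0 \<rho>. u (g2 z) \<noteq> u (g0 x))"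
        using dich
      proof
        assume "\<exists>\<zeta>. \<zeta> holomorphic_on ball 0 r' \<and> \<zeta> 0 = 0 \<and> (\<forall>z\<in>ball 0 r'. \<zeta> z \<in> cball 0 \<rho> \<and> (snd d \<circ> u \<circ> g2) z = (snd d \<circ> u \<circ> g0) (\<zeta> z))"
        thus ?thesis using inj by blast
      next
        assume "\<forall>z\<in>ball 0 r' - {0}. \<forall>x\<in>cball 0 \<rho>. (snd d \<circ> u \<circ> g2) z \<noteq> (snd d \<circ> u \<circ> g0) x"
        thus ?thesis using inj by blast
      qed
    qed (use \<rho> r r'r2 in auto)
  qed (use g0 in auto)
qed

text \<open>At \<open>0\<close> this is \<open>jcurve_descend\<close>; elsewhere the power map has holomorphic local inverses.\<close>

lemma disc_descend:
  assumes g: "disc g r" and k: "k \<ge> 1" and v: "\<And>z. z \<in> ball 0 r \<Longrightarrow> v (z ^ k) = u (g z)" and d: "d \<in> B"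
  shows "jcurve (JJ d) (snd d ` fst d) {x \<in> ball 0 (r ^ k). v x \<in> fst d} (snd d \<circ> v) (\<lambda>z. frechet_derivative (snd d \<circ> v) (at z))"
proof (rule jcurve_glue)
  have r: "r > 0" by (rule hol_discD(1)[OF g])
  let ?W = "{x \<in> ball 0 (r ^ k). v x \<in> fst d}"
  let ?U = "{z \<in> ball 0 r. u (g z) \<in> fst d}"
  note jc = disc_jcurve[OF g d]
  fix x assume x: "x \<in> ?W"
  show "\<exists>W' v' dv. x \<in> W' \<and> W' \<subseteq> ?W \<and> jcurve (JJ d) (snd d ` fst d) W' v' dv \<and> (\<forall>x\<in>W'. v' x = (snd d \<circ> v) x)"
  proof (cases "x = 0")
    case True
    have "v 0 = u (g 0)" using v[of 0] r k by (simp add: power_0_left)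
    hence 0: "0 \<in> ?U" using x True r by simp
    show ?thesis
    proof (rule jcurve_order[OF acs[OF d] jc 0])
      \<comment> \<open>A derivative vanishing near 0 would make \<open>u\<close> constant there,
        which \<open>disc_isolated\<close> excludes.\<close>
      fix \<rho> assume \<rho>: "\<rho> > 0" "ball 0 \<rho> \<subseteq> ?U" "\<And>z t. z \<in> ball 0 \<rho> \<Longrightarrow> frechet_derivative (snd d \<circ> u \<circ> g) (at z) t = 0"
      obtain \<rho>' where \<rho>': "0 < \<rho>'" "\<rho>' \<le> r" "\<And>z. z \<in> ball 0 \<rho>' - {0} \<Longrightarrow> imm (g z) \<and> u (g z) \<noteq> u (g 0)" using disc_isolated[OF g] by blast
      define z where "z = complex_of_real (min \<rho> \<rho>' / 2)"
      have z: "z \<in> ball 0 \<rho>" "z \<in> ball 0 \<rho>' - {0}" using \<rho>(1) \<rho>'(1) by (auto simp: z_def)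
      have "norm ((snd d \<circ> u \<circ> g) z - (snd d \<circ> u \<circ> g) 0) \<le> 0 * norm (z - 0)"
        by (rule jcurve_lipschitz_ball[OF jc, where S="ball 0 \<rho>"]) (use \<rho> z in auto)
      hence "snd d (u (g z)) = snd d (u (g 0))" by simp
      moreover have "u (g z) \<in> fst d" "u (g 0) \<in> fst d" using \<rho>(2) z(1) 0 by auto
      ultimately have "u (g z) = u (g 0)" using inj_onD[OF is_chart_inj[OF chart_B[OF d]]] by blast
      thus ?thesis using \<rho>'(3)[OF z(2)] by blast
    next
      fix m a b0 assume a: "b0 \<in> Basis" "a b0 \<noteq> 0" "\<And>b. b \<in> Basis \<Longrightarrow> ((\<lambda>z. jfun (JJ d) ((snd d \<circ> u \<circ> g) z) b (frechet_derivative (snd d \<circ> u \<circ> g) (at z) 1) / z ^ m) \<longlongrightarrow> a b) (at 0)"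
      obtain \<rho> where \<rho>: "\<rho> > 0" "ball 0 \<rho> \<subseteq> ?U" using jcurveD(1)[OF jc] 0 openE by blast
      have \<rho>r: "\<rho> \<le> r"
      proof (rule ccontr)
        assume "\<not> \<rho> \<le> r"
        hence "of_real r \<in> ball (0::complex) \<rho>" using r by simp
        hence "of_real r \<in> ?U" using \<rho>(2) by blast
        thus False using r by simp
      qed
      have jc': "jcurve (JJ d) (snd d ` fst d) (ball 0 \<rho>) (snd d \<circ> u \<circ> g) (\<lambda>z. frechet_derivative (snd d \<circ> u \<circ> g) (at z))"
        by (rule jcurve_subset[OF jc open_ball \<rho>(2)])
      obtain dv where dv: "jcurve (JJ d) (snd d ` fst d) (ball 0 (\<rho> ^ k)) (snd d \<circ> v) dv"
      proof (rule jcurve_descend[OF acs[OF d] jc' \<rho>(1) k _ a])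
        show "(snd d \<circ> v) (y ^ k) = (snd d \<circ> u \<circ> g) y" if "y \<in> ball 0 \<rho>" for y using v[of y] that \<rho>r by simp
      qed (use that in blast)
      have sub: "ball 0 (\<rho> ^ k) \<subseteq> ?W"
      proof
        fix w :: complex assume w: "w \<in> ball 0 (\<rho> ^ k)"
        obtain y where y: "y ^ k = w" using ex_nth_root[OF k] by blast
        have yr: "norm y < \<rho>" using norm_root_less[OF k y _ \<rho>(1)] w by simp
        have "v w = u (g y)" using v[of y] y yr \<rho>r by simp
        moreover have "u (g y) \<in> fst d" using \<rho>(2) yr by auto
        moreover have "\<rho> ^ k \<le> r ^ k" using \<rho>(1) \<rho>r by (simp add: power_mono)
        ultimately show "w \<in> ?W" using w by simp
      qed
      show ?thesis using dv sub True \<rho>(1) by (intro exI[of _ "ball 0 (\<rho> ^ k)"] exI[of _ "snd d \<circ> v"] exI[of _ dv]) simp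
    qed
  next
    case False
    obtain y where y: "y ^ k = x" using ex_nth_root[OF k] by blast
    have yr: "norm y < r" using norm_root_less[OF k y _ r] x by simp
    have y0: "y \<noteq> 0" using y False k by (auto simp: power_0_left)
    obtain T where T: "open T" "y ^ k \<in> T" "0 \<notin> T" "root_near y k (y ^ k) = y" "\<And>x. x \<in> T \<Longrightarrow> root_near y k x ^ k = x"
      "\<And>x. x \<in> T \<Longrightarrow> (root_near y k has_field_derivative 1 / (of_nat k * root_near y k x ^ (k - 1))) (at x)"
      using root_near[OF y0 k] by blast
    define W' where "W' = T \<inter> root_near y k -` ?U"
    have holT: "root_near y k holomorphic_on T" using T(6) by (auto simp: holomorphic_on_open[OF T(1)])
    have "open W'" unfolding W'_def
      using continuous_open_preimage[OF holomorphic_on_imp_continuous_on[OF holT] T(1) jcurveD(1)[OF jc]] by simp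
    have rin: "root_near y k w \<in> ball 0 r \<and> v w = u (g (root_near y k w))" if "w \<in> T" "norm w < r ^ k" for w
    proof -
      have "norm (root_near y k w) < r" using norm_root_less[OF k T(5)[OF that(1)] that(2) r] .
      thus ?thesis using v[of "root_near y k w"] T(5)[OF that(1)] by simp
    qed
    have xW: "x \<in> W'" using rin[of x] T(2) y x by (simp add: W'_def)
    have W'W: "W' \<subseteq> ?W"
    proof
      fix w assume w: "w \<in> W'"
      hence n: "norm (root_near y k w) < r" "w \<in> T" "u (g (root_near y k w)) \<in> fst d" by (auto simp: W'_def)
      have "norm w = norm (root_near y k w) ^ k" using T(5)[OF n(2)] by (metis norm_power)
      also have "\<dots> < r ^ k" using n(1) k by (intro power_strict_mono) auto
      finally have nw: "norm w < r ^ k" .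
      thus "w \<in> ?W" using rin[OF n(2) nw] n(3) by simp
    qed
    have "jcurve (JJ d) (snd d ` fst d) W' ((snd d \<circ> u \<circ> g) \<circ> root_near y k) (\<lambda>z t. frechet_derivative (snd d \<circ> u \<circ> g) (at (root_near y k z)) (deriv (root_near y k) z * t))"
      by (rule jcurve_compose[OF jc \<open>open W'\<close> holomorphic_on_subset[OF holT]]) (auto simp: W'_def)
    moreover have "((snd d \<circ> u \<circ> g) \<circ> root_near y k) w = (snd d \<circ> v) w" if "w \<in> W'" for w
      using rin[of w] that W'W by (auto simp: W'_def)
    ultimately show ?thesis using xW W'W by blast
  qed
qed

end

subsection \<open>The equivalence relation\<close>

lemma holomorphic_on_locallyI:
  assumes "\<And>z. z \<in> W \<Longrightarrow> \<exists>W'. open W' \<and> z \<in> W' \<and> f holomorphic_on W'"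
  shows "f holomorphic_on W"
  unfolding holomorphic_on_def
proof
  fix z assume "z \<in> W"
  then obtain W' where "open W'" "z \<in> W'" "f holomorphic_on W'" using assms by blast
  thus "f field_differentiable at z within W"
    using holomorphic_on_imp_differentiable_at field_differentiable_at_within by blast
qed

context jcurve_setup
begin

text \<open>In a chart of the surface both discs become holomorphic functions, and the injective
  function of \<open>g\<close> has a holomorphic inverse on its image.\<close>

lemma disc_transition:
  assumes g: "disc g r" and h: "disc h r'"
  shows "open {z \<in> ball 0 r'. h z \<in> g ` ball 0 r}"
    "(inv_into (ball 0 r) g \<circ> h) holomorphic_on {z \<in> ball 0 r'. h z \<in> g ` ball 0 r}"
proof -
  let ?W = "{z \<in> ball 0 r'. h z \<in> g ` ball 0 r}"
  show oW: "open ?W" by (rule open_disc_preimage[OF hol_discD(3)[OF h] hol_discD(4)[OF g]]) auto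
  show "(inv_into (ball 0 r) g \<circ> h) holomorphic_on ?W"
  proof (rule holomorphic_on_locallyI)
    fix z assume z: "z \<in> ?W"
    obtain c where c: "c \<in> A" "h z \<in> fst c" using chart_A_at hol_discD(6)[OF h] z by blast
    have oc: "openin S (fst c)" using chart_A[OF c(1)] by (simp add: is_chart_def)
    define Wg where "Wg = {z \<in> ball 0 r. g z \<in> fst c}"
    define W' where "W' = ?W \<inter> {z \<in> ball 0 r'. h z \<in> fst c}"
    have oWg: "open Wg" unfolding Wg_def by (rule open_disc_preimage[OF hol_discD(3)[OF g] oc])
    have oW': "open W'" unfolding W'_def by (rule open_Int[OF oW open_disc_preimage[OF hol_discD(3)[OF h] oc]])
    have G: "(snd c \<circ> g) holomorphic_on Wg" unfolding Wg_def by (rule hol_discD(5)[OF g c(1)])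
    have "inj_on (snd c \<circ> g) Wg"
    proof (rule comp_inj_on)
      show "inj_on g Wg" by (rule inj_on_subset[OF hol_discD(2)[OF g]]) (auto simp: Wg_def)
      show "inj_on (snd c) (g ` Wg)" by (rule inj_on_subset[OF is_chart_inj[OF chart_A[OF c(1)]]]) (auto simp: Wg_def)
    qed
    then obtain p where p: "p holomorphic_on (snd c \<circ> g) ` Wg" "\<And>z. z \<in> Wg \<Longrightarrow> p ((snd c \<circ> g) z) = z"
      using holomorphic_has_inverse[OF G oWg] by metis
    have key: "snd c (h w) \<in> (snd c \<circ> g) ` Wg \<and> p (snd c (h w)) = inv_into (ball 0 r) g (h w)" if w: "w \<in> W'" for w
    proof -
      obtain x where x: "x \<in> ball 0 r" "h w = g x" using w by (auto simp: W'_def)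
      have xW: "x \<in> Wg" using x w by (simp add: Wg_def W'_def)
      have "inv_into (ball 0 r) g (h w) = x" using x hol_discD(2)[OF g] by simp
      moreover have e: "snd c (h w) = (snd c \<circ> g) x" using x(2) by simp
      ultimately show ?thesis unfolding e using p(2)[OF xW] xW by blast
    qed
    have "p \<circ> (snd c \<circ> h) holomorphic_on W'"
      by (rule holomorphic_on_compose_gen[OF holomorphic_on_subset[OF hol_discD(5)[OF h c(1)]] p(1)])
        (use key in \<open>auto simp: W'_def\<close>)
    hence "(inv_into (ball 0 r) g \<circ> h) holomorphic_on W'" by (rule holomorphic_transform) (use key in simp)
    thus "\<exists>W'. open W' \<and> z \<in> W' \<and> (inv_into (ball 0 r) g \<circ> h) holomorphic_on W'" using oW' z c by (auto simp: W'_def)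
  qed
qed

lemma disc_near:
  assumes V: "openin S V" "s \<in> V"
  obtains g r where "disc g r" "g 0 = s" "g ` ball 0 r \<subseteq> V" "\<And>z. z \<in> ball 0 r - {0} \<Longrightarrow> imm (g z) \<and> u (g z) \<noteq> u s"
proof -
  have "s \<in> topspace S" using V openin_subset by blast
  then obtain g r where g: "disc g r" "g 0 = s" using hol_disc_exists[OF S] by blast
  obtain \<rho> where \<rho>: "0 < \<rho>" "\<rho> \<le> r" "\<And>z. z \<in> ball 0 \<rho> - {0} \<Longrightarrow> imm (g z) \<and> u (g z) \<noteq> u (g 0)"
    using disc_isolated[OF g(1)] by blast
  have "open {z \<in> ball 0 r. g z \<in> V}" by (rule open_disc_preimage[OF hol_discD(3)[OF g(1)] V(1)])
  moreover have "0 \<in> {z \<in> ball 0 r. g z \<in> V}" using V(2) g(2) disc_zero_in[OF g(1)] by simp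
  ultimately obtain e where e: "e > 0" "ball 0 e \<subseteq> {z \<in> ball 0 r. g z \<in> V}" using openE by blast
  show ?thesis
  proof (rule that[of g "min e \<rho>"])
    show "disc g (min e \<rho>)" by (rule hol_disc_shrink[OF g(1)]) (use \<rho> e in auto)
    show "g ` ball 0 (min e \<rho>) \<subseteq> V" using e by auto
    show "imm (g z) \<and> u (g z) \<noteq> u s" if "z \<in> ball 0 (min e \<rho>) - {0}" for z using \<rho>(3)[of z] that g(2) by simp
  qed (rule g(2))
qed

lemma imm_dense:
  assumes V: "openin S V" "s \<in> V"
  obtains a where "a \<in> V" "a \<noteq> s" "imm a"
proof -
  obtain g r where g: "disc g r" "g 0 = s" "g ` ball 0 r \<subseteq> V" "\<And>z. z \<in> ball 0 r - {0} \<Longrightarrow> imm (g z) \<and> u (g z) \<noteq> u s"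
    using disc_near[OF V] by blast
  have z: "of_real (r / 2) \<in> ball (0::complex) r - {0}" using hol_discD(1)[OF g(1)] by auto
  show ?thesis using that[of "g (of_real (r / 2))"] g(3) g(4)[OF z] z by blast
qed

lemma imm_locally_injective:
  assumes "imm s"
  obtains U where "openin S U" "s \<in> U" "inj_on u U"
proof -
  obtain g r where g: "disc g r" "g 0 = s" "inj_on (u \<circ> g) (ball 0 r)" by (rule imm_disc[OF assms]) blast
  show ?thesis
  proof (rule that[of "g ` ball 0 r"])
    show "openin S (g ` ball 0 r)" by (rule hol_discD(4)[OF g(1)]) auto
    show "s \<in> g ` ball 0 r" using g(2) disc_zero_in[OF g(1)] by blast
    show "inj_on u (g ` ball 0 r)" using g(3) by (rule inj_on_imageI)
  qed
qed

definition overlap :: "'s set \<Rightarrow> 's set \<Rightarrow> bool" where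
  "overlap U V \<longleftrightarrow> (\<exists>U' V'. openin S U' \<and> openin S V' \<and> U' \<subseteq> U \<and> V' \<subseteq> V \<and> U' \<noteq> {} \<and> u ` U' = u ` V')"

text \<open>Asking for equal images of open sets, instead of equal values at the points, ties the
  relation to primitivity; asking it in all neighbourhoods makes the relation closed. The price is
  that transitivity is not formal, see \<open>R_trans\<close>.\<close>

definition R :: "'s \<Rightarrow> 's \<Rightarrow> bool" where
  "R s t \<longleftrightarrow> s \<in> topspace S \<and> t \<in> topspace S \<and>
    (\<forall>U V. openin S U \<longrightarrow> openin S V \<longrightarrow> s \<in> U \<longrightarrow> t \<in> V \<longrightarrow> overlap U V)"

lemma R_topspace: "R s t \<Longrightarrow> s \<in> topspace S" "R s t \<Longrightarrow> t \<in> topspace S"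
  by (simp_all add: R_def)

lemma R_open:
  assumes "R s t" "openin S U" "openin S V" "s \<in> U" "t \<in> V"
  obtains U' V' where "openin S U'" "openin S V'" "U' \<subseteq> U" "V' \<subseteq> V" "U' \<noteq> {}" "u ` U' = u ` V'"
proof -
  have "overlap U V" using assms by (simp add: R_def)
  thus ?thesis using that unfolding overlap_def by blast
qed

lemma R_refl: "s \<in> topspace S \<Longrightarrow> R s s"
  unfolding R_def
proof (intro conjI allI impI)
  fix U V assume "openin S U" "openin S V" "s \<in> U" "s \<in> V"
  thus "overlap U V" unfolding overlap_def by (intro exI[of _ "U \<inter> V"]) auto
qed

lemma R_sym: "R s t \<Longrightarrow> R t s"
proof -
  have "overlap V U" if ov: "overlap U V" for U V
  proof -
    obtain U' V' where "openin S U'" "openin S V'" "U' \<subseteq> U" "V' \<subseteq> V" "U' \<noteq> {}" "u ` U' = u ` V'"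
      using ov unfolding overlap_def by blast
    thus ?thesis unfolding overlap_def by (intro exI[of _ V'] exI[of _ U']) auto
  qed
  thus "R s t \<Longrightarrow> R t s" by (simp add: R_def)
qed

lemma R_closed:
  assumes "s \<in> topspace S" "t \<in> topspace S" "\<not> R s t"
  obtains U V where "openin S U" "openin S V" "s \<in> U" "t \<in> V" "\<And>a b. a \<in> U \<Longrightarrow> b \<in> V \<Longrightarrow> \<not> R a b"
proof -
  obtain U V where UV: "openin S U" "openin S V" "s \<in> U" "t \<in> V" "\<not> overlap U V" using assms unfolding R_def by blast
  have "\<not> R a b" if "a \<in> U" "b \<in> V" for a b
    using UV(1,2,5) that unfolding R_def by blast
  thus ?thesis using that UV(1-4) by blast
qed

text \<open>Otherwise disjoint neighbourhoods of the two values in the Hausdorff space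
  \<open>X\<close> would pull back to neighbourhoods without coincidences.\<close>

lemma coincidence_imp_eq:
  assumes "s \<in> topspace S" "t \<in> topspace S"
    and co: "\<And>U V. openin S U \<Longrightarrow> openin S V \<Longrightarrow> s \<in> U \<Longrightarrow> t \<in> V \<Longrightarrow> \<exists>a\<in>U. \<exists>b\<in>V. u a = u b"
  shows "u s = u t"
proof (rule ccontr)
  assume "u s \<noteq> u t"
  moreover have "u s \<in> topspace X" "u t \<in> topspace X" using cont_u assms by (auto simp: continuous_map_def)
  ultimately obtain P Q where PQ: "openin X P" "openin X Q" "u s \<in> P" "u t \<in> Q" "P \<inter> Q = {}"
    using Hausdorff_X unfolding Hausdorff_space_def disjnt_def by metis
  have "openin S {x \<in> topspace S. u x \<in> P}" "openin S {x \<in> topspace S. u x \<in> Q}"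
    using openin_continuous_map_preimage[OF cont_u] PQ by blast+
  from co[OF this] show False using assms PQ by fastforce
qed

text \<open>The part b \<noteq> t matters: the curves meet away from the centre, which rules out the
  second alternative of \<open>jcurve_meet\<close>. It can be had because a nonempty open set
  contains points other than \<open>t\<close>.\<close>

lemma R_coincidence:
  assumes R: "R s t" and UV: "openin S U" "openin S V" "s \<in> U" "t \<in> V"
  shows "\<exists>a\<in>U. \<exists>b\<in>V. b \<noteq> t \<and> u a = u b"
proof -
  obtain U' V' where V': "openin S U'" "openin S V'" "U' \<subseteq> U" "V' \<subseteq> V" "U' \<noteq> {}" "u ` U' = u ` V'"
    using R_open[OF R UV] by blast
  have "\<exists>b\<in>V'. b \<noteq> t"
  proof (cases "t \<in> V'")
    case True
    from imm_dense[OF V'(2) True] show ?thesis by blast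
  next
    case False
    have "V' \<noteq> {}" using V'(5,6) by auto
    then obtain b where "b \<in> V'" by blast
    thus ?thesis using False by (intro bexI[of _ b]) auto
  qed
  then obtain b where b: "b \<in> V'" "b \<noteq> t" by blast
  then obtain a where "a \<in> U'" "u b = u a" using V'(6) by (metis imageE imageI)
  thus ?thesis using b V' by (metis subsetD)
qed

lemma R_imp_eq: "R s t \<Longrightarrow> u s = u t"
  by (rule coincidence_imp_eq) (use R_topspace R_coincidence in blast)+

text \<open>If \<zeta> were constant, \<open>u\<close> would be constant on the disc
  \<open>g2\<close>; so the open mapping theorem applies.\<close>

lemma factor_open:
  assumes g2: "disc g2 r2" and r': "0 < r'" "r' \<le> r2" and hol: "\<zeta> holomorphic_on ball 0 r'"
    and eq: "\<And>z. z \<in> ball 0 r' \<Longrightarrow> u (g2 z) = u (g (\<zeta> z))" and D: "open D" "D \<subseteq> ball 0 r'"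
  shows "open (\<zeta> ` D)"
proof (rule open_mapping_thm[OF hol _ _ D])
  show "\<not> \<zeta> constant_on ball 0 r'"
  proof
    assume "\<zeta> constant_on ball 0 r'"
    then obtain y where y: "\<And>z. z \<in> ball 0 r' \<Longrightarrow> \<zeta> z = y" by (auto simp: constant_on_def)
    obtain \<rho> where \<rho>: "0 < \<rho>" "\<rho> \<le> r'" "\<And>z. z \<in> ball 0 \<rho> - {0} \<Longrightarrow> imm (g2 z) \<and> u (g2 z) \<noteq> u (g2 0)"
      using disc_isolated[OF hol_disc_shrink[OF g2 r']] by blast
    define w where "w = complex_of_real (\<rho> / 2)"
    have w: "w \<in> ball 0 \<rho> - {0}" "w \<in> ball 0 r'" "0 \<in> ball (0::complex) r'" using \<rho>(1,2) by (auto simp: w_def)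
    show False using \<rho>(3)[OF w(1)] eq[OF w(2)] eq[OF w(3)] y[OF w(2)] y[OF w(3)] by simp
  qed
qed auto

text \<open>As \<zeta> is open, small neighbourhoods of z and their images under \<zeta> give open
  sets of the surface with the same image under \<open>u\<close>.\<close>

lemma factor_imp_R:
  assumes g: "disc g r" and g2: "disc g2 r2" and r': "0 < r'" "r' \<le> r2" and hol: "\<zeta> holomorphic_on ball 0 r'"
    and im: "\<zeta> ` ball 0 r' \<subseteq> ball 0 r" and eq: "\<And>z. z \<in> ball 0 r' \<Longrightarrow> u (g2 z) = u (g (\<zeta> z))" and z: "z \<in> ball 0 r'"
  shows "R (g (\<zeta> z)) (g2 z)"
  unfolding R_def
proof (intro conjI allI impI)
  have sub: "ball (0::complex) r' \<subseteq> ball 0 r2" using r'(2) by auto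
  show "g (\<zeta> z) \<in> topspace S" "g2 z \<in> topspace S" using hol_discD(6)[OF g] hol_discD(6)[OF g2] z im sub by blast+
  fix U V assume U: "openin S U" "g (\<zeta> z) \<in> U" and V: "openin S V" "g2 z \<in> V"
  define D where "D = ball 0 r' \<inter> {w \<in> ball 0 r2. g2 w \<in> V} \<inter> (ball 0 r' \<inter> \<zeta> -` {w \<in> ball 0 r. g w \<in> U})"
  have "open (ball 0 r' \<inter> \<zeta> -` {w \<in> ball 0 r. g w \<in> U})"
    by (rule continuous_open_preimage[OF holomorphic_on_imp_continuous_on[OF hol] open_ball open_disc_preimage[OF hol_discD(3)[OF g] U(1)]])
  hence oD: "open D" unfolding D_def using open_disc_preimage[OF hol_discD(3)[OF g2] V(1)] by blast
  have "open (\<zeta> ` D)" by (rule factor_open[OF g2 r' hol eq oD]) (auto simp: D_def)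
  hence o1: "openin S (g ` (\<zeta> ` D))" by (rule hol_discD(4)[OF g]) (auto simp: D_def)
  have o2: "openin S (g2 ` D)" by (rule hol_discD(4)[OF g2 oD]) (auto simp: D_def)
  have zD: "z \<in> D" using z im sub U V unfolding D_def by blast
  have ee: "u ` (g ` (\<zeta> ` D)) = u ` (g2 ` D)" unfolding image_image
    by (rule image_cong) (use eq in \<open>auto simp: D_def\<close>)
  have "g ` (\<zeta> ` D) \<subseteq> U" "g2 ` D \<subseteq> V" by (auto simp: D_def)
  thus "overlap U V" unfolding overlap_def using o1 o2 ee zD by blast
qed

text \<open>Less than \<open>R\<close> is assumed: coincidences off the second centre that
  accumulate at the two centres suffice. This is what the pigeonhole argument in
  \<open>image_subset_imp_R\<close> provides.\<close>

lemma coincidence_branch: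
  assumes g: "disc g r" and imm: "imm (g 0)" and g2: "disc g2 r2"
    and co: "\<And>U V. openin S U \<Longrightarrow> openin S V \<Longrightarrow> g 0 \<in> U \<Longrightarrow> g2 0 \<in> V \<Longrightarrow> \<exists>a\<in>U. \<exists>b\<in>V. b \<noteq> g2 0 \<and> u a = u b"
  obtains r' \<zeta> where "0 < r'" "r' \<le> r2" "\<zeta> holomorphic_on ball 0 r'" "\<zeta> 0 = 0" "\<zeta> ` ball 0 r' \<subseteq> ball 0 r"
    "\<And>z. z \<in> ball 0 r' \<Longrightarrow> u (g2 z) = u (g (\<zeta> z))" "\<And>z. z \<in> ball 0 r' \<Longrightarrow> R (g (\<zeta> z)) (g2 z)"
proof -
  have top: "g 0 \<in> topspace S" "g2 0 \<in> topspace S"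
    using hol_discD(6)[OF g disc_zero_in[OF g]] hol_discD(6)[OF g2 disc_zero_in[OF g2]] by auto
  have "u (g 0) = u (g2 0)" by (rule coincidence_imp_eq[OF top]) (use co in blast)
  hence eq: "u (g2 0) = u (g 0)" ..
  obtain gi ri where gi: "disc gi ri" "gi 0 = g 0" "inj_on (u \<circ> gi) (ball 0 ri)"
    and meet: "\<And>g2 r2 \<rho>0. disc g2 r2 \<Longrightarrow> u (g2 0) = u (g 0) \<Longrightarrow> \<rho>0 > 0 \<Longrightarrow>
       \<exists>\<rho> r'. 0 < \<rho> \<and> \<rho> \<le> \<rho>0 \<and> \<rho> < ri \<and> 0 < r' \<and> r' \<le> r2 \<and>
        ((\<exists>\<zeta>. \<zeta> holomorphic_on ball 0 r' \<and> \<zeta> 0 = 0 \<and> (\<forall>z\<in>ball 0 r'. \<zeta> z \<in> cball 0 \<rho> \<and> u (g2 z) = u (gi (\<zeta> z)))) \<or>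
         (\<forall>z\<in>ball 0 r' - {0}. \<forall>x\<in>cball 0 \<rho>. u (g2 z) \<noteq> u (gi x)))"
    using imm_disc[OF imm] by blast
  obtain \<rho> r1 where \<rho>: "0 < \<rho>" "\<rho> < ri" "0 < r1" "r1 \<le> r2"
    and dich: "(\<exists>\<zeta>. \<zeta> holomorphic_on ball 0 r1 \<and> \<zeta> 0 = 0 \<and> (\<forall>z\<in>ball 0 r1. \<zeta> z \<in> cball 0 \<rho> \<and> u (g2 z) = u (gi (\<zeta> z)))) \<or>
         (\<forall>z\<in>ball 0 r1 - {0}. \<forall>x\<in>cball 0 \<rho>. u (g2 z) \<noteq> u (gi x))"
    using meet[OF g2 eq zero_less_one] by blast
  have "\<not> (\<forall>z\<in>ball 0 r1 - {0}. \<forall>x\<in>cball 0 \<rho>. u (g2 z) \<noteq> u (gi x))"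
  proof -
    have "openin S (gi ` ball 0 \<rho>)" by (rule hol_discD(4)[OF gi(1)]) (use \<rho> in auto)
    moreover have "openin S (g2 ` ball 0 r1)" by (rule hol_discD(4)[OF g2]) (use \<rho> in auto)
    moreover have "g 0 \<in> gi ` ball 0 \<rho>" using gi(2) \<rho>(1) by (metis centre_in_ball imageI)
    moreover have "g2 0 \<in> g2 ` ball 0 r1" using \<rho>(3) by simp
    ultimately have "\<exists>a\<in>gi ` ball 0 \<rho>. \<exists>b\<in>g2 ` ball 0 r1. b \<noteq> g2 0 \<and> u a = u b" by (rule co)
    then obtain x z where xz: "x \<in> ball 0 \<rho>" "z \<in> ball 0 r1" "g2 z \<noteq> g2 0" "u (gi x) = u (g2 z)" by blast
    hence "z \<in> ball 0 r1 - {0}" "x \<in> cball 0 \<rho>" by auto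
    thus ?thesis using xz(4) by metis
  qed
  then obtain \<xi> where \<xi>: "\<xi> holomorphic_on ball 0 r1" "\<xi> 0 = 0" "\<And>z. z \<in> ball 0 r1 \<Longrightarrow> \<xi> z \<in> cball 0 \<rho>" "\<And>z. z \<in> ball 0 r1 \<Longrightarrow> u (g2 z) = u (gi (\<xi> z))"
    using dich by blast
  define W where "W = {z \<in> ball 0 ri. gi z \<in> g ` ball 0 r}"
  \<comment> \<open>\<open>imm_disc\<close> comes with its own disc at the immersed point; \<tau>
    translates its parameter into that of \<open>g\<close>.\<close>
  define \<tau> where "\<tau> = inv_into (ball 0 r) g \<circ> gi"
  have W: "open W" "\<tau> holomorphic_on W" unfolding W_def \<tau>_def by (rule disc_transition[OF g gi(1)])+
  have 0: "0 \<in> W" using disc_zero_in[OF gi(1)] disc_zero_in[OF g] gi(2) by (simp add: W_def)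
  have "open (ball 0 r1 \<inter> \<xi> -` W)"
    by (rule continuous_open_preimage[OF holomorphic_on_imp_continuous_on[OF \<xi>(1)] open_ball W(1)])
  then obtain e where e: "e > 0" "ball 0 e \<subseteq> ball 0 r1 \<inter> \<xi> -` W" using 0 \<rho>(3) \<xi>(2) openE[of "ball 0 r1 \<inter> \<xi> -` W" 0] by auto
  define r' where "r' = min e r1"
  have sub: "z \<in> ball 0 r1" "\<xi> z \<in> W" if "z \<in> ball 0 r'" for z using that e by (auto simp: r'_def)
  have \<tau>: "\<tau> z \<in> ball 0 r \<and> g (\<tau> z) = gi z" if "z \<in> W" for z
    using that inv_into_into[of "gi z" g "ball 0 r"] f_inv_into_f[of "gi z" g "ball 0 r"] by (simp add: W_def \<tau>_def)
  have r': "0 < r'" "r' \<le> r2" using e \<rho> by (auto simp: r'_def)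
  have hol: "(\<tau> \<circ> \<xi>) holomorphic_on ball 0 r'"
    by (rule holomorphic_on_compose_gen[OF holomorphic_on_subset[OF \<xi>(1)] W(2)]) (use sub in auto)
  have im: "(\<tau> \<circ> \<xi>) ` ball 0 r' \<subseteq> ball 0 r" using sub \<tau> by fastforce
  have eqz: "u (g2 z) = u (g ((\<tau> \<circ> \<xi>) z))" if "z \<in> ball 0 r'" for z
    using \<xi>(4)[OF sub(1)[OF that]] \<tau>[OF sub(2)[OF that]] by simp
  have "\<tau> 0 = 0" using gi(2) inv_into_f_f[OF hol_discD(2)[OF g] disc_zero_in[OF g]] by (simp add: \<tau>_def)
  hence z0: "(\<tau> \<circ> \<xi>) 0 = 0" using \<xi>(2) by simp
  show ?thesis by (rule that[OF r' hol z0 im eqz factor_imp_R[OF g g2 r' hol im eqz]])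
qed

lemma R_branch:
  assumes g: "disc g r" and imm: "imm (g 0)" and g2: "disc g2 r2" and R: "R (g 0) (g2 0)"
  obtains r' \<zeta> where "0 < r'" "r' \<le> r2" "\<zeta> holomorphic_on ball 0 r'" "\<zeta> 0 = 0" "\<zeta> ` ball 0 r' \<subseteq> ball 0 r"
    "\<And>z. z \<in> ball 0 r' \<Longrightarrow> u (g2 z) = u (g (\<zeta> z))" "\<And>z. z \<in> ball 0 r' \<Longrightarrow> R (g (\<zeta> z)) (g2 z)"
proof (rule coincidence_branch[OF g imm g2])
  show "\<exists>a\<in>U. \<exists>b\<in>V. b \<noteq> g2 0 \<and> u a = u b"
    if "openin S U" "openin S V" "g 0 \<in> U" "g2 0 \<in> V" for U V
    by (rule R_coincidence[OF R that])
qed (rule that)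

end

context jcurve_setup
begin

section \<open>Open sets with comparable images contain related points\<close>

lemma second_countable_S: "second_countable S"
  using S by (simp add: riemann_surface_def topological_manifold_def)

text \<open>The Lindeloef property. The covering discs have half the radius of discs inside
  \<open>V\<close>, so the corresponding closed parameter discs are compact and still parametrize
  subsets of \<open>V\<close>.\<close>

lemma disc_cover:
  assumes V: "openin S V"
  obtains \<V> where "countable \<V>" "\<Union>\<V> = V" "\<And>W. W \<in> \<V> \<Longrightarrow> \<exists>g r. disc g r \<and> W = g ` ball 0 (r / 2) \<and> g ` ball 0 r \<subseteq> V"
proof -
  define \<U> where "\<U> = {W. \<exists>g r. disc g r \<and> W = g ` ball 0 (r / 2) \<and> g ` ball 0 r \<subseteq> V}"
  have "Lindelof_space (subtopology S V)"
    by (intro second_countable_imp_Lindelof_space second_countable_subtopology second_countable_S)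
  moreover have op: "openin (subtopology S V) W" if W: "W \<in> \<U>" for W
  proof -
    obtain g r where g: "disc g r" "W = g ` ball 0 (r / 2)" "g ` ball 0 r \<subseteq> V" using W unfolding \<U>_def by blast
    have "ball (0::complex) (r / 2) \<subseteq> ball 0 r" using hol_discD(1)[OF g(1)] by auto
    hence "openin S W" "W \<subseteq> V" using hol_discD(4)[OF g(1), of "ball 0 (r / 2)"] g(2,3) by auto
    thus ?thesis using openin_open_subtopology[OF V] by blast
  qed
  moreover have un: "\<Union>\<U> = topspace (subtopology S V)"
  proof (intro equalityI subsetI)
    fix s assume "s \<in> topspace (subtopology S V)"
    hence s: "s \<in> V" by simp
    obtain g r where g: "disc g r" "g 0 = s" "g ` ball 0 r \<subseteq> V" 
      by (rule disc_near[OF V s]) (rule that; assumption)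
    have "s \<in> g ` ball 0 (r / 2)" using g(2) hol_discD(1)[OF g(1)] by (intro image_eqI[of _ _ 0]) auto
    moreover have "g ` ball 0 (r / 2) \<in> \<U>" unfolding \<U>_def using g by blast
    ultimately show "s \<in> \<Union>\<U>" by blast
  next
    fix s assume "s \<in> \<Union>\<U>"
    then obtain W where "W \<in> \<U>" "s \<in> W" by blast
    thus "s \<in> topspace (subtopology S V)" using op openin_subset by blast
  qed
  ultimately obtain \<V> where "countable \<V>" "\<V> \<subseteq> \<U>" "\<Union>\<V> = topspace (subtopology S V)"
    using Lindelof_spaceD[OF _ op un] by metis
  thus ?thesis using that[of \<V>] openin_subset[OF V] unfolding \<U>_def by (auto simp: inf_absorb2)
qed

text \<open>
  By the pigeonhole principle infinitely many of the uncountably many points of a closed disc in \<open>U\<close>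
  have the same value as points of a single closed disc in \<open>V\<close>; these pairs accumulate at \<open>R\<close>-related points.
\<close>

lemma image_subset_imp_R:
  assumes U: "openin S U" "U \<noteq> {}" and V: "openin S V" and UV: "u ` U \<subseteq> u ` V"
  shows "\<exists>a\<in>U. \<exists>b\<in>V. R a b"
proof -
  obtain a0 where a0: "a0 \<in> U" "imm a0" using imm_dense[OF U(1)] U(2) by blast
  obtain U1 where U1: "openin S U1" "a0 \<in> U1" "inj_on u U1" using imm_locally_injective[OF a0(2)] by blast
  obtain g r where g: "disc g r" "g 0 = a0" "g ` ball 0 r \<subseteq> U \<inter> U1" "\<And>z. z \<in> ball 0 r - {0} \<Longrightarrow> imm (g z) \<and> u (g z) \<noteq> u a0"
    using disc_near[OF openin_Int[OF U(1) U1(1)], of a0] a0(1) U1(2) by blast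
  have im: "imm (g z)" if "z \<in> ball 0 r" for z using g(2,4) a0(2) that by (cases "z = 0") auto
  have r: "r > 0" by (rule hol_discD(1)[OF g(1)])
  \<comment> \<open>Injectivity on the first disc means that a coinciding pair is determined by its
    second member.\<close>
  have ui: "z = z'" if "z \<in> ball 0 r" "z' \<in> ball 0 r" "u (g z) = u (g z')" for z z'
  proof -
    have "g z \<in> U1" "g z' \<in> U1" using g(3) that by auto
    hence "g z = g z'" using U1(3) that(3) by (auto dest: inj_onD)
    thus ?thesis using hol_discD(2)[OF g(1)] that by (auto dest: inj_onD)
  qed
  obtain \<V> where \<V>: "countable \<V>" "\<Union>\<V> = V" "\<And>W. W \<in> \<V> \<Longrightarrow> \<exists>g r. disc g r \<and> W = g ` ball 0 (r / 2) \<and> g ` ball 0 r \<subseteq> V"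
    using disc_cover[OF V] by blast
  let ?K = "cball (0::complex) (r / 2)"
  have Kr: "?K \<subseteq> ball 0 r" using r by auto
  define T where "T = (\<lambda>W. {x \<in> ?K. u (g x) \<in> u ` W})"
  have "?K \<subseteq> (\<Union>W\<in>\<V>. T W)"
  proof
    fix x assume x: "x \<in> ?K"
    hence "g x \<in> U" using g(3) Kr by blast
    then obtain b where b: "b \<in> V" "u (g x) = u b" using UV by blast
    then obtain W where "W \<in> \<V>" "b \<in> W" using \<V>(2) by blast
    thus "x \<in> (\<Union>W\<in>\<V>. T W)" using x b(2) by (auto simp: T_def)
  qed
  moreover have "uncountable ?K" by (rule uncountable_cball) (use r in simp)
  ultimately have "uncountable (\<Union>W\<in>\<V>. T W)" using countable_subset by blast
  then obtain W where W: "W \<in> \<V>" "uncountable (T W)" using countable_UN[OF \<V>(1), of T] by blast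
  obtain g2 r2 where g2: "disc g2 r2" "W = g2 ` ball 0 (r2 / 2)" "g2 ` ball 0 r2 \<subseteq> V" using \<V>(3)[OF W(1)] by blast
  have r2: "r2 > 0" by (rule hol_discD(1)[OF g2(1)])
  let ?L = "cball (0::complex) (r2 / 2)"
  define P where "P = {p \<in> ?K \<times> ?L. u (g (fst p)) = u (g2 (snd p))}"
  have "T W \<subseteq> fst ` P"
  proof
    fix x assume x: "x \<in> T W"
    then obtain w where w: "w \<in> ball 0 (r2 / 2)" "u (g x) = u (g2 w)" using g2(2) by (auto simp: T_def)
    hence "(x, w) \<in> P" using x by (auto simp: P_def T_def)
    thus "x \<in> fst ` P" by force
  qed
  moreover have "infinite (T W)" using W(2) uncountable_infinite by blast
  ultimately have "infinite P" using finite_subset finite_imageI by metis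
  moreover have "compact (?K \<times> ?L)" by (intro compact_Times compact_cball)
  moreover have "P \<subseteq> ?K \<times> ?L" by (auto simp: P_def)
  ultimately obtain p where p: "p \<in> ?K \<times> ?L" "p islimpt P" unfolding compact_eq_Bolzano_Weierstrass by blast
  define x0 w0 where "x0 = fst p" and "w0 = snd p"
  have x0: "x0 \<in> ball 0 r" and w0: "w0 \<in> ball 0 r2" using p(1) r r2 by (auto simp: x0_def w0_def)
  have G: "disc (\<lambda>z. g (x0 + z)) (r - norm x0)" by (rule hol_disc_recenter[OF g(1) x0])
  have G2: "disc (\<lambda>z. g2 (w0 + z)) (r2 - norm w0)" by (rule hol_disc_recenter[OF g2(1) w0])
  have co: "\<exists>a\<in>O1. \<exists>b\<in>Q. b \<noteq> g2 (w0 + 0) \<and> u a = u b" if OQ: "openin S O1" "openin S Q" "g (x0 + 0) \<in> O1" "g2 (w0 + 0) \<in> Q" for O1 Q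
  proof -
    define N where "N = {z \<in> ball 0 r. g z \<in> O1} \<times> {z \<in> ball 0 r2. g2 z \<in> Q}"
    have "open N" unfolding N_def
      by (intro open_Times open_disc_preimage[OF hol_discD(3)[OF g(1)] OQ(1)] open_disc_preimage[OF hol_discD(3)[OF g2(1)] OQ(2)])
    moreover have "p \<in> N" using x0 w0 OQ(3,4) by (simp add: N_def x0_def w0_def mem_Times_iff)
    ultimately have inf: "infinite (N \<inter> P)" using p(2) unfolding islimpt_eq_acc_point by blast
    \<comment> \<open>If all pairs near the limit point had second member \<open>w0\<close>, they
      would be equal by \<open>ui\<close>; but there are infinitely many of them.\<close>
    have "\<exists>q\<in>N \<inter> P. snd q \<noteq> w0"
    proof (rule ccontr)
      assume *: "\<not> (\<exists>q\<in>N \<inter> P. snd q \<noteq> w0)"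
      have "q = q'" if "q \<in> N \<inter> P" "q' \<in> N \<inter> P" for q q'
      proof -
        have s: "snd q = w0" "snd q' = w0" using * that by auto
        have "u (g (fst q)) = u (g2 (snd q))" "u (g (fst q')) = u (g2 (snd q'))" using that by (auto simp: P_def)
        hence "u (g (fst q)) = u (g (fst q'))" using s by simp
        moreover have "fst q \<in> ball 0 r" "fst q' \<in> ball 0 r" using that by (auto simp: N_def)
        ultimately have "fst q = fst q'" by (rule ui[rotated 2])
        thus ?thesis using s by (simp add: prod_eq_iff)
      qed
      hence "finite (N \<inter> P)" using infinite_imp_nonempty by (metis finite.simps insertI1 is_singletonI' is_singleton_def)
      thus False using inf by blast
    qed
    then obtain q where q: "q \<in> N" "q \<in> P" "snd q \<noteq> w0" by blast
    have "snd q \<in> ball 0 r2" using q by (auto simp: N_def)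
    hence "g2 (snd q) \<noteq> g2 w0" using q(3) w0 hol_discD(2)[OF g2(1)] by (auto dest: inj_onD)
    moreover have "g (fst q) \<in> O1" "g2 (snd q) \<in> Q" using q(1) by (auto simp: N_def)
    moreover have "u (g (fst q)) = u (g2 (snd q))" using q(2) by (simp add: P_def)
    ultimately show ?thesis by (metis add_0_right)
  qed
  have imG: "imm (g (x0 + 0))" using im[OF x0] by simp
  obtain r' \<zeta> where \<zeta>: "0 < r'" "\<zeta> 0 = 0" "\<And>z. z \<in> ball 0 r' \<Longrightarrow> R (g (x0 + \<zeta> z)) (g2 (w0 + z))"
    by (rule coincidence_branch[OF G imG G2 co]) auto
  have "R (g x0) (g2 w0)" using \<zeta>(3)[of 0] \<zeta>(1,2) by simp
  thus ?thesis using g(3) g2(3) x0 w0 by blast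
qed

text \<open>Near \<open>a\<close> and near \<open>c\<close> the curve factors through the disc at
  the immersed point \<open>b\<close>, by \<zeta> and \<xi>. Their images are open and contain 0, so
  they share an open set \<open>D\<close>; its preimages give open sets near \<open>a\<close> and
  \<open>c\<close> with the same image under \<open>u\<close>.\<close>

lemma R_trans_imm:
  assumes ab: "R a b" and bc: "R b c" and b: "imm b"
  shows "R a c"
  unfolding R_def
proof (intro conjI allI impI)
  show "a \<in> topspace S" "c \<in> topspace S" using ab bc R_topspace by blast+
  fix U V assume U: "openin S U" "a \<in> U" and V: "openin S V" "c \<in> V"
  obtain g r where g: "disc g r" "g 0 = b" using hol_disc_exists[OF S R_topspace(1)[OF bc]] by blast
  obtain g2 r2 where g2: "disc g2 r2" "g2 0 = a" "g2 ` ball 0 r2 \<subseteq> U" 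
    by (rule disc_near[OF U]) (rule that; assumption)
  obtain g3 r3 where g3: "disc g3 r3" "g3 0 = c" "g3 ` ball 0 r3 \<subseteq> V" 
    by (rule disc_near[OF V]) (rule that; assumption)
  have im: "imm (g 0)" using b g(2) by simp
  have R2: "R (g 0) (g2 0)" using R_sym[OF ab] g(2) g2(2) by simp
  have R3: "R (g 0) (g3 0)" using bc g(2) g3(2) by simp
  obtain s2 \<zeta> where \<zeta>: "0 < s2" "s2 \<le> r2" "\<zeta> holomorphic_on ball 0 s2" "\<zeta> 0 = 0" "\<And>z. z \<in> ball 0 s2 \<Longrightarrow> u (g2 z) = u (g (\<zeta> z))"
    by (rule R_branch[OF g(1) im g2(1) R2]) (rule that; assumption)
  obtain s3 \<xi> where \<xi>: "0 < s3" "s3 \<le> r3" "\<xi> holomorphic_on ball 0 s3" "\<xi> 0 = 0" "\<And>z. z \<in> ball 0 s3 \<Longrightarrow> u (g3 z) = u (g (\<xi> z))"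
    by (rule R_branch[OF g(1) im g3(1) R3]) (rule that; assumption)
  define D where "D = \<zeta> ` ball 0 s2 \<inter> \<xi> ` ball 0 s3"
  have oD: "open D" unfolding D_def
    by (intro open_Int factor_open[OF g2(1) \<zeta>(1,2,3,5)] factor_open[OF g3(1) \<xi>(1,2,3,5)]) auto
  define D2 where "D2 = ball 0 s2 \<inter> \<zeta> -` D"
  define D3 where "D3 = ball 0 s3 \<inter> \<xi> -` D"
  have oD2: "open D2" unfolding D2_def
    by (rule continuous_open_preimage[OF holomorphic_on_imp_continuous_on[OF \<zeta>(3)] open_ball oD])
  have oD3: "open D3" unfolding D3_def
    by (rule continuous_open_preimage[OF holomorphic_on_imp_continuous_on[OF \<xi>(3)] open_ball oD])
  have sub2: "D2 \<subseteq> ball 0 r2" and sub3: "D3 \<subseteq> ball 0 r3" using \<zeta>(2) \<xi>(2) by (auto simp: D2_def D3_def)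
  have o2: "openin S (g2 ` D2)" by (rule hol_discD(4)[OF g2(1) oD2 sub2])
  have o3: "openin S (g3 ` D3)" by (rule hol_discD(4)[OF g3(1) oD3 sub3])
  have "u ` g2 ` D2 = u ` g ` D"
  proof -
    have "D \<subseteq> \<zeta> ` ball 0 s2" by (simp add: D_def)
    hence "D = \<zeta> ` D2" unfolding D2_def by blast
    moreover have "u (g2 z) = u (g (\<zeta> z))" if "z \<in> D2" for z by (rule \<zeta>(5)) (use that in \<open>simp add: D2_def\<close>)
    ultimately show ?thesis by (simp add: image_image)
  qed
  moreover have "u ` g3 ` D3 = u ` g ` D"
  proof -
    have "D \<subseteq> \<xi> ` ball 0 s3" by (simp add: D_def)
    hence "D = \<xi> ` D3" unfolding D3_def by blast
    moreover have "u (g3 z) = u (g (\<xi> z))" if "z \<in> D3" for z by (rule \<xi>(5)) (use that in \<open>simp add: D3_def\<close>)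
    ultimately show ?thesis by (simp add: image_image)
  qed
  moreover have "0 \<in> D2"
  proof -
    have "\<zeta> 0 \<in> \<zeta> ` ball 0 s2" "\<xi> 0 \<in> \<xi> ` ball 0 s3" using \<zeta>(1) \<xi>(1) by auto
    thus ?thesis using \<zeta>(1,4) \<xi>(4) by (simp add: D2_def D_def)
  qed
  moreover have "g2 ` D2 \<subseteq> U" using sub2 g2(3) by blast
  moreover have "g3 ` D3 \<subseteq> V" using sub3 g3(3) by blast
  ultimately show "overlap U V"
    unfolding overlap_def using o2 o3 by (intro exI[of _ "g2 ` D2"] exI[of _ "g3 ` D3"]) auto
qed

section \<open>Continuation of related points, and transitivity\<close>

lemma closed_R_discs:
  assumes g: "disc g r" and h: "disc h \<delta>" and K: "K \<subseteq> ball 0 r" and P: "P \<subseteq> ball 0 \<delta>"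
  shows "closedin (top_of_set (K \<times> P)) {p \<in> K \<times> P. R (h (snd p)) (g (fst p))}"
  unfolding closedin_def
proof (intro conjI)
  let ?M = "K \<times> P" let ?E = "{p \<in> ?M. R (h (snd p)) (g (fst p))}"
  show "?E \<subseteq> topspace (top_of_set ?M)" by auto
  show "openin (top_of_set ?M) (topspace (top_of_set ?M) - ?E)"
  proof (subst openin_subopen, intro ballI)
    fix p assume p: "p \<in> topspace (top_of_set ?M) - ?E"
    hence in1: "fst p \<in> ball 0 r" "snd p \<in> ball 0 \<delta>" and nR: "\<not> R (h (snd p)) (g (fst p))" using K P by auto
    obtain U V where UV: "openin S U" "openin S V" "h (snd p) \<in> U" "g (fst p) \<in> V" "\<And>a b. a \<in> U \<Longrightarrow> b \<in> V \<Longrightarrow> \<not> R a b"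
    proof (rule R_closed[OF hol_discD(6)[OF h in1(2)] hol_discD(6)[OF g in1(1)] nR])
    qed (rule that)
    define T where "T = {z \<in> ball 0 r. g z \<in> V} \<times> {z \<in> ball 0 \<delta>. h z \<in> U}"
    have "open T" unfolding T_def
      by (intro open_Times open_disc_preimage[OF hol_discD(3)[OF g] UV(2)] open_disc_preimage[OF hol_discD(3)[OF h] UV(1)])
    hence "openin (top_of_set ?M) (?M \<inter> T)" by (rule openin_open_Int)
    moreover have "p \<in> ?M \<inter> T" using p in1 UV(3,4) by (auto simp: T_def mem_Times_iff)
    moreover have "?M \<inter> T \<subseteq> topspace (top_of_set ?M) - ?E" using UV(5) by (auto simp: T_def)
    ultimately show "\<exists>T. openin (top_of_set ?M) T \<and> p \<in> T \<and> T \<subseteq> topspace (top_of_set ?M) - ?E" by blast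
  qed
qed

text \<open>The circle of radius \<rho> is compact and its image misses u (g 0). Near the points
  over u (g 0) the values of \<open>u\<close> avoid that image, so coincidences within the closed
  disc cannot lie on its boundary.\<close>

lemma disc_trap:
  assumes g: "disc g r" and \<rho>: "0 < \<rho>" "\<rho> < r" and ne: "\<And>z. z \<in> ball 0 r - {0} \<Longrightarrow> u (g z) \<noteq> u (g 0)"
  obtains N where "openin S N" "\<And>s. s \<in> topspace S \<Longrightarrow> u s = u (g 0) \<Longrightarrow> s \<in> N"
    "\<And>x b. x \<in> N \<Longrightarrow> b \<in> cball 0 \<rho> \<Longrightarrow> u x = u (g b) \<Longrightarrow> b \<in> ball 0 \<rho>"
proof -
  have sph: "sphere (0::complex) \<rho> \<subseteq> ball 0 r - {0}" using \<rho> by auto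
  define C where "C = (u \<circ> g) ` sphere 0 \<rho>"
  have "compactin (top_of_set (ball 0 r)) (sphere (0::complex) \<rho>)"
    using sph by (auto simp: compactin_subtopology)
  hence "compactin X C" unfolding C_def
    using continuous_map_compose[OF hol_discD(3)[OF g] cont_u] by (rule image_compactin)
  hence "closedin X C" by (rule compactin_imp_closedin[OF Hausdorff_X])
  show ?thesis
  proof (rule that[of "{x \<in> topspace S. u x \<in> topspace X - C}"])
    show "openin S {x \<in> topspace S. u x \<in> topspace X - C}"
      using openin_continuous_map_preimage[OF cont_u] \<open>closedin X C\<close> by blast
    have "u (g 0) \<notin> C"
    proof
      assume "u (g 0) \<in> C"
      then obtain z where "z \<in> sphere 0 \<rho>" "u (g 0) = u (g z)" by (auto simp: C_def)
      thus False using ne[OF subsetD[OF sph]] by metis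
    qed
    moreover have "u s \<in> topspace X" if "s \<in> topspace S" for s using that cont_u by (auto simp: continuous_map_def)
    ultimately show "s \<in> {x \<in> topspace S. u x \<in> topspace X - C}" if "s \<in> topspace S" "u s = u (g 0)" for s
      using that by (metis (mono_tags, lifting) DiffI mem_Collect_eq)
    show "b \<in> ball 0 \<rho>" if "x \<in> {x \<in> topspace S. u x \<in> topspace X - C}" "b \<in> cball 0 \<rho>" "u x = u (g b)" for x b
      using that by (force simp: C_def)
  qed
qed

text \<open>Continuation along a punctured disc around \<open>s\<close>. The parameters whose point
  has a partner in the closed disc around \<open>t\<close> form a set that is closed by compactness,
  open by \<open>R_branch\<close> at the partner, and nonempty; the punctured disc is connected. The
  centre is left out because \<open>t\<close> need not be immersed.\<close>

lemma R_lift: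
  assumes R: "R s t" and V: "openin S V" "t \<in> V"
  obtains U where "openin S U" "s \<in> U" "\<And>a. a \<in> U \<Longrightarrow> \<exists>b\<in>V. R a b \<and> (a \<noteq> s \<longrightarrow> imm b)"
proof -
  obtain g r where g: "disc g r" "g 0 = t" "g ` ball 0 r \<subseteq> V" "\<And>z. z \<in> ball 0 r - {0} \<Longrightarrow> imm (g z) \<and> u (g z) \<noteq> u t"
    using disc_near[OF V] by blast
  have r: "r > 0" by (rule hol_discD(1)[OF g(1)])
  define \<rho> where "\<rho> = r / 2"
  have \<rho>: "\<rho> > 0" "\<rho> \<le> r" "\<rho> < r" "cball (0::complex) \<rho> \<subseteq> ball 0 r" using r by (auto simp: \<rho>_def)
  have us: "u s = u t" by (rule R_imp_eq[OF R])
  have ne: "u (g z) \<noteq> u (g 0)" if "z \<in> ball 0 r - {0}" for z using g(2) g(4)[OF that] by simp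
  obtain N where N: "openin S N" "\<And>s. s \<in> topspace S \<Longrightarrow> u s = u (g 0) \<Longrightarrow> s \<in> N"
    "\<And>x b. x \<in> N \<Longrightarrow> b \<in> cball 0 \<rho> \<Longrightarrow> u x = u (g b) \<Longrightarrow> b \<in> ball 0 \<rho>"
  proof (rule disc_trap[OF g(1) \<rho>(1,3)])
    show "u (g z) \<noteq> u (g 0)" if "z \<in> ball 0 r - {0}" for z by (rule ne[OF that])
  qed (rule that)
  have sN: "s \<in> N" using N(2) us g(2) R_topspace(1)[OF R] by simp
  obtain h \<delta> where h: "disc h \<delta>" "h 0 = s" "h ` ball 0 \<delta> \<subseteq> N" "\<And>z. z \<in> ball 0 \<delta> - {0} \<Longrightarrow> imm (h z) \<and> u (h z) \<noteq> u s"
    using disc_near[OF N(1) sN] by blast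
  define P where "P = ball (0::complex) \<delta> - {0}"
  define E where "E = {a. \<exists>b. b \<in> cball 0 \<rho> \<and> (b, a) \<in> {p \<in> cball 0 \<rho> \<times> P. R (h (snd p)) (g (fst p))}}"
  have E: "a \<in> E \<longleftrightarrow> a \<in> P \<and> (\<exists>b \<in> cball 0 \<rho>. R (h a) (g b))" for a by (auto simp: E_def)
  \<comment> \<open>A partner is neither on the circle, by \<open>disc_trap\<close>, nor the centre,
    since u (h a) \<noteq> u s = u t. So it is immersed and \<open>R_branch\<close> applies to
    it.\<close>
  have inner: "b \<in> ball 0 \<rho> - {0}" if a: "a \<in> P" and b: "b \<in> cball 0 \<rho>" and Rab: "R (h a) (g b)" for a b
  proof -
    have "u (h a) \<noteq> u s" using h(4)[of a] a by (simp add: P_def)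
    moreover have "h a \<in> N" using h(3) a by (auto simp: P_def)
    moreover have e: "u (h a) = u (g b)" by (rule R_imp_eq[OF Rab])
    ultimately have "u (g b) \<noteq> u (g 0)" "b \<in> ball 0 \<rho>" using us g(2) N(3) b by auto
    thus ?thesis by auto
  qed
  \<comment> \<open>The partner ranges over a compact disc, so the projection of the closed relation
    is closed.\<close>
  have "closedin (top_of_set P) E" unfolding E_def
    by (rule closedin_compact_projection[OF compact_cball closed_R_discs[OF g(1) h(1) \<rho>(4)]]) (auto simp: P_def)
  moreover have "openin (top_of_set P) E"
  proof (subst openin_subopen, intro ballI)
    fix a assume "a \<in> E"
    then obtain b where ab: "a \<in> P" "b \<in> cball 0 \<rho>" "R (h a) (g b)" using E by blast
    have b: "b \<in> ball 0 \<rho> - {0}" by (rule inner[OF ab])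
    hence bb: "b \<in> ball 0 \<rho>" "b \<in> ball 0 r - {0}" using \<rho> by auto
    have aa: "a \<in> ball 0 \<delta>" using ab(1) by (simp add: P_def)
    have G: "disc (\<lambda>z. g (b + z)) (\<rho> - norm b)" by (rule hol_disc_recenter[OF hol_disc_shrink[OF g(1) \<rho>(1,2)] bb(1)])
    have H: "disc (\<lambda>z. h (a + z)) (\<delta> - norm a)" by (rule hol_disc_recenter[OF h(1) aa])
    have iG: "imm (g (b + 0))" using g(4)[OF bb(2)] by simp
    have RG: "R (g (b + 0)) (h (a + 0))" using R_sym[OF ab(3)] by simp
    obtain r' \<zeta> where \<zeta>: "0 < r'" "\<zeta> ` ball 0 r' \<subseteq> ball 0 (\<rho> - norm b)" "\<And>z. z \<in> ball 0 r' \<Longrightarrow> R (g (b + \<zeta> z)) (h (a + z))"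
      by (rule R_branch[OF G iG H RG]) (rule that; assumption)
    have "P \<inter> ball a r' \<subseteq> E"
    proof
      fix x assume x: "x \<in> P \<inter> ball a r'"
      hence z: "x - a \<in> ball 0 r'" by (simp add: dist_norm norm_minus_commute)
      have "norm (\<zeta> (x - a)) < \<rho> - norm b" using \<zeta>(2) z by force
      hence "b + \<zeta> (x - a) \<in> cball 0 \<rho>" using norm_triangle_ineq[of b "\<zeta> (x - a)"] by simp
      moreover have "R (h x) (g (b + \<zeta> (x - a)))" using R_sym[OF \<zeta>(3)[OF z]] by simp
      ultimately show "x \<in> E" using E x by blast
    qed
    moreover have "openin (top_of_set P) (P \<inter> ball a r')" by (rule openin_open_Int) simp
    ultimately show "\<exists>T. openin (top_of_set P) T \<and> a \<in> T \<and> T \<subseteq> E" using ab(1) \<zeta>(1) by (intro exI[of _ "P \<inter> ball a r'"]) auto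
  qed
  moreover have "connected P" unfolding P_def by (rule connected_punctured_ball) simp
  moreover have "E \<noteq> {}"
  proof -
    have oU: "openin S (h ` ball 0 \<delta>)" by (rule hol_discD(4)[OF h(1)]) auto
    have oV: "openin S (g ` ball 0 \<rho>)" by (rule hol_discD(4)[OF g(1)]) (use \<rho> in auto)
    have in': "s \<in> h ` ball 0 \<delta>" "t \<in> g ` ball 0 \<rho>"
      using h(2) g(2) disc_zero_in[OF h(1)] \<rho>(1) by (metis centre_in_ball imageI)+
    obtain U' V' where UV: "openin S U'" "openin S V'" "U' \<subseteq> h ` ball 0 \<delta>" "V' \<subseteq> g ` ball 0 \<rho>" "U' \<noteq> {}" "u ` U' = u ` V'"
      by (rule R_open[OF R oU oV in'])
    \<comment> \<open>The centre is removed so that the related pair found next lies over the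
      punctured disc.\<close>
    have o1: "openin S (U' - {s})" using Hausdorff_imp_t1_space[OF Hausdorff_S] UV(1) unfolding t1_space_openin_delete_alt by blast
    obtain x where "x \<in> U'" using UV(5) by blast
    then obtain y where "y \<in> U'" "y \<noteq> s"
    proof (cases "x = s")
      case True
      then show ?thesis using imm_dense[OF UV(1)] \<open>x \<in> U'\<close> that by metis
    qed (use that in blast)
    hence ne: "U' - {s} \<noteq> {}" by blast
    have "u ` (U' - {s}) \<subseteq> u ` V'" using UV(6) by blast
    from image_subset_imp_R[OF o1 ne UV(2) this] obtain a' b' where ab: "a' \<in> U' - {s}" "b' \<in> V'" "R a' b'" by blast
    then obtain a b where a: "a \<in> ball 0 \<delta>" "a' = h a" and b: "b \<in> ball 0 \<rho>" "b' = g b" using UV(3,4) by blast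
    have "a \<noteq> 0" using ab(1) a(2) h(2) by auto
    hence "a \<in> E" using E a b ab(3) by (auto simp: P_def)
    thus ?thesis by blast
  qed
  ultimately have EP: "E = P" using connected_clopen[of P] by blast
  show ?thesis
  proof (rule that[of "h ` ball 0 \<delta>"])
    show "openin S (h ` ball 0 \<delta>)" by (rule hol_discD(4)[OF h(1)]) auto
    show "s \<in> h ` ball 0 \<delta>" using h(2) disc_zero_in[OF h(1)] by blast
    fix x assume "x \<in> h ` ball 0 \<delta>"
    then obtain a where a: "a \<in> ball 0 \<delta>" "x = h a" by blast
    show "\<exists>b\<in>V. R x b \<and> (x \<noteq> s \<longrightarrow> imm b)"
    proof (cases "a = 0")
      case True
      thus ?thesis using R V a h(2) by blast
    next
      case False
      hence aP: "a \<in> P" using a by (simp add: P_def)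
      then obtain b where b: "b \<in> cball 0 \<rho>" "R (h a) (g b)" using E EP by blast
      have "b \<in> ball 0 \<rho> - {0}" by (rule inner[OF aP b])
      hence bb: "b \<in> ball 0 r - {0}" using \<rho> by auto
      have "g b \<in> V" using g(3) bb by blast
      thus ?thesis using b(2) a(2) g(4)[OF bb] by blast
    qed
  qed
qed

text \<open>Two continuations move the chain off \<open>s\<close>: a point a \<noteq> s near
  \<open>s\<close> has an immersed partner \<open>b\<close> near \<open>t\<close>, which has a
  partner \<open>c\<close> near \<open>p\<close>, and \<open>R_trans_imm\<close> applies to the
  triple. As \<open>R\<close> speaks of neighbourhoods, R a c yields the overlap needed for
  \<open>s\<close> and \<open>p\<close>.\<close>

lemma R_trans:
  assumes st: "R s t" and tp: "R t p"
  shows "R s p"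
  unfolding R_def
proof (intro conjI allI impI)
  show s: "s \<in> topspace S" and "p \<in> topspace S" using st tp R_topspace by blast+
  fix U V assume U: "openin S U" "s \<in> U" and V: "openin S V" "p \<in> V"
  obtain T where T: "openin S T" "t \<in> T" "\<And>a. a \<in> T \<Longrightarrow> \<exists>b\<in>V. R a b \<and> (a \<noteq> t \<longrightarrow> imm b)"
    by (rule R_lift[OF tp V]) (rule that; assumption)
  obtain U2 where U2: "openin S U2" "s \<in> U2" "\<And>a. a \<in> U2 \<Longrightarrow> \<exists>b\<in>T. R a b \<and> (a \<noteq> s \<longrightarrow> imm b)"
    by (rule R_lift[OF st T(1,2)]) (rule that; assumption)
  obtain a where a: "a \<in> U \<inter> U2" "a \<noteq> s" using imm_dense[OF openin_Int[OF U(1) U2(1)], of s] U(2) U2(2) by blast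
  obtain b where b: "b \<in> T" "R a b" "imm b" using U2(3)[of a] a by blast
  obtain c where c: "c \<in> V" "R b c" using T(3)[OF b(1)] by blast
  have "R a c" by (rule R_trans_imm[OF b(2) c(2) b(3)])
  thus "overlap U V"
    using U(1) V(1) a(1) c(1) by (simp add: R_def)
qed

end

subsection \<open>Normal form of the equivalence relation\<close>

text \<open>Each radius may be shrunk, so the minimum over the finite set works without any
  monotonicity of \<open>P\<close>.\<close>

lemma finite_uniform_radius:
  assumes "finite F" "\<And>b. b \<in> F \<Longrightarrow> \<exists>e>0. \<forall>d. 0 < d \<longrightarrow> d \<le> e \<longrightarrow> P b d"
  shows "\<exists>e>0. \<forall>b\<in>F. P b (e::real)"
proof -
  have "\<exists>e>0. \<forall>b\<in>F. \<forall>d. 0 < d \<longrightarrow> d \<le> (e::real) \<longrightarrow> P b d"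
    using assms
  proof (induction F rule: finite_induct)
    case empty
    show ?case by (intro exI[of _ 1]) simp
  next
    case (insert x F)
    obtain e where e: "e > 0" "\<And>b d. b \<in> F \<Longrightarrow> 0 < d \<Longrightarrow> d \<le> e \<Longrightarrow> P b d" using insert.IH insert.prems by blast
    obtain e' where e': "e' > 0" "\<And>d. 0 < d \<Longrightarrow> d \<le> e' \<Longrightarrow> P x d" using insert.prems[of x] by blast
    show ?case
      by (rule exI[of _ "min e e'"]) (use e e' in auto)
  qed
  thus ?thesis by blast
qed

text \<open>Q = z ^ k \<gamma> with \<gamma> free of zeros on a disc, so \<gamma> has a logarithm
  and a k-th root \<kappa>; take h = z \<kappa>. \<open>C\<close> bounds \<kappa> near 0 and later
  compares |h z| with |z|.\<close>

lemma zero_power_form: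
  assumes Q: "Q holomorphic_on ball 0 \<delta>" and \<delta>: "\<delta> > 0" and Q0: "Q 0 = 0" and nz: "\<And>z. z \<in> ball 0 \<delta> - {0} \<Longrightarrow> Q z \<noteq> 0"
  obtains h \<rho> k C where "0 < \<rho>" "\<rho> \<le> \<delta>" "k \<ge> 1" "C \<ge> 1" "h holomorphic_on ball 0 \<rho>" "inj_on h (ball 0 \<rho>)" "h 0 = 0"
    "\<And>z. z \<in> ball 0 \<rho> \<Longrightarrow> Q z = h z ^ k" "\<And>z. z \<in> ball 0 \<rho> \<Longrightarrow> norm (h z) \<le> C * norm z"
proof -
  have nc: "\<not> Q constant_on ball 0 \<delta>"
  proof
    assume "Q constant_on ball 0 \<delta>"
    then obtain y where y: "\<And>z. z \<in> ball 0 \<delta> \<Longrightarrow> Q z = y" unfolding constant_on_def by blast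
    have z: "of_real (\<delta> / 2) \<in> ball (0::complex) \<delta> - {0}" "0 \<in> ball (0::complex) \<delta>" using \<delta> by auto
    have "of_real (\<delta> / 2) \<in> ball (0::complex) \<delta>" using z(1) by blast
    from y[OF this] show False using nz[OF z(1)] Q0 y[OF z(2)] by metis
  qed
  have 0: "0 \<in> ball (0::complex) \<delta>" using \<delta> by simp
  obtain \<gamma> r k where f: "0 < k" "0 < r" "ball (0::complex) r \<subseteq> ball 0 \<delta>" "\<gamma> holomorphic_on ball 0 r"
    "\<And>w. w \<in> ball 0 r \<Longrightarrow> Q w = (w - 0) ^ k * \<gamma> w" "\<And>w. w \<in> ball 0 r \<Longrightarrow> \<gamma> w \<noteq> 0"
  proof (rule holomorphic_factor_zero_nonconstant[OF Q open_ball connected_ball 0 Q0 nc])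
  qed (rule that)
  have 0: "0 \<in> ball (0::complex) r" using f(2) by simp
  obtain l where l: "l holomorphic_on ball 0 r" "\<And>x. x \<in> ball 0 r \<Longrightarrow> exp (l x) = \<gamma> x"
    using holomorphic_logarithm_exists[OF convex_ball open_ball f(4,6) 0] by metis
  define \<kappa> where "\<kappa> = (\<lambda>z. exp (l z / of_nat k))"
  define h where "h = (\<lambda>z. z * \<kappa> z)"
  have \<kappa>: "\<kappa> holomorphic_on ball 0 r" unfolding \<kappa>_def by (intro holomorphic_intros l) (use f(1) in auto)
  have h: "h holomorphic_on ball 0 r" unfolding h_def by (intro holomorphic_intros \<kappa>)
  have \<kappa>k: "\<kappa> z ^ k = \<gamma> z" if "z \<in> ball 0 r" for z
    using l(2)[OF that] f(1) by (simp add: \<kappa>_def flip: exp_of_nat_mult)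
  have Qh: "Q z = h z ^ k" if "z \<in> ball 0 r" for z
    using f(5)[OF that] \<kappa>k[OF that] by (simp add: h_def power_mult_distrib)
  have "(\<kappa> has_field_derivative deriv \<kappa> 0) (at 0)" using holomorphic_derivI[OF \<kappa> open_ball 0] by simp
  hence "(h has_field_derivative \<kappa> 0) (at 0)" unfolding h_def by (auto intro!: derivative_eq_intros)
  hence "deriv h 0 \<noteq> 0" by (simp add: DERIV_imp_deriv \<kappa>_def)
  from has_complex_derivative_locally_injective[OF h 0 open_ball this]
  obtain r1 where r1: "r1 > 0" "ball (0::complex) r1 \<subseteq> ball 0 r" "inj_on h (ball 0 r1)" by blast
  have "continuous (at 0) \<kappa>" using holomorphic_on_imp_continuous_on[OF \<kappa>] 0 continuous_on_eq_continuous_at open_ball by blast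
  then obtain d where d: "d > 0" "\<And>z. dist z 0 < d \<Longrightarrow> dist (\<kappa> z) (\<kappa> 0) < 1"
    using continuous_at_eps_delta[of 0 \<kappa>] zero_less_one by blast
  define \<rho> where "\<rho> = min d (min r1 \<delta>)"
  have sub1: "z \<in> ball 0 r1" "norm z < d" if "z \<in> ball 0 \<rho>" for z :: complex using that by (auto simp: \<rho>_def)
  note sub = sub1(1) subsetD[OF r1(2) sub1(1)] sub1(2)
  show ?thesis
  proof (rule that[of \<rho> k "norm (\<kappa> 0) + 1" h])
    show "0 < \<rho>" "\<rho> \<le> \<delta>" "k \<ge> 1" "norm (\<kappa> 0) + 1 \<ge> 1" "h 0 = 0" using d r1 \<delta> f(1) by (auto simp: \<rho>_def h_def)
    show "h holomorphic_on ball 0 \<rho>" by (rule holomorphic_on_subset[OF h]) (use sub in blast)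
    show "inj_on h (ball 0 \<rho>)" by (rule inj_on_subset[OF r1(3)]) (use sub in blast)
    fix z :: complex assume z: "z \<in> ball 0 \<rho>"
    show "Q z = h z ^ k" by (rule Qh[OF sub(2)[OF z]])
    have "norm (\<kappa> z - \<kappa> 0) < 1" using d(2)[of z] sub(3)[OF z] by (simp add: dist_norm)
    hence "norm (\<kappa> z) \<le> norm (\<kappa> 0) + 1" using norm_triangle_ineq2[of "\<kappa> z" "\<kappa> 0"] by simp
    from mult_right_mono[OF this norm_ge_zero[of z]] show "norm (h z) \<le> (norm (\<kappa> 0) + 1) * norm z" by (simp add: h_def norm_mult mult.commute)
  qed
qed

context jcurve_setup
begin

text \<open>The closed disc provides compactness; under the assumptions of the next context the
  fibre of a small \<open>a\<close> does not reach the boundary circle.\<close>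

definition fib :: "(complex \<Rightarrow> 's) \<Rightarrow> real \<Rightarrow> complex \<Rightarrow> complex set" where
  "fib g \<rho> a = {b \<in> cball 0 \<rho>. R (g a) (g b)}"

context
  fixes g r \<rho> \<delta>
  assumes g: "disc g r" and g_imm: "\<And>z. z \<in> ball 0 r - {0} \<Longrightarrow> imm (g z) \<and> u (g z) \<noteq> u (g 0)"
    and \<rho>: "0 < \<rho>" "\<rho> < r" and \<delta>: "0 < \<delta>" "\<delta> \<le> \<rho>"
    and trap: "\<And>a b. a \<in> ball 0 \<delta> \<Longrightarrow> b \<in> cball 0 \<rho> \<Longrightarrow> u (g a) = u (g b) \<Longrightarrow> b \<in> ball 0 \<rho>"
begin

lemma fib_inner:
  assumes a: "a \<in> ball 0 \<delta> - {0}" and b: "b \<in> fib g \<rho> a"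
  shows "b \<in> ball 0 \<rho> - {0}"
proof -
  have e: "u (g a) = u (g b)" using b R_imp_eq by (auto simp: fib_def)
  have "b \<in> ball 0 \<rho>" using trap[of a b] a b e by (auto simp: fib_def)
  moreover have "a \<in> ball 0 r - {0}" using a \<rho> \<delta> by auto
  hence "u (g a) \<noteq> u (g 0)" using g_imm by blast
  hence "b \<noteq> 0" using e by auto
  ultimately show ?thesis by blast
qed

lemma fib_zero: "fib g \<rho> 0 = {0}"
proof -
  have "b = 0" if "b \<in> cball 0 \<rho>" "R (g 0) (g b)" for b
  proof (rule ccontr)
    assume "b \<noteq> 0"
    hence "b \<in> ball 0 r - {0}" using that(1) \<rho> by auto
    thus False using g_imm R_imp_eq[OF that(2)] by metis
  qed
  moreover have "R (g 0) (g 0)" by (rule R_refl[OF hol_discD(6)[OF g disc_zero_in[OF g]]])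
  ultimately show ?thesis using \<rho> unfolding fib_def by auto
qed

lemma fib_refl: "a \<in> ball 0 \<delta> \<Longrightarrow> a \<in> fib g \<rho> a"
  using R_refl[OF hol_discD(6)[OF g, of a]] \<rho> \<delta> by (auto simp: fib_def)

lemma fib_eq: "b \<in> fib g \<rho> a \<Longrightarrow> fib g \<rho> b = fib g \<rho> a"
  using R_trans R_sym unfolding fib_def by blast

lemma disc_locally_injective:
  assumes b: "b \<in> ball 0 r - {0}"
  obtains e where "e > 0" "ball b e \<subseteq> ball 0 r" "inj_on (u \<circ> g) (ball b e)"
proof -
  obtain U where U: "openin S U" "g b \<in> U" "inj_on u U" by (rule imm_locally_injective[OF conjunct1[OF g_imm[OF b]]])
  have "open {z \<in> ball 0 r. g z \<in> U}" by (rule open_disc_preimage[OF hol_discD(3)[OF g] U(1)])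
  moreover have "b \<in> {z \<in> ball 0 r. g z \<in> U}" using b U(2) by simp
  ultimately obtain e where e: "e > 0" "ball b e \<subseteq> {z \<in> ball 0 r. g z \<in> U}" using openE by blast
  have sub: "ball b e \<subseteq> ball 0 r" and im: "g ` ball b e \<subseteq> U" using e(2) by auto
  have "inj_on (u \<circ> g) (ball b e)"
    by (rule comp_inj_on[OF inj_on_subset[OF hol_discD(2)[OF g] sub] inj_on_subset[OF U(3) im]])
  thus ?thesis using that e(1) sub by blast
qed

text \<open>An accumulation point \<open>b\<close> would satisfy u (g b) = u (g a) \<noteq> u (g 0).
  So b \<noteq> 0 and \<open>u\<close> is injective near g b, whereas it is constant on the
  fibre.\<close>

lemma fib_finite:
  assumes a: "a \<in> ball 0 \<delta> - {0}"
  shows "finite (fib g \<rho> a)"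
proof (rule ccontr)
  assume inf: "infinite (fib g \<rho> a)"
  have "fib g \<rho> a \<subseteq> cball 0 \<rho>" by (auto simp: fib_def)
  then obtain b where b: "b \<in> cball 0 \<rho>" "b islimpt fib g \<rho> a"
    using inf compact_cball[of "0::complex" \<rho>] unfolding compact_eq_Bolzano_Weierstrass by blast
  have br: "b \<in> ball 0 r" using b(1) \<rho> by auto
  have ar: "a \<in> ball 0 r - {0}" using a \<rho> \<delta> by auto
  have lim: "infinite (U \<inter> fib g \<rho> a)" if "b \<in> U" "open U" for U
    using b(2) that unfolding islimpt_eq_acc_point by blast
  have at: "a \<in> ball 0 r" using ar by blast
  have "u (g b) = u (g a)"
  proof (rule coincidence_imp_eq[OF hol_discD(6)[OF g br] hol_discD(6)[OF g at]])
    fix U V assume U: "openin S U" "openin S V" "g b \<in> U" "g a \<in> V"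
    have "infinite ({z \<in> ball 0 r. g z \<in> U} \<inter> fib g \<rho> a)"
      by (rule lim[OF _ open_disc_preimage[OF hol_discD(3)[OF g] U(1)]]) (use U br in simp)
    then obtain b' where "g b' \<in> U" "R (g a) (g b')" using infinite_imp_nonempty unfolding fib_def by blast
    thus "\<exists>x\<in>U. \<exists>y\<in>V. u x = u y" using R_imp_eq[of "g a" "g b'"] U(4) by metis
  qed
  moreover have "u (g a) \<noteq> u (g 0)" using g_imm[OF ar] by blast
  ultimately have b0: "b \<in> ball 0 r - {0}" using br by auto
  obtain e where e: "e > 0" "inj_on (u \<circ> g) (ball b e)" using disc_locally_injective[OF b0] by blast
  have "infinite (ball b e \<inter> fib g \<rho> a)" by (rule lim) (use e(1) in auto)
  moreover have "x = y" if "x \<in> ball b e \<inter> fib g \<rho> a" "y \<in> ball b e \<inter> fib g \<rho> a" for x y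
  proof (rule inj_onD[OF e(2)])
    have "R (g a) (g x)" "R (g a) (g y)" using that by (auto simp: fib_def)
    thus "(u \<circ> g) x = (u \<circ> g) y" using R_imp_eq[of "g a" "g x"] R_imp_eq[of "g a" "g y"] by simp
  qed (use that in auto)
  hence "finite (ball b e \<inter> fib g \<rho> a)" by (metis finite.simps insertI1 is_singletonI' is_singleton_def)
  ultimately show False by blast
qed

text \<open>Upper semicontinuity of the fibre: the parameters with a partner in the compact
  complement of \<open>O1\<close> form a relatively closed set.\<close>

lemma fib_near:
  assumes a0: "a0 \<in> ball 0 \<delta>" and O1: "open O1" "fib g \<rho> a0 \<subseteq> O1"
  obtains e where "e > 0" "ball a0 e \<subseteq> ball 0 \<delta>" "\<And>a. a \<in> ball a0 e \<Longrightarrow> fib g \<rho> a \<subseteq> O1"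
proof -
  let ?K = "cball 0 \<rho> - O1"
  have K: "compact ?K" "?K \<subseteq> ball 0 r" using \<rho> O1(1) by (auto intro: compact_diff)
  have "ball (0::complex) \<delta> \<subseteq> ball 0 r" using \<rho> \<delta> by auto
  from closedin_compact_projection[OF K(1) closed_R_discs[OF g g K(2) this]]
  have "openin (top_of_set (ball 0 \<delta>)) (ball 0 \<delta> - {a. \<exists>b. b \<in> ?K \<and> (b, a) \<in> {p \<in> ?K \<times> ball 0 \<delta>. R (g (snd p)) (g (fst p))}})"
    by (simp add: closedin_def)
  hence "open (ball 0 \<delta> - {a. \<exists>b. b \<in> ?K \<and> (b, a) \<in> {p \<in> ?K \<times> ball 0 \<delta>. R (g (snd p)) (g (fst p))}})" (is "open ?N")
    using openin_open_eq[OF open_ball] by blast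
  moreover have N: "a \<in> ?N \<longleftrightarrow> a \<in> ball 0 \<delta> \<and> fib g \<rho> a \<subseteq> O1" for a by (auto simp: fib_def)
  moreover have "a0 \<in> ?N" using N a0 O1(2) by blast
  ultimately obtain e where "e > 0" "ball a0 e \<subseteq> ?N" using openE by blast
  thus ?thesis using that N by blast
qed

text \<open>Over the punctured disc the fibres form an unramified covering. \<open>R_branch\<close>
  gives a holomorphic sheet through each of the finitely many points, disjoint balls keep the sheets
  apart, and \<open>fib_near\<close> with local injectivity shows that there are no others.\<close>

lemma fib_branches:
  assumes a0: "a0 \<in> ball 0 \<delta> - {0}"
  obtains e Z where "e > 0" "ball a0 e \<subseteq> ball 0 \<delta>" "\<And>b. b \<in> fib g \<rho> a0 \<Longrightarrow> Z b holomorphic_on ball a0 e"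
    "\<And>a. a \<in> ball a0 e \<Longrightarrow> inj_on (\<lambda>b. Z b a) (fib g \<rho> a0)"
    "\<And>a. a \<in> ball a0 e \<Longrightarrow> fib g \<rho> a = (\<lambda>b. Z b a) ` fib g \<rho> a0"
proof -
  let ?F = "fib g \<rho> a0"
  have fin: "finite ?F" by (rule fib_finite[OF a0])
  have inn: "b \<in> ball 0 \<rho>" "b \<in> ball 0 r - {0}" if "b \<in> ?F" for b using fib_inner[OF a0 that] \<rho> by auto
  have ar: "a0 \<in> ball 0 r" using a0 \<rho> \<delta> by auto
  have rad: "\<exists>e>0. \<forall>d. 0 < d \<longrightarrow> d \<le> e \<longrightarrow> ball b d \<subseteq> ball 0 \<rho> \<and> inj_on (u \<circ> g) (ball b d) \<and> (\<forall>b'\<in>?F. b' \<noteq> b \<longrightarrow> 2 * d \<le> dist b b')"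
    if b: "b \<in> ?F" for b
  proof -
    obtain e1 where e1: "e1 > 0" "inj_on (u \<circ> g) (ball b e1)" using disc_locally_injective[OF inn(2)[OF b]] by blast
    obtain e2 where e2: "e2 > 0" "ball b e2 \<subseteq> ball 0 \<rho>" using inn(1)[OF b] openE[OF open_ball] by blast
    obtain e3 where e3: "e3 > 0" "\<forall>b'\<in>?F. b' \<noteq> b \<longrightarrow> e3 \<le> dist b b'" using finite_set_avoid[OF fin, of b] by blast
    \<comment> \<open>Half the distance to the other points of the fibre keeps the balls
      disjoint.\<close>
    define e where "e = min e1 (min e2 (e3 / 2))"
    have "ball b d \<subseteq> ball 0 \<rho> \<and> inj_on (u \<circ> g) (ball b d) \<and> (\<forall>b'\<in>?F. b' \<noteq> b \<longrightarrow> 2 * d \<le> dist b b')" if d: "d \<le> e" for d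
    proof (intro conjI ballI impI)
      have *: "d \<le> e1" "d \<le> e2" "2 * d \<le> e3" using d by (auto simp: e_def)
      show "ball b d \<subseteq> ball 0 \<rho>" using subset_ball[OF *(2)] e2(2) by blast
      show "inj_on (u \<circ> g) (ball b d)" by (rule inj_on_subset[OF e1(2) subset_ball[OF *(1)]])
      show "2 * d \<le> dist b b'" if "b' \<in> ?F" "b' \<noteq> b" for b' using e3(2) that *(3) by fastforce
    qed
    moreover have "e > 0" using e1 e2 e3 by (simp add: e_def)
    ultimately show ?thesis by blast
  qed
  obtain \<eta> where \<eta>: "\<eta> > 0" "\<And>b. b \<in> ?F \<Longrightarrow> ball b \<eta> \<subseteq> ball 0 \<rho> \<and> inj_on (u \<circ> g) (ball b \<eta>) \<and> (\<forall>b'\<in>?F. b' \<noteq> b \<longrightarrow> 2 * \<eta> \<le> dist b b')"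
    using finite_uniform_radius[where P="\<lambda>b d. ball b d \<subseteq> ball 0 \<rho> \<and> inj_on (u \<circ> g) (ball b d) \<and> (\<forall>b'\<in>?F. b' \<noteq> b \<longrightarrow> 2 * d \<le> dist b b')", OF fin rad] by blast
  have "\<exists>e Z. e > 0 \<and> Z holomorphic_on ball a0 e \<and> (\<forall>a\<in>ball a0 e. Z a \<in> ball b \<eta> \<and> R (g a) (g (Z a)))" if b: "b \<in> ?F" for b
  proof -
    have br: "b \<in> ball 0 r" using inn(2)[OF b] by blast
    have \<eta>r: "\<eta> \<le> r - norm b"
    proof -
      have "ball b \<eta> \<subseteq> ball 0 \<rho>" using \<eta>(2)[OF b] by blast
      thus ?thesis using \<eta>(1) \<rho> unfolding ball_subset_ball_iff by auto
    qed
    have G: "disc (\<lambda>z. g (b + z)) \<eta>" by (rule hol_disc_shrink[OF hol_disc_recenter[OF g br] \<eta>(1) \<eta>r])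
    have H: "disc (\<lambda>z. g (a0 + z)) (r - norm a0)" by (rule hol_disc_recenter[OF g ar])
    have iG: "imm (g (b + 0))" using g_imm[OF inn(2)[OF b]] by simp
    have RG: "R (g (b + 0)) (g (a0 + 0))" using b R_sym by (auto simp: fib_def)
    obtain r' \<zeta> where \<zeta>: "0 < r'" "\<zeta> holomorphic_on ball 0 r'" "\<zeta> ` ball 0 r' \<subseteq> ball 0 \<eta>" "\<And>z. z \<in> ball 0 r' \<Longrightarrow> R (g (b + \<zeta> z)) (g (a0 + z))"
      by (rule R_branch[OF G iG H RG]) (rule that; assumption)
    have sh: "a - a0 \<in> ball 0 r'" if "a \<in> ball a0 r'" for a using that by (simp add: dist_norm norm_minus_commute)
    have "(\<zeta> \<circ> (\<lambda>a. a - a0)) holomorphic_on ball a0 r'"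
      by (rule holomorphic_on_compose_gen[OF _ \<zeta>(2)]) (use sh in \<open>auto intro!: holomorphic_intros\<close>)
    hence "(\<lambda>a. b + \<zeta> (a - a0)) holomorphic_on ball a0 r'" unfolding o_def by (intro holomorphic_intros)
    moreover have "b + \<zeta> (a - a0) \<in> ball b \<eta> \<and> R (g a) (g (b + \<zeta> (a - a0)))" if "a \<in> ball a0 r'" for a
    proof -
      have "\<zeta> (a - a0) \<in> ball 0 \<eta>" using \<zeta>(3) sh[OF that] by blast
      thus ?thesis using R_sym[OF \<zeta>(4)[OF sh[OF that]]] by (simp add: dist_norm)
    qed
    ultimately show ?thesis using \<zeta>(1) by (intro exI[of _ r'] exI[of _ "\<lambda>a. b + \<zeta> (a - a0)"]) blast
  qed
  then obtain e Z where eZ: "\<And>b. b \<in> ?F \<Longrightarrow> e b > 0" "\<And>b. b \<in> ?F \<Longrightarrow> Z b holomorphic_on ball a0 (e b)"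
    "\<And>b a. b \<in> ?F \<Longrightarrow> a \<in> ball a0 (e b) \<Longrightarrow> Z b a \<in> ball b \<eta> \<and> R (g a) (g (Z b a))" by metis
  have "\<exists>e1>0. \<forall>d. 0 < d \<longrightarrow> d \<le> e1 \<longrightarrow> d \<le> e b" if "b \<in> ?F" for b using eZ(1)[OF that] by blast
  from finite_uniform_radius[where P="\<lambda>b d. d \<le> e b", OF fin this] obtain e1 where e1: "e1 > 0" "\<And>b. b \<in> ?F \<Longrightarrow> e1 \<le> e b" by blast
  have oU: "open (\<Union>b\<in>?F. ball b \<eta>)" and sU: "?F \<subseteq> (\<Union>b\<in>?F. ball b \<eta>)" using \<eta>(1) by auto
  have a0': "a0 \<in> ball 0 \<delta>" using a0 by blast
  obtain e2 where e2: "e2 > 0" "ball a0 e2 \<subseteq> ball 0 \<delta>" "\<And>a. a \<in> ball a0 e2 \<Longrightarrow> fib g \<rho> a \<subseteq> (\<Union>b\<in>?F. ball b \<eta>)"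
    using fib_near[OF a0' oU sU] by metis
  define \<epsilon> where "\<epsilon> = min e1 e2"
  have sub: "a \<in> ball a0 e2" "b \<in> ?F \<Longrightarrow> a \<in> ball a0 (e b)" if "a \<in> ball a0 \<epsilon>" for a b
    using that e1(2)[of b] by (auto simp: \<epsilon>_def)
  show ?thesis
  proof (rule that[of \<epsilon> Z])
    show "\<epsilon> > 0" using e1 e2 by (simp add: \<epsilon>_def)
    show "ball a0 \<epsilon> \<subseteq> ball 0 \<delta>" using e2(2) sub(1) by blast
    show "Z b holomorphic_on ball a0 \<epsilon>" if "b \<in> ?F" for b
      by (rule holomorphic_on_subset[OF eZ(2)[OF that]]) (use sub(2) that in blast)
    fix a assume a: "a \<in> ball a0 \<epsilon>"
    have Z: "Z b a \<in> ball b \<eta>" "R (g a) (g (Z b a))" if "b \<in> ?F" for b using eZ(3)[OF that sub(2)[OF a that]] by auto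
    show "inj_on (\<lambda>b. Z b a) ?F"
    proof (rule inj_onI, rule ccontr)
      fix b b' assume b: "b \<in> ?F" "b' \<in> ?F" "Z b a = Z b' a" "b \<noteq> b'"
      have "dist b b' \<le> dist b (Z b a) + dist b' (Z b a)" by (metis dist_commute dist_triangle)
      also have "\<dots> < 2 * \<eta>" using Z(1)[OF b(1)] Z(1)[OF b(2)] b(3) by simp
      finally have "dist b b' < 2 * \<eta>" .
      moreover have "2 * \<eta> \<le> dist b b'" using conjunct2[OF conjunct2[OF \<eta>(2)[OF b(1)]]] b(2,4) by auto
      ultimately show False by simp
    qed
    have Zf: "Z b a \<in> fib g \<rho> a" if "b \<in> ?F" for b
    proof -
      have "Z b a \<in> ball 0 \<rho>" using \<eta>(2)[OF that] Z(1)[OF that] by blast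
      thus ?thesis using Z(2)[OF that] by (simp add: fib_def)
    qed
    show "fib g \<rho> a = (\<lambda>b. Z b a) ` ?F"
    proof
      show "(\<lambda>b. Z b a) ` ?F \<subseteq> fib g \<rho> a" using Zf by blast
      show "fib g \<rho> a \<subseteq> (\<lambda>b. Z b a) ` ?F"
      proof
        fix x assume x: "x \<in> fib g \<rho> a"
        then obtain b where b: "b \<in> ?F" "x \<in> ball b \<eta>" using e2(3)[OF sub(1)[OF a]] by blast
        have "R (g a) (g x)" using x by (simp add: fib_def)
        hence "(u \<circ> g) x = (u \<circ> g) (Z b a)" using R_imp_eq[of "g a" "g x"] R_imp_eq[OF Z(2)[OF b(1)]] by simp
        \<comment> \<open>Both points lie in one ball on which u composed with g is
          injective.\<close>
        hence "x = Z b a" using \<eta>(2)[OF b(1)] b(2) Z(1)[OF b(1)] by (meson inj_onD)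
        thus "x \<in> (\<lambda>b. Z b a) ` ?F" using b(1) by blast
      qed
    qed
  qed
qed

text \<open>A symmetric function of the sheets does not depend on their labelling, so it is well
  defined although the sheets may be permuted around 0.\<close>

lemma fib_prod_holomorphic: "(\<lambda>a. \<Prod>b\<in>fib g \<rho> a. b) holomorphic_on ball 0 \<delta> - {0}"
proof (rule holomorphic_on_locallyI)
  fix a0 :: complex assume a0: "a0 \<in> ball 0 \<delta> - {0}"
  obtain e Z where eZ: "e > 0" "ball a0 e \<subseteq> ball 0 \<delta>" "\<And>b. b \<in> fib g \<rho> a0 \<Longrightarrow> Z b holomorphic_on ball a0 e"
    "\<And>a. a \<in> ball a0 e \<Longrightarrow> inj_on (\<lambda>b. Z b a) (fib g \<rho> a0)"
    "\<And>a. a \<in> ball a0 e \<Longrightarrow> fib g \<rho> a = (\<lambda>b. Z b a) ` fib g \<rho> a0"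
  proof (rule fib_branches[OF a0])
  qed (rule that)
  have "(\<lambda>a. \<Prod>b\<in>fib g \<rho> a0. Z b a) holomorphic_on ball a0 e" by (intro holomorphic_intros eZ(3))
  hence "(\<lambda>a. \<Prod>b\<in>fib g \<rho> a. b) holomorphic_on ball a0 e"
    by (rule holomorphic_transform) (simp add: eZ(5) prod.reindex[OF eZ(4)])
  thus "\<exists>W'. open W' \<and> a0 \<in> W' \<and> (\<lambda>a. \<Prod>b\<in>fib g \<rho> a. b) holomorphic_on W'" using eZ(1) by (intro exI[of _ "ball a0 e"]) simp
qed


text \<open>
  Let \<open>Q a\<close> be the product of the points of the fibre through \<open>a\<close>. It is constant on fibres, and
  \<open>Q = h ^ k\<close> with an injective \<open>h\<close>, so a fibre has at most \<open>m \<le> k\<close> points, all of the same \<open>\<bar>h\<bar>\<close>;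
  then \<open>\<bar>h a\<bar> ^ k = \<bar>Q a\<bar>\<close> is at least a constant times \<open>\<bar>h a\<bar> ^ m\<close>, which forces \<open>m = k\<close> for small \<open>a\<close>.
\<close>

lemma fib_normal_form:
  assumes \<rho>1: "\<rho> \<le> 1"
  obtains h \<delta>3 k where "0 < \<delta>3" "\<delta>3 \<le> \<delta>" "k \<ge> 1" "h holomorphic_on ball 0 \<delta>3" "inj_on h (ball 0 \<delta>3)" "h 0 = 0"
    "\<And>a a'. a \<in> ball 0 \<delta>3 \<Longrightarrow> a' \<in> ball 0 \<delta>3 \<Longrightarrow> R (g a) (g a') \<longleftrightarrow> h a ^ k = h a' ^ k"
proof -
  define Q where "Q a = (\<Prod>b\<in>fib g \<rho> a. b)" for a
  have Q0: "Q 0 = 0" by (simp add: Q_def fib_zero)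
  have Qnz: "Q a \<noteq> 0" if "a \<in> ball 0 \<delta> - {0}" for a
    using fib_finite[OF that] fib_inner[OF that] by (auto simp: Q_def)
  \<comment> \<open>\<open>a\<close> lies in its own fibre, and the other factors have norm at most
    \<rho> \<le> 1. This makes \<open>Q\<close> continuous at 0, hence the singularity
    removable.\<close>
  have Qle: "norm (Q a) \<le> norm a" if a: "a \<in> ball 0 \<delta>" for a
  proof (cases "a = 0")
    case False
    hence a': "a \<in> ball 0 \<delta> - {0}" using a by blast
    have "Q a = a * (\<Prod>b\<in>fib g \<rho> a - {a}. b)"
      unfolding Q_def by (rule prod.remove[OF fib_finite[OF a'] fib_refl[OF a]])
    moreover have "norm (\<Prod>b\<in>fib g \<rho> a - {a}. b) \<le> 1"
      unfolding prod_norm[symmetric] by (rule prod_le_1) (use \<rho>1 in \<open>auto simp: fib_def\<close>)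
    ultimately show ?thesis using mult_left_mono[of "norm (\<Prod>b\<in>fib g \<rho> a - {a}. b)" 1 "norm a"] by (simp add: norm_mult)
  qed (simp add: Q0)
  have holp: "Q holomorphic_on ball 0 \<delta> - {0}" unfolding Q_def by (rule fib_prod_holomorphic)
  have cont: "continuous (at z) Q" if z: "z \<in> ball 0 \<delta>" for z
  proof (cases "z = 0")
    case True
    have "eventually (\<lambda>a. a \<in> ball 0 \<delta>) (at (0::complex))" using \<delta>(1) by (intro eventually_at_in_open') auto
    hence "eventually (\<lambda>a. norm (Q a) \<le> norm a) (at 0)" by eventually_elim (rule Qle)
    moreover have "((\<lambda>a::complex. norm a) \<longlongrightarrow> 0) (at 0)" by (rule tendsto_norm_zero) (rule tendsto_ident_at)
    ultimately have "(Q \<longlongrightarrow> 0) (at 0)" by (rule Lim_null_comparison)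
    thus ?thesis using True Q0 by (simp add: continuous_at)
  next
    case False
    have "open (ball 0 \<delta> - {0::complex})" by (intro open_Diff) auto
    thus ?thesis using holomorphic_on_imp_continuous_on[OF holp] z False continuous_on_eq_continuous_at by blast
  qed
  have "continuous_on (ball 0 \<delta>) Q" by (rule continuous_at_imp_continuous_on) (use cont in blast)
  from no_isolated_singularity[OF this holp open_ball] have hol: "Q holomorphic_on ball 0 \<delta>" by simp
  obtain h \<delta>1 k C where h: "0 < \<delta>1" "\<delta>1 \<le> \<delta>" "k \<ge> 1" "C \<ge> 1" "h holomorphic_on ball 0 \<delta>1" "inj_on h (ball 0 \<delta>1)" "h 0 = 0"
    "\<And>z. z \<in> ball 0 \<delta>1 \<Longrightarrow> Q z = h z ^ k" "\<And>z. z \<in> ball 0 \<delta>1 \<Longrightarrow> norm (h z) \<le> C * norm z"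
  proof (rule zero_power_form[OF hol \<delta>(1) Q0])
    show "Q z \<noteq> 0" if "z \<in> ball 0 \<delta> - {0}" for z by (rule Qnz[OF that])
  qed (rule that)
  have f0: "fib g \<rho> 0 \<subseteq> ball 0 \<delta>1" using fib_zero h(1) by simp
  have z0: "0 \<in> ball (0::complex) \<delta>" using \<delta> by simp
  obtain \<delta>2 where \<delta>2: "\<delta>2 > 0" "\<And>a. a \<in> ball 0 \<delta>2 \<Longrightarrow> fib g \<rho> a \<subseteq> ball 0 \<delta>1"
    using fib_near[OF z0 open_ball f0] by metis
  \<comment> \<open>The last bound gives |h a| < 1 / C ^ k. A fibre with m < k points would imply |h
    a|^(k-m) \<ge> 1 / C ^ m, which is then impossible.\<close>
  define \<delta>3 where "\<delta>3 = min \<delta>2 (min \<delta>1 (1 / (C * C ^ k)))"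
  have C: "C > 0" "C ^ k \<ge> 1" using h(4) by (auto simp: one_le_power)
  have d3: "a \<in> ball 0 \<delta>2" "a \<in> ball 0 \<delta>1" "a \<in> ball 0 \<delta>" "norm (h a) < 1 / C ^ k" if a: "a \<in> ball 0 \<delta>3" for a
  proof -
    show "a \<in> ball 0 \<delta>2" and 1: "a \<in> ball 0 \<delta>1" and "a \<in> ball 0 \<delta>" using a h(2) by (auto simp: \<delta>3_def)
    have "norm a < 1 / (C * C ^ k)" using a by (simp add: \<delta>3_def)
    hence "C * norm a < C * (1 / (C * C ^ k))" using C(1) by (rule mult_strict_left_mono)
    hence "C * norm a < 1 / C ^ k" using C(1) by simp
    thus "norm (h a) < 1 / C ^ k" using h(9)[OF 1] by simp
  qed
  have hnz: "h a \<noteq> 0" if "a \<in> ball 0 \<delta>1" "a \<noteq> 0" for a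
  proof
    assume "h a = 0"
    hence "h a = h 0" using h(7) by simp
    thus False using inj_onD[OF h(6)] that h(1) by (metis centre_in_ball)
  qed
  have fibQ: "h b ^ k = h a ^ k" if a: "a \<in> ball 0 \<delta>3" and b: "b \<in> fib g \<rho> a" for a b
  proof -
    have "Q b = Q a" unfolding Q_def fib_eq[OF b] ..
    thus ?thesis using h(8)[of b] h(8)[OF d3(2)[OF a]] \<delta>2(2)[OF d3(1)[OF a]] b by auto
  qed
  \<comment> \<open>Each fibre is mapped onto a complete set of k-th roots; with the injectivity of
    \<open>h\<close> this is the normal form.\<close>
  have full: "h ` fib g \<rho> a = {z. z ^ k = h a ^ k}" if a: "a \<in> ball 0 \<delta>3" and a0: "a \<noteq> 0" for a
  proof (rule card_subset_eq)
    have ha: "h a \<noteq> 0" by (rule hnz[OF d3(2)[OF a] a0])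
    hence cardk: "card {z. z ^ k = h a ^ k} = k" using h(3) by (intro card_nth_roots) auto
    show fin: "finite {z. z ^ k = h a ^ k}" by (rule card_ge_0_finite) (use cardk h(3) in simp)
    show sub: "h ` fib g \<rho> a \<subseteq> {z. z ^ k = h a ^ k}" using fibQ[OF a] by blast
    have F1: "fib g \<rho> a \<subseteq> ball 0 \<delta>1" by (rule \<delta>2(2)[OF d3(1)[OF a]])
    define m where "m = card (fib g \<rho> a)"
    have cm: "card (h ` fib g \<rho> a) = m" unfolding m_def by (rule card_image[OF inj_on_subset[OF h(6) F1]])
    have mk: "m \<le> k" using card_mono[OF fin sub] cm cardk by simp
    have "m = k"
    proof (rule ccontr)
      assume "m \<noteq> k"
      hence lt: "m < k" using mk by simp
      have nb: "norm (h a) / C \<le> norm b" if b: "b \<in> fib g \<rho> a" for b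
      proof -
        have "norm (h b) ^ k = norm (h a) ^ k" using fibQ[OF a b] by (metis norm_power)
        hence "norm (h b) = norm (h a)" using h(3) by (simp add: power_eq_iff_eq_base)
        thus ?thesis using h(9)[of b] b F1 C(1) by (auto simp: field_simps)
      qed
      have "(norm (h a) / C) ^ m = (\<Prod>b\<in>fib g \<rho> a. norm (h a) / C)" by (simp add: m_def)
      also have "\<dots> \<le> (\<Prod>b\<in>fib g \<rho> a. norm b)" by (rule prod_mono) (use nb C(1) in auto)
      also have "\<dots> = norm (h a) ^ k" using h(8)[OF d3(2)[OF a]] by (simp add: Q_def prod_norm norm_power)
      also have "\<dots> = norm (h a) ^ m * norm (h a) ^ (k - m)" using mk by (simp flip: power_add)
      finally have "norm (h a) ^ m * (1 / C ^ m) \<le> norm (h a) ^ m * norm (h a) ^ (k - m)" by (simp add: power_divide)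
      hence "1 / C ^ m \<le> norm (h a) ^ (k - m)" by (rule mult_left_le_imp_le) (use ha in simp)
      moreover have "norm (h a) ^ (k - m) \<le> norm (h a) ^ 1"
      proof (rule power_decreasing)
        have "norm (h a) < 1 / C ^ k" by (rule d3(4)[OF a])
        also have "\<dots> \<le> 1" using C by simp
        finally show "norm (h a) \<le> 1" by simp
      qed (use lt in auto)
      moreover have "C ^ m \<le> C ^ k" using h(4) mk by (rule power_increasing[rotated])
      hence "1 / C ^ k \<le> 1 / C ^ m" using C(1) by (simp add: frac_le)
      ultimately show False using d3(4)[OF a] by simp
    qed
    thus "card (h ` fib g \<rho> a) = card {z. z ^ k = h a ^ k}" using cm cardk by simp
  qed
  show ?thesis
  proof (rule that[of \<delta>3 k h])
    show "0 < \<delta>3" using \<delta>2(1) h(1) C by (simp add: \<delta>3_def)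
    show "\<delta>3 \<le> \<delta>" "k \<ge> 1" "h 0 = 0" using h(2,3,7) by (auto simp: \<delta>3_def)
    show "h holomorphic_on ball 0 \<delta>3" by (rule holomorphic_on_subset[OF h(5)]) (use d3(2) in blast)
    show "inj_on h (ball 0 \<delta>3)" by (rule inj_on_subset[OF h(6)]) (use d3(2) in blast)
    fix a a' :: complex assume a: "a \<in> ball 0 \<delta>3" and a': "a' \<in> ball 0 \<delta>3"
    have a'\<rho>: "a' \<in> cball 0 \<rho>" using d3(3)[OF a'] \<delta> by simp
    show "R (g a) (g a') \<longleftrightarrow> h a ^ k = h a' ^ k"
    proof
      assume "R (g a) (g a')"
      hence "a' \<in> fib g \<rho> a" using a'\<rho> by (simp add: fib_def)
      from fibQ[OF a this] show "h a ^ k = h a' ^ k" ..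
    next
      assume eq: "h a ^ k = h a' ^ k"
      show "R (g a) (g a')"
      proof (cases "a = 0")
        case True
        hence "h a' = 0" using eq h(3,7) by (simp add: power_0_left)
        hence "a' = 0" using hnz[OF d3(2)[OF a']] by blast
        thus ?thesis using True R_refl[OF hol_discD(6)[OF g disc_zero_in[OF g]]] by simp
      next
        case False
        have "h a' \<in> h ` fib g \<rho> a" using full[OF a False] eq by simp
        then obtain b where b: "b \<in> fib g \<rho> a" "h a' = h b" by blast
        have "b \<in> ball 0 \<delta>1" using \<delta>2(2)[OF d3(1)[OF a]] b(1) by blast
        hence "a' = b" using inj_onD[OF h(6) b(2) d3(2)[OF a']] by blast
        thus ?thesis using b(1) by (simp add: fib_def)
      qed
    qed
  qed
qed

end

text \<open>\<open>disc_trap\<close> supplies the assumption of the fibre analysis. Reparametrizing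
  the disc by the inverse of the injective \<open>h\<close> turns h a ^ k = h a' ^ k into y ^ k = y'
  ^ k.\<close>

lemma R_normal_form:
  assumes s: "s \<in> topspace S"
  obtains g r k where "disc g r" "g 0 = s" "k \<ge> 1" "\<And>y y'. y \<in> ball 0 r \<Longrightarrow> y' \<in> ball 0 r \<Longrightarrow> R (g y) (g y') \<longleftrightarrow> y ^ k = y' ^ k"
proof -
  obtain g r where g: "disc g r" "g 0 = s" "g ` ball 0 r \<subseteq> topspace S" "\<And>z. z \<in> ball 0 r - {0} \<Longrightarrow> imm (g z) \<and> u (g z) \<noteq> u s"
    using disc_near[OF openin_topspace s] by blast
  have g_imm: "imm (g z) \<and> u (g z) \<noteq> u (g 0)" if "z \<in> ball 0 r - {0}" for z using g(4)[OF that] g(2) by simp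
  have r: "r > 0" by (rule hol_discD(1)[OF g(1)])
  \<comment> \<open>At most 1 as \<open>fib_normal_form\<close> requires, and below \<open>r\<close>
    so that the closed disc stays inside.\<close>
  define \<rho> where "\<rho> = min 1 (r / 2)"
  have \<rho>: "0 < \<rho>" "\<rho> < r" "\<rho> \<le> 1" using r by (auto simp: \<rho>_def)
  obtain N where N: "openin S N" "\<And>s. s \<in> topspace S \<Longrightarrow> u s = u (g 0) \<Longrightarrow> s \<in> N"
    "\<And>x b. x \<in> N \<Longrightarrow> b \<in> cball 0 \<rho> \<Longrightarrow> u x = u (g b) \<Longrightarrow> b \<in> ball 0 \<rho>"
  proof (rule disc_trap[OF g(1) \<rho>(1,2)])
    show "u (g z) \<noteq> u (g 0)" if "z \<in> ball 0 r - {0}" for z using g_imm[OF that] by blast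
  qed (rule that)
  have "open {z \<in> ball 0 r. g z \<in> N}" by (rule open_disc_preimage[OF hol_discD(3)[OF g(1)] N(1)])
  moreover have "0 \<in> {z \<in> ball 0 r. g z \<in> N}" using N(2)[OF s] g(2) r by simp
  ultimately obtain e where e: "e > 0" "ball 0 e \<subseteq> {z \<in> ball 0 r. g z \<in> N}" using openE by blast
  define \<delta> where "\<delta> = min e \<rho>"
  have \<delta>: "0 < \<delta>" "\<delta> \<le> \<rho>" using e(1) \<rho> by (auto simp: \<delta>_def)
  have trap: "b \<in> ball 0 \<rho>" if "a \<in> ball 0 \<delta>" "b \<in> cball 0 \<rho>" "u (g a) = u (g b)" for a b
  proof -
    have "a \<in> ball 0 e" using that(1) by (simp add: \<delta>_def)
    hence "g a \<in> N" using e(2) by blast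
    thus ?thesis using N(3) that by blast
  qed
  obtain h \<delta>3 k where h: "0 < \<delta>3" "\<delta>3 \<le> \<delta>" "k \<ge> 1" "h holomorphic_on ball 0 \<delta>3" "inj_on h (ball 0 \<delta>3)" "h 0 = 0"
    "\<And>a a'. a \<in> ball 0 \<delta>3 \<Longrightarrow> a' \<in> ball 0 \<delta>3 \<Longrightarrow> R (g a) (g a') \<longleftrightarrow> h a ^ k = h a' ^ k"
  proof (rule fib_normal_form[OF g(1) g_imm \<rho>(1,2) \<delta> trap \<rho>(3)])
  qed (assumption | rule that)+
  obtain p where p: "p holomorphic_on h ` ball 0 \<delta>3" "\<And>z. z \<in> ball 0 \<delta>3 \<Longrightarrow> p (h z) = z"
    using holomorphic_has_inverse[OF h(4) open_ball h(5)] by metis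
  have "open (h ` ball 0 \<delta>3)" by (rule open_mapping_thm3[OF h(4) open_ball h(5)])
  moreover have "0 \<in> h ` ball 0 \<delta>3" using h(1,6) by (metis centre_in_ball imageI)
  ultimately obtain r2 where r2: "r2 > 0" "ball 0 r2 \<subseteq> h ` ball 0 \<delta>3" using openE by blast
  have hp: "p y \<in> ball 0 \<delta>3 \<and> h (p y) = y" if y: "y \<in> ball 0 r2" for y
  proof -
    obtain a where a: "a \<in> ball 0 \<delta>3" "y = h a" using r2(2) y by blast
    thus ?thesis using p(2)[OF a(1)] by simp
  qed
  have "disc (g \<circ> p) r2"
  proof (rule hol_disc_compose[OF g(1) r2(1) holomorphic_on_subset[OF p(1) r2(2)]])
    show "inj_on p (ball 0 r2)" by (rule inj_on_inverseI[of _ h]) (use hp in blast)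
    have "ball (0::complex) \<delta>3 \<subseteq> ball 0 r" using h(2) \<delta> \<rho> by auto
    thus "p ` ball 0 r2 \<subseteq> ball 0 r" using hp by blast
  qed
  moreover have "(g \<circ> p) 0 = s" using p(2)[of 0] h(1,6) g(2) by simp
  moreover have "R ((g \<circ> p) y) ((g \<circ> p) y') \<longleftrightarrow> y ^ k = y' ^ k" if "y \<in> ball 0 r2" "y' \<in> ball 0 r2" for y y'
    using h(7)[of "p y" "p y'"] hp[OF that(1)] hp[OF that(2)] by simp
  ultimately show ?thesis using that[of "g \<circ> p" r2 k] h(3) by blast
qed

end

subsection \<open>The quotient surface\<close>

text \<open>Away from 0 compose with a local k-th root; at 0 continuity makes the singularity
  removable.\<close>

lemma holomorphic_descend_power:
  assumes W: "open W" and k: "k \<ge> 1" and cont: "continuous_on W f"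
    and hol: "(\<lambda>y. f (y ^ k)) holomorphic_on {y. y ^ k \<in> W}"
  shows "f holomorphic_on W"
proof (rule no_isolated_singularity[OF cont _ W])
  show "f holomorphic_on (W - {0})"
  proof (rule holomorphic_on_locallyI)
    fix x assume x: "x \<in> W - {0}"
    obtain y where y: "y ^ k = x" using ex_nth_root[OF k] by blast
    have y0: "y \<noteq> 0" using y x k by (auto simp: power_0_left)
    obtain T where T: "open T" "y ^ k \<in> T" "0 \<notin> T" "root_near y k (y ^ k) = y" "\<And>x. x \<in> T \<Longrightarrow> root_near y k x ^ k = x"
      "\<And>x. x \<in> T \<Longrightarrow> (root_near y k has_field_derivative 1 / (of_nat k * root_near y k x ^ (k - 1))) (at x)"
      using root_near[OF y0 k] by blast
    have "root_near y k holomorphic_on T" using T(6) by (auto simp: holomorphic_on_open[OF T(1)])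
    hence "(\<lambda>y. f (y ^ k)) \<circ> root_near y k holomorphic_on T \<inter> W"
      by (intro holomorphic_on_compose_gen[OF holomorphic_on_subset hol]) (auto simp: T(5))
    hence "f holomorphic_on T \<inter> W" by (rule holomorphic_transform) (simp add: T(5))
    thus "\<exists>W'. open W' \<and> x \<in> W' \<and> f holomorphic_on W'" using T(1,2) W x y by (intro exI[of _ "T \<inter> W"]) auto
  qed
qed simp

context jcurve_setup
begin

text \<open>Classes are represented by chosen points, so the quotient lives on the type of
  \<open>S\<close>, as the theorem states it. By transitivity related points have equal predicates
  \<open>R s\<close>, so \<open>SOME\<close> picks the same representative.\<close>

definition proj :: "'s \<Rightarrow> 's" where
  "proj s = (SOME t. R s t)"

lemma R_proj: "s \<in> topspace S \<Longrightarrow> R s (proj s)"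
  unfolding proj_def by (rule someI[of "R s" s]) (rule R_refl)

lemma proj_eq_iff:
  assumes s: "s \<in> topspace S" and t: "t \<in> topspace S"
  shows "proj s = proj t \<longleftrightarrow> R s t"
proof
  assume "proj s = proj t"
  thus "R s t" using R_trans[OF R_proj[OF s] R_sym] R_proj[OF t] by simp
next
  assume st: "R s t"
  have "R s = R t" using R_trans[OF st] R_trans[OF R_sym[OF st]] by blast
  thus "proj s = proj t" by (simp add: proj_def)
qed

lemma u_proj: "s \<in> topspace S \<Longrightarrow> u (proj s) = u s"
  using R_imp_eq[OF R_proj] by simp

text \<open>The quotient topology for \<open>proj\<close>, carried by the representatives; it is not
  the subspace topology that they inherit from \<open>S\<close>.\<close>

definition quot :: "'s topology" where
  "quot = topology (\<lambda>U. U \<subseteq> proj ` topspace S \<and> openin S {s \<in> topspace S. proj s \<in> U})"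

lemma openin_quot: "openin quot U \<longleftrightarrow> U \<subseteq> proj ` topspace S \<and> openin S {s \<in> topspace S. proj s \<in> U}"
proof -
  have "istopology (\<lambda>U. U \<subseteq> proj ` topspace S \<and> openin S {s \<in> topspace S. proj s \<in> U})"
    unfolding istopology_def
  proof (intro conjI allI impI)
    fix U V assume UV: "U \<subseteq> proj ` topspace S \<and> openin S {s \<in> topspace S. proj s \<in> U}"
      "V \<subseteq> proj ` topspace S \<and> openin S {s \<in> topspace S. proj s \<in> V}"
    have e: "{s \<in> topspace S. proj s \<in> U \<inter> V} = {s \<in> topspace S. proj s \<in> U} \<inter> {s \<in> topspace S. proj s \<in> V}" by blast
    show "openin S {s \<in> topspace S. proj s \<in> U \<inter> V}" unfolding e using UV by (intro openin_Int) blast+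
    show "U \<inter> V \<subseteq> proj ` topspace S" using UV by blast
  next
    fix K assume K: "\<forall>U\<in>K. U \<subseteq> proj ` topspace S \<and> openin S {s \<in> topspace S. proj s \<in> U}"
    have "{s \<in> topspace S. proj s \<in> \<Union>K} = (\<Union>U\<in>K. {s \<in> topspace S. proj s \<in> U})" by blast
    moreover have "openin S (\<Union>U\<in>K. {s \<in> topspace S. proj s \<in> U})" using K by (intro openin_Union) blast
    ultimately show "openin S {s \<in> topspace S. proj s \<in> \<Union>K}" by simp
    show "\<Union>K \<subseteq> proj ` topspace S" using K by blast
  qed
  thus ?thesis by (simp add: quot_def topology_inverse')
qed

lemma topspace_quot: "topspace quot = proj ` topspace S"
proof
  show "topspace quot \<subseteq> proj ` topspace S" using openin_topspace[of quot] openin_quot by blast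
  have "{s \<in> topspace S. proj s \<in> proj ` topspace S} = topspace S" by blast
  hence "openin quot (proj ` topspace S)" by (simp add: openin_quot)
  thus "proj ` topspace S \<subseteq> topspace quot" by (rule openin_subset)
qed

lemma continuous_proj: "continuous_map S quot proj"
  unfolding continuous_map_def using topspace_quot openin_quot by auto

text \<open>The saturation of an open set is open: by \<open>R_lift\<close> all points near a point
  related to one of \<open>U\<close> have partners in \<open>U\<close>.\<close>

lemma open_proj: "open_map S quot proj"
  unfolding open_map_def
proof (intro allI impI)
  fix U assume U: "openin S U"
  have sub: "U \<subseteq> topspace S" by (rule openin_subset[OF U])
  have "openin S {s \<in> topspace S. proj s \<in> proj ` U}"
  proof (subst openin_subopen, intro ballI)
    fix s assume "s \<in> {s \<in> topspace S. proj s \<in> proj ` U}"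
    then obtain t where t: "s \<in> topspace S" "t \<in> U" "proj s = proj t" by blast
    have "R s t" using proj_eq_iff[OF t(1)] t sub by blast
    then obtain V where V: "openin S V" "s \<in> V" "\<And>a. a \<in> V \<Longrightarrow> \<exists>b\<in>U. R a b \<and> (a \<noteq> s \<longrightarrow> imm b)"
      using R_lift[OF _ U t(2)] by metis
    have "V \<subseteq> {s \<in> topspace S. proj s \<in> proj ` U}"
    proof
      fix a assume "a \<in> V"
      then obtain b where b: "b \<in> U" "R a b" using V(3) by blast
      have "a \<in> topspace S" by (rule R_topspace(1)[OF b(2)])
      thus "a \<in> {s \<in> topspace S. proj s \<in> proj ` U}" using proj_eq_iff[of a b] b sub by blast
    qed
    thus "\<exists>T. openin S T \<and> s \<in> T \<and> T \<subseteq> {s \<in> topspace S. proj s \<in> proj ` U}" using V by blast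
  qed
  thus "openin quot (proj ` U)" using sub by (auto simp: openin_quot)
qed

text \<open>As \<open>R\<close> is closed and \<open>proj\<close> is open, neighbourhoods without
  related pairs project to disjoint open sets.\<close>

lemma Hausdorff_quot: "Hausdorff_space quot"
  unfolding Hausdorff_space_def
proof (intro allI impI; elim conjE)
  fix p q assume "p \<in> topspace quot" "q \<in> topspace quot" and pq: "p \<noteq> q"
  then obtain s t where st: "s \<in> topspace S" "t \<in> topspace S" "p = proj s" "q = proj t" by (auto simp: topspace_quot)
  have "\<not> R s t" using proj_eq_iff[OF st(1,2)] st(3,4) pq by simp
  then obtain U V where UV: "openin S U" "openin S V" "s \<in> U" "t \<in> V" "\<And>a b. a \<in> U \<Longrightarrow> b \<in> V \<Longrightarrow> \<not> R a b"
    using R_closed[OF st(1,2)] by metis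
  have "disjnt (proj ` U) (proj ` V)"
    unfolding disjnt_def
  proof (rule ccontr)
    assume "proj ` U \<inter> proj ` V \<noteq> {}"
    then obtain a b where ab: "a \<in> U" "b \<in> V" "proj a = proj b" by blast
    have "a \<in> topspace S" "b \<in> topspace S" using ab openin_subset[OF UV(1)] openin_subset[OF UV(2)] by blast+
    from proj_eq_iff[OF this] show False using ab UV(5) by blast
  qed
  moreover have "openin quot (proj ` U)" "openin quot (proj ` V)" using open_proj UV(1,2) by (auto simp: open_map_def)
  ultimately show "\<exists>U V. openin quot U \<and> openin quot V \<and> p \<in> U \<and> q \<in> V \<and> disjnt U V" using st(3,4) UV(3,4) by blast
qed

lemma second_countable_quot: "second_countable quot"
  by (rule second_countable_open_map_image[OF continuous_proj open_proj topspace_quot[symmetric] second_countable_S])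

lemma connected_quot: "connected_space quot"
  using connectedin_continuous_map_image[OF continuous_proj, of "topspace S"] conn
  by (simp add: connectedin_topspace flip: topspace_quot)

section \<open>The charts y ^ k of the quotient\<close>

definition normal_disc :: "(complex \<Rightarrow> 's) \<Rightarrow> real \<Rightarrow> nat \<Rightarrow> bool" where
  "normal_disc g r k \<longleftrightarrow> disc g r \<and> k \<ge> 1 \<and> (\<forall>y\<in>ball 0 r. \<forall>y'\<in>ball 0 r. R (g y) (g y') \<longleftrightarrow> y ^ k = y' ^ k)"

text \<open>The inverse of the chart. A root of \<open>x\<close> is determined up to a root of
  unity, and on a normal disc all roots give the same class, so the choice by \<open>SOME\<close> is
  harmless.\<close>

definition power_disc :: "(complex \<Rightarrow> 's) \<Rightarrow> nat \<Rightarrow> complex \<Rightarrow> 's" where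
  "power_disc g k x = proj (g (SOME y. y ^ k = x))"

definition quot_chart :: "(complex \<Rightarrow> 's) \<Rightarrow> real \<Rightarrow> nat \<Rightarrow> ('s, complex) chart" where
  "quot_chart g r k = (proj ` g ` ball 0 r, inv_into (ball 0 (r ^ k)) (power_disc g k))"

definition quot_atlas :: "('s, complex) chart set" where
  "quot_atlas = {quot_chart g r k | g r k. normal_disc g r k}"

context
  fixes g r k
  assumes N: "normal_disc g r k"
begin

lemma normal_discD: "disc g r" "k \<ge> 1" "r > 0" and normal_disc_iff: "y \<in> ball 0 r \<Longrightarrow> y' \<in> ball 0 r \<Longrightarrow> proj (g y) = proj (g y') \<longleftrightarrow> y ^ k = y' ^ k"
proof -
  show 1: "disc g r" "k \<ge> 1" using N by (auto simp: normal_disc_def)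
  show "r > 0" by (rule hol_discD(1)[OF 1(1)])
  assume y: "y \<in> ball 0 r" "y' \<in> ball 0 r"
  show "proj (g y) = proj (g y') \<longleftrightarrow> y ^ k = y' ^ k"
    using proj_eq_iff[OF hol_discD(6)[OF 1(1) y(1)] hol_discD(6)[OF 1(1) y(2)]] N y by (simp add: normal_disc_def)
qed

lemma power_in_ball:
  assumes "y \<in> ball (0::complex) r" shows "y ^ k \<in> ball 0 (r ^ k)"
proof -
  have "norm y ^ k < r ^ k" by (rule power_strict_mono) (use assms normal_discD(2) in auto)
  thus ?thesis by (simp add: norm_power)
qed

lemma root_in_ball:
  assumes x: "x \<in> ball 0 (r ^ k)"
  obtains y :: complex where "y \<in> ball 0 r" "y ^ k = x"
proof -
  obtain y where y: "y ^ k = x" using ex_nth_root[OF normal_discD(2)] by blast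
  have "norm y < r" by (rule norm_root_less[OF normal_discD(2) y _ normal_discD(3)]) (use x in simp)
  thus ?thesis using that y by simp
qed

lemma power_disc:
  assumes y: "y \<in> ball 0 r"
  shows "power_disc g k (y ^ k) = proj (g y)"
proof -
  have e: "(SOME z. z ^ k = y ^ k) ^ k = y ^ k" by (rule someI) (rule refl)
  have "norm (SOME z. z ^ k = y ^ k) < r" by (rule norm_root_less[OF normal_discD(2) e _ normal_discD(3)]) (use power_in_ball[OF y] in simp)
  thus ?thesis using normal_disc_iff[of "SOME z. z ^ k = y ^ k" y] e y by (simp add: power_disc_def)
qed

lemma inj_power_disc: "inj_on (power_disc g k) (ball 0 (r ^ k))"
proof (rule inj_onI)
  fix x x' assume x: "x \<in> ball 0 (r ^ k)" "x' \<in> ball 0 (r ^ k)" "power_disc g k x = power_disc g k x'"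
  obtain y where y: "y \<in> ball 0 r" "y ^ k = x" by (rule root_in_ball[OF x(1)])
  obtain y' where y': "y' \<in> ball 0 r" "y' ^ k = x'" by (rule root_in_ball[OF x(2)])
  show "x = x'" using power_disc[OF y(1)] power_disc[OF y'(1)] x(3) y(2) y'(2) normal_disc_iff[OF y(1) y'(1)] by simp
qed

lemma quot_chart_fst: "fst (quot_chart g r k) = power_disc g k ` ball 0 (r ^ k)"
proof (intro equalityI subsetI)
  fix p assume "p \<in> fst (quot_chart g r k)"
  then obtain y where y: "y \<in> ball 0 r" "p = proj (g y)" by (auto simp: quot_chart_def)
  thus "p \<in> power_disc g k ` ball 0 (r ^ k)" using power_disc[OF y(1)] power_in_ball[OF y(1)] by (metis imageI)
next
  fix p assume "p \<in> power_disc g k ` ball 0 (r ^ k)"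
  then obtain x where x: "x \<in> ball 0 (r ^ k)" "p = power_disc g k x" by blast
  obtain y where y: "y \<in> ball 0 r" "y ^ k = x" by (rule root_in_ball[OF x(1)])
  show "p \<in> fst (quot_chart g r k)" using power_disc[OF y(1)] x(2) y by (auto simp: quot_chart_def)
qed

lemma quot_chart_power_disc: "x \<in> ball 0 (r ^ k) \<Longrightarrow> snd (quot_chart g r k) (power_disc g k x) = x"
  by (simp add: quot_chart_def inv_into_f_f[OF inj_power_disc])

lemma quot_chart_proj: "y \<in> ball 0 r \<Longrightarrow> snd (quot_chart g r k) (proj (g y)) = y ^ k"
  using quot_chart_power_disc[OF power_in_ball] power_disc by simp

lemma quot_chart_image: "snd (quot_chart g r k) ` fst (quot_chart g r k) = ball 0 (r ^ k)"
proof -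
  have "(\<lambda>x. snd (quot_chart g r k) (power_disc g k x)) ` ball 0 (r ^ k) = (\<lambda>x. x) ` ball 0 (r ^ k)"
    by (rule image_cong[OF refl quot_chart_power_disc])
  thus ?thesis by (simp add: quot_chart_fst image_image)
qed

lemma is_chart_quot_chart: "is_chart quot (quot_chart g r k)"
proof -
  let ?d = "quot_chart g r k"
  have op: "openin quot (proj ` g ` D)" if "open D" "D \<subseteq> ball 0 r" for D
    using open_proj hol_discD(4)[OF normal_discD(1) that] by (simp add: open_map_def)
  have of: "openin quot (fst ?d)" unfolding quot_chart_def fst_conv by (rule op) auto
  have cp: "continuous_map (top_of_set (ball 0 r)) quot (proj \<circ> g)"
    by (rule continuous_map_compose[OF hol_discD(3)[OF normal_discD(1)] continuous_proj])
  have top: "topspace (subtopology quot (fst ?d)) = fst ?d" using openin_subset[OF of] by auto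
  have "continuous_map (top_of_set (ball 0 (r ^ k))) quot (power_disc g k)"
    unfolding continuous_map_def
  proof (intro conjI allI impI)
    show "power_disc g k \<in> topspace (top_of_set (ball 0 (r ^ k))) \<rightarrow> topspace quot"
      using openin_subset[OF of] unfolding quot_chart_fst by auto
    fix U assume U: "openin quot U"
    define D where "D = {y \<in> ball 0 r. (proj \<circ> g) y \<in> U}"
    have oD: "open D" unfolding D_def by (rule open_disc_preimage[OF cp U])
    \<comment> \<open>Continuity of the inverse chart comes from openness of the power map: the
      preimage of \<open>U\<close> is the image of \<open>D\<close>.\<close>
    have "open ((\<lambda>y. y ^ k) ` D)"
    proof (rule open_mapping_thm[of _ UNIV, OF _ _ _ oD])
      show "\<not> (\<lambda>y::complex. y ^ k) constant_on UNIV"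
      proof
        assume "(\<lambda>y::complex. y ^ k) constant_on UNIV"
        then obtain c where "\<And>y::complex. y ^ k = c" by (auto simp: constant_on_def)
        from this[of 0] this[of 1] show False using normal_discD(2) by (simp add: power_0_left)
      qed
    qed (auto intro!: holomorphic_intros)
    moreover have "{x \<in> ball 0 (r ^ k). power_disc g k x \<in> U} = (\<lambda>y. y ^ k) ` D"
    proof (intro equalityI subsetI)
      fix x assume x: "x \<in> {x \<in> ball 0 (r ^ k). power_disc g k x \<in> U}"
      hence xb: "x \<in> ball 0 (r ^ k)" by blast
      obtain y where y: "y \<in> ball 0 r" "y ^ k = x" by (rule root_in_ball[OF xb])
      have "y \<in> D" using x y power_disc[OF y(1)] by (auto simp: D_def)
      thus "x \<in> (\<lambda>y. y ^ k) ` D" using y(2) by blast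
    next
      fix x assume "x \<in> (\<lambda>y. y ^ k) ` D"
      then obtain y where y: "y \<in> ball 0 r" "proj (g y) \<in> U" "x = y ^ k" by (auto simp: D_def)
      show "x \<in> {x \<in> ball 0 (r ^ k). power_disc g k x \<in> U}" using power_in_ball[OF y(1)] power_disc[OF y(1)] y by simp
    qed
    ultimately show "openin (top_of_set (ball 0 (r ^ k))) {x \<in> topspace (top_of_set (ball 0 (r ^ k))). power_disc g k x \<in> U}"
      by (simp add: openin_open_eq) auto
  qed
  moreover have "continuous_map (subtopology quot (fst ?d)) euclidean (snd ?d)"
    unfolding continuous_map_def
  proof (intro conjI allI impI)
    fix U :: "complex set" assume U: "openin euclidean U"
    define D where "D = {y \<in> ball 0 r. y ^ k \<in> U}"
    have "D = ball 0 r \<inter> (\<lambda>y. y ^ k) -` U" by (auto simp: D_def)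
    hence "open D" using U by (auto intro!: continuous_open_preimage continuous_intros)
    hence "openin quot (proj ` g ` D)" by (rule op) (auto simp: D_def)
    moreover have "{p \<in> fst ?d. snd ?d p \<in> U} = proj ` g ` D"
      using quot_chart_proj by (auto simp: D_def) (auto simp: quot_chart_def)
    moreover have "proj ` g ` D \<subseteq> fst ?d" by (auto simp: D_def quot_chart_def)
    ultimately show "openin (subtopology quot (fst ?d)) {p \<in> topspace (subtopology quot (fst ?d)). snd ?d p \<in> U}"
      unfolding top using openin_open_subtopology[OF of] by simp
  qed simp
  ultimately have "homeomorphic_maps (subtopology quot (fst ?d)) (top_of_set (ball 0 (r ^ k))) (snd ?d) (power_disc g k)"
    unfolding homeomorphic_maps_def top continuous_map_in_subtopology
    using quot_chart_image quot_chart_power_disc quot_chart_fst by auto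
  thus ?thesis unfolding is_chart_def quot_chart_image using of homeomorphic_maps_imp_map by blast
qed

lemma chart_inv_quot_chart: "y \<in> ball 0 r \<Longrightarrow> chart_inv (quot_chart g r k) (y ^ k) = proj (g y)"
  using chart_inv_chart[OF is_chart_quot_chart, of "proj (g y)"] quot_chart_proj[of y] by (auto simp: quot_chart_def)

text \<open>By \<open>R_lift\<close> the points h z near h z0 have partners in the disc
  \<open>g\<close>, immersed ones if z \<noteq> z0. There \<open>R_branch\<close> exhibits the
  partner as a holomorphic function of z, and its k-th power is the chart value. At
  \<open>z0\<close> the function is continuous, so the singularity is removable.\<close>

lemma quot_chart_holomorphic_disc:
  assumes h: "disc h r'"
  shows "(\<lambda>z. snd (quot_chart g r k) (proj (h z))) holomorphic_on {z \<in> ball 0 r'. proj (h z) \<in> fst (quot_chart g r k)}"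
    (is "?F holomorphic_on ?W")
proof (rule holomorphic_on_locallyI)
  let ?d = "quot_chart g r k"
  have cp: "continuous_map (top_of_set (ball 0 r')) quot (proj \<circ> h)"
    by (rule continuous_map_compose[OF hol_discD(3)[OF h] continuous_proj])
  have od: "openin quot (fst ?d)" using is_chart_quot_chart by (simp add: is_chart_def)
  have oW: "open ?W" using open_disc_preimage[OF cp od] by simp
  have contF: "continuous_on ?W ?F"
  proof -
    have "continuous_map (top_of_set ?W) (subtopology quot (fst ?d)) (proj \<circ> h)"
      unfolding continuous_map_in_subtopology
      by (intro conjI continuous_map_from_subtopology_mono[OF cp]) auto
    from continuous_map_compose[OF this is_chart_continuous[OF is_chart_quot_chart]] show ?thesis by (simp add: o_def)
  qed
  have imgV: "openin S (g ` ball 0 r)" by (rule hol_discD(4)[OF normal_discD(1)]) auto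
  fix z0 assume z0: "z0 \<in> ?W"
  then obtain b0 where b0: "b0 \<in> ball 0 r" "proj (h z0) = proj (g b0)" by (auto simp: quot_chart_def)
  have z0r: "z0 \<in> ball 0 r'" using z0 by blast
  have "R (h z0) (g b0)" using b0(2) proj_eq_iff[OF hol_discD(6)[OF h z0r] hol_discD(6)[OF normal_discD(1) b0(1)]] by simp
  then obtain U where U: "openin S U" "h z0 \<in> U" "\<And>a. a \<in> U \<Longrightarrow> \<exists>b\<in>g ` ball 0 r. R a b \<and> (a \<noteq> h z0 \<longrightarrow> imm b)"
    using R_lift[OF _ imgV, of "h z0" "g b0"] b0(1) by blast
  define W' where "W' = ?W \<inter> {z \<in> ball 0 r'. h z \<in> U}"
  have oW': "open W'" unfolding W'_def by (rule open_Int[OF oW open_disc_preimage[OF hol_discD(3)[OF h] U(1)]])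
  have "?F holomorphic_on W'"
  proof (rule no_isolated_singularity[OF _ _ oW', of _ "{z0}"])
    show "continuous_on W' ?F" by (rule continuous_on_subset[OF contF]) (auto simp: W'_def)
    show "?F holomorphic_on (W' - {z0})"
    proof (rule holomorphic_on_locallyI)
      fix z1 assume z1: "z1 \<in> W' - {z0}"
      hence z1r: "z1 \<in> ball 0 r'" "h z1 \<in> U" by (auto simp: W'_def)
      have "h z1 \<noteq> h z0" using z1 z1r z0r hol_discD(2)[OF h] by (auto dest: inj_onD)
      then obtain y where y: "y \<in> ball 0 r" "R (h z1) (g y)" "imm (g y)" using U(3)[OF z1r(2)] by blast
      have G: "disc (\<lambda>z. g (y + z)) (r - norm y)" by (rule hol_disc_recenter[OF normal_discD(1) y(1)])
      have H: "disc (\<lambda>z. h (z1 + z)) (r' - norm z1)" by (rule hol_disc_recenter[OF h z1r(1)])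
      have iG: "imm (g (y + 0))" using y(3) by simp
      have RG: "R (g (y + 0)) (h (z1 + 0))" using R_sym[OF y(2)] by simp
      obtain e \<zeta> where \<zeta>: "0 < e" "\<zeta> holomorphic_on ball 0 e" "\<zeta> ` ball 0 e \<subseteq> ball 0 (r - norm y)" "\<And>z. z \<in> ball 0 e \<Longrightarrow> R (g (y + \<zeta> z)) (h (z1 + z))"
        by (rule R_branch[OF G iG H RG]) (rule that; assumption)
      have sh: "a - z1 \<in> ball 0 e" if "a \<in> ball z1 e" for a using that by (simp add: dist_norm norm_minus_commute)
      have "(\<zeta> \<circ> (\<lambda>a. a - z1)) holomorphic_on ball z1 e"
        by (rule holomorphic_on_compose_gen[OF _ \<zeta>(2)]) (use sh in \<open>auto intro!: holomorphic_intros\<close>)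
      hence "(\<lambda>a. (y + \<zeta> (a - z1)) ^ k) holomorphic_on ball z1 e" unfolding o_def by (intro holomorphic_intros)
      moreover have "(y + \<zeta> (a - z1)) ^ k = ?F a" if a: "a \<in> ball z1 e" for a
      proof -
        have "norm (\<zeta> (a - z1)) < r - norm y" using \<zeta>(3) sh[OF a] by force
        hence yb: "y + \<zeta> (a - z1) \<in> ball 0 r" using norm_triangle_ineq[of y "\<zeta> (a - z1)"] by simp
        have Ra: "R (g (y + \<zeta> (a - z1))) (h a)" using \<zeta>(4)[OF sh[OF a]] by simp
        have "proj (g (y + \<zeta> (a - z1))) = proj (h a)" using proj_eq_iff R_topspace[OF Ra] Ra by blast
        thus ?thesis using quot_chart_proj[OF yb] by simp
      qed
      ultimately have "?F holomorphic_on ball z1 e" by (rule holomorphic_transform)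
      thus "\<exists>W'. open W' \<and> z1 \<in> W' \<and> ?F holomorphic_on W'" using \<zeta>(1) by (intro exI[of _ "ball z1 e"]) simp
    qed
  qed simp
  thus "\<exists>W'. open W' \<and> z0 \<in> W' \<and> ?F holomorphic_on W'" using oW' z0 U(2) by (intro exI[of _ W']) (simp add: W'_def)
qed

end

lemma riemann_surface_quot: "riemann_surface quot quot_atlas"
  unfolding riemann_surface_def topological_manifold_def
proof (intro conjI ballI Hausdorff_quot second_countable_quot)
  show ch: "is_chart quot c" if "c \<in> quot_atlas" for c using that is_chart_quot_chart by (auto simp: quot_atlas_def)
  show "\<Union> (fst ` quot_atlas) = topspace quot"
  proof
    show "\<Union> (fst ` quot_atlas) \<subseteq> topspace quot" using is_chart_subset[OF ch] by blast
    show "topspace quot \<subseteq> \<Union> (fst ` quot_atlas)"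
    proof
      fix p assume "p \<in> topspace quot"
      then obtain s where s: "s \<in> topspace S" "p = proj s" by (auto simp: topspace_quot)
      obtain g r k where g: "disc g r" "g 0 = s" "k \<ge> 1" "\<And>y y'. y \<in> ball 0 r \<Longrightarrow> y' \<in> ball 0 r \<Longrightarrow> R (g y) (g y') \<longleftrightarrow> y ^ k = y' ^ k"
        by (rule R_normal_form[OF s(1)]) (rule that; assumption)
      have "normal_disc g r k" using g(1,3,4) by (simp add: normal_disc_def)
      hence "quot_chart g r k \<in> quot_atlas" by (auto simp: quot_atlas_def)
      moreover have "p \<in> fst (quot_chart g r k)" using g(2) s(2) disc_zero_in[OF g(1)] by (auto simp: quot_chart_def)
      ultimately show "p \<in> \<Union> (fst ` quot_atlas)" by blast
    qed
  qed
  fix c d assume c: "c \<in> quot_atlas" and d: "d \<in> quot_atlas"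
  obtain g r k where g: "normal_disc g r k" "c = quot_chart g r k" using c by (auto simp: quot_atlas_def)
  obtain g2 r2 k2 where g2: "normal_disc g2 r2 k2" "d = quot_chart g2 r2 k2" using d by (auto simp: quot_atlas_def)
  have dom: "local_dom c d id = {x \<in> ball 0 (r ^ k). chart_inv c x \<in> fst d}"
    using local_dom_eq[OF ch[OF c], of d id] quot_chart_image[OF g(1)] g(2) by simp
  show "local_rep c d id holomorphic_on local_dom c d id"
  \<comment> \<open>Composed with y ^ k the transition becomes the chart \<open>d\<close> along the
    disc \<open>g\<close>, which \<open>quot_chart_holomorphic_disc\<close> covers.\<close>
  proof (rule holomorphic_descend_power[OF open_transition_dom[OF ch[OF c] ch[OF d]] normal_discD(2)[OF g(1)]])
    have "continuous_map (top_of_set (local_dom c d id)) (subtopology quot (fst d)) (chart_inv c)"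
      unfolding continuous_map_in_subtopology
      by (intro conjI continuous_map_from_subtopology_mono[OF chart_inv_continuous[OF ch[OF c]]])
        (auto simp: local_dom_eq[OF ch[OF c]])
    from continuous_map_compose[OF this is_chart_continuous[OF ch[OF d]]]
    show "continuous_on (local_dom c d id) (local_rep c d id)" by (simp add: local_rep_def o_def)
    have eq: "{y. y ^ k \<in> local_dom c d id} \<subseteq> {z \<in> ball 0 r. proj (g z) \<in> fst d}" and
      rep: "\<And>y. y ^ k \<in> local_dom c d id \<Longrightarrow> snd d (proj (g y)) = local_rep c d id (y ^ k)"
    proof -
      have *: "y \<in> ball 0 r \<and> proj (g y) = chart_inv c (y ^ k) \<and> chart_inv c (y ^ k) \<in> fst d" if "y ^ k \<in> local_dom c d id" for y
      proof -
        have "norm (y ^ k) < r ^ k" "chart_inv c (y ^ k) \<in> fst d" using that unfolding dom by auto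
        hence "y \<in> ball 0 r" using norm_root_less[OF normal_discD(2)[OF g(1)] refl _ normal_discD(3)[OF g(1)]] by simp
        thus ?thesis using chart_inv_quot_chart[OF g(1)] g(2) \<open>chart_inv c (y ^ k) \<in> fst d\<close> by simp
      qed
      show "{y. y ^ k \<in> local_dom c d id} \<subseteq> {z \<in> ball 0 r. proj (g z) \<in> fst d}" using * by auto
      show "snd d (proj (g y)) = local_rep c d id (y ^ k)" if "y ^ k \<in> local_dom c d id" for y
        using *[OF that] by (simp add: local_rep_def)
    qed
    have "(\<lambda>z. snd d (proj (g z))) holomorphic_on {y. y ^ k \<in> local_dom c d id}"
      by (rule holomorphic_on_subset[OF quot_chart_holomorphic_disc[OF g2(1) normal_discD(1)[OF g(1)], folded g2(2)] eq])
    thus "(\<lambda>y. local_rep c d id (y ^ k)) holomorphic_on {y. y ^ k \<in> local_dom c d id}"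
      by (rule holomorphic_transform) (use rep in simp)
  qed
qed

lemma holomorphic_proj: "holomorphic_map S A quot quot_atlas proj"
  unfolding holomorphic_map_def
proof (intro conjI ballI continuous_proj)
  fix c d assume c: "c \<in> A" and d: "d \<in> quot_atlas"
  obtain g r k where g: "normal_disc g r k" "d = quot_chart g r k" using d by (auto simp: quot_atlas_def)
  have ch: "is_chart S c" by (rule chart_A[OF c])
  show "local_rep c d proj holomorphic_on local_dom c d proj"
  proof (rule holomorphic_on_locallyI)
    fix z0 assume z0: "z0 \<in> local_dom c d proj"
    hence "z0 \<in> snd c ` fst c" by (simp add: local_dom_eq[OF ch])
    then obtain e where e: "disc (\<lambda>z. chart_inv c (z0 + z)) e" using hol_disc_chart[OF S c] by blast
    have e0: "e > 0" by (rule hol_discD(1)[OF e])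
    define W where "W = {z \<in> ball 0 e. proj (chart_inv c (z0 + z)) \<in> fst d}"
    have hol: "(\<lambda>z. snd d (proj (chart_inv c (z0 + z)))) holomorphic_on W"
      unfolding W_def g(2) by (rule quot_chart_holomorphic_disc[OF g(1) e])
    define W' where "W' = local_dom c d proj \<inter> ball z0 e"
    have sh: "z - z0 \<in> W" if "z \<in> W'" for z
      using that by (auto simp: W'_def W_def local_dom_eq[OF ch] dist_norm norm_minus_commute)
    have "(\<lambda>z. snd d (proj (chart_inv c (z0 + z)))) \<circ> (\<lambda>z. z - z0) holomorphic_on W'"
      by (rule holomorphic_on_compose_gen[OF _ hol]) (use sh in \<open>auto intro!: holomorphic_intros\<close>)
    hence "local_rep c d proj holomorphic_on W'" by (simp add: local_rep_def o_def)
    moreover have "is_chart quot d" unfolding g(2) by (rule is_chart_quot_chart[OF g(1)])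
    hence "open W'" unfolding W'_def by (intro open_Int open_local_dom[OF ch _ continuous_proj]) auto
    ultimately show "\<exists>W'. open W' \<and> z0 \<in> W' \<and> local_rep c d proj holomorphic_on W'"
      using z0 e0 by (intro exI[of _ W']) (simp add: W'_def)
  qed
qed

lemma continuous_u_quot: "continuous_map quot X u"
  unfolding continuous_map_def
proof (intro conjI allI impI)
  have "u (proj s) \<in> topspace X" if "s \<in> topspace S" for s using cont_u that u_proj[OF that] by (auto simp: continuous_map_def)
  thus "u \<in> topspace quot \<rightarrow> topspace X" by (auto simp: topspace_quot)
  fix U assume "openin X U"
  hence "openin S {s \<in> topspace S. u s \<in> U}" by (rule openin_continuous_map_preimage[OF cont_u])
  moreover have "{s \<in> topspace S. proj s \<in> {p \<in> topspace quot. u p \<in> U}} = {s \<in> topspace S. u s \<in> U}"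
    by (intro Collect_cong conj_cong refl) (simp add: topspace_quot u_proj)
  ultimately show "openin quot {p \<in> topspace quot. u p \<in> U}" by (auto simp: openin_quot topspace_quot)
qed

text \<open>\<open>u\<close> itself is the descended map, as the points of \<open>quot\<close> are
  points of \<open>S\<close> and u (proj s) = u s. In a chart y ^ k it is the \<open>v\<close> of
  \<open>disc_descend\<close>.\<close>

lemma J_holomorphic_quot: "J_holomorphic quot quot_atlas X B J u"
proof (rule jcurve_imp_J_holomorphic[OF riemann_surface_quot atlas_B cover_B J continuous_u_quot])
  fix c d assume c: "c \<in> quot_atlas" and d: "d \<in> B"
  obtain g r k where g: "normal_disc g r k" "c = quot_chart g r k" using c by (auto simp: quot_atlas_def)
  have ch: "is_chart quot c" unfolding g(2) by (rule is_chart_quot_chart[OF g(1)])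
  have "local_dom c d u = {x \<in> ball 0 (r ^ k). (u \<circ> chart_inv c) x \<in> fst d}"
    using local_dom_eq[OF ch, of d u] quot_chart_image[OF g(1)] g(2) by simp
  moreover have "local_rep c d u = snd d \<circ> (u \<circ> chart_inv c)" by (simp add: local_rep_def o_assoc)
  moreover have "(u \<circ> chart_inv c) (z ^ k) = u (g z)" if "z \<in> ball 0 r" for z
    using chart_inv_quot_chart[OF g(1) that] g(2) u_proj[OF hol_discD(6)[OF normal_discD(1)[OF g(1)] that]] by simp
  ultimately show "jcurve (JJ d) (snd d ` fst d) (local_dom c d u) (local_rep c d u) (\<lambda>z. frechet_derivative (local_rep c d u) (at z))"
    using disc_descend[OF normal_discD(1)[OF g(1)] normal_discD(2)[OF g(1)] _ d, of "u \<circ> chart_inv c"] by simp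
qed

text \<open>The preimages in \<open>S\<close> of two disjoint open sets with the same image would
  contain related points by \<open>image_subset_imp_R\<close>; their common class would lie in both
  sets.\<close>

lemma primitive_quot: "primitive_map quot u"
  unfolding primitive_map_def
proof
  assume "\<exists>U1 U2. openin quot U1 \<and> openin quot U2 \<and> U1 \<noteq> {} \<and> U2 \<noteq> {} \<and> U1 \<inter> U2 = {} \<and> u ` U1 = u ` U2"
  then obtain U1 U2 where U: "openin quot U1" "openin quot U2" "U1 \<noteq> {}" "U1 \<inter> U2 = {}" "u ` U1 = u ` U2" by blast
  define W where "W U = {s \<in> topspace S. proj s \<in> U}" for U
  have W: "openin S (W U)" "proj ` W U = U" "u ` W U = u ` U" if "openin quot U" for U
  proof -
    show "openin S (W U)" using that by (simp add: W_def openin_quot)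
    show *: "proj ` W U = U" using that by (auto simp: W_def openin_quot)
    have "u ` W U = u ` proj ` W U" unfolding image_image by (rule image_cong) (auto simp: W_def u_proj)
    thus "u ` W U = u ` U" using * by simp
  qed
  have "W U1 \<noteq> {}" using W(2)[OF U(1)] U(3) by blast
  moreover have "u ` W U1 \<subseteq> u ` W U2" using W(3)[OF U(1)] W(3)[OF U(2)] U(5) by simp
  ultimately obtain a b where ab: "a \<in> W U1" "b \<in> W U2" "R a b"
    using image_subset_imp_R[OF W(1)[OF U(1)] _ W(1)[OF U(2)]] by blast
  have "proj a = proj b" using proj_eq_iff[of a b] ab by (simp add: W_def)
  thus False using ab U(4) by (auto simp: W_def)
qed

end

theorem theoremA:
  fixes X :: "'x topology" and B :: "('x, 'e::euclidean_space) chart set"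
    and J :: "'x \<Rightarrow> ('x, 'e) tangent \<Rightarrow> ('x, 'e) tangent"
    and S :: "'s topology" and A :: "('s, complex) chart set"
    and u :: "'s \<Rightarrow> 'x"
  assumes "smooth_manifold X B"
    and "almost_complex_structure X B J"
    and "lipschitz_structure B J"
    and "riemann_surface S A" and "connected_space S"
    and "J_holomorphic S A X B J u"
    and "\<not> u constant_on topspace S"
  shows "\<exists>(S' :: 's topology) (A' :: ('s, complex) chart set) (u' :: 's \<Rightarrow> 'x) (\<pi> :: 's \<Rightarrow> 's).
           riemann_surface S' A' \<and> connected_space S' \<and>
           J_holomorphic S' A' X B J u' \<and> primitive_map S' u' \<and>
           holomorphic_map S A S' A' \<pi> \<and> \<pi> ` topspace S = topspace S' \<and>
           (\<forall>s\<in>topspace S. u s = u' (\<pi> s))"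
proof -
  interpret jcurve_setup X B J S A u by standard (fact assms)+
  show ?thesis
    by (intro exI[of _ quot] exI[of _ quot_atlas] exI[of _ u] exI[of _ proj] conjI ballI riemann_surface_quot
        connected_quot J_holomorphic_quot primitive_quot holomorphic_proj topspace_quot[symmetric] u_proj[symmetric])
qed

end
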